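(* Let $M^2$ be a compact oriented $2$-manifold, $f\colon M^2\to\mathbb{R}^3$ an immersion and $\nu\colon M^2\to S^2$ the Gauss map of $f$. Assume that the singular set $\Sigma_\#$ of $\nu$ consists of folds (i.e. $A_2$-points) and cusps (i.e. $A_3$-points). Then $$\int_{\Sigma_\#}\kappa_\#\,d\tau_\#=\int_{M^-_\#}K\,d\hat A=\int_{M^2}K^-\,dA$$ holds, where $K^-=\min(0,K)$. In particular, the total dual singular curvature (with respect to $\nu$) $\int_{\Sigma_\#}\kappa_\#\,d\tau_\#$ is non-positive.
   Context: Manifolds are smooth and without boundary. $\nu$ is a globally defined unit normal field of $f$. Let $\mathcal{E}=\{w\in f^*T\mathbb{R}^3: w\perp\nu\}$ (rank $2$ bundle), with the induced inner product, the connection $D$ = tangential part of the flat connection of $\mathbb{R}^3$, and the homomorphisms $\varphi=df$, $\psi=d\nu\colon TM^2\to\mathcal{E}$. Let $\mu$ be the area form on $\mathcal{E}$ for the orientation making $\varphi$ orientation preserving; a frame of $\mathcal{E}$ is positive if $\mu>0$ on it. For positively oriented local coordinates $(u,v)$ put $\lambda=\mu(\varphi(\partial_u),\varphi(\partial_v))>0$ and $\lambda_\#=\mu(\psi(\partial_u),\psi(\partial_v))$. Then $d\hat A=\lambda\,du\wedge dv=dA$ is the area form of $f$; $\Sigma_\#=\{\lambda_\#=0\}$; $M^-_\#=\{\lambda_\#<0\}$. $K$ is the Gaussian curvature of the first fundamental form $f^*\langle\,,\,\rangle$. A point $p\in\Sigma_\#$ is non-degenerate if $d\lambda_\#(p)\ne0$;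 then near $p$ the set $\Sigma_\#$ is a regular curve along which $\psi$ has rank $1$. Let $\eta$ be a non-vanishing vector field near $p$ whose restriction to $\Sigma_\#$ spans $\operatorname{Ker}\psi$, and put $\lambda_\#'=d\lambda_\#(\eta)$, $\lambda_\#''=d\lambda_\#'(\eta)$. A non-degenerate $p$ is an $A_2$-point (fold of $\nu$) if $\lambda_\#'(p)\neq0$ (equivalently $\eta(p)$ is transversal to $\Sigma_\#$), and an $A_3$-point (cusp of $\nu$) if $\lambda_\#'(p)=0$, $\lambda_\#''(p)\neq0$. Singular curvature $\kappa_\#$ at $A_2$-points: parametrize $\Sigma_\#$ by a regular curve $\gamma(t)$ near the point, let $\boldsymbol{n}(t)$ be the section of $\mathcal{E}$ along $\gamma$ with $\{\psi(\dot\gamma)/|\psi(\dot\gamma)|,\boldsymbol{n}\}$ a positive orthonormal frame, and choose the null field $\eta(t)\in\operatorname{Ker}\psi$ so that $\{\dot\gamma,\eta\}$ is positively oriented on $M^2$. Then $$\kappa_\#(t)=-\operatorname{sgn}(d\lambda_\#(\eta(t)))\,\frac{\langle D_{d/dt}\boldsymbol{n}(t),\psi(\dot\gamma(t))\rangle}{|\psi(\dot\gamma(t))|^2},\qquad d\tau_\#=|\psi(\dot\gamma)|\,dt.$$ The integral over $\Sigma_\#$ is over its $A_2$-points (i.e. $\Sigma_\#$ minus finitely many $A_3$-points). *)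

theory Defs
  imports "HOL-Analysis.Analysis"
begin

text \<open>
  A 2-manifold is a topological space \<open>M\<close> with a set \<open>\<A>\<close> of charts; a chart is a pair
  \<open>(U, x)\<close> of a domain and a coordinate map. Tangent vectors at \<open>p\<close> are represented by their
  components in a chart around \<open>p\<close>, i.e. by elements of \<open>real^2\<close>. Definitions that take a single
  chart \<open>c\<close> are meaningful only at points of \<open>fst c\<close>.
\<close>

type_synonym 'a chart = "'a set \<times> ('a \<Rightarrow> real^2)"

primrec C_k_on :: "nat \<Rightarrow> 'a::real_normed_vector set \<Rightarrow> ('a \<Rightarrow> 'b::real_normed_vector) \<Rightarrow> bool" where
  "C_k_on 0 S g \<longleftrightarrow> continuous_on S g"
| "C_k_on (Suc k) S g \<longleftrightarrow>
     (\<forall>z\<in>S. g differentiable (at z)) \<and> (\<forall>v. C_k_on k S (\<lambda>z. frechet_derivative g (at z) v))"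

text \<open>Intended for open domains.\<close>

definition smooth_on :: "'a::real_normed_vector set \<Rightarrow> ('a \<Rightarrow> 'b::real_normed_vector) \<Rightarrow> bool" where
  "smooth_on S g \<longleftrightarrow> (\<forall>k. C_k_on k S g)"

definition in_chart :: "'a chart \<Rightarrow> ('a \<Rightarrow> 'b) \<Rightarrow> real^2 \<Rightarrow> 'b" where
  "in_chart c h = h \<circ> inv_into (fst c) (snd c)"

definition is_chart :: "'a topology \<Rightarrow> 'a chart \<Rightarrow> bool" where
  "is_chart M c \<longleftrightarrow>
     openin M (fst c) \<and> open (snd c ` fst c) \<and>
     homeomorphic_map (subtopology M (fst c)) (top_of_set (snd c ` fst c)) (snd c)"

text \<open>
  The orientation is the one given by the charts of the atlas, so every chart of \<open>\<A>\<close> is a positively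
  oriented local coordinate system. The atlas need not be maximal.
\<close>

definition oriented_surface :: "'a topology \<Rightarrow> 'a chart set \<Rightarrow> bool" where
  "oriented_surface M \<A> \<longleftrightarrow>
     Hausdorff_space M \<and> second_countable M \<and>
     (\<forall>c\<in>\<A>. is_chart M c) \<and> (\<Union>c\<in>\<A>. fst c) = topspace M \<and>
     (\<forall>c\<in>\<A>. \<forall>d\<in>\<A>.
        smooth_on (snd c ` (fst c \<inter> fst d)) (in_chart c (snd d)) \<and>
        (\<forall>z \<in> snd c ` (fst c \<inter> fst d).
           det (matrix (frechet_derivative (in_chart c (snd d)) (at z))) > 0))"

definition smooth_map :: "'a chart set \<Rightarrow> ('a \<Rightarrow> 'b::real_normed_vector) \<Rightarrow> bool" where
  "smooth_map \<A> h \<longleftrightarrow> (\<forall>c\<in>\<A>. smooth_on (snd c ` fst c) (in_chart c h))"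

text \<open>
  The differential of \<open>h\<close> at \<open>p\<close>, as a map on component vectors in the chart \<open>c\<close>. In particular
  \<open>differential c f p\<close> and \<open>differential c \<nu> p\<close> are the homomorphisms \<open>\<phi>\<close> and \<open>\<psi>\<close>.
\<close>

definition differential ::
    "'a chart \<Rightarrow> ('a \<Rightarrow> 'b::real_normed_vector) \<Rightarrow> 'a \<Rightarrow> real^2 \<Rightarrow> 'b" where
  "differential c h p = frechet_derivative (in_chart c h) (at (snd c p))"

definition partial ::
    "'a chart \<Rightarrow> 2 \<Rightarrow> ('a \<Rightarrow> 'b::real_normed_vector) \<Rightarrow> 'a \<Rightarrow> 'b" where
  "partial c i h p = differential c h p (axis i 1)"

definition immersion :: "'a chart set \<Rightarrow> ('a \<Rightarrow> real^3) \<Rightarrow> bool" where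
  "immersion \<A> f \<longleftrightarrow> smooth_map \<A> f \<and> (\<forall>c\<in>\<A>. \<forall>p\<in>fst c. inj (differential c f p))"

definition unit_normal_field :: "'a chart set \<Rightarrow> ('a \<Rightarrow> real^3) \<Rightarrow> ('a \<Rightarrow> real^3) \<Rightarrow> bool" where
  "unit_normal_field \<A> f \<nu> \<longleftrightarrow> smooth_map \<A> \<nu> \<and>
     (\<forall>c\<in>\<A>. \<forall>p\<in>fst c. norm (\<nu> p) = 1 \<and> (\<forall>\<zeta>. \<nu> p \<bullet> differential c f p \<zeta> = 0))"

text \<open>
  The area form \<open>\<mu>\<close> on the fibre \<open>\<nu>(p)\<^sup>\<bottom>\<close> of \<open>\<E>\<close>. The factor \<open>sgn\<close> makes \<open>\<phi>\<close> orientation preserving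
  whichever of the two unit normals \<open>\<nu>\<close> is.
\<close>

definition area_form ::
    "'a chart \<Rightarrow> ('a \<Rightarrow> real^3) \<Rightarrow> ('a \<Rightarrow> real^3) \<Rightarrow> 'a \<Rightarrow> real^3 \<Rightarrow> real^3 \<Rightarrow> real" where
  "area_form c f \<nu> p w1 w2 =
     sgn (cross3 (partial c 1 f p) (partial c 2 f p) \<bullet> \<nu> p) * (cross3 w1 w2 \<bullet> \<nu> p)"

definition lam :: "'a chart \<Rightarrow> ('a \<Rightarrow> real^3) \<Rightarrow> ('a \<Rightarrow> real^3) \<Rightarrow> 'a \<Rightarrow> real" where
  "lam c f \<nu> p = area_form c f \<nu> p (partial c 1 f p) (partial c 2 f p)"

definition lam_sharp :: "'a chart \<Rightarrow> ('a \<Rightarrow> real^3) \<Rightarrow> ('a \<Rightarrow> real^3) \<Rightarrow> 'a \<Rightarrow> real" where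
  "lam_sharp c f \<nu> p = area_form c f \<nu> p (partial c 1 \<nu> p) (partial c 2 \<nu> p)"

definition Sigma_sharp :: "'a chart set \<Rightarrow> ('a \<Rightarrow> real^3) \<Rightarrow> ('a \<Rightarrow> real^3) \<Rightarrow> 'a set" where
  "Sigma_sharp \<A> f \<nu> = {p. \<exists>c\<in>\<A>. p \<in> fst c \<and> lam_sharp c f \<nu> p = 0}"

definition M_sharp_minus :: "'a chart set \<Rightarrow> ('a \<Rightarrow> real^3) \<Rightarrow> ('a \<Rightarrow> real^3) \<Rightarrow> 'a set" where
  "M_sharp_minus \<A> f \<nu> = {p. \<exists>c\<in>\<A>. p \<in> fst c \<and> lam_sharp c f \<nu> p < 0}"

definition nondegenerate ::
    "'a chart \<Rightarrow> ('a \<Rightarrow> real^3) \<Rightarrow> ('a \<Rightarrow> real^3) \<Rightarrow> 'a \<Rightarrow> bool" where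
  "nondegenerate c f \<nu> p \<longleftrightarrow> (\<exists>\<zeta>. differential c (lam_sharp c f \<nu>) p \<zeta> \<noteq> 0)"

text \<open>
  \<open>\<eta>\<close> gives the components in \<open>c\<close> of a non-vanishing vector field on \<open>V\<close> that spans the kernel of
  \<open>\<psi>\<close> along the singular set.
\<close>

definition null_field ::
    "'a topology \<Rightarrow> 'a chart set \<Rightarrow> 'a chart \<Rightarrow> ('a \<Rightarrow> real^3) \<Rightarrow> ('a \<Rightarrow> real^3) \<Rightarrow> 'a set
       \<Rightarrow> ('a \<Rightarrow> real^2) \<Rightarrow> bool" where
  "null_field M \<A> c f \<nu> V \<eta> \<longleftrightarrow>
     openin M V \<and> V \<subseteq> fst c \<and> smooth_on (snd c ` V) (in_chart c \<eta>) \<and>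
     (\<forall>q\<in>V. \<eta> q \<noteq> 0) \<and>
     (\<forall>q \<in> V \<inter> Sigma_sharp \<A> f \<nu>. {\<zeta>. differential c \<nu> q \<zeta> = 0} = span {\<eta> q})"

definition along :: "'a chart \<Rightarrow> ('a \<Rightarrow> real^2) \<Rightarrow> ('a \<Rightarrow> real) \<Rightarrow> 'a \<Rightarrow> real" where
  "along c \<eta> h q = differential c h q (\<eta> q)"

definition A2_points ::
    "'a topology \<Rightarrow> 'a chart set \<Rightarrow> ('a \<Rightarrow> real^3) \<Rightarrow> ('a \<Rightarrow> real^3) \<Rightarrow> 'a set" where
  "A2_points M \<A> f \<nu> = {p \<in> Sigma_sharp \<A> f \<nu>.
     \<exists>c\<in>\<A>. p \<in> fst c \<and> nondegenerate c f \<nu> p \<and>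
       (\<exists>V \<eta>. p \<in> V \<and> null_field M \<A> c f \<nu> V \<eta> \<and>
          along c \<eta> (lam_sharp c f \<nu>) p \<noteq> 0)}"

definition A3_points ::
    "'a topology \<Rightarrow> 'a chart set \<Rightarrow> ('a \<Rightarrow> real^3) \<Rightarrow> ('a \<Rightarrow> real^3) \<Rightarrow> 'a set" where
  "A3_points M \<A> f \<nu> = {p \<in> Sigma_sharp \<A> f \<nu>.
     \<exists>c\<in>\<A>. p \<in> fst c \<and> nondegenerate c f \<nu> p \<and>
       (\<exists>V \<eta>. p \<in> V \<and> null_field M \<A> c f \<nu> V \<eta> \<and>
          along c \<eta> (lam_sharp c f \<nu>) p = 0 \<and>
          along c \<eta> (along c \<eta> (lam_sharp c f \<nu>)) p \<noteq> 0)}"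

definition velocity :: "'a chart \<Rightarrow> (real \<Rightarrow> 'a) \<Rightarrow> real \<Rightarrow> real^2" where
  "velocity c \<gamma> t = vector_derivative (snd c \<circ> \<gamma>) (at t)"

definition regular_curve :: "'a chart \<Rightarrow> (real \<Rightarrow> 'a) \<Rightarrow> real \<Rightarrow> real \<Rightarrow> bool" where
  "regular_curve c \<gamma> a b \<longleftrightarrow>
     \<gamma> ` {a<..<b} \<subseteq> fst c \<and> smooth_on {a<..<b} (snd c \<circ> \<gamma>) \<and>
     (\<forall>t\<in>{a<..<b}. velocity c \<gamma> t \<noteq> 0)"

text \<open>\<open>\<psi>(d\<gamma>/dt)\<close>\<close>

definition psi_velocity :: "'a chart \<Rightarrow> ('a \<Rightarrow> real^3) \<Rightarrow> (real \<Rightarrow> 'a) \<Rightarrow> real \<Rightarrow> real^3" where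
  "psi_velocity c \<nu> \<gamma> t = differential c \<nu> (\<gamma> t) (velocity c \<gamma> t)"

text \<open>The connection \<open>D\<close> applied to a section \<open>n\<close> of \<open>\<E>\<close> along \<open>\<gamma>\<close>: the tangential part of \<open>dn/dt\<close>.\<close>

definition D_along :: "('a \<Rightarrow> real^3) \<Rightarrow> (real \<Rightarrow> 'a) \<Rightarrow> (real \<Rightarrow> real^3) \<Rightarrow> real \<Rightarrow> real^3" where
  "D_along \<nu> \<gamma> n t =
     vector_derivative n (at t) - (vector_derivative n (at t) \<bullet> \<nu> (\<gamma> t)) *\<^sub>R \<nu> (\<gamma> t)"

definition conormal_along ::
    "'a chart \<Rightarrow> ('a \<Rightarrow> real^3) \<Rightarrow> ('a \<Rightarrow> real^3) \<Rightarrow> (real \<Rightarrow> 'a) \<Rightarrow> real \<Rightarrow> real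
       \<Rightarrow> (real \<Rightarrow> real^3) \<Rightarrow> bool" where
  "conormal_along c f \<nu> \<gamma> a b n \<longleftrightarrow>
     (\<forall>t\<in>{a<..<b}. psi_velocity c \<nu> \<gamma> t \<noteq> 0 \<and>
        n t \<bullet> \<nu> (\<gamma> t) = 0 \<and> norm (n t) = 1 \<and> n t \<bullet> psi_velocity c \<nu> \<gamma> t = 0 \<and>
        area_form c f \<nu> (\<gamma> t) (psi_velocity c \<nu> \<gamma> t /\<^sub>R norm (psi_velocity c \<nu> \<gamma> t)) (n t) > 0)"

text \<open>
  \<open>\<kappa>\<^sub>#\<close> as a function on the \<open>A\<^sub>2\<close>-points. The value does not depend on the chart, the
  parametrization of the singular set or the null vector, so the description is unique.
\<close>

definition singular_curvature ::
    "'a chart set \<Rightarrow> ('a \<Rightarrow> real^3) \<Rightarrow> ('a \<Rightarrow> real^3) \<Rightarrow> 'a \<Rightarrow> real" where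
  "singular_curvature \<A> f \<nu> p = (THE k.
     \<exists>c\<in>\<A>. \<exists>\<gamma> a b t n \<eta>.
       regular_curve c \<gamma> a b \<and> \<gamma> ` {a<..<b} \<subseteq> Sigma_sharp \<A> f \<nu> \<and>
       t \<in> {a<..<b} \<and> \<gamma> t = p \<and>
       conormal_along c f \<nu> \<gamma> a b n \<and>
       differential c \<nu> p \<eta> = 0 \<and> det (vector [velocity c \<gamma> t, \<eta>] :: real^2^2) > 0 \<and>
       k = - sgn (differential c (lam_sharp c f \<nu>) p \<eta>) *
             (D_along \<nu> \<gamma> n t \<bullet> psi_velocity c \<nu> \<gamma> t) / (norm (psi_velocity c \<nu> \<gamma> t))\<^sup>2)"

definition borel_sets :: "'a topology \<Rightarrow> 'a set set" where
  "borel_sets M = sigma_sets (topspace M) {U. openin M U}"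

text \<open>
  The length measure \<open>d\<tau>\<^sub># = \<bar>\<psi>(d\<gamma>/dt)\<bar> dt\<close>: the unique Borel measure carried by the
  \<open>A\<^sub>2\<close>-points that is given by this density on every injectively parametrized arc of \<open>A\<^sub>2\<close>-points.
\<close>

definition length_measure ::
    "'a topology \<Rightarrow> 'a chart set \<Rightarrow> ('a \<Rightarrow> real^3) \<Rightarrow> ('a \<Rightarrow> real^3) \<Rightarrow> 'a measure" where
  "length_measure M \<A> f \<nu> = (THE m.
     space m = topspace M \<and> sets m = borel_sets M \<and>
     emeasure m (topspace M - A2_points M \<A> f \<nu>) = 0 \<and>
     (\<forall>c\<in>\<A>. \<forall>\<gamma> a b. regular_curve c \<gamma> a b \<and> inj_on \<gamma> {a<..<b} \<and>
          \<gamma> ` {a<..<b} \<subseteq> A2_points M \<A> f \<nu> \<longrightarrow>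
        (\<forall>B\<in>sets borel. B \<subseteq> {a<..<b} \<longrightarrow>
           emeasure m (\<gamma> ` B) = (\<integral>\<^sup>+t\<in>B. ennreal (norm (psi_velocity c \<nu> \<gamma> t)) \<partial>lborel))))"

text \<open>
  The Riemannian area measure: the unique Borel measure equal to \<open>\<lambda> du dv\<close> in every chart. Since
  \<open>\<lambda> > 0\<close>, integration against it is integration against the 2-form \<open>\<lambda> du \<and> dv\<close> on the oriented
  surface.
\<close>

definition area_measure ::
    "'a topology \<Rightarrow> 'a chart set \<Rightarrow> ('a \<Rightarrow> real^3) \<Rightarrow> ('a \<Rightarrow> real^3) \<Rightarrow> 'a measure" where
  "area_measure M \<A> f \<nu> = (THE m.
     space m = topspace M \<and> sets m = borel_sets M \<and>
     (\<forall>c\<in>\<A>. \<forall>B\<in>borel_sets M. B \<subseteq> fst c \<longrightarrow>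
        emeasure m B = (\<integral>\<^sup>+z \<in> snd c ` B. ennreal (in_chart c (lam c f \<nu>) z) \<partial>lborel)))"

definition metric :: "'a chart \<Rightarrow> ('a \<Rightarrow> real^3) \<Rightarrow> 2 \<Rightarrow> 2 \<Rightarrow> 'a \<Rightarrow> real" where
  "metric c f i j p = partial c i f p \<bullet> partial c j f p"

definition metric_matrix :: "'a chart \<Rightarrow> ('a \<Rightarrow> real^3) \<Rightarrow> 'a \<Rightarrow> real^2^2" where
  "metric_matrix c f p = (\<chi> i j. metric c f i j p)"

text \<open>\<open>christoffel c f k i j\<close> is \<open>\<Gamma>\<^sup>k\<^sub>i\<^sub>j\<close>.\<close>

definition christoffel :: "'a chart \<Rightarrow> ('a \<Rightarrow> real^3) \<Rightarrow> 2 \<Rightarrow> 2 \<Rightarrow> 2 \<Rightarrow> 'a \<Rightarrow> real" where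
  "christoffel c f k i j p =
     (\<Sum>l\<in>UNIV. matrix_inv (metric_matrix c f p) $ k $ l *
        (partial c i (metric c f j l) p + partial c j (metric c f i l) p
          - partial c l (metric c f i j) p)) / 2"

text \<open>\<open>R(\<partial>\<^sub>i, \<partial>\<^sub>j) \<partial>\<^sub>k = (\<Sum>l. riemann c f l k i j \<partial>\<^sub>l)\<close>, where \<open>R(X, Y) = [\<nabla>\<^sub>X, \<nabla>\<^sub>Y] - \<nabla>\<^bsub>[X,Y]\<^esub>\<close>.\<close>

definition riemann :: "'a chart \<Rightarrow> ('a \<Rightarrow> real^3) \<Rightarrow> 2 \<Rightarrow> 2 \<Rightarrow> 2 \<Rightarrow> 2 \<Rightarrow> 'a \<Rightarrow> real" where
  "riemann c f l k i j p =
     partial c i (christoffel c f l j k) p - partial c j (christoffel c f l i k) p +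
     (\<Sum>m\<in>UNIV. christoffel c f l i m p * christoffel c f m j k p
              - christoffel c f l j m p * christoffel c f m i k p)"

text \<open>
  The Gaussian curvature of the first fundamental form, i.e. the sectional curvature
  \<open>\<langle>R(\<partial>\<^sub>1, \<partial>\<^sub>2) \<partial>\<^sub>2, \<partial>\<^sub>1\<rangle> / det g\<close>; it does not depend on the chart around \<open>p\<close>.
\<close>

definition gaussian_curvature :: "'a chart set \<Rightarrow> ('a \<Rightarrow> real^3) \<Rightarrow> 'a \<Rightarrow> real" where
  "gaussian_curvature \<A> f p = (let c = (SOME c. c \<in> \<A> \<and> p \<in> fst c) in
     (\<Sum>l\<in>UNIV. metric c f l 1 p * riemann c f l 2 1 2 p) / det (metric_matrix c f p))"

end

theory Submission
  imports Defs
begin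

text \<open>
  In a chart let \<open>\<omega>\<close> be the mean of the connection forms of two sections of the bundle orthogonal to
  \<open>\<nu>\<close>: the section \<open>df(\<partial>\<^sub>1)\<close> and its image under the trace-free part of the shape operator. The
  trace-free part anticommutes with rotations by a right angle, so turning \<open>\<partial>\<^sub>1\<close> by an angle turns the
  two sections by opposite angles and leaves \<open>\<omega>\<close> unchanged: \<open>\<omega>\<close> is the connection form of the
  principal directions. It is therefore a global 1-form wherever the trace-free part does not vanish,
  in particular on \<open>M\<^sup>-\<close> and near its boundary \<open>\<Sigma>\<close>, where \<open>d\<nu>\<close> has rank 1. There \<open>d\<omega> = \<plusminus> K dA\<close>, and
  along \<open>\<Sigma>\<close>, where \<open>d\<nu>(\<gamma>')\<close> spans a principal direction, \<open>\<omega>(\<gamma>') = \<plusminus> \<kappa> \<bar>d\<nu>(\<gamma>')\<bar>\<close>. Stokes' formula for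
  \<open>\<rho> \<omega>\<close> below a graph, summed over a partition of unity, gives the theorem; no boundary terms arise at the
  cusps, because \<open>\<Sigma>\<close> is a smooth curve there too.
\<close>

section \<open>Calculus of smooth maps\<close>

text \<open>Umbilics are the obstacle to a global \<omega>, and the sign of the curvature removes
  them. At an umbilic K is the square of the principal curvature, so K \<le> 0 leaves only flat
  points with d\<nu> = 0. There det d\<nu>, being quadratic in d\<nu>, has vanishing differential,
  which non-degeneracy excludes on \<Sigma>; where K < 0 no umbilic exists at all. No branch of the
  principal directions is ever selected, because \<omega> is built from smooth sections. At a cusp
  d\<nu>(\<gamma>') vanishes and \<kappa> may blow up, but \<kappa> times the length element is
  \<plusminus>\<omega>(\<gamma>') dt with \<omega> smooth, so integrability comes out along with the
  formula and cusps matter only as a null set of parameters. The area measure, the length measure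
  and the singular curvature are definite descriptions. Much of the proof shows that each has
  exactly one solution: local measures in charts and on arcs are glued over finite covers supplied
  by compactness, and competing curves and charts are compared.\<close>

lemma C_k_on_cong:
  assumes "open S" "\<And>z. z \<in> S \<Longrightarrow> f z = g z"
  shows "C_k_on k S f \<longleftrightarrow> C_k_on k S g"
  using assms(2)
proof (induction k arbitrary: f g)
  case 0
  then show ?case by (simp cong: continuous_on_cong)
next
  case (Suc k)
  have d: "f differentiable (at z) \<longleftrightarrow> g differentiable (at z)" if "z \<in> S" for z
    unfolding differentiable_def
    by (metis Suc.prems assms(1) has_derivative_transform_within_open that)
  have e: "frechet_derivative f (at z) = frechet_derivative g (at z)"
    if "z \<in> S" "f differentiable (at z)" for z
    using frechet_derivative_transform_within_open[OF that(2) assms(1) that(1)] Suc.prems by blast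
  show ?case
  proof (cases "\<forall>z\<in>S. f differentiable (at z)")
    case True
    then have "C_k_on k S (\<lambda>z. frechet_derivative f (at z) v) \<longleftrightarrow>
        C_k_on k S (\<lambda>z. frechet_derivative g (at z) v)" for v
      by (intro Suc.IH) (simp add: e)
    then show ?thesis using d by simp
  qed (use d in auto)
qed

lemma C_k_on_subset: "C_k_on k S g \<Longrightarrow> T \<subseteq> S \<Longrightarrow> C_k_on k T g"
  by (induction k arbitrary: g) (auto intro: continuous_on_subset)

lemma C_k_on_has_derivative:
  "C_k_on (Suc k) S g \<Longrightarrow> z \<in> S \<Longrightarrow> (g has_derivative frechet_derivative g (at z)) (at z)"
  by (simp add: frechet_derivative_works)

text \<open>Derivatives at a point are unique, so an explicit formula \<open>g'\<close> may stand in
  for \<open>frechet_derivative\<close>; the closure properties below are proved by supplying such a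
  formula.\<close>

lemma C_k_on_SucI:
  assumes "open S" "\<And>z. z \<in> S \<Longrightarrow> (g has_derivative g' z) (at z)" "\<And>v. C_k_on k S (\<lambda>z. g' z v)"
  shows "C_k_on (Suc k) S g"
proof -
  have "frechet_derivative g (at z) = g' z" if "z \<in> S" for z
    using assms(2)[OF that] by (metis frechet_derivative_at)
  then have "C_k_on k S (\<lambda>z. frechet_derivative g (at z) v)" for v
    using C_k_on_cong[OF assms(1), of "\<lambda>z. frechet_derivative g (at z) v" "\<lambda>z. g' z v"] assms(3) by simp
  then show ?thesis using assms(2) by (auto simp: differentiable_def)
qed

lemma C_k_on_SucD: "C_k_on (Suc k) S g \<Longrightarrow> C_k_on k S g"
proof (induction k arbitrary: g)
  case 0
  then show ?case
    by (auto intro!: continuous_at_imp_continuous_on differentiable_imp_continuous_within)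
qed auto

lemma C_k_on_imp_continuous_on: "C_k_on k S g \<Longrightarrow> continuous_on S g"
  by (induction k) (auto dest: C_k_on_SucD simp del: C_k_on.simps(2))

lemma C_k_on_const: "C_k_on k S (\<lambda>z. c)"
  by (induction k arbitrary: c) auto

lemma C_k_on_bounded_linear:
  assumes "bounded_linear L" "open S" "C_k_on k S f"
  shows "C_k_on k S (\<lambda>z. L (f z))"
  using assms(3)
proof (induction k arbitrary: f)
  case 0
  then show ?case using assms(1) by (auto intro: bounded_linear.continuous_on)
next
  case (Suc k)
  then show ?case
    by (intro C_k_on_SucI[where g' = "\<lambda>z v. L (frechet_derivative f (at z) v)"])
       (auto intro: assms bounded_linear.has_derivative[OF assms(1)] simp: frechet_derivative_works)
qed

lemma C_k_on_add:
  assumes "open S" "C_k_on k S f" "C_k_on k S g"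
  shows "C_k_on k S (\<lambda>z. f z + g z)"
  using assms(2,3)
proof (induction k arbitrary: f g)
  case (Suc k)
  then show ?case
    by (intro C_k_on_SucI[where g' = "\<lambda>z v. frechet_derivative f (at z) v + frechet_derivative g (at z) v"])
       (auto intro: assms has_derivative_add simp: frechet_derivative_works)
qed (auto intro: continuous_on_add)

text \<open>The product rule for an arbitrary bounded bilinear map serves products, scalings, inner
  products and \<open>cross3\<close> at once. The induction generalises over both factors because
  each summand of the derivative pairs one factor with a derivative of the other.\<close>

lemma C_k_on_bounded_bilinear:
  assumes "bounded_bilinear B" "open S" "C_k_on k S f" "C_k_on k S g"
  shows "C_k_on k S (\<lambda>z. B (f z) (g z))"
  using assms(3,4)
proof (induction k arbitrary: f g)
  case 0
  then show ?case using assms(1) by (auto intro: bounded_bilinear.continuous_on)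
next
  case (Suc k)
  show ?case
  proof (rule C_k_on_SucI[where g' = "\<lambda>z v. B (f z) (frechet_derivative g (at z) v) + B (frechet_derivative f (at z) v) (g z)"])
    show "((\<lambda>z. B (f z) (g z)) has_derivative
       (\<lambda>v. B (f z) (frechet_derivative g (at z) v) + B (frechet_derivative f (at z) v) (g z))) (at z)" if "z \<in> S" for z
      by (rule bounded_bilinear.FDERIV[OF assms(1) C_k_on_has_derivative[OF Suc.prems(1) that] C_k_on_has_derivative[OF Suc.prems(2) that]])
    show "C_k_on k S (\<lambda>z. B (f z) (frechet_derivative g (at z) v) + B (frechet_derivative f (at z) v) (g z))" for v
      using Suc.prems C_k_on_SucD[OF Suc.prems(1)] C_k_on_SucD[OF Suc.prems(2)]
      by (intro C_k_on_add assms(2) Suc.IH) auto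
  qed (rule assms)
qed

lemma C_k_on_sum:
  assumes "open S" "\<And>i. i \<in> I \<Longrightarrow> C_k_on k S (f i)"
  shows "C_k_on k S (\<lambda>z. \<Sum>i\<in>I. f i z)"
  using assms(2) by (induction I rule: infinite_finite_induct) (auto intro: C_k_on_const C_k_on_add assms(1))

lemma C_k_on_compose:
  fixes g :: "'b::euclidean_space \<Rightarrow> 'c::real_normed_vector"
  assumes "open S" "open T" "h ` S \<subseteq> T" "C_k_on k S h" "C_k_on k T g"
  shows "C_k_on k S (\<lambda>z. g (h z))"
  using assms(4,5)
proof (induction k arbitrary: g)
  case 0
  then show ?case using assms(3) by (auto intro: continuous_on_compose2)
next
  case (Suc k)
  \<comment> \<open>\<open>C_k_on\<close> controls derivatives in fixed directions only, while the
    chain rule evaluates the derivative of \<open>g\<close> in the moving direction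
    \<open>frechet_derivative h (at z) v\<close>. Expanding that direction in \<open>Basis\<close>
    gives products to which the induction hypothesis applies.\<close>
  let ?D = "\<lambda>z v. \<Sum>b\<in>Basis. (frechet_derivative h (at z) v \<bullet> b) *\<^sub>R frechet_derivative g (at (h z)) b"
  show ?case
  proof (rule C_k_on_SucI[where g' = ?D])
    fix z assume z: "z \<in> S"
    then have hz: "h z \<in> T" using assms(3) by auto
    have dg: "(g has_derivative frechet_derivative g (at (h z))) (at (h z))"
      using Suc.prems(2) hz by (rule C_k_on_has_derivative)
    have "((\<lambda>z. g (h z)) has_derivative (\<lambda>v. frechet_derivative g (at (h z)) (frechet_derivative h (at z) v))) (at z)"
      using diff_chain_at[OF C_k_on_has_derivative[OF Suc.prems(1) z] dg] by (simp add: o_def)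
    moreover
    have "frechet_derivative g (at (h z)) x = (\<Sum>b\<in>Basis. (x \<bullet> b) *\<^sub>R frechet_derivative g (at (h z)) b)" for x
    proof -
      interpret linear "frechet_derivative g (at (h z))" using dg by (rule has_derivative_linear)
      have "frechet_derivative g (at (h z)) x = frechet_derivative g (at (h z)) (\<Sum>b\<in>Basis. (x \<bullet> b) *\<^sub>R b)"
        by (simp only: euclidean_representation)
      then show ?thesis by (simp only: sum scale)
    qed
    then have "(\<lambda>v. frechet_derivative g (at (h z)) (frechet_derivative h (at z) v)) = ?D z" by blast
    ultimately show "((\<lambda>z. g (h z)) has_derivative ?D z) (at z)" by simp
  next
    show "C_k_on k S (\<lambda>z. ?D z v)" for v
    proof (rule C_k_on_sum[OF assms(1)], rule C_k_on_bounded_bilinear[OF bounded_bilinear_scaleR assms(1)])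
      show "C_k_on k S (\<lambda>z. frechet_derivative h (at z) v \<bullet> b)" for b
        using Suc.prems(1) by (intro C_k_on_bounded_linear[OF bounded_linear_inner_left assms(1)]) auto
      show "C_k_on k S (\<lambda>z. frechet_derivative g (at (h z)) b)" for b
        by (rule Suc.IH[OF C_k_on_SucD[OF Suc.prems(1)]]) (use Suc.prems(2) in simp)
    qed
  qed (rule assms(1))
qed

lemma C_k_on_inverse:
  fixes f :: "'a::real_normed_vector \<Rightarrow> real"
  assumes "open S" "C_k_on k S f" "\<And>z. z \<in> S \<Longrightarrow> f z \<noteq> 0"
  shows "C_k_on k S (\<lambda>z. inverse (f z))"
  using assms(2)
proof (induction k)
  case 0
  then show ?case using assms(3) by (auto intro: continuous_on_inverse)
next
  case (Suc k)
  show ?case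
  proof (rule C_k_on_SucI[where g' = "\<lambda>z v. - (inverse (f z) * frechet_derivative f (at z) v * inverse (f z))"])
    show "((\<lambda>z. inverse (f z)) has_derivative
       (\<lambda>v. - (inverse (f z) * frechet_derivative f (at z) v * inverse (f z)))) (at z)" if "z \<in> S" for z
      by (rule Deriv.has_derivative_inverse[OF assms(3)[OF that] C_k_on_has_derivative[OF Suc.prems that]])
    show "C_k_on k S (\<lambda>z. - (inverse (f z) * frechet_derivative f (at z) v * inverse (f z)))" for v
      using Suc.IH[OF C_k_on_SucD[OF Suc.prems]] Suc.prems
      by (intro C_k_on_bounded_linear[OF bounded_linear_minus[OF bounded_linear_ident]]
            C_k_on_bounded_bilinear[OF bounded_bilinear_mult] assms(1)) auto
  qed (rule assms(1))
qed

lemma bounded_bilinear_cross3: "bounded_bilinear cross3"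
  by (simp add: bilinear_conv_bounded_bilinear[symmetric] bilinear_cross)

lemmas C_k_on_mult = C_k_on_bounded_bilinear[OF bounded_bilinear_mult]
lemmas C_k_on_scaleR = C_k_on_bounded_bilinear[OF bounded_bilinear_scaleR]
lemmas C_k_on_inner = C_k_on_bounded_bilinear[OF bounded_bilinear_inner]
lemmas C_k_on_cross3 = C_k_on_bounded_bilinear[OF bounded_bilinear_cross3]
lemmas C_k_on_minus = C_k_on_bounded_linear[OF bounded_linear_minus[OF bounded_linear_ident]]

lemma C_k_on_diff:
  assumes "open S" "C_k_on k S f" "C_k_on k S g"
  shows "C_k_on k S (\<lambda>z. f z - g z)"
  using C_k_on_add[OF assms(1,2) C_k_on_minus[OF assms(1,3)]] by simp

lemma C_k_on_divide:
  fixes f g :: "'a::real_normed_vector \<Rightarrow> real"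
  assumes "open S" "C_k_on k S f" "C_k_on k S g" "\<And>z. z \<in> S \<Longrightarrow> g z \<noteq> 0"
  shows "C_k_on k S (\<lambda>z. f z / g z)"
  unfolding divide_inverse by (intro C_k_on_mult C_k_on_inverse assms)

lemma C_k_on_ident: "C_k_on k S (\<lambda>z. z)"
  by (cases k) (auto intro: C_k_on_const)

lemma smooth_onD: "smooth_on S g \<Longrightarrow> C_k_on k S g"
  by (simp add: smooth_on_def)

lemma smooth_on_has_derivative:
  "smooth_on S g \<Longrightarrow> z \<in> S \<Longrightarrow> (g has_derivative frechet_derivative g (at z)) (at z)"
  using C_k_on_has_derivative smooth_onD by blast

lemma smooth_on_frechet_derivative: "smooth_on S g \<Longrightarrow> smooth_on S (\<lambda>z. frechet_derivative g (at z) v)"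
  unfolding smooth_on_def using C_k_on.simps(2) by blast

lemma smooth_on_imp_continuous_on: "smooth_on S g \<Longrightarrow> continuous_on S g"
  using C_k_on_imp_continuous_on smooth_onD by blast

lemma smooth_on_subset: "smooth_on S g \<Longrightarrow> T \<subseteq> S \<Longrightarrow> smooth_on T g"
  unfolding smooth_on_def using C_k_on_subset by blast

lemma smooth_on_cong:
  assumes "open S" "\<And>z. z \<in> S \<Longrightarrow> f z = g z"
  shows "smooth_on S f \<longleftrightarrow> smooth_on S g"
  unfolding smooth_on_def using C_k_on_cong[OF assms(1), of f g] assms(2) by simp

lemma smooth_on_compose:
  fixes g :: "'b::euclidean_space \<Rightarrow> 'c::real_normed_vector"
  shows "open S \<Longrightarrow> open T \<Longrightarrow> h ` S \<subseteq> T \<Longrightarrow> smooth_on S h \<Longrightarrow> smooth_on T g \<Longrightarrow> smooth_on S (\<lambda>z. g (h z))"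
  unfolding smooth_on_def by (blast intro: C_k_on_compose)

lemma smooth_on_intros:
  assumes "open S"
  shows "smooth_on S (\<lambda>z. c)" and "smooth_on S (\<lambda>z. z)"
    and "smooth_on S a \<Longrightarrow> smooth_on S b \<Longrightarrow> smooth_on S (\<lambda>z. a z + b z)"
    and "smooth_on S a \<Longrightarrow> smooth_on S b \<Longrightarrow> smooth_on S (\<lambda>z. a z - b z)"
    and "smooth_on S a \<Longrightarrow> smooth_on S (\<lambda>z. - a z)"
    and "smooth_on S r \<Longrightarrow> smooth_on S a \<Longrightarrow> smooth_on S (\<lambda>z. r z *\<^sub>R a z)"
    and "smooth_on S r \<Longrightarrow> smooth_on S s \<Longrightarrow> smooth_on S (\<lambda>z. r z * s z :: real)"
    and "smooth_on S r \<Longrightarrow> smooth_on S s \<Longrightarrow> (\<And>z. z \<in> S \<Longrightarrow> s z \<noteq> 0) \<Longrightarrow> smooth_on S (\<lambda>z. r z / s z :: real)"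
    and "smooth_on S x \<Longrightarrow> smooth_on S y \<Longrightarrow> smooth_on S (\<lambda>z. cross3 (x z) (y z))"
    and "smooth_on S p \<Longrightarrow> smooth_on S q \<Longrightarrow> smooth_on S (\<lambda>z. p z \<bullet> q z)"
  unfolding smooth_on_def
  by (simp_all add: C_k_on_const C_k_on_ident C_k_on_add[OF assms] C_k_on_diff[OF assms] C_k_on_minus[OF assms]
      C_k_on_scaleR[OF assms] C_k_on_mult[OF assms] C_k_on_divide[OF assms] C_k_on_cross3[OF assms] C_k_on_inner[OF assms])

lemma has_vector_derivative_chain:
  assumes "(\<gamma> has_vector_derivative v) (at t)" "(g has_derivative g') (at (\<gamma> t))"
  shows "((\<lambda>s. g (\<gamma> s)) has_vector_derivative g' v) (at t)"
proof -
  have "((\<lambda>s. g (\<gamma> s)) has_derivative (\<lambda>r. g' (r *\<^sub>R v))) (at t)"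
    using diff_chain_at[OF assms(1)[unfolded has_vector_derivative_def] assms(2)] by (simp add: o_def)
  then show ?thesis
    unfolding has_vector_derivative_def
    using linear_cmul[OF has_derivative_linear[OF assms(2)]] by simp
qed

section \<open>Symmetry of second derivatives\<close>

lemma second_difference:
  fixes f :: "'a::real_normed_vector \<Rightarrow> real"
  assumes e: "e > 0" "ball x e \<subseteq> S" and C: "C_k_on 2 S f"
    and h: "h > 0" "h * (norm v + norm w) < e"
  obtains r s where "0 < r" "r < h" "0 < s" "s < h"
    "f (x + h *\<^sub>R v + h *\<^sub>R w) - f (x + h *\<^sub>R v) - f (x + h *\<^sub>R w) + f x =
      h * h * frechet_derivative (\<lambda>z. frechet_derivative f (at z) v) (at (x + r *\<^sub>R v + s *\<^sub>R w)) w"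
proof -
  have C2: "C_k_on (Suc (Suc 0)) S f" using C by (simp add: numeral_2_eq_2)
  have in_S: "x + r *\<^sub>R v + s *\<^sub>R w \<in> S" if "0 \<le> r" "r \<le> h" "0 \<le> s" "s \<le> h" for r s
  proof -
    have "norm (r *\<^sub>R v + s *\<^sub>R w) \<le> r * norm v + s * norm w"
      using that norm_triangle_ineq[of "r *\<^sub>R v" "s *\<^sub>R w"] by simp
    also have "\<dots> \<le> h * norm v + h * norm w"
      using that by (intro add_mono mult_right_mono) auto
    also have "\<dots> < e" using h by (simp add: algebra_simps)
    finally have "dist x (x + (r *\<^sub>R v + s *\<^sub>R w)) < e"
      by (metis add_diff_cancel_left' dist_commute dist_norm)
    then show ?thesis using subsetD[OF e(2), of "x + (r *\<^sub>R v + s *\<^sub>R w)"] by (simp add: add.assoc)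
  qed
  let ?D = "\<lambda>z. frechet_derivative f (at z)"
  have df: "((\<lambda>r. f (p + r *\<^sub>R u)) has_real_derivative ?D (p + r *\<^sub>R u) u) (at r)" if "p + r *\<^sub>R u \<in> S" for p r u
  proof -
    have "((\<lambda>r. p + r *\<^sub>R u) has_vector_derivative u) (at r)"
      by (auto intro!: derivative_eq_intros)
    from has_vector_derivative_chain[OF this C_k_on_has_derivative[OF C2 that]]
    show ?thesis by (simp add: has_real_derivative_iff_has_vector_derivative)
  qed
  have ddf: "((\<lambda>s. ?D (p + s *\<^sub>R u) v) has_real_derivative frechet_derivative (\<lambda>z. ?D z v) (at (p + s *\<^sub>R u)) u) (at s)"
    if "p + s *\<^sub>R u \<in> S" for p s u
  proof -
    have 1: "((\<lambda>r. p + r *\<^sub>R u) has_vector_derivative u) (at s)"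
      by (auto intro!: derivative_eq_intros)
    have 2: "C_k_on (Suc 0) S (\<lambda>z. ?D z v)" using C2 C_k_on.simps(2) by blast
    have "((\<lambda>s. ?D (p + s *\<^sub>R u) v) has_vector_derivative frechet_derivative (\<lambda>z. ?D z v) (at (p + s *\<^sub>R u)) u) (at s)"
      by (rule has_vector_derivative_chain[OF 1, of "\<lambda>z. ?D z v"], rule C_k_on_has_derivative[OF 2 that])
    then show ?thesis by (simp add: has_real_derivative_iff_has_vector_derivative)
  qed
  \<comment> \<open>The second difference is the increment of \<open>\<phi>\<close> over
    \<open>[0, h]\<close>. The mean value theorem in direction \<open>v\<close>, and then in
    direction \<open>w\<close> for the resulting difference of first derivatives, yields the mixed
    derivative at an intermediate point.\<close>
  define \<phi> where "\<phi> r = f ((x + h *\<^sub>R w) + r *\<^sub>R v) - f (x + r *\<^sub>R v)" for r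
  have "\<exists>r>0. r < h \<and> \<phi> h - \<phi> 0 = (h - 0) * (?D ((x + h *\<^sub>R w) + r *\<^sub>R v) v - ?D (x + r *\<^sub>R v) v)"
  proof (rule MVT2)
    fix r assume "0 \<le> r" "r \<le> h"
    then have "(x + h *\<^sub>R w) + r *\<^sub>R v \<in> S" "x + r *\<^sub>R v \<in> S"
      using in_S[of r h] in_S[of r 0] h(1) by (simp_all add: algebra_simps)
    then show "(\<phi> has_real_derivative (?D ((x + h *\<^sub>R w) + r *\<^sub>R v) v - ?D (x + r *\<^sub>R v) v)) (at r)"
      unfolding \<phi>_def by (intro DERIV_diff df)
  qed (rule h)
  then obtain r where r: "0 < r" "r < h" "\<phi> h - \<phi> 0 = h * (?D ((x + h *\<^sub>R w) + r *\<^sub>R v) v - ?D (x + r *\<^sub>R v) v)"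
    by auto
  have "\<exists>s>0. s < h \<and> ?D ((x + r *\<^sub>R v) + h *\<^sub>R w) v - ?D ((x + r *\<^sub>R v) + 0 *\<^sub>R w) v =
      (h - 0) * frechet_derivative (\<lambda>z. ?D z v) (at ((x + r *\<^sub>R v) + s *\<^sub>R w)) w"
  proof (rule MVT2)
    fix s assume "0 \<le> s" "s \<le> h"
    then show "((\<lambda>s. ?D ((x + r *\<^sub>R v) + s *\<^sub>R w) v) has_real_derivative
        frechet_derivative (\<lambda>z. ?D z v) (at ((x + r *\<^sub>R v) + s *\<^sub>R w)) w) (at s)"
      using in_S[of r s] r(1,2) by (intro ddf) auto
  qed (rule h)
  then obtain s where s: "0 < s" "s < h" "?D (x + r *\<^sub>R v + h *\<^sub>R w) v - ?D (x + r *\<^sub>R v) v =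
      h * frechet_derivative (\<lambda>z. ?D z v) (at (x + r *\<^sub>R v + s *\<^sub>R w)) w"
    by auto
  have "f (x + h *\<^sub>R v + h *\<^sub>R w) - f (x + h *\<^sub>R v) - f (x + h *\<^sub>R w) + f x = \<phi> h - \<phi> 0"
    by (simp add: \<phi>_def algebra_simps)
  also have "\<dots> = h * (h * frechet_derivative (\<lambda>z. ?D z v) (at (x + r *\<^sub>R v + s *\<^sub>R w)) w)"
    using r(3) s(3) by (simp add: algebra_simps)
  finally show thesis using that r s by (simp add: mult.assoc)
qed

text \<open>The second difference is symmetric in \<open>v\<close> and \<open>w\<close>, so the two
  mixed derivatives agree at pairs of points tending to \<open>x\<close>; continuity of the second
  derivatives gives equality at \<open>x\<close>.\<close>

lemma frechet_derivative_commute_real: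
  fixes f :: "'a::real_normed_vector \<Rightarrow> real"
  assumes S: "open S" "x \<in> S" and C: "C_k_on 2 S f"
  shows "frechet_derivative (\<lambda>z. frechet_derivative f (at z) v) (at x) w =
    frechet_derivative (\<lambda>z. frechet_derivative f (at z) w) (at x) v" (is "?F v w x = ?F w v x")
proof -
  obtain e where e: "e > 0" "ball x e \<subseteq> S" using S open_contains_ball by blast
  \<comment> \<open>A null sequence of admissible step sizes: the summand 2 keeps the product with
    \<open>norm v + norm w\<close> strictly below \<open>e\<close> from \<open>n = 0\<close> on, and
    the summand 1 covers \<open>v = w = 0\<close>.\<close>
  define h where "h n = e / (real n + 2) / (norm v + norm w + 1)" for n
  have h: "h n > 0" "h n * (norm v + norm w) < e" for n
  proof -
    show "h n > 0" unfolding h_def using e(1)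
      by (intro divide_pos_pos) (auto intro: add_nonneg_pos)
    have "h n * (norm v + norm w) \<le> h n * (norm v + norm w + 1)" using \<open>h n > 0\<close> by simp
    also have "\<dots> = e / (real n + 2)"
      unfolding h_def using add_nonneg_pos[of "norm v + norm w" 1] by simp
    also have "\<dots> < e" using e(1) by (simp add: field_simps add_pos_nonneg)
    finally show "h n * (norm v + norm w) < e" .
  qed
  have h0: "h \<longlonglongrightarrow> 0"
    unfolding h_def using tendsto_divide[OF LIMSEQ_ignore_initial_segment[OF lim_const_over_n[of e], of 2] tendsto_const[of "norm v + norm w + 1"]]
    add_nonneg_pos[of "norm v + norm w" 1] by (simp add: add.commute)
  have lim: "(\<lambda>n. ?F a b (x + r n *\<^sub>R a + s n *\<^sub>R b)) \<longlonglongrightarrow> ?F a b x"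
    if "\<And>n. 0 < r n \<and> r n < h n" "\<And>n. 0 < s n \<and> s n < h n" for r s a b
  proof -
    have "r \<longlonglongrightarrow> 0" "s \<longlonglongrightarrow> 0"
      using that by (auto intro!: tendsto_sandwich[OF _ _ tendsto_const h0] always_eventually less_imp_le)
    then have "(\<lambda>n. x + r n *\<^sub>R a + s n *\<^sub>R b) \<longlonglongrightarrow> x + 0 *\<^sub>R a + 0 *\<^sub>R b"
      by (intro tendsto_intros)
    moreover have "C_k_on 0 S (?F a b)" using C unfolding numeral_2_eq_2 C_k_on.simps(2) by blast
    then have "isCont (?F a b) x" using S by (simp add: continuous_on_eq_continuous_at)
    ultimately show ?thesis using isCont_tendsto_compose[of x "?F a b" "\<lambda>n. x + r n *\<^sub>R a + s n *\<^sub>R b" sequentially] by simp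
  qed
  have "\<exists>r s r' s'. 0 < r \<and> r < h n \<and> 0 < s \<and> s < h n \<and> 0 < r' \<and> r' < h n \<and> 0 < s' \<and> s' < h n \<and>
      ?F v w (x + r *\<^sub>R v + s *\<^sub>R w) = ?F w v (x + r' *\<^sub>R w + s' *\<^sub>R v)" for n
  proof -
    obtain r s where rs: "0 < r" "r < h n" "0 < s" "s < h n"
      "f (x + h n *\<^sub>R v + h n *\<^sub>R w) - f (x + h n *\<^sub>R v) - f (x + h n *\<^sub>R w) + f x = h n * h n * ?F v w (x + r *\<^sub>R v + s *\<^sub>R w)"
      using second_difference[OF e C h] by blast
    have "h n * (norm w + norm v) < e" using h(2)[of n] by (simp add: add.commute)
    then obtain r' s' where rs': "0 < r'" "r' < h n" "0 < s'" "s' < h n"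
      "f (x + h n *\<^sub>R w + h n *\<^sub>R v) - f (x + h n *\<^sub>R w) - f (x + h n *\<^sub>R v) + f x = h n * h n * ?F w v (x + r' *\<^sub>R w + s' *\<^sub>R v)"
      using second_difference[OF e C h(1)] by blast
    have "x + h n *\<^sub>R w + h n *\<^sub>R v = x + h n *\<^sub>R v + h n *\<^sub>R w" by (simp add: algebra_simps)
    with rs(5) rs'(5)[unfolded this] have "h n * h n * ?F v w (x + r *\<^sub>R v + s *\<^sub>R w) = h n * h n * ?F w v (x + r' *\<^sub>R w + s' *\<^sub>R v)"
      by linarith
    then have "?F v w (x + r *\<^sub>R v + s *\<^sub>R w) = ?F w v (x + r' *\<^sub>R w + s' *\<^sub>R v)" using h(1)[of n] by simp
    then show ?thesis using rs rs' by blast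
  qed
  then obtain r s r' s' where *: "\<And>n. 0 < r n \<and> r n < h n" "\<And>n. 0 < s n \<and> s n < h n"
      "\<And>n. 0 < r' n \<and> r' n < h n" "\<And>n. 0 < s' n \<and> s' n < h n"
      "\<And>n. ?F v w (x + r n *\<^sub>R v + s n *\<^sub>R w) = ?F w v (x + r' n *\<^sub>R w + s' n *\<^sub>R v)"
    by metis
  show ?thesis
    using lim[OF *(1,2), of v w] lim[OF *(3,4), of w v] unfolding *(5) by (rule LIMSEQ_unique)
qed

lemma frechet_derivative_commute:
  fixes f :: "'a::real_normed_vector \<Rightarrow> 'b::real_inner"
  assumes S: "open S" "x \<in> S" and C: "C_k_on 2 S f"
  shows "frechet_derivative (\<lambda>z. frechet_derivative f (at z) v) (at x) w =
    frechet_derivative (\<lambda>z. frechet_derivative f (at z) w) (at x) v"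
proof -
  have C2: "C_k_on (Suc (Suc 0)) S f" using C by (simp add: numeral_2_eq_2)
  have 1: "frechet_derivative (\<lambda>z. g z \<bullet> b) (at z) = (\<lambda>u. frechet_derivative g (at z) u \<bullet> b)"
    if "z \<in> S" "C_k_on (Suc 0) S g" for g :: "'a \<Rightarrow> 'b" and z b
    by (rule frechet_derivative_at[symmetric],
        rule bounded_linear.has_derivative[OF bounded_linear_inner_left C_k_on_has_derivative[OF that(2,1)]])
  have 2: "frechet_derivative (\<lambda>z. frechet_derivative (\<lambda>z. f z \<bullet> b) (at z) v) (at x) w =
      frechet_derivative (\<lambda>z. frechet_derivative f (at z) v) (at x) w \<bullet> b" for v w b
  proof -
    have Cv: "C_k_on (Suc 0) S (\<lambda>z. frechet_derivative f (at z) v)" using C2 C_k_on.simps(2) by blast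
    have "C_k_on (Suc 0) S (\<lambda>z. frechet_derivative f (at z) v \<bullet> b)"
      using Cv by (intro C_k_on_bounded_linear[OF bounded_linear_inner_left S(1)])
    moreover have *: "frechet_derivative f (at z) v \<bullet> b = frechet_derivative (\<lambda>z. f z \<bullet> b) (at z) v" if "z \<in> S" for z
      using 1[OF that C_k_on_SucD[OF C2]] by simp
    ultimately have "frechet_derivative (\<lambda>z. frechet_derivative f (at z) v \<bullet> b) (at x) =
        frechet_derivative (\<lambda>z. frechet_derivative (\<lambda>z. f z \<bullet> b) (at z) v) (at x)"
      using S(2) by (intro frechet_derivative_transform_within_open[OF _ S]) auto
    from fun_cong[OF this, of w] show ?thesis unfolding 1[OF S(2) Cv] by simp
  qed
  have "C_k_on 2 S (\<lambda>z. f z \<bullet> b)" for b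
    using C by (intro C_k_on_bounded_linear[OF bounded_linear_inner_left S(1)])
  then have "frechet_derivative (\<lambda>z. frechet_derivative f (at z) v) (at x) w \<bullet> b =
      frechet_derivative (\<lambda>z. frechet_derivative f (at z) w) (at x) v \<bullet> b" for b
    using frechet_derivative_commute_real[OF S, of "\<lambda>z. f z \<bullet> b" v w] by (simp only: 2)
  then have "\<forall>b. frechet_derivative (\<lambda>z. frechet_derivative f (at z) v) (at x) w \<bullet> b =
      frechet_derivative (\<lambda>z. frechet_derivative f (at z) w) (at x) v \<bullet> b" by (rule allI)
  then show ?thesis by (rule vector_eq_rdot[THEN iffD1])
qed

lemma continuous_on_frechet_derivative:
  "smooth_on S g \<Longrightarrow> continuous_on S (\<lambda>z. frechet_derivative g (at z) v)"
  using smooth_on_frechet_derivative smooth_on_imp_continuous_on by blast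

lemma linear_real2:
  fixes F :: "real^2 \<Rightarrow> 'b::real_vector"
  assumes "linear F"
  shows "F \<zeta> = \<zeta>$1 *\<^sub>R F (axis 1 1) + \<zeta>$2 *\<^sub>R F (axis 2 1)"
proof -
  have "\<zeta> = \<zeta>$1 *\<^sub>R axis 1 1 + \<zeta>$2 *\<^sub>R axis 2 1"
    by (simp add: vec_eq_iff forall_2 axis_def)
  then have "F \<zeta> = F (\<zeta>$1 *\<^sub>R axis 1 1 + \<zeta>$2 *\<^sub>R axis 2 1)" by (rule arg_cong)
  then show ?thesis by (simp only: linear_add[OF assms] linear_cmul[OF assms])
qed

section \<open>Level sets in the plane as graphs\<close>

lemma isCont_eventually_nhds:
  fixes f :: "'a::t2_space \<Rightarrow> real"
  assumes "isCont f x"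
  shows "c < f x \<Longrightarrow> \<forall>\<^sub>F y in nhds x. c < f y" and "f x < c \<Longrightarrow> \<forall>\<^sub>F y in nhds x. f y < c"
proof -
  have "(f \<longlongrightarrow> f x) (nhds x)"
    using assms by (simp add: isCont_def tendsto_at_iff_tendsto_nhds[of f x, symmetric])
  then show "c < f x \<Longrightarrow> \<forall>\<^sub>F y in nhds x. c < f y" and "f x < c \<Longrightarrow> \<forall>\<^sub>F y in nhds x. f y < c"
    by (auto dest: order_tendstoD)
qed

text \<open>An implicit function theorem in the form that Stokes' formula needs: besides the graph
  it describes the whole sublevel set in the box. In the construction \<open>r2\<close> is the
  normalised gradient at \<open>z0\<close>, which puts the negative side below the graph, and
  \<open>r1\<close> is \<open>r2\<close> turned by a right angle. The determinant 1 makes the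
  coordinates \<open>(u, v)\<close> preserve area and orientation.\<close>

theorem implicit_graph:
  fixes L :: "real^2 \<Rightarrow> real"
  assumes S: "open S" "z0 \<in> S" and L: "smooth_on S L" "L z0 = 0"
    and nz: "frechet_derivative L (at z0) \<zeta> \<noteq> 0"
  obtains r1 r2 :: "real^2" and a b :: real and g :: "real \<Rightarrow> real"
  where "r1$1 * r2$2 - r1$2 * r2$1 = 1" "a > 0" "b > 0" "smooth_on {-a<..<a} g" "g 0 = 0"
    "\<And>u. \<bar>u\<bar> < a \<Longrightarrow> \<bar>g u\<bar> < b"
    "\<And>u v. \<bar>u\<bar> < a \<Longrightarrow> \<bar>v\<bar> < b \<Longrightarrow> z0 + u *\<^sub>R r1 + v *\<^sub>R r2 \<in> S"
    "\<And>u v. \<bar>u\<bar> < a \<Longrightarrow> \<bar>v\<bar> < b \<Longrightarrow> frechet_derivative L (at (z0 + u *\<^sub>R r1 + v *\<^sub>R r2)) r2 > 0"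
    "\<And>u v. \<bar>u\<bar> < a \<Longrightarrow> \<bar>v\<bar> < b \<Longrightarrow> L (z0 + u *\<^sub>R r1 + v *\<^sub>R r2) < 0 \<longleftrightarrow> v < g u"
    "\<And>u v. \<bar>u\<bar> < a \<Longrightarrow> \<bar>v\<bar> < b \<Longrightarrow> L (z0 + u *\<^sub>R r1 + v *\<^sub>R r2) = 0 \<longleftrightarrow> v = g u"
proof -
  let ?D = "\<lambda>z. frechet_derivative L (at z)"
  have lin: "linear (?D z)" if "z \<in> S" for z
    using smooth_on_has_derivative[OF L(1) that] by (rule has_derivative_linear)
  define n :: "real^2" where "n = vector [?D z0 (axis 1 1), ?D z0 (axis 2 1)]"
  have n0: "n \<noteq> 0"
    using nz linear_real2[OF lin[OF S(2)], of \<zeta>] by (auto simp: n_def vec_eq_iff forall_2)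
  define r2 where "r2 = n /\<^sub>R norm n"
  define r1 :: "real^2" where "r1 = vector [r2$2, - r2$1]"
  have nr2: "norm r2 = 1" using n0 by (simp add: r2_def)
  then have sq: "r2$1 * r2$1 + r2$2 * r2$2 = 1"
    by (simp add: norm_eq_1 inner_vec_def sum_2)
  then have nr1: "norm r1 = 1"
    by (simp add: r1_def norm_eq_1 inner_vec_def sum_2)
  have det: "r1$1 * r2$2 - r1$2 * r2$1 = 1" using sq by (simp add: r1_def)
  have "?D z0 r2 = (n \<bullet> n) / norm n"
    using linear_real2[OF lin[OF S(2)], of r2]
    by (simp add: r2_def n_def inner_vec_def sum_2 add_divide_distrib field_simps)
  then have pos0: "?D z0 r2 > 0" using n0 by simp
  have "isCont (\<lambda>z. ?D z r2) z0"
    using continuous_on_frechet_derivative[OF L(1)] S by (simp add: continuous_on_eq_continuous_at)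
  then have "\<forall>\<^sub>F z in nhds z0. ?D z r2 > 0"
    using pos0 by (rule isCont_eventually_nhds(1))
  moreover have "\<forall>\<^sub>F z in nhds z0. z \<in> S" using S by (rule eventually_nhds_in_open)
  ultimately have "\<forall>\<^sub>F z in nhds z0. ?D z r2 > 0 \<and> z \<in> S" by (rule eventually_conj)
  then obtain e where e: "e > 0" "\<And>z. dist z z0 < e \<Longrightarrow> ?D z r2 > 0 \<and> z \<in> S"
    unfolding eventually_nhds_metric by auto
  \<comment> \<open>The closed box \<open>\<bar>u\<bar> \<le> b\<close>,
    \<open>\<bar>v\<bar> \<le> b\<close> then lies within distance \<open>2 * b < e\<close> of
    \<open>z0\<close>.\<close>
  define b where "b = e / 4"
  have b: "b > 0" using e by (simp add: b_def)
  define A where "A u v = z0 + u *\<^sub>R r1 + v *\<^sub>R r2" for u v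
  have box: "?D (A u v) r2 > 0 \<and> A u v \<in> S" if "\<bar>u\<bar> \<le> b" "\<bar>v\<bar> \<le> b" for u v
  proof (rule e(2))
    have "dist (A u v) z0 = norm (u *\<^sub>R r1 + v *\<^sub>R r2)" by (simp add: A_def dist_norm)
    also have "\<dots> \<le> \<bar>u\<bar> + \<bar>v\<bar>"
      using norm_triangle_ineq[of "u *\<^sub>R r1" "v *\<^sub>R r2"] nr1 nr2 by simp
    also have "\<dots> < e" using that b by (simp add: b_def)
    finally show "dist (A u v) z0 < e" .
  qed
  have contL: "isCont L z" if "z \<in> S" for z
    using smooth_on_imp_continuous_on[OF L(1)] S(1) that by (simp add: continuous_on_eq_continuous_at)
  have contu: "isCont (\<lambda>u. L (A u v)) u" if "\<bar>u\<bar> \<le> b" "\<bar>v\<bar> \<le> b" for u v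
  proof -
    have "isCont (\<lambda>u. A u v) u" by (simp add: A_def)
    then show ?thesis using contL[of "A u v"] box[OF that] by (auto intro: isCont_o2)
  qed
  have dv: "((\<lambda>v. L (A u v)) has_real_derivative ?D (A u v) r2) (at v)" if "\<bar>u\<bar> \<le> b" "\<bar>v\<bar> \<le> b" for u v
  proof -
    have 1: "((\<lambda>v. A u v) has_vector_derivative r2) (at v)"
      unfolding A_def by (auto intro!: derivative_eq_intros)
    have "((\<lambda>v. L (A u v)) has_vector_derivative ?D (A u v) r2) (at v)"
      by (rule has_vector_derivative_chain[OF 1], rule smooth_on_has_derivative[OF L(1)]) (use box[OF that] in simp)
    then show ?thesis by (simp add: has_real_derivative_iff_has_vector_derivative)
  qed
  \<comment> \<open>Strict monotonicity in \<open>v\<close> gives both the uniqueness of the zero on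
    each vertical line and the sign of \<open>L\<close> on either side of it.\<close>
  have mono: "L (A u v) < L (A u w)" if "\<bar>u\<bar> \<le> b" "-b \<le> v" "v < w" "w \<le> b" for u v w
  proof (rule DERIV_pos_imp_increasing[OF that(3)])
    fix x assume "v \<le> x" "x \<le> w"
    then have "\<bar>x\<bar> \<le> b" using that by auto
    from dv[OF that(1) this] box[OF that(1) this] show "\<exists>y. ((\<lambda>v. L (A u v)) has_real_derivative y) (at x) \<and> y > 0" by blast
  qed
  have A0: "L (A 0 0) = 0" using L(2) by (simp add: A_def)
  have "L (A 0 b) > 0" "L (A 0 (-b)) < 0" using mono[of 0 0 b] mono[of 0 "-b" 0] b A0 by auto
  then have "\<forall>\<^sub>F u in nhds 0. L (A u b) > 0" "\<forall>\<^sub>F u in nhds 0. L (A u (-b)) < 0"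
    using contu[of 0 b] contu[of 0 "-b"] b by (simp_all add: isCont_eventually_nhds)
  then have "\<forall>\<^sub>F u in nhds 0. L (A u b) > 0 \<and> L (A u (-b)) < 0" by (rule eventually_conj)
  then obtain a0 where a0: "a0 > 0" "\<And>u. dist u 0 < a0 \<Longrightarrow> L (A u b) > 0 \<and> L (A u (-b)) < 0"
    unfolding eventually_nhds_metric by blast
  define a where "a = min a0 b"
  have a: "a > 0" "a \<le> b" using a0 b by (auto simp: a_def)
  have sgn_b: "L (A u b) > 0" "L (A u (-b)) < 0" if "\<bar>u\<bar> < a" for u
    using a0(2)[of u] that by (auto simp: a_def)
  have "\<exists>v. \<bar>v\<bar> < b \<and> L (A u v) = 0" if u: "\<bar>u\<bar> < a" for u
  proof -
    have ub: "\<bar>u\<bar> \<le> b" using u a by simp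
    have "\<exists>v\<ge>-b. v \<le> b \<and> L (A u v) = 0"
      by (rule IVT') (use sgn_b[OF u] b in \<open>auto intro!: continuous_at_imp_continuous_on DERIV_isCont[OF dv[OF ub]]\<close>)
    then obtain v where v: "-b \<le> v" "v \<le> b" "L (A u v) = 0" by blast
    moreover have "v \<noteq> b" "v \<noteq> -b" using sgn_b[OF u] v(3) by auto
    ultimately show ?thesis by (intro exI[of _ v]) auto
  qed
  then obtain g where g: "\<And>u. \<bar>u\<bar> < a \<Longrightarrow> \<bar>g u\<bar> < b" "\<And>u. \<bar>u\<bar> < a \<Longrightarrow> L (A u (g u)) = 0"
    by metis
  have lt: "L (A u v) < 0 \<longleftrightarrow> v < g u" and eq: "L (A u v) = 0 \<longleftrightarrow> v = g u"
    if "\<bar>u\<bar> < a" "\<bar>v\<bar> < b" for u v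
  proof -
    have *: "L (A u (g u)) = 0" "\<bar>u\<bar> \<le> b" "\<bar>g u\<bar> < b" using g[OF that(1)] that a by auto
    have "v < g u \<Longrightarrow> L (A u v) < 0" "g u < v \<Longrightarrow> L (A u v) > 0"
      using mono[of u v "g u"] mono[of u "g u" v] * that by auto
    then show "L (A u v) < 0 \<longleftrightarrow> v < g u" "L (A u v) = 0 \<longleftrightarrow> v = g u"
      using *(1) by (cases v "g u" rule: linorder_cases; force)+
  qed
  have g0: "g 0 = 0" using eq[of 0 0] A0 a b by simp
  have g_tendsto: "(g \<longlongrightarrow> g u0) (nhds u0)" if u0: "\<bar>u0\<bar> < a" for u0
  proof (rule order_tendstoI)
    have near: "\<forall>\<^sub>F u in nhds u0. \<bar>u\<bar> < a"
      using eventually_nhds_in_open[of "{-a<..<a}" u0] u0 by (simp add: abs_less_iff) (auto elim: eventually_mono)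
    fix x
    {
      assume x: "x < g u0"
      \<comment> \<open>Truncation at the midpoint between \<open>g u0\<close> and \<open>-b\<close>
        keeps \<open>x'\<close> in the range where the sign of \<open>L\<close> is known; the upper
        bound is treated in the same way.\<close>
      define x' where "x' = max x ((g u0 - b) / 2)"
      have x': "\<bar>x'\<bar> < b" "x' < g u0" "x \<le> x'" using g(1)[OF u0] x by (auto simp: x'_def max_def)
      then have "L (A u0 x') < 0" using lt[OF u0] by simp
      then have "\<forall>\<^sub>F u in nhds u0. L (A u x') < 0"
        using contu[of u0 x'] u0 a x' by (simp add: isCont_eventually_nhds)
      with near show "\<forall>\<^sub>F u in nhds u0. x < g u"
        by eventually_elim (use lt[OF _ x'(1)] x'(3) in fastforce)
    next
      assume x: "g u0 < x"
      define x' where "x' = min x ((g u0 + b) / 2)"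
      have x': "\<bar>x'\<bar> < b" "g u0 < x'" "x' \<le> x" using g(1)[OF u0] x by (auto simp: x'_def min_def)
      then have "L (A u0 x') > 0" using lt[OF u0 x'(1)] eq[OF u0 x'(1)] by linarith
      then have "\<forall>\<^sub>F u in nhds u0. L (A u x') > 0"
        using contu[of u0 x'] u0 a x' by (simp add: isCont_eventually_nhds)
      with near show "\<forall>\<^sub>F u in nhds u0. g u < x"
      proof eventually_elim
        case (elim u)
        then show ?case using lt[OF elim(1) x'(1)] eq[OF elim(1) x'(1)] x'(3) by linarith
      qed
    }
  qed
  have g_deriv: "(g has_real_derivative - ?D (A u0 (g u0)) r1 / ?D (A u0 (g u0)) r2) (at u0)" if u0: "\<bar>u0\<bar> < a" for u0
  proof -
    let ?p = "A u0 (g u0)"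
    \<comment> \<open>The mean value theorem on the segment between two points of the graph:
      \<open>L\<close> vanishes at both ends, so the difference quotient of \<open>g\<close> is
      minus the quotient of the derivatives in directions \<open>r1\<close> and \<open>r2\<close> at
      a point \<open>\<xi>\<close> of the segment. By continuity of \<open>g\<close> this point
      tends to \<open>?p\<close>.\<close>
    have "\<exists>\<xi>. dist \<xi> ?p \<le> \<bar>u - u0\<bar> + \<bar>g u - g u0\<bar> \<and> (g u - g u0) * ?D \<xi> r2 = - (u - u0) * ?D \<xi> r1 \<and> \<xi> \<in> S \<and> ?D \<xi> r2 > 0"
      if u: "\<bar>u\<bar> < a" for u
    proof -
      define w where "w = (u - u0) *\<^sub>R r1 + (g u - g u0) *\<^sub>R r2"
      have seg: "?p + s *\<^sub>R w = A (u0 + s * (u - u0)) (g u0 + s * (g u - g u0))" for s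
        by (simp add: A_def w_def algebra_simps)
      have cb: "\<bar>x + s * (y - x)\<bar> \<le> c" if "\<bar>x\<bar> \<le> c" "\<bar>y\<bar> \<le> c" "0 \<le> s" "s \<le> 1" for x y s c :: real
      proof -
        have "x + s * (y - x) = (1 - s) * x + s * y" by (simp add: algebra_simps)
        then have "\<bar>x + s * (y - x)\<bar> \<le> (1 - s) * \<bar>x\<bar> + s * \<bar>y\<bar>"
          using that(3,4) abs_triangle_ineq[of "(1 - s) * x" "s * y"] by (simp add: abs_mult)
        also have "\<dots> \<le> (1 - s) * c + s * c" using that by (intro add_mono mult_left_mono) auto
        finally show ?thesis by (simp add: algebra_simps)
      qed
      have inS: "?p + s *\<^sub>R w \<in> S \<and> ?D (?p + s *\<^sub>R w) r2 > 0" if "0 \<le> s" "s \<le> 1" for s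
        using box[OF cb[OF _ _ that] cb[OF _ _ that], of u0 u "g u0" "g u"] u u0 a g(1)[OF u] g(1)[OF u0]
        unfolding seg by auto
      have "\<exists>s>0. s < 1 \<and> L (?p + 1 *\<^sub>R w) - L (?p + 0 *\<^sub>R w) = (1 - 0) * ?D (?p + s *\<^sub>R w) w"
      proof (rule MVT2)
        fix s :: real assume s: "0 \<le> s" "s \<le> 1"
        have 1: "((\<lambda>s. ?p + s *\<^sub>R w) has_vector_derivative w) (at s)"
          by (auto intro!: derivative_eq_intros)
        have "((\<lambda>s. L (?p + s *\<^sub>R w)) has_vector_derivative ?D (?p + s *\<^sub>R w) w) (at s)"
          by (rule has_vector_derivative_chain[OF 1], rule smooth_on_has_derivative[OF L(1)]) (use inS[OF s] in simp)
        then show "((\<lambda>s. L (?p + s *\<^sub>R w)) has_real_derivative ?D (?p + s *\<^sub>R w) w) (at s)"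
          by (simp add: has_real_derivative_iff_has_vector_derivative)
      qed simp
      then obtain s where s: "0 < s" "s < 1" "L (?p + 1 *\<^sub>R w) - L (?p + 0 *\<^sub>R w) = ?D (?p + s *\<^sub>R w) w"
        by auto
      have "?p + 1 *\<^sub>R w = A u (g u)" "?p + 0 *\<^sub>R w = A u0 (g u0)" unfolding seg by simp_all
      with s(3) have 0: "?D (?p + s *\<^sub>R w) w = 0" using g(2)[OF u] g(2)[OF u0] by simp
      have inS': "?p + s *\<^sub>R w \<in> S" using inS[of s] s by simp
      have "?D (?p + s *\<^sub>R w) w = (u - u0) * ?D (?p + s *\<^sub>R w) r1 + (g u - g u0) * ?D (?p + s *\<^sub>R w) r2"
        unfolding w_def[THEN arg_cong, of "?D (?p + s *\<^sub>R w)"]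
        by (simp only: linear_add[OF lin[OF inS']] linear_cmul[OF lin[OF inS']] real_scaleR_def)
      with 0 have "(g u - g u0) * ?D (?p + s *\<^sub>R w) r2 = - (u - u0) * ?D (?p + s *\<^sub>R w) r1" by (simp add: algebra_simps)
      moreover have "dist (?p + s *\<^sub>R w) ?p \<le> \<bar>u - u0\<bar> + \<bar>g u - g u0\<bar>"
      proof -
        have "dist (?p + s *\<^sub>R w) ?p = s * norm w" using s by (simp add: dist_norm)
        also have "\<dots> \<le> norm w" using s by (simp add: mult_left_le_one_le)
        also have "\<dots> \<le> \<bar>u - u0\<bar> + \<bar>g u - g u0\<bar>"
          unfolding w_def using norm_triangle_ineq[of "(u - u0) *\<^sub>R r1" "(g u - g u0) *\<^sub>R r2"] nr1 nr2 by simp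
        finally show ?thesis .
      qed
      ultimately show ?thesis using inS[of s] s by (intro exI[of _ "?p + s *\<^sub>R w"]) auto
    qed
    then obtain \<xi> where \<xi>: "\<And>u. \<bar>u\<bar> < a \<Longrightarrow> dist (\<xi> u) ?p \<le> \<bar>u - u0\<bar> + \<bar>g u - g u0\<bar>"
      "\<And>u. \<bar>u\<bar> < a \<Longrightarrow> (g u - g u0) * ?D (\<xi> u) r2 = - (u - u0) * ?D (\<xi> u) r1"
      "\<And>u. \<bar>u\<bar> < a \<Longrightarrow> \<xi> u \<in> S \<and> ?D (\<xi> u) r2 > 0" by metis
    have near: "\<forall>\<^sub>F u in at u0. \<bar>u\<bar> < a"
      using eventually_at_in_open'[of "{-a<..<a}" u0] u0 by (simp add: abs_less_iff) (auto elim: eventually_mono)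
    have gt: "(g \<longlongrightarrow> g u0) (at u0)" using g_tendsto[OF u0] by (simp add: tendsto_at_iff_tendsto_nhds)
    have "((\<lambda>u. dist (\<xi> u) ?p) \<longlongrightarrow> 0) (at u0)"
    proof (rule tendsto_sandwich[OF _ _ tendsto_const])
      show "((\<lambda>u. \<bar>u - u0\<bar> + \<bar>g u - g u0\<bar>) \<longlongrightarrow> 0) (at u0)"
        using gt by (auto intro!: tendsto_eq_intros)
      show "\<forall>\<^sub>F u in at u0. dist (\<xi> u) ?p \<le> \<bar>u - u0\<bar> + \<bar>g u - g u0\<bar>"
        using near by eventually_elim (rule \<xi>(1))
    qed simp
    then have \<xi>p: "(\<xi> \<longlongrightarrow> ?p) (at u0)" by (rule tendsto_dist_iff[THEN iffD2])
    have pS: "?p \<in> S" "?D ?p r2 > 0" using box[of u0 "g u0"] u0 a g(1)[OF u0] by auto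
    have "isCont (\<lambda>z. ?D z v) ?p" for v
      using continuous_on_frechet_derivative[OF L(1)] S(1) pS by (simp add: continuous_on_eq_continuous_at)
    then have Dl: "((\<lambda>u. ?D (\<xi> u) v) \<longlongrightarrow> ?D ?p v) (at u0)" for v
      using isCont_tendsto_compose[OF _ \<xi>p, of "\<lambda>z. ?D z v"] by blast
    have "((\<lambda>u. - ?D (\<xi> u) r1 / ?D (\<xi> u) r2) \<longlongrightarrow> - ?D ?p r1 / ?D ?p r2) (at u0)"
      using pS(2) by (intro tendsto_divide tendsto_minus Dl) simp
    moreover have "\<forall>\<^sub>F u in at u0. - ?D (\<xi> u) r1 / ?D (\<xi> u) r2 = (g u - g u0) / (u - u0)"
      using near eventually_neq_at_within[of u0 u0]
    proof eventually_elim
      case (elim u)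
      then have "u - u0 \<noteq> 0" "?D (\<xi> u) r2 \<noteq> 0" using \<xi>(3)[of u] by auto
      then show ?case using \<xi>(2)[OF elim(1)] by (subst frac_eq_eq) (simp_all add: algebra_simps)
    qed
    ultimately show ?thesis
      unfolding has_field_derivative_iff by (rule Lim_transform_eventually)
  qed
  \<comment> \<open>Bootstrap: the derivative of \<open>g\<close> is a quotient of derivatives of
    the smooth \<open>L\<close> along the graph, hence as regular as \<open>g\<close>
    itself.\<close>
  have C: "C_k_on k {-a<..<a} g" for k
  proof (induction k)
    case 0
    show ?case by (auto intro!: continuous_at_imp_continuous_on DERIV_isCont[OF g_deriv])
  next
    case (Suc k)
    have img: "(\<lambda>u. A u (g u)) ` {-a<..<a} \<subseteq> S"
    proof
      fix z assume "z \<in> (\<lambda>u. A u (g u)) ` {-a<..<a}"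
      then obtain u where "z = A u (g u)" "\<bar>u\<bar> < a" by auto
      then show "z \<in> S" using box[of u "g u"] a g(1)[of u] by auto
    qed
    have CA: "C_k_on k {-a<..<a} (\<lambda>u. A u (g u))"
      unfolding A_def
      by (intro C_k_on_add C_k_on_scaleR C_k_on_const C_k_on_ident Suc.IH open_greaterThanLessThan)
    have CD: "C_k_on k {-a<..<a} (\<lambda>u. ?D (A u (g u)) v)" for v
      by (rule C_k_on_compose[OF open_greaterThanLessThan S(1) img CA, of "\<lambda>z. ?D z v"])
         (rule smooth_onD[OF smooth_on_frechet_derivative[OF L(1)]])
    show ?case
    proof (rule C_k_on_SucI[where g' = "\<lambda>u h. h * (- ?D (A u (g u)) r1 / ?D (A u (g u)) r2)"])
      show "(g has_derivative (\<lambda>h. h * (- ?D (A u (g u)) r1 / ?D (A u (g u)) r2))) (at u)" if "u \<in> {-a<..<a}" for u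
        using g_deriv[of u] that unfolding has_field_derivative_def
        by (subst mult.commute) (simp add: abs_less_iff)
      show "C_k_on k {-a<..<a} (\<lambda>u. h * (- ?D (A u (g u)) r1 / ?D (A u (g u)) r2))" for h
      proof (rule C_k_on_mult[OF open_greaterThanLessThan C_k_on_const],
          rule C_k_on_divide[OF open_greaterThanLessThan C_k_on_minus[OF open_greaterThanLessThan CD] CD])
        fix u assume "u \<in> {-a<..<a}"
        then have "\<bar>u\<bar> < a" by auto
        then show "?D (A u (g u)) r2 \<noteq> 0" using box[of u "g u"] a g(1)[of u] by auto
      qed
    qed simp
  qed
  have "smooth_on {-a<..<a} g" using C by (simp add: smooth_on_def)
  note * = that[OF det a(1) b this g0]
  show thesis
    by (rule *) (use box g lt eq a in \<open>auto simp: A_def\<close>)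
qed

section \<open>Measure theory\<close>

lemma measure_eqI_cover:
  fixes A :: "nat \<Rightarrow> 'a set"
  assumes "sets m = sets m'" and A: "\<And>n. A n \<in> sets m" "(\<Union>n. A n) = space m"
    and eq: "\<And>n B. B \<in> sets m \<Longrightarrow> B \<subseteq> A n \<Longrightarrow> emeasure m B = emeasure m' B"
  shows "m = m'"
proof (rule measure_eqI[OF assms(1)])
  fix B assume B: "B \<in> sets m"
  have D: "disjointed A n \<in> sets m" for n
    using A(1) sets.range_disjointed_sets[of A m] by auto
  have dis: "disjoint_family (\<lambda>n. B \<inter> disjointed A n)"
    using disjoint_family_disjointed[of A] by (auto simp: disjoint_family_on_def)
  have U: "(\<Union>n. B \<inter> disjointed A n) = B"
    using UN_disjointed_eq[of A] A(2) sets.sets_into_space[OF B] by auto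
  have "emeasure m B = (\<Sum>n. emeasure m (B \<inter> disjointed A n))"
    using B D dis by (subst suminf_emeasure) (auto simp only: U intro!: sets.Int)
  also have "\<dots> = (\<Sum>n. emeasure m' (B \<inter> disjointed A n))"
    using B D disjointed_subset[of A] by (intro suminf_cong eq) auto
  also have "\<dots> = emeasure m' B"
    using B D dis unfolding assms(1) by (subst suminf_emeasure) (auto simp only: U intro!: sets.Int)
  finally show "emeasure m B = emeasure m' B" .
qed

text \<open>Each set is cut along the disjointed cover and the \<open>n\<close>-th part is measured
  by \<open>\<mu> n\<close>. Agreement on overlaps makes the value independent of which covering set
  is credited with a part.\<close>

lemma glue_measures:
  fixes A :: "nat \<Rightarrow> 'a set" and N :: "'a measure"
  assumes s: "\<And>n. sets (\<mu> n) = sets N" and A: "\<And>n. A n \<in> sets N" "(\<Union>n. A n) = space N"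
    and eq: "\<And>i j B. B \<in> sets N \<Longrightarrow> B \<subseteq> A i \<Longrightarrow> B \<subseteq> A j \<Longrightarrow> emeasure (\<mu> i) B = emeasure (\<mu> j) B"
  obtains m where "space m = space N" "sets m = sets N"
    "\<And>n B. B \<in> sets N \<Longrightarrow> B \<subseteq> A n \<Longrightarrow> emeasure m B = emeasure (\<mu> n) B"
proof -
  have D: "disjointed A n \<in> sets N" for n
    using A(1) sets.range_disjointed_sets[of A N] by auto
  define F where "F B = (\<Sum>n. emeasure (\<mu> n) (B \<inter> disjointed A n))" for B
  define m where "m = measure_of (space N) (sets N) F"
  have sm: "sets m = sets N" "space m = space N"
    by (simp_all add: m_def sets.sigma_sets_eq sets.space_closed)
  have em: "emeasure m B = F B" if "B \<in> sets N" for B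
    unfolding m_def
  proof (rule emeasure_measure_of_sigma)
    show "sigma_algebra (space N) (sets N)" by (rule sets.sigma_algebra_axioms)
    show "positive (sets N) F" by (simp add: positive_def F_def)
    show "countably_additive (sets N) F"
    proof (rule countably_additiveI)
      fix B :: "nat \<Rightarrow> 'a set"
      assume B: "range B \<subseteq> sets N" "disjoint_family B"
      \<comment> \<open>Interchange of two series of nonnegative terms, read as Fubini for counting
        measures.\<close>
      have "(\<Sum>k. F (B k)) = (\<Sum>n. \<Sum>k. emeasure (\<mu> n) (B k \<inter> disjointed A n))"
        unfolding F_def nn_integral_count_space_nat[symmetric]
        by (rule pair_sigma_finite.Fubini') (auto simp: pair_sigma_finite_def sigma_finite_measure_count_space)
      also have "\<dots> = F (\<Union>k. B k)"
        unfolding F_def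
      proof (rule suminf_cong)
        fix n
        have "(\<Sum>k. emeasure (\<mu> n) (B k \<inter> disjointed A n)) = emeasure (\<mu> n) (\<Union>k. B k \<inter> disjointed A n)"
          using B D s by (intro suminf_emeasure) (auto simp: disjoint_family_on_def)
        then show "(\<Sum>k. emeasure (\<mu> n) (B k \<inter> disjointed A n)) = emeasure (\<mu> n) ((\<Union>k. B k) \<inter> disjointed A n)"
          by simp
      qed
      finally show "(\<Sum>k. F (B k)) = F (\<Union>k. B k)" .
    qed
  qed (rule that)
  show thesis
  proof (rule that[OF sm(2,1)])
    fix k B assume B: "B \<in> sets N" "B \<subseteq> A k"
    have dis: "disjoint_family (\<lambda>n. B \<inter> disjointed A n)"
      using disjoint_family_disjointed[of A] by (auto simp: disjoint_family_on_def)
    have U: "(\<Union>n. B \<inter> disjointed A n) = B"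
      using UN_disjointed_eq[of A] A(2) sets.sets_into_space[OF B(1)] by auto
    have "emeasure m B = (\<Sum>n. emeasure (\<mu> k) (B \<inter> disjointed A n))"
      unfolding em[OF B(1)] F_def using B D disjointed_subset[of A] by (intro suminf_cong eq) auto
    also have "\<dots> = emeasure (\<mu> k) B"
      using B D dis s by (subst suminf_emeasure) (auto simp only: U intro!: sets.Int)
    finally show "emeasure m B = emeasure (\<mu> k) B" .
  qed
qed

section \<open>Change of variables for nonnegative integrals\<close>

lemma nn_integral_cov:
  fixes h k :: "'a::euclidean_space \<Rightarrow> real"
  assumes cov: "\<And>b. k absolutely_integrable_on S \<and> integral S k = b \<longleftrightarrow>
      h absolutely_integrable_on T \<and> integral T h = b"
    and m: "(\<lambda>x. indicator S x * k x) \<in> borel_measurable borel" "(\<lambda>x. indicator T x * h x) \<in> borel_measurable borel"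
    and pos: "\<And>x. x \<in> S \<Longrightarrow> k x \<ge> 0" "\<And>x. x \<in> T \<Longrightarrow> h x \<ge> 0"
  shows "(\<integral>\<^sup>+x\<in>T. ennreal (h x) \<partial>lborel) = (\<integral>\<^sup>+x\<in>S. ennreal (k x) \<partial>lborel)"
proof -
  \<comment> \<open>For a nonnegative measurable function the Lebesgue integral is the gauge
    integral if the function is absolutely integrable, and infinity otherwise. Hence the equivalence
    \<open>cov\<close>, available for every value \<open>b\<close>, decides the equality in the
    infinite case as well.\<close>
  have *: "(\<integral>\<^sup>+x\<in>U. ennreal (f x) \<partial>lborel) = (if f absolutely_integrable_on U then ennreal (integral U f) else \<infinity>)"
    if f: "(\<lambda>x. indicator U x * f x) \<in> borel_measurable borel" "\<And>x. x \<in> U \<Longrightarrow> f x \<ge> 0" for U and f :: "'a \<Rightarrow> real"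
  proof -
    have nn: "(\<integral>\<^sup>+x\<in>U. ennreal (f x) \<partial>lborel) = (\<integral>\<^sup>+x. ennreal (indicator U x * f x) \<partial>lborel)"
      by (intro nn_integral_cong) (auto simp: indicator_def)
    have iff: "f absolutely_integrable_on U \<longleftrightarrow> integrable lborel (\<lambda>x. indicator U x * f x)"
      using f(1) by (simp add: set_integrable_def integrable_completion)
    show ?thesis
    proof (cases "integrable lborel (\<lambda>x. indicator U x * f x)")
      case True
      then have "(\<integral>\<^sup>+x. ennreal (indicator U x * f x) \<partial>lborel) = ennreal (\<integral>x. indicator U x * f x \<partial>lborel)"
        using f(2) by (intro nn_integral_eq_integral) (auto simp: indicator_def)
      also have "(\<integral>x. indicator U x * f x \<partial>lborel) = (LINT x:U|lebesgue. f x)"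
        using f(1) by (simp add: set_lebesgue_integral_def integral_completion)
      also have "\<dots> = integral U f"
        using True iff by (intro set_lebesgue_integral_eq_integral(2)) simp
      finally show ?thesis using True iff nn by simp
    next
      case False
      have "(\<integral>\<^sup>+x. ennreal (indicator U x * f x) \<partial>lborel) = \<infinity>"
      proof (rule ccontr)
        assume "(\<integral>\<^sup>+x. ennreal (indicator U x * f x) \<partial>lborel) \<noteq> \<infinity>"
        then have "integrable lborel (\<lambda>x. indicator U x * f x)"
          using f by (intro integrableI_nonneg) (auto simp: indicator_def less_top)
        then show False using False by simp
      qed
      then show ?thesis using False iff nn by simp
    qed
  qed
  show ?thesis
    using cov[of "integral S k"] cov[of "integral T h"] by (simp add: *[OF m(1) pos(1)] *[OF m(2) pos(2)]) metis
qed

lemma nn_integral_change_of_variables_vec: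
  fixes T :: "real^'m::{finite,wellorder} \<Rightarrow> real^'m::_" and h :: "real^'m::_ \<Rightarrow> real"
  assumes S: "S \<in> sets borel" and der: "\<And>x. x \<in> S \<Longrightarrow> (T has_derivative T' x) (at x within S)"
    and inj: "inj_on T S"
    and m: "(\<lambda>x. indicator S x * (\<bar>det (matrix (T' x))\<bar> * h (T x))) \<in> borel_measurable borel"
      "(\<lambda>x. indicator (T ` S) x * h x) \<in> borel_measurable borel"
    and pos: "\<And>x. x \<in> T ` S \<Longrightarrow> h x \<ge> 0"
  shows "(\<integral>\<^sup>+x\<in>T ` S. ennreal (h x) \<partial>lborel) = (\<integral>\<^sup>+x\<in>S. ennreal (\<bar>det (matrix (T' x))\<bar> * h (T x)) \<partial>lborel)"
proof (rule nn_integral_cov[OF _ m])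
  have S': "S \<in> sets lebesgue" using S by simp
  fix b :: real
  have "(\<lambda>x. \<bar>det (matrix (T' x))\<bar> *\<^sub>R vec (h (T x)) :: real ^ 1) absolutely_integrable_on S \<and>
           integral S (\<lambda>x. \<bar>det (matrix (T' x))\<bar> *\<^sub>R vec (h (T x))) = (vec b :: real ^ 1)
         \<longleftrightarrow> (\<lambda>x. vec (h x) :: real ^ 1) absolutely_integrable_on (T ` S) \<and>
           integral (T ` S) (\<lambda>x. vec (h x)) = (vec b :: real ^ 1)"
    by (intro has_absolute_integral_change_of_variables S' der inj)
  then show "(\<lambda>x. \<bar>det (matrix (T' x))\<bar> * h (T x)) absolutely_integrable_on S \<and>
      integral S (\<lambda>x. \<bar>det (matrix (T' x))\<bar> * h (T x)) = b \<longleftrightarrow>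
      h absolutely_integrable_on (T ` S) \<and> integral (T ` S) h = b"
    by (simp add: absolutely_integrable_on_1_iff integral_on_1_eq)
qed (use pos in auto)

lemma nn_integral_change_of_variables_real:
  fixes T :: "real \<Rightarrow> real" and h :: "real \<Rightarrow> real"
  assumes S: "S \<in> sets borel" and der: "\<And>x. x \<in> S \<Longrightarrow> (T has_real_derivative T' x) (at x)"
    and inj: "inj_on T S"
    and m: "(\<lambda>x. indicator S x * (\<bar>T' x\<bar> * h (T x))) \<in> borel_measurable borel"
      "(\<lambda>x. indicator (T ` S) x * h x) \<in> borel_measurable borel"
    and pos: "\<And>x. x \<in> T ` S \<Longrightarrow> h x \<ge> 0"
  shows "(\<integral>\<^sup>+x\<in>T ` S. ennreal (h x) \<partial>lborel) = (\<integral>\<^sup>+x\<in>S. ennreal (\<bar>T' x\<bar> * h (T x)) \<partial>lborel)"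
proof (rule nn_integral_cov[OF _ m])
  have S': "S \<in> sets lebesgue" using S by simp
  show "(\<lambda>x. \<bar>T' x\<bar> * h (T x)) absolutely_integrable_on S \<and> integral S (\<lambda>x. \<bar>T' x\<bar> * h (T x)) = b \<longleftrightarrow>
      h absolutely_integrable_on (T ` S) \<and> integral (T ` S) h = b" for b
    using der by (intro has_absolute_integral_change_of_variables_1' S' inj) (auto intro: has_field_derivative_at_within)
qed (use pos in auto)

lemma vector2_eq: "vector [x, y] = x *\<^sub>R axis 1 1 + y *\<^sub>R (axis 2 1 :: real^2)"
  by (auto simp: vec_eq_iff forall_2 axis_def)

lemma measurable_vector2: "(\<lambda>p::real \<times> real. vector [fst p, snd p] :: real^2) \<in> borel_measurable borel"
  unfolding vector2_eq by (intro borel_measurable_continuous_onI continuous_intros)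

text \<open>Links the plane \<open>real \<times> real\<close>, where integrals are iterated, with
  \<open>real^2\<close>, where charts take their values.\<close>

lemma lborel_vec2:
  "distr (lborel :: (real \<times> real) measure) borel (\<lambda>p. vector [fst p, snd p] :: real^2) = lborel"
proof (rule lborel_eqI[symmetric])
  note m = measurable_vector2
  fix l u :: "real^2" assume lu: "\<And>b. b \<in> Basis \<Longrightarrow> l \<bullet> b \<le> u \<bullet> b"
  have B: "Basis = {axis 1 1, axis 2 (1::real) :: real^2}" by (auto simp: Basis_vec_def UNIV_2)
  have ne: "axis 1 1 \<noteq> (axis 2 (1::real) :: real^2)" by (simp add: axis_eq_axis)
  have le: "l$1 \<le> u$1" "l$2 \<le> u$2" using lu[of "axis 1 1"] lu[of "axis 2 1"] by (auto simp: B inner_axis)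
  have vim: "(\<lambda>p::real \<times> real. vector [fst p, snd p] :: real^2) -` box l u = {l$1<..<u$1} \<times> {l$2<..<u$2}"
    by (auto simp: mem_box_cart forall_2)
  have "emeasure (distr lborel borel (\<lambda>p::real \<times> real. vector [fst p, snd p] :: real^2)) (box l u)
      = emeasure (lborel \<Otimes>\<^sub>M lborel) ({l$1<..<u$1} \<times> {l$2<..<u$2})"
    using m by (subst emeasure_distr) (auto simp: vim lborel_prod)
  also have "\<dots> = ennreal (u$1 - l$1) * ennreal (u$2 - l$2)"
    using le by (subst lborel.emeasure_pair_measure_Times) auto
  also have "\<dots> = (\<Prod>b\<in>Basis. (u - l) \<bullet> b)"
    using le ne by (simp add: B inner_axis ennreal_mult)
  finally show "emeasure (distr lborel borel (\<lambda>p::real \<times> real. vector [fst p, snd p] :: real^2)) (box l u) = (\<Prod>b\<in>Basis. (u - l) \<bullet> b)" .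
qed simp

lemma lborel_affine_plane:
  fixes r1 r2 z0 :: "real^2"
  assumes det: "r1$1 * r2$2 - r1$2 * r2$1 = 1"
  shows "distr (lborel :: (real \<times> real) measure) borel (\<lambda>p. z0 + fst p *\<^sub>R r1 + snd p *\<^sub>R r2) = lborel"
proof -
  define G where "G y = z0 + (y$1) *\<^sub>R r1 + (y$2) *\<^sub>R r2" for y :: "real^2"
  \<comment> \<open>The inverse of \<open>G\<close> by Cramer's rule; the denominator is the
    determinant 1.\<close>
  define H :: "real^2 \<Rightarrow> real^2" where "H w = vector [(w - z0)$1 * r2$2 - (w - z0)$2 * r2$1, r1$1 * (w - z0)$2 - r1$2 * (w - z0)$1]" for w
  have HG: "H (G y) = y" for y
  proof -
    have "(y$1 * r1$1 + y$2 * r2$1) * r2$2 - (y$1 * r1$2 + y$2 * r2$2) * r2$1 = y$1 * (r1$1 * r2$2 - r1$2 * r2$1)"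
      "r1$1 * (y$1 * r1$2 + y$2 * r2$2) - r1$2 * (y$1 * r1$1 + y$2 * r2$1) = y$2 * (r1$1 * r2$2 - r1$2 * r2$1)"
      by (simp_all add: algebra_simps)
    then show ?thesis unfolding det by (simp add: H_def G_def vec_eq_iff forall_2)
  qed
  have GH: "G (H w) = w" for w
  proof -
    define x y where "x = (w - z0)$1" and "y = (w - z0)$2"
    have "(x * r2$2 - y * r2$1) * r1$1 + (r1$1 * y - r1$2 * x) * r2$1 = x * (r1$1 * r2$2 - r1$2 * r2$1)"
      "(x * r2$2 - y * r2$1) * r1$2 + (r1$1 * y - r1$2 * x) * r2$2 = y * (r1$1 * r2$2 - r1$2 * r2$1)"
      by (simp_all add: algebra_simps)
    then show ?thesis unfolding det
      by (simp add: H_def G_def vec_eq_iff forall_2 x_def y_def algebra_simps)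
  qed
  let ?L = "\<lambda>y::real^2. (y$1) *\<^sub>R r1 + (y$2) *\<^sub>R r2"
  have GL: "(G has_derivative ?L) (at y within X)" for y X
  proof -
    have "bounded_linear ?L"
      by (auto intro!: bounded_linear_intros)
    then have "((\<lambda>y. z0 + ?L y) has_derivative (\<lambda>h. 0 + ?L h)) (at y within X)"
      by (intro has_derivative_add has_derivative_const bounded_linear.has_derivative[OF _ has_derivative_ident])
    then show ?thesis by (simp add: G_def[abs_def] add.assoc)
  qed
  have detL: "det (matrix ?L) = 1"
    using det by (simp add: det_2 matrix_def axis_def algebra_simps)
  have cG: "continuous_on UNIV G" unfolding G_def by (intro continuous_intros)
  have mG: "G \<in> borel_measurable borel" by (rule borel_measurable_continuous_onI[OF cG])
  have "distr lborel borel G = lborel"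
  proof (rule measure_eqI)
    fix B assume "B \<in> sets (distr lborel borel G)"
    then have B: "B \<in> sets borel" by simp
    have S: "G -` B \<in> sets borel" using measurable_sets[OF mG B] by simp
    have img: "G ` (G -` B) = B" using GH by (metis surj_def surj_image_vimage_eq)
    have "emeasure lborel B = (\<integral>\<^sup>+x\<in>G ` (G -` B). ennreal 1 \<partial>lborel)"
      unfolding img using B by simp
    also have "\<dots> = (\<integral>\<^sup>+x\<in>G -` B. ennreal (\<bar>det (matrix ?L)\<bar> * 1) \<partial>lborel)"
      using S B GL inj_on_inverseI[of "G -` B" H G] HG
      by (intro nn_integral_change_of_variables_vec) (auto simp only: img intro!: borel_measurable_times borel_measurable_indicator borel_measurable_const)
    also have "\<dots> = emeasure lborel (G -` B)"
      using S by (simp add: detL)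
    also have "\<dots> = emeasure (distr lborel borel G) B"
      using B mG by (simp add: emeasure_distr)
    finally show "emeasure (distr lborel borel G) B = emeasure lborel B" by simp
  qed simp
  moreover have "distr lborel borel (\<lambda>p. z0 + fst p *\<^sub>R r1 + snd p *\<^sub>R r2) =
      distr (distr lborel borel (\<lambda>p::real \<times> real. vector [fst p, snd p] :: real^2)) borel G"
  proof -
    note measurable_vector2
    then show ?thesis using mG by (subst distr_distr) (auto simp: o_def G_def)
  qed
  ultimately show ?thesis unfolding lborel_vec2 by simp
qed

section \<open>Green's theorem below a graph\<close>

lemma integral_FTC_zero_ends:
  fixes F :: "real \<Rightarrow> real"
  assumes "a \<le> b" "\<And>x. a \<le> x \<Longrightarrow> x \<le> b \<Longrightarrow> (F has_real_derivative f x) (at x)"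
    and "continuous_on {a..b} f"
  shows "(\<integral>x. indicator {a..b} x * f x \<partial>lborel) = F b - F a"
proof -
  have "has_bochner_integral lborel (\<lambda>x. indicator {a..b} x *\<^sub>R f x) (F b - F a)"
    using assms
    by (intro has_bochner_integral_FTC_Icc)
       (auto intro: has_field_derivative_at_within simp: has_real_derivative_iff_has_vector_derivative[symmetric])
  then show ?thesis by (simp add: has_bochner_integral_integral_eq)
qed

lemma integrable_continuous_compact_indicator:
  fixes f :: "'a::euclidean_space \<Rightarrow> real"
  assumes "continuous_on K f" "compact K"
  shows "integrable lborel (\<lambda>x. indicator K x * f x)"
  using borel_integrable_compact[OF assms(2,1)] by simp

text \<open>The shear \<open>v = g u + s\<close> straightens the region to \<open>s < 0\<close>; it
  is applied on each vertical line separately, where it is a translation. In these coordinates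
  \<open>Q1 + g' * Q2\<close> is the total \<open>u\<close>-derivative of
  \<open>Q u (g u + s)\<close> and integrates to zero by compact support, while \<open>P2\<close>
  and the compensating \<open>g' * Q2\<close> are integrated in \<open>s\<close> and leave the
  values on the graph.\<close>

lemma green_below_graph:
  fixes P Q P2 Q1 Q2 :: "real \<Rightarrow> real \<Rightarrow> real" and g g' :: "real \<Rightarrow> real"
  assumes a: "0 < a" "a < a'"
    and dP: "\<And>u v. (P u has_real_derivative P2 u v) (at v)"
    and dQ: "\<And>u v. ((\<lambda>p. Q (fst p) (snd p)) has_derivative (\<lambda>h. fst h * Q1 u v + snd h * Q2 u v)) (at (u, v))"
    and cP: "continuous_on UNIV (\<lambda>p. P (fst p) (snd p))" and cP2: "continuous_on UNIV (\<lambda>p. P2 (fst p) (snd p))"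
    and cQ1: "continuous_on UNIV (\<lambda>p. Q1 (fst p) (snd p))" and cQ2: "continuous_on UNIV (\<lambda>p. Q2 (fst p) (snd p))"
    and supp: "\<And>u v. \<not> (\<bar>u\<bar> \<le> a \<and> \<bar>v\<bar> \<le> b) \<Longrightarrow> P u v = 0 \<and> Q u v = 0 \<and> P2 u v = 0 \<and> Q1 u v = 0 \<and> Q2 u v = 0"
    and dg: "\<And>u. \<bar>u\<bar> < a' \<Longrightarrow> (g has_real_derivative g' u) (at u)" and cg': "continuous_on {-a'<..<a'} g'"
  shows "integrable lborel (\<lambda>p. indicator {p. \<bar>fst p\<bar> < a' \<and> snd p < g (fst p)} p * (Q1 (fst p) (snd p) - P2 (fst p) (snd p)))" (is ?I1)
    and "integrable lborel (\<lambda>u. indicator {-a'<..<a'} u * (P u (g u) + Q u (g u) * g' u))" (is ?I2)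
    and "(\<integral>p. indicator {p. \<bar>fst p\<bar> < a' \<and> snd p < g (fst p)} p * (Q1 (fst p) (snd p) - P2 (fst p) (snd p)) \<partial>lborel)
       = - (\<integral>u. indicator {-a'<..<a'} u * (P u (g u) + Q u (g u) * g' u) \<partial>lborel)" (is ?G)
proof -
  \<comment> \<open>An intermediate half-width: \<open>[-c, c]\<close> is a compact part of the
    interval on which \<open>g\<close> is controlled, and its ends already lie outside the
    support.\<close>
  define c where "c = (a + a') / 2"
  have c: "a < c" "c < a'" "0 < c" using a by (auto simp: c_def)
  have cg: "continuous_on {-a'<..<a'} g"
    by (auto intro!: continuous_at_imp_continuous_on DERIV_isCont[OF dg])
  have cgc: "continuous_on {-c..c} g" "continuous_on {-c..c} g'"
    by (rule continuous_on_subset[OF cg], use c in force, rule continuous_on_subset[OF cg'], use c in force)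
  have "bounded (g ` {-c..c})" using cgc(1) by (intro compact_imp_bounded compact_continuous_image) auto
  then obtain m where m: "\<And>u. \<bar>u\<bar> \<le> c \<Longrightarrow> \<bar>g u\<bar> \<le> m" by (force simp: bounded_iff)
  \<comment> \<open>So deep that \<open>g u - N\<close> lies below the support whenever
    \<open>\<bar>u\<bar> \<le> c\<close>; the half-line \<open>s < 0\<close> may then be cut off at
    \<open>-N\<close>.\<close>
  define N where "N = \<bar>b\<bar> + \<bar>m\<bar> + 1"
  have N: "N > 0" by (simp add: N_def)
  have low: "\<not> \<bar>g u + s\<bar> \<le> b" if "\<bar>u\<bar> \<le> c" "s \<le> -N" for u s
    using m[OF that(1)] that(2) by (simp add: N_def)
  have cQ: "continuous_on UNIV (\<lambda>p. Q (fst p) (snd p))"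
    by (auto intro!: continuous_at_imp_continuous_on has_derivative_continuous[OF dQ])
  let ?\<Phi> = "\<lambda>p. indicator {p. \<bar>fst p\<bar> < a' \<and> snd p < g (fst p)} p * (Q1 (fst p) (snd p) - P2 (fst p) (snd p))"
  let ?D = "{-c..c}" and ?E = "{-N..0::real}"
  have comp: "continuous_on (?D \<times> ?E) (\<lambda>p. R (fst p) (g (fst p) + snd p))"
    if "continuous_on UNIV (\<lambda>p. R (fst p) (snd p))" for R :: "real \<Rightarrow> real \<Rightarrow> real"
  proof -
    have "continuous_on (?D \<times> ?E) (\<lambda>p. (fst p, g (fst p) + snd p))"
      by (intro continuous_intros continuous_on_compose2[OF cgc(1)]) auto
    from continuous_on_compose2[OF that this] show ?thesis by simp
  qed
  have diag: "continuous_on ?D (\<lambda>u. R u (g u))" if "continuous_on UNIV (\<lambda>p. R (fst p) (snd p))" for R :: "real \<Rightarrow> real \<Rightarrow> real"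
  proof -
    have "continuous_on ?D (\<lambda>u. (u, g u))" by (intro continuous_intros cgc)
    from continuous_on_compose2[OF that this] show ?thesis by simp
  qed
  have row: "continuous_on ?E (\<lambda>s. R u (g u + s))" if "continuous_on UNIV (\<lambda>p. R (fst p) (snd p))" for R :: "real \<Rightarrow> real \<Rightarrow> real" and u
  proof -
    have "continuous_on ?E (\<lambda>s. (u, g u + s))" by (intro continuous_intros)
    from continuous_on_compose2[OF that this] show ?thesis by simp
  qed
  have cgf: "continuous_on ({-a'<..<a'} \<times> (UNIV :: real set)) (\<lambda>p. g (fst p))"
    by (rule continuous_on_compose2[OF cg continuous_on_fst[OF continuous_on_id]]) auto
  obtain A where A: "open A" "A \<inter> ({-a'<..<a'} \<times> UNIV) = {p \<in> {-a'<..<a'} \<times> UNIV. snd p < g (fst p)}"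
    using open_Collect_less_Int[OF continuous_on_snd[OF continuous_on_id] cgf] by blast
  have "open {p \<in> {-a'<..<a'} \<times> UNIV. snd p < g (fst p)}"
    unfolding A(2)[symmetric] by (intro open_Int A(1) open_Times open_greaterThanLessThan open_UNIV)
  moreover have "{p \<in> {-a'<..<a'} \<times> UNIV. snd p < g (fst p)} = {p. \<bar>fst p\<bar> < a' \<and> snd p < g (fst p)}"
    by (auto simp: abs_less_iff)
  ultimately have meas: "{p. \<bar>fst p\<bar> < a' \<and> snd p < g (fst p)} \<in> sets borel" by auto
  have int0: "integrable lborel (\<lambda>p. indicator (cbox (-a, -b) (a, b)) p * (Q1 (fst p) (snd p) - P2 (fst p) (snd p)))"
    by (intro integrable_continuous_compact_indicator continuous_intros compact_cbox continuous_on_subset[OF cQ1] continuous_on_subset[OF cP2]) auto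
  have eq0: "?\<Phi> = (\<lambda>p. indicator {p. \<bar>fst p\<bar> < a' \<and> snd p < g (fst p)} p *
      (indicator (cbox (-a, -b) (a, b)) p * (Q1 (fst p) (snd p) - P2 (fst p) (snd p))))"
  proof
    fix p :: "real \<times> real"
    show "?\<Phi> p = indicator {p. \<bar>fst p\<bar> < a' \<and> snd p < g (fst p)} p *
      (indicator (cbox (-a, -b) (a, b)) p * (Q1 (fst p) (snd p) - P2 (fst p) (snd p)))"
      using supp[of "fst p" "snd p"]
      by (cases "\<bar>fst p\<bar> \<le> a \<and> \<bar>snd p\<bar> \<le> b") (cases p; auto simp: cbox_Pair_eq abs_le_iff indicator_def)+
  qed
  show I1: ?I1
    unfolding eq0 using integrable_real_mult_indicator[OF _ int0, of "{p. \<bar>fst p\<bar> < a' \<and> snd p < g (fst p)}"] meas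
    by (simp add: mult.commute)
  let ?B = "\<lambda>u. P u (g u) + Q u (g u) * g' u"
  have cB: "continuous_on ?D ?B"
    by (intro continuous_intros diag cP cQ cgc)
  have Beq: "indicator {-a'<..<a'} u * ?B u = indicator ?D u * ?B u" for u
    using supp[of u "g u"] c by (cases "\<bar>u\<bar> \<le> a") (auto simp: indicator_def)
  show ?I2 unfolding Beq by (intro integrable_continuous_compact_indicator cB) auto
  let ?W = "\<lambda>u s. Q1 u (g u + s) + g' u * Q2 u (g u + s)"
  have cW: "continuous_on (?D \<times> ?E) (\<lambda>p. ?W (fst p) (snd p))"
  proof -
    have "continuous_on (?D \<times> ?E) (\<lambda>p. g' (fst p))"
      by (rule continuous_on_compose2[OF cgc(2) continuous_on_fst[OF continuous_on_id]]) auto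
    then show ?thesis by (rule continuous_on_add[OF comp[OF cQ1] continuous_on_mult[OF _ comp[OF cQ2]]])
  qed
  have cWu: "continuous_on ?E (?W u)" for u
    by (intro continuous_intros row cQ1 cQ2)
  have ftc: "(\<integral>s. indicator ?E s * R2 u (g u + s) \<partial>lborel) = R u (g u)"
    if u: "\<bar>u\<bar> \<le> c" and d: "\<And>v. (R u has_real_derivative R2 u v) (at v)"
      and cR: "continuous_on UNIV (\<lambda>p. R2 (fst p) (snd p))" and z: "R u (g u - N) = 0" for R R2 :: "real \<Rightarrow> real \<Rightarrow> real" and u
  proof -
    have "(\<integral>s. indicator ?E s * R2 u (g u + s) \<partial>lborel) = R u (g u + 0) - R u (g u + - N)"
    proof (rule integral_FTC_zero_ends)
      show "((\<lambda>s. R u (g u + s)) has_real_derivative R2 u (g u + x)) (at x)" for x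
        using DERIV_shift[of "R u" "R2 u (g u + x)" x "g u"] d[of "g u + x"] by (simp add: add.commute)
    qed (use N row[OF cR] in auto)
    then show ?thesis using z by simp
  qed
  have dQ2: "(Q u has_real_derivative Q2 u v) (at v)" for u v
  proof -
    have "((\<lambda>s. (u, s)) has_vector_derivative (0, 1)) (at v)"
      by (auto intro!: derivative_eq_intros has_vector_derivative_Pair)
    from has_vector_derivative_chain[OF this dQ[of u v]] show ?thesis
      by (simp add: has_real_derivative_iff_has_vector_derivative)
  qed
  have inner: "(\<integral>v. ?\<Phi> (u, v) \<partial>lborel) = indicator ?D u * (\<integral>s. indicator ?E s * ?W u s \<partial>lborel) - indicator ?D u * ?B u" for u
  proof (cases "\<bar>u\<bar> \<le> c")
    case True
    have i: "integrable lborel (\<lambda>s. indicator ?E s * ?W u s)" "integrable lborel (\<lambda>s. indicator ?E s * Q2 u (g u + s))"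
        "integrable lborel (\<lambda>s. indicator ?E s * P2 u (g u + s))"
        by (intro integrable_continuous_compact_indicator cWu row cQ2 cP2; simp)+
    have "(\<integral>v. ?\<Phi> (u, v) \<partial>lborel) = (\<integral>s. ?\<Phi> (u, g u + s) \<partial>lborel)"
      using lborel_integral_real_affine[of 1 "\<lambda>v. ?\<Phi> (u, v)" "g u"] by simp
    also have "\<dots> = (\<integral>s. indicator ?E s * ?W u s - g' u * (indicator ?E s * Q2 u (g u + s)) - indicator ?E s * P2 u (g u + s) \<partial>lborel)"
    proof (rule integral_cong_AE)
      \<comment> \<open>The region lies strictly below the graph while \<open>?E\<close> contains
        \<open>s = 0\<close>; the two integrands may differ at that single point of the
        line.\<close>
      show "AE s in lborel. ?\<Phi> (u, g u + s) = indicator ?E s * ?W u s - g' u * (indicator ?E s * Q2 u (g u + s)) - indicator ?E s * P2 u (g u + s)"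
        using AE_lborel_singleton[of 0]
      proof eventually_elim
        case (elim s)
        show ?case
        proof (cases "s < -N")
          case True
          then show ?thesis using low[OF \<open>\<bar>u\<bar> \<le> c\<close>, of s] supp[of u "g u + s"] by (simp add: indicator_def)
        next
          case False
          then show ?thesis using elim \<open>\<bar>u\<bar> \<le> c\<close> c by (auto simp: indicator_def)
        qed
      qed
      have "(\<lambda>s::real. (u, g u + s)) \<in> borel_measurable borel"
        by (intro borel_measurable_continuous_onI continuous_intros)
      from measurable_compose[OF this, of ?\<Phi> borel] borel_measurable_integrable[OF I1]
      show "(\<lambda>s. ?\<Phi> (u, g u + s)) \<in> borel_measurable lborel"
        unfolding measurable_lborel2 by blast
      show "(\<lambda>s. indicator ?E s * ?W u s - g' u * (indicator ?E s * Q2 u (g u + s)) - indicator ?E s * P2 u (g u + s)) \<in> borel_measurable lborel"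
        by (intro borel_measurable_diff borel_measurable_times[OF borel_measurable_const] borel_measurable_integrable i)
    qed
    also have "\<dots> = (\<integral>s. indicator ?E s * ?W u s \<partial>lborel) - g' u * (\<integral>s. indicator ?E s * Q2 u (g u + s) \<partial>lborel)
        - (\<integral>s. indicator ?E s * P2 u (g u + s) \<partial>lborel)"
    proof -
      show ?thesis using i by (simp add: Bochner_Integration.integral_diff)
    qed
    also have "(\<integral>s. indicator ?E s * Q2 u (g u + s) \<partial>lborel) = Q u (g u)"
      using True low[OF True, of "-N"] supp[of u "g u - N"] by (intro ftc dQ2 cQ2) auto
    also have "(\<integral>s. indicator ?E s * P2 u (g u + s) \<partial>lborel) = P u (g u)"
      using True low[OF True, of "-N"] supp[of u "g u - N"] by (intro ftc dP cP2) auto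
    finally have *: "(\<integral>v. ?\<Phi> (u, v) \<partial>lborel) = (\<integral>s. indicator ?E s * ?W u s \<partial>lborel) - g' u * Q u (g u) - P u (g u)" .
    have "indicator ?D u = (1::real)" using True by (simp add: abs_le_iff)
    then show ?thesis by (simp only: * mult_1 mult.commute[of "Q u (g u)"])
  next
    case False
    then have "(\<lambda>v. ?\<Phi> (u, v)) = (\<lambda>_. 0)" using supp[of u] c by (intro ext) simp
    then have *: "(\<integral>v. ?\<Phi> (u, v) \<partial>lborel) = 0" by (simp only: Bochner_Integration.integral_zero)
    have "indicator ?D u = (0::real)" using False by (auto simp: indicator_def abs_le_iff)
    then show ?thesis by (simp only: *)
  qed
  have iW: "integrable (lborel \<Otimes>\<^sub>M lborel) (\<lambda>p. indicator (?D \<times> ?E) p * ?W (fst p) (snd p))"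
    unfolding lborel_prod by (intro integrable_continuous_compact_indicator cW compact_Times) auto
  have iW2: "integrable (lborel \<Otimes>\<^sub>M lborel) (\<lambda>(u, s). indicator ?D u * (indicator ?E s * ?W u s))"
    using iW by (rule Bochner_Integration.integrable_cong[THEN iffD1, rotated 2]) (auto simp: indicator_times)
  have Wzero: "(\<integral>u. indicator ?D u * (indicator ?E s * ?W u s) \<partial>lborel) = 0" for s
  proof (cases "s \<in> ?E")
    case True
    have "(\<integral>u. indicator ?D u * ?W u s \<partial>lborel) = Q c (g c + s) - Q (-c) (g (-c) + s)"
    proof (rule integral_FTC_zero_ends)
      fix u assume u: "-c \<le> u" "u \<le> c"
      then have u': "\<bar>u\<bar> < a'" using c by auto
      have "((\<lambda>u. (u, g u + s)) has_vector_derivative (1, g' u)) (at u)"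
        using dg[OF u'] by (auto intro!: derivative_eq_intros has_vector_derivative_Pair simp: has_real_derivative_iff_has_vector_derivative)
      from has_vector_derivative_chain[OF this dQ[of u "g u + s"]]
      show "((\<lambda>u. Q u (g u + s)) has_real_derivative ?W u s) (at u)"
        by (simp add: has_real_derivative_iff_has_vector_derivative)
    next
      have "continuous_on ?D (\<lambda>u. (u, s))" by (intro continuous_intros)
      then have "continuous_on ?D (\<lambda>u. ?W (fst (u, s)) (snd (u, s)))"
        by (rule continuous_on_compose2[OF cW]) (use True in auto)
      then show "continuous_on ?D (\<lambda>u. ?W u s)" by (simp only: fst_conv snd_conv)
    qed (use c in simp)
    also have "\<dots> = 0" using supp[of c "g c + s"] supp[of "-c" "g (-c) + s"] c by simp
    finally show ?thesis using True by simp
  qed simp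
  have "(\<integral>u. indicator ?D u * (\<integral>s. indicator ?E s * ?W u s \<partial>lborel) \<partial>lborel)
      = (\<integral>u. (\<integral>s. indicator ?D u * (indicator ?E s * ?W u s) \<partial>lborel) \<partial>lborel)" by simp
  also have "\<dots> = (\<integral>s. (\<integral>u. indicator ?D u * (indicator ?E s * ?W u s) \<partial>lborel) \<partial>lborel)"
    using lborel_pair.Fubini_integral[OF iW2] by simp
  also have "\<dots> = 0" unfolding Wzero by simp
  finally have W0: "(\<integral>u. indicator ?D u * (\<integral>s. indicator ?E s * ?W u s \<partial>lborel) \<partial>lborel) = 0" .
  have iW3: "integrable lborel (\<lambda>u. indicator ?D u * (\<integral>s. indicator ?E s * ?W u s \<partial>lborel))"
    using lborel_pair.integrable_fst[OF iW2] by simp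
  have iB: "integrable lborel (\<lambda>u. indicator ?D u * ?B u)"
    by (intro integrable_continuous_compact_indicator cB) auto
  have "(\<integral>p. ?\<Phi> p \<partial>lborel) = (\<integral>p. ?\<Phi> p \<partial>(lborel \<Otimes>\<^sub>M lborel))" by (simp add: lborel_prod)
  also have "\<dots> = (\<integral>u. (\<integral>v. ?\<Phi> (u, v) \<partial>lborel) \<partial>lborel)"
    using I1 unfolding lborel_prod[symmetric] by (rule lborel_pair.integral_fst'[symmetric])
  also have "\<dots> = (\<integral>u. indicator ?D u * (\<integral>s. indicator ?E s * ?W u s \<partial>lborel) \<partial>lborel) - (\<integral>u. indicator ?D u * ?B u \<partial>lborel)"
    unfolding inner using iW3 iB by (rule Bochner_Integration.integral_diff)
  finally show ?G unfolding W0 Beq by simp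
qed

unbundle cross3_syntax

section \<open>Sections of the plane bundle orthogonal to a unit vector field\<close>

lemma cross_area_identity:
  fixes w n a b :: "real^3"
  assumes "w \<bullet> n = 0"
  shows "(w \<bullet> w) * (n \<bullet> (a \<times> b)) = (w \<bullet> a) * ((n \<times> w) \<bullet> b) - (w \<bullet> b) * ((n \<times> w) \<bullet> a)"
proof -
  have "w \<times> (n \<times> w) = (w \<bullet> w) *\<^sub>R n" using assms by (simp add: Lagrange)
  then have "(w \<bullet> w) * (n \<bullet> (a \<times> b)) = (w \<times> (n \<times> w)) \<bullet> (a \<times> b)" by simp
  then show ?thesis by (simp add: dot_cross)
qed

lemma cross_parallel_normal:
  fixes n a b :: "real^3"
  assumes "n \<bullet> n = 1" "a \<bullet> n = 0" "b \<bullet> n = 0"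
  shows "a \<times> b = ((a \<times> b) \<bullet> n) *\<^sub>R n"
proof -
  have "n \<times> (a \<times> b) = 0" using assms by (simp add: Lagrange inner_commute)
  then have "n \<times> (n \<times> (a \<times> b)) = 0" by simp
  then have "(n \<bullet> (a \<times> b)) *\<^sub>R n - (a \<times> b) = 0" using Lagrange[of n n "a \<times> b"] assms(1) by simp
  then show ?thesis by (simp add: inner_commute)
qed

lemma cross_normal_twice:
  fixes n w :: "real^3"
  assumes "n \<bullet> n = 1" "w \<bullet> n = 0"
  shows "n \<times> (n \<times> w) = - w" and "(n \<times> w) \<bullet> (n \<times> w) = w \<bullet> w" and "(n \<times> w) \<bullet> n = 0" "(n \<times> w) \<bullet> w = 0"
  using assms by (simp_all add: Lagrange dot_cross inner_commute dot_cross_self)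

text \<open>The nonzero triple product makes \<open>a, b, n\<close> a basis, so inner products with
  these vectors determine a vector. Many identities below are verified in this way.\<close>

lemma eq_by_inner2:
  fixes n a b x y :: "real^3"
  assumes "(a \<times> b) \<bullet> n \<noteq> 0" "x \<bullet> n = y \<bullet> n" "x \<bullet> a = y \<bullet> a" "x \<bullet> b = y \<bullet> b"
  shows "x = y"
proof -
  define d where "d = x - y"
  have d: "d \<bullet> n = 0" "d \<bullet> a = 0" "d \<bullet> b = 0" using assms by (simp_all add: d_def inner_diff_left)
  have "d \<times> (a \<times> b) = 0" using d by (simp add: Lagrange)
  then have "n \<times> (d \<times> (a \<times> b)) = 0" by simp
  then have "(n \<bullet> (a \<times> b)) *\<^sub>R d = 0" using d(1) Lagrange[of n d "a \<times> b"] by (simp add: inner_commute[of n d])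
  then show ?thesis using assms(1) by (simp add: d_def inner_commute)
qed

text \<open>The left side is the numerator of the exterior derivative of
  \<open>(n \<times> w) \<bullet> dw / (w \<bullet> w)\<close> once the second derivatives of
  \<open>w\<close> have cancelled. By \<open>cross_area_identity\<close> the terms with both
  \<open>w1\<close> and \<open>w2\<close> cancel; the rest depends on \<open>w\<close> only through
  its length. After division it is minus the area form of the sphere pulled back by
  \<open>n\<close>, the same for every section.\<close>

lemma connection_curvature_algebra:
  fixes w n w1 w2 n1 n2 :: "real^3"
  assumes "n \<bullet> n = 1" "w \<bullet> n = 0" "n1 \<bullet> n = 0" "n2 \<bullet> n = 0"
    and "w1 \<bullet> n = - (w \<bullet> n1)" "w2 \<bullet> n = - (w \<bullet> n2)"
  shows "(w \<bullet> w) * ((n1 \<times> w) \<bullet> w2 + (n \<times> w1) \<bullet> w2 - (n2 \<times> w) \<bullet> w1 - (n \<times> w2) \<bullet> w1)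
     - 2 * ((w \<bullet> w1) * ((n \<times> w) \<bullet> w2) - (w \<bullet> w2) * ((n \<times> w) \<bullet> w1))
     = - ((w \<bullet> w) * (w \<bullet> w)) * ((n1 \<times> n2) \<bullet> n)"
proof -
  have 1: "(n1 \<times> w) \<bullet> w2 = ((n \<times> w) \<bullet> n1) * (w \<bullet> n2)"
  proof -
    have "(n1 \<times> w) \<bullet> w2 = ((n1 \<times> w) \<bullet> n) * (n \<bullet> w2)"
      by (subst cross_parallel_normal[OF assms(1,3,2)]) simp
    also have "(n1 \<times> w) \<bullet> n = - ((n \<times> w) \<bullet> n1)" by (metis cross_triple cross_skew inner_minus_left)
    finally show ?thesis using assms(6) by (simp add: inner_commute)
  qed
  have 2: "(n2 \<times> w) \<bullet> w1 = ((n \<times> w) \<bullet> n2) * (w \<bullet> n1)"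
  proof -
    have "(n2 \<times> w) \<bullet> w1 = ((n2 \<times> w) \<bullet> n) * (n \<bullet> w1)"
      by (subst cross_parallel_normal[OF assms(1,4,2)]) simp
    also have "(n2 \<times> w) \<bullet> n = - ((n \<times> w) \<bullet> n2)" by (metis cross_triple cross_skew inner_minus_left)
    finally show ?thesis using assms(5) by (simp add: inner_commute)
  qed
  have 3: "(n \<times> w1) \<bullet> w2 = n \<bullet> (w1 \<times> w2)" "(n \<times> w2) \<bullet> w1 = - (n \<bullet> (w1 \<times> w2))"
    by (metis cross_triple inner_commute) (metis cross_skew cross_triple inner_commute inner_minus_right)
  have 4: "(w \<bullet> w) * (n \<bullet> (w1 \<times> w2)) = (w \<bullet> w1) * ((n \<times> w) \<bullet> w2) - (w \<bullet> w2) * ((n \<times> w) \<bullet> w1)"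
    by (rule cross_area_identity[OF assms(2)])
  have 5: "(w \<bullet> w) * (n \<bullet> (n1 \<times> n2)) = (w \<bullet> n1) * ((n \<times> w) \<bullet> n2) - (w \<bullet> n2) * ((n \<times> w) \<bullet> n1)"
    by (rule cross_area_identity[OF assms(2)])
  have "(w \<bullet> w) * ((n1 \<times> w) \<bullet> w2 + (n \<times> w1) \<bullet> w2 - (n2 \<times> w) \<bullet> w1 - (n \<times> w2) \<bullet> w1)
     - 2 * ((w \<bullet> w1) * ((n \<times> w) \<bullet> w2) - (w \<bullet> w2) * ((n \<times> w) \<bullet> w1))
     = (w \<bullet> w) * (((n \<times> w) \<bullet> n1) * (w \<bullet> n2) - ((n \<times> w) \<bullet> n2) * (w \<bullet> n1))"
    unfolding 1 2 3 4[symmetric] by (simp add: algebra_simps)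
  also have "\<dots> = - ((w \<bullet> w) * ((w \<bullet> w) * (n \<bullet> (n1 \<times> n2))))"
    unfolding 5 by (simp add: algebra_simps)
  finally show ?thesis by (simp add: inner_commute)
qed

text \<open>\<open>conn n w x\<close> is the connection form of the direction field of \<open>w\<close>, evaluated on a tangent vector
  along which \<open>w\<close> has derivative \<open>x\<close>.\<close>

definition conn :: "real^3 \<Rightarrow> real^3 \<Rightarrow> real^3 \<Rightarrow> real" where
  "conn n w x = (n \<times> w) \<bullet> x / (w \<bullet> w)"

lemma rotate_section_inner:
  fixes n w :: "real^3"
  assumes "n \<bullet> n = 1" "w \<bullet> n = 0"
  shows "(a *\<^sub>R w + b *\<^sub>R (n \<times> w)) \<bullet> (a *\<^sub>R w + b *\<^sub>R (n \<times> w)) = (a * a + b * b) * (w \<bullet> w)"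
    "(a *\<^sub>R w + b *\<^sub>R (n \<times> w)) \<bullet> n = 0"
  using cross_normal_twice[OF assms] assms
  by (simp_all add: inner_add_left inner_add_right algebra_simps inner_commute)

text \<open>For \<open>a = r cos \<theta>\<close> and \<open>b = r sin \<theta>\<close> the extra
  term is the derivative of \<open>\<theta>\<close>. The vector \<open>n'\<close> leaves no trace
  because \<open>n' \<times> w\<close> is parallel to \<open>n\<close>.\<close>

lemma conn_rotate_section:
  fixes n w n' w' :: "real^3" and a b a' b' :: real
  assumes "n \<bullet> n = 1" "w \<bullet> n = 0" "w \<noteq> 0" "a * a + b * b \<noteq> 0" "n' \<bullet> n = 0"
  shows "conn n (a *\<^sub>R w + b *\<^sub>R (n \<times> w)) (a *\<^sub>R w' + a' *\<^sub>R w + (b *\<^sub>R (n \<times> w' + n' \<times> w) + b' *\<^sub>R (n \<times> w)))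
     = conn n w w' + (a * b' - b * a') / (a * a + b * b)"
proof -
  note J = cross_normal_twice[OF assms(1,2)]
  have nw: "n \<times> (a *\<^sub>R w + b *\<^sub>R (n \<times> w)) = a *\<^sub>R (n \<times> w) - b *\<^sub>R w"
    by (simp add: cross_add_right cross_mult_right J)
  have z1: "(n \<times> w) \<bullet> (n' \<times> w) = 0"
    using assms by (simp add: dot_cross inner_commute)
  have z2: "(n \<times> w) \<bullet> (n \<times> w') = w \<bullet> w'"
    using assms by (simp add: dot_cross inner_commute)
  have z3: "w \<bullet> (n' \<times> w) = 0" by (simp add: dot_cross_self)
  have z4: "w \<bullet> (n \<times> w') = - ((n \<times> w) \<bullet> w')"
    by (metis cross_skew cross_triple inner_commute inner_minus_right)
  have num: "(a *\<^sub>R (n \<times> w) - b *\<^sub>R w) \<bullet> (a *\<^sub>R w' + a' *\<^sub>R w + (b *\<^sub>R (n \<times> w' + n' \<times> w) + b' *\<^sub>R (n \<times> w)))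
      = (a * a + b * b) * ((n \<times> w) \<bullet> w') + (a * b' - b * a') * (w \<bullet> w)"
    using J by (simp add: inner_add_left inner_add_right inner_diff_left inner_diff_right z1 z2 z3 z4 inner_commute[of w "n \<times> w"] algebra_simps)
  have ww: "w \<bullet> w \<noteq> 0" using assms by simp
  have quot: "(P * X + Q * W) / (P * W) = X / W + Q / P" if "P \<noteq> 0" "W \<noteq> 0" for P Q X W :: real
    using that by (simp add: field_simps)
  show ?thesis
    unfolding conn_def nw num rotate_section_inner[OF assms(1,2)]
    using quot[OF assms(4) ww] .
qed

text \<open>The derivative of the factor contributes a multiple of \<open>w\<close>, which is
  orthogonal to \<open>n \<times> w\<close>. The factor may be negative, as in its applications to
  quotients of \<open>delta\<close> and to \<open>trace_h\<close>.\<close>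

lemma conn_scale:
  assumes "s \<noteq> 0"
  shows "conn n (s *\<^sub>R w) (s *\<^sub>R x + s' *\<^sub>R w) = conn n w x"
  using assms by (simp add: conn_def cross_mult_right inner_add_right dot_cross_self)

lemma conn_add_right: "conn n w (x + y) = conn n w x + conn n w y"
  and conn_scaleR_right: "conn n w (c *\<^sub>R x) = c * conn n w x"
  by (simp_all add: conn_def inner_add_right add_divide_distrib)

subsection \<open>Algebra of the shape operator\<close>

text \<open>The vectors \<open>f1, f2\<close> and \<open>n1, n2\<close> are the partial derivatives of the immersion and of its
  unit normal.\<close>

locale surface_point =
  fixes f1 f2 n n1 n2 :: "real^3"
  assumes nn: "n \<bullet> n = 1" and f1n: "f1 \<bullet> n = 0" and f2n: "f2 \<bullet> n = 0"
    and n1n: "n1 \<bullet> n = 0" and n2n: "n2 \<bullet> n = 0"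
    and sym: "n1 \<bullet> f2 = n2 \<bullet> f1" and reg: "(f1 \<times> f2) \<bullet> n \<noteq> 0"
begin

text \<open>Let the shape map be the linear map of the tangent plane that takes
  \<open>f1, f2\<close> to \<open>n1, n2\<close>. Then \<open>del\<close> is the signed area
  density, \<open>h\<close> is \<open>del\<close> times the trace of the shape map, and
  \<open>m1, m2\<close> are the images of \<open>f1, f2\<close> under its trace-free part,
  multiplied by \<open>2 * del\<close> so that all formulas stay polynomial.\<close>

definition "del = (f1 \<times> f2) \<bullet> n"
definition "h = (n1 \<times> f2 + f1 \<times> n2) \<bullet> n"
definition "m1 = (2 * del) *\<^sub>R n1 - h *\<^sub>R f1"
definition "m2 = (2 * del) *\<^sub>R n2 - h *\<^sub>R f2"

lemma f1_nz: "f1 \<noteq> 0" using reg by auto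

lemma cross_f: "f1 \<times> f2 = del *\<^sub>R n"
  using cross_parallel_normal[OF nn f1n f2n] by (simp add: del_def)

lemma del_nz: "del \<noteq> 0" using reg by (simp add: del_def)

lemma bracket: "x \<bullet> n = 0 \<Longrightarrow> y \<bullet> n = 0 \<Longrightarrow> del * ((x \<times> y) \<bullet> n) = (x \<bullet> f1) * (y \<bullet> f2) - (x \<bullet> f2) * (y \<bullet> f1)"
proof -
  have "(x \<times> y) \<bullet> (f1 \<times> f2) = (x \<bullet> f1) * (y \<bullet> f2) - (x \<bullet> f2) * (y \<bullet> f1)" by (rule dot_cross)
  then show ?thesis unfolding cross_f by simp
qed

lemma del_sq: "del * del = (f1 \<bullet> f1) * (f2 \<bullet> f2) - (f1 \<bullet> f2) * (f1 \<bullet> f2)"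
  using bracket[OF f1n f2n] unfolding del_def[symmetric] by (simp add: inner_commute[of f2 f1])

lemma h_del: "h * del = (n1 \<bullet> f1) * (f2 \<bullet> f2) - 2 * ((n1 \<bullet> f2) * (f1 \<bullet> f2)) + (n2 \<bullet> f2) * (f1 \<bullet> f1)"
  using bracket[OF n1n f2n] bracket[OF f1n n2n] sym
  by (simp add: h_def inner_add_left algebra_simps inner_commute)

lemma Jf: "del *\<^sub>R (n \<times> f1) = (f1 \<bullet> f1) *\<^sub>R f2 - (f1 \<bullet> f2) *\<^sub>R f1"
    "del *\<^sub>R (n \<times> f2) = (f1 \<bullet> f2) *\<^sub>R f2 - (f2 \<bullet> f2) *\<^sub>R f1"
proof -
  have "del *\<^sub>R (n \<times> f1) = - (f1 \<times> (f1 \<times> f2))" "del *\<^sub>R (n \<times> f2) = - (f2 \<times> (f1 \<times> f2))"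
    unfolding cross_f cross_mult_right using cross_skew[of n f1] cross_skew[of n f2] by simp_all
  then show "del *\<^sub>R (n \<times> f1) = (f1 \<bullet> f1) *\<^sub>R f2 - (f1 \<bullet> f2) *\<^sub>R f1"
    "del *\<^sub>R (n \<times> f2) = (f1 \<bullet> f2) *\<^sub>R f2 - (f2 \<bullet> f2) *\<^sub>R f1"
    by (simp_all add: Lagrange inner_commute)
qed

lemma m_n: "m1 \<bullet> n = 0" "m2 \<bullet> n = 0"
  by (simp_all add: m1_def m2_def inner_diff_left f1n f2n n1n n2n)

lemma m_sym: "m1 \<bullet> f2 = m2 \<bullet> f1"
  using sym by (simp add: m1_def m2_def inner_diff_left inner_commute[of f2 f1])

text \<open>The trace with respect to the first fundamental form, with the adjugate of the Gram
  matrix of \<open>f1, f2\<close> in place of its inverse.\<close>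

lemma m_trace: "(f1 \<bullet> f1) * (m2 \<bullet> f2) - 2 * ((f1 \<bullet> f2) * (m1 \<bullet> f2)) + (f2 \<bullet> f2) * (m1 \<bullet> f1) = 0"
proof -
  have "(f1 \<bullet> f1) * (m2 \<bullet> f2) - 2 * ((f1 \<bullet> f2) * (m1 \<bullet> f2)) + (f2 \<bullet> f2) * (m1 \<bullet> f1)
      = 2 * del * (h * del) - 2 * h * (del * del)"
    unfolding h_del del_sq
    by (simp add: m1_def m2_def inner_diff_left algebra_simps inner_commute)
  then show ?thesis by simp
qed

text \<open>By \<open>Jf\<close>, the vector \<open>(f1 \<bullet> f1) f2\<close> equals
  \<open>(f1 \<bullet> f2) f1 + del (n \<times> f1)\<close>. The trace-free part maps this relation
  to the one claimed, with the quarter turn changing sign; symmetry and vanishing trace enter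
  through the inner products with \<open>f1\<close> and \<open>f2\<close>.\<close>

lemma m2_eq: "(f1 \<bullet> f1) *\<^sub>R m2 = (f1 \<bullet> f2) *\<^sub>R m1 - del *\<^sub>R (n \<times> m1)"
proof (rule eq_by_inner2[OF reg])
  have sk: "(n \<times> m1) \<bullet> x = - ((n \<times> x) \<bullet> m1)" for x
    by (metis cross_skew cross_triple inner_commute inner_minus_right)
  have k1: "del * ((n \<times> m1) \<bullet> f1) = - ((f1 \<bullet> f1) * (f2 \<bullet> m1) - (f1 \<bullet> f2) * (f1 \<bullet> m1))"
    using arg_cong[OF Jf(1), of "\<lambda>x. x \<bullet> m1"] by (simp add: sk inner_diff_left)
  have k2: "del * ((n \<times> m1) \<bullet> f2) = - ((f1 \<bullet> f2) * (f2 \<bullet> m1) - (f2 \<bullet> f2) * (f1 \<bullet> m1))"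
    using arg_cong[OF Jf(2), of "\<lambda>x. x \<bullet> m1"] by (simp add: sk inner_diff_left)
  show "((f1 \<bullet> f1) *\<^sub>R m2) \<bullet> n = ((f1 \<bullet> f2) *\<^sub>R m1 - del *\<^sub>R (n \<times> m1)) \<bullet> n"
    using m_n cross_normal_twice(3)[OF nn m_n(1)] by (simp add: inner_diff_left)
  show "((f1 \<bullet> f1) *\<^sub>R m2) \<bullet> f1 = ((f1 \<bullet> f2) *\<^sub>R m1 - del *\<^sub>R (n \<times> m1)) \<bullet> f1"
    using k1 m_sym by (simp add: inner_diff_left inner_commute algebra_simps)
  show "((f1 \<bullet> f1) *\<^sub>R m2) \<bullet> f2 = ((f1 \<bullet> f2) *\<^sub>R m1 - del *\<^sub>R (n \<times> m1)) \<bullet> f2"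
    using k2 m_trace by (simp add: inner_diff_left inner_commute algebra_simps)
qed

text \<open>The trace-free part anticommutes with the rotation by a right angle.\<close>

lemma tracefree_anticommute:
  assumes "x *\<^sub>R f1 + y *\<^sub>R f2 = a *\<^sub>R f1 + b *\<^sub>R (n \<times> f1)"
  shows "x *\<^sub>R m1 + y *\<^sub>R m2 = a *\<^sub>R m1 - b *\<^sub>R (n \<times> m1)"
proof -
  have ff: "f1 \<bullet> f1 \<noteq> 0" using f1_nz by simp
  have J: "(n \<times> f1) \<bullet> f1 = 0" "(n \<times> f1) \<bullet> (n \<times> f1) = f1 \<bullet> f1" using cross_normal_twice[OF nn f1n] by auto
  have dd: "f2 \<bullet> (n \<times> f1) = del"
    by (metis cross_triple del_def inner_commute)
  have "(x *\<^sub>R f1 + y *\<^sub>R f2) \<bullet> f1 = (a *\<^sub>R f1 + b *\<^sub>R (n \<times> f1)) \<bullet> f1" "(x *\<^sub>R f1 + y *\<^sub>R f2) \<bullet> (n \<times> f1) = (a *\<^sub>R f1 + b *\<^sub>R (n \<times> f1)) \<bullet> (n \<times> f1)"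
    using assms by simp_all
  then have a: "x * (f1 \<bullet> f1) + y * (f1 \<bullet> f2) = a * (f1 \<bullet> f1)" and b: "y * del = b * (f1 \<bullet> f1)"
    using J dd by (simp_all add: inner_add_left inner_commute[of f2 f1] inner_commute[of f1 "n \<times> f1"])
  have "(f1 \<bullet> f1) *\<^sub>R (x *\<^sub>R m1 + y *\<^sub>R m2) = (x * (f1 \<bullet> f1)) *\<^sub>R m1 + y *\<^sub>R ((f1 \<bullet> f1) *\<^sub>R m2)"
    by (simp add: scaleR_add_right mult.commute)
  also have "\<dots> = (x * (f1 \<bullet> f1) + y * (f1 \<bullet> f2)) *\<^sub>R m1 - (y * del) *\<^sub>R (n \<times> m1)"
    unfolding m2_eq by (simp add: scaleR_add_left scaleR_diff_right)
  also have "\<dots> = (f1 \<bullet> f1) *\<^sub>R (a *\<^sub>R m1 - b *\<^sub>R (n \<times> m1))"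
    unfolding a b by (simp add: scaleR_diff_right mult.commute)
  finally show ?thesis using ff by simp
qed

lemma cross_n: "n1 \<times> n2 = ((n1 \<times> n2) \<bullet> n) *\<^sub>R n"
  by (rule cross_parallel_normal[OF nn n1n n2n])

text \<open>At an umbilic the shape map is half its trace times the identity, so four times its
  determinant is the square of its trace. If the determinant is not positive, the trace vanishes and
  with it the shape map.\<close>

lemma m1_nonzero:
  assumes "((n1 \<times> n2) \<bullet> n) * del \<le> 0" "n1 \<noteq> 0 \<or> n2 \<noteq> 0"
  shows "m1 \<noteq> 0"
proof
  assume m1: "m1 = 0"
  then have m2: "m2 = 0" using m2_eq f1_nz by simp
  have e: "(2 * del) *\<^sub>R n1 = h *\<^sub>R f1" "(2 * del) *\<^sub>R n2 = h *\<^sub>R f2" using m1 m2 by (simp_all add: m1_def m2_def)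
  have "((2 * del) *\<^sub>R n1) \<times> ((2 * del) *\<^sub>R n2) = (h *\<^sub>R f1) \<times> (h *\<^sub>R f2)" using e by simp
  then have "(4 * del * del) *\<^sub>R (n1 \<times> n2) = (h * h) *\<^sub>R (del *\<^sub>R n)"
    by (simp add: cross_mult_left cross_mult_right cross_f algebra_simps)
  from arg_cong[OF this, of "\<lambda>x. x \<bullet> n"] have "4 * del * del * ((n1 \<times> n2) \<bullet> n) = h * h * del"
    using nn by simp
  then have "4 * (((n1 \<times> n2) \<bullet> n) * del) = h * h" using del_nz by (simp add: algebra_simps)
  then have "h = 0" using assms(1) by (metis mult_eq_0_iff mult_pos_pos linorder_not_less mult_nonneg_nonneg mult_le_0_iff zero_le_numeral zero_le_square order_antisym zero_less_numeral)
  then show False using e assms(2) del_nz by simp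
qed

text \<open>Cayley--Hamilton for the shape operator where its determinant vanishes.\<close>

lemma singular_shape:
  assumes s: "n1 \<times> n2 = 0" and e: "e = p *\<^sub>R n1 + q *\<^sub>R n2" "e = x *\<^sub>R f1 + y *\<^sub>R f2"
  shows "x *\<^sub>R m1 + y *\<^sub>R m2 = h *\<^sub>R e"
proof -
  define br where "br a b = (a \<times> b) \<bullet> n" for a b :: "real^3"
  have LL: "(n1 \<bullet> f1) * (n2 \<bullet> f2) = (n1 \<bullet> f2) * (n2 \<bullet> f1)"
    using bracket[OF n1n n2n] s by simp
  have D1: "del * (n1 \<bullet> v) = br n1 f2 * (f1 \<bullet> v) + br f1 n1 * (f2 \<bullet> v)"
    and D2: "del * (n2 \<bullet> v) = br n2 f2 * (f1 \<bullet> v) + br f1 n2 * (f2 \<bullet> v)" for v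
  proof -
    have gen: "del *\<^sub>R a = br a f2 *\<^sub>R f1 + br f1 a *\<^sub>R f2" if an: "a \<bullet> n = 0" for a
    proof (rule eq_by_inner2[OF reg])
      have c: "del * br a f2 = (a \<bullet> f1) * (f2 \<bullet> f2) - (a \<bullet> f2) * (f1 \<bullet> f2)"
        "del * br f1 a = (f1 \<bullet> f1) * (a \<bullet> f2) - (f1 \<bullet> f2) * (a \<bullet> f1)"
        using bracket[OF an f2n] bracket[OF f1n an] by (simp_all add: br_def inner_commute)
      show "(del *\<^sub>R a) \<bullet> n = (br a f2 *\<^sub>R f1 + br f1 a *\<^sub>R f2) \<bullet> n" by (simp add: inner_add_left an f1n f2n)
      have "del * (del * (a \<bullet> f1)) = (a \<bullet> f1) * ((f1 \<bullet> f1) * (f2 \<bullet> f2) - (f1 \<bullet> f2) * (f1 \<bullet> f2))" unfolding del_sq[symmetric] by simp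
      also have "\<dots> = (del * br a f2) * (f1 \<bullet> f1) + (del * br f1 a) * (f1 \<bullet> f2)" unfolding c by (simp add: algebra_simps)
      finally have "del * (del * (a \<bullet> f1)) = del * (br a f2 * (f1 \<bullet> f1) + br f1 a * (f1 \<bullet> f2))" by (simp add: algebra_simps)
      then show "(del *\<^sub>R a) \<bullet> f1 = (br a f2 *\<^sub>R f1 + br f1 a *\<^sub>R f2) \<bullet> f1"
        using del_nz by (simp add: inner_add_left inner_commute[of f2 f1])
      have "del * (del * (a \<bullet> f2)) = (a \<bullet> f2) * ((f1 \<bullet> f1) * (f2 \<bullet> f2) - (f1 \<bullet> f2) * (f1 \<bullet> f2))" unfolding del_sq[symmetric] by simp
      also have "\<dots> = (del * br a f2) * (f1 \<bullet> f2) + (del * br f1 a) * (f2 \<bullet> f2)" unfolding c by (simp add: algebra_simps)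
      finally have "del * (del * (a \<bullet> f2)) = del * (br a f2 * (f1 \<bullet> f2) + br f1 a * (f2 \<bullet> f2))" by (simp add: algebra_simps)
      then show "(del *\<^sub>R a) \<bullet> f2 = (br a f2 *\<^sub>R f1 + br f1 a *\<^sub>R f2) \<bullet> f2"
        using del_nz by (simp add: inner_add_left inner_commute[of f2 f1])
    qed
    show "del * (n1 \<bullet> v) = br n1 f2 * (f1 \<bullet> v) + br f1 n1 * (f2 \<bullet> v)"
      using arg_cong[OF gen[OF n1n], of "\<lambda>x. x \<bullet> v"] by (simp add: inner_add_left)
    show "del * (n2 \<bullet> v) = br n2 f2 * (f1 \<bullet> v) + br f1 n2 * (f2 \<bullet> v)"
      using arg_cong[OF gen[OF n2n], of "\<lambda>x. x \<bullet> v"] by (simp add: inner_add_left)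
  qed
  have hb: "h = br n1 f2 + br f1 n2" by (simp add: h_def br_def inner_add_left)
  have bb: "del * br f1 n1 = (f1 \<bullet> f1) * (n1 \<bullet> f2) - (f1 \<bullet> f2) * (n1 \<bullet> f1)"
      "del * br f1 n2 = (f1 \<bullet> f1) * (n2 \<bullet> f2) - (f1 \<bullet> f2) * (n2 \<bullet> f1)"
      "del * br n1 f2 = (n1 \<bullet> f1) * (f2 \<bullet> f2) - (n1 \<bullet> f2) * (f1 \<bullet> f2)"
      "del * br n2 f2 = (n2 \<bullet> f1) * (f2 \<bullet> f2) - (n2 \<bullet> f2) * (f1 \<bullet> f2)"
    using bracket[OF f1n n1n] bracket[OF f1n n2n] bracket[OF n1n f2n] bracket[OF n2n f2n]
    by (simp_all add: br_def inner_commute)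
  have k: "br f1 n1 * (f2 \<bullet> n1) = br f1 n2 * (f1 \<bullet> n1)" "br f1 n1 * (f2 \<bullet> n2) = br f1 n2 * (f1 \<bullet> n2)"
    "br n2 f2 * (f1 \<bullet> n1) = br n1 f2 * (f2 \<bullet> n1)" "br n2 f2 * (f1 \<bullet> n2) = br n1 f2 * (f2 \<bullet> n2)"
  proof -
    have "del * (br f1 n1 * (f2 \<bullet> n1)) = del * (br f1 n2 * (f1 \<bullet> n1))"
      using LL sym unfolding mult.assoc[symmetric] bb by (simp add: inner_commute algebra_simps)
    moreover have "del * (br f1 n1 * (f2 \<bullet> n2)) = del * (br f1 n2 * (f1 \<bullet> n2))"
      using LL sym unfolding mult.assoc[symmetric] bb by (simp add: inner_commute algebra_simps)
    moreover have "del * (br n2 f2 * (f1 \<bullet> n1)) = del * (br n1 f2 * (f2 \<bullet> n1))"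
      using LL sym unfolding mult.assoc[symmetric] bb by (simp add: inner_commute algebra_simps)
    moreover have "del * (br n2 f2 * (f1 \<bullet> n2)) = del * (br n1 f2 * (f2 \<bullet> n2))"
      using LL sym unfolding mult.assoc[symmetric] bb by (simp add: inner_commute algebra_simps)
    ultimately show "br f1 n1 * (f2 \<bullet> n1) = br f1 n2 * (f1 \<bullet> n1)" "br f1 n1 * (f2 \<bullet> n2) = br f1 n2 * (f1 \<bullet> n2)"
      "br n2 f2 * (f1 \<bullet> n1) = br n1 f2 * (f2 \<bullet> n1)" "br n2 f2 * (f1 \<bullet> n2) = br n1 f2 * (f2 \<bullet> n2)"
      using del_nz by simp_all
  qed
  \<comment> \<open>With determinant zero the square of the shape map is its trace times the map
    itself. These are the inner product forms of that identity, multiplied by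
    \<open>del\<close>.\<close>
  have III: "del * (n1 \<bullet> n1) = h * (f1 \<bullet> n1)" "del * (n1 \<bullet> n2) = h * (f1 \<bullet> n2)"
    "del * (n2 \<bullet> n1) = h * (f2 \<bullet> n1)" "del * (n2 \<bullet> n2) = h * (f2 \<bullet> n2)"
    unfolding D1 D2 hb using k by (simp_all add: algebra_simps)
  have en: "e \<bullet> n = 0" by (simp add: e(1) inner_add_left n1n n2n)
  \<comment> \<open>The image of \<open>e\<close> under the shape map. As \<open>e\<close> lies in
    the range of that map, \<open>III\<close> makes it an eigenvector for the eigenvalue
    \<open>h / del\<close>.\<close>
  define L where "L = x *\<^sub>R n1 + y *\<^sub>R n2"
  have Lf: "L \<bullet> f1 = n1 \<bullet> e" "L \<bullet> f2 = n2 \<bullet> e"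
    using sym by (simp_all add: L_def e(2) inner_add_left inner_add_right inner_commute)
  have "del *\<^sub>R L = h *\<^sub>R e"
  proof (rule eq_by_inner2[OF reg])
    show "(del *\<^sub>R L) \<bullet> n = (h *\<^sub>R e) \<bullet> n" by (simp add: en L_def inner_add_left n1n n2n)
    show "(del *\<^sub>R L) \<bullet> f1 = (h *\<^sub>R e) \<bullet> f1"
      using III by (simp add: Lf) (simp add: e(1) inner_add_left inner_add_right algebra_simps inner_commute)
    show "(del *\<^sub>R L) \<bullet> f2 = (h *\<^sub>R e) \<bullet> f2"
      using III by (simp add: Lf) (simp add: e(1) inner_add_left inner_add_right algebra_simps inner_commute)
  qed
  moreover have "x *\<^sub>R m1 + y *\<^sub>R m2 = 2 *\<^sub>R (del *\<^sub>R L) - h *\<^sub>R e"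
    unfolding e(2) by (simp add: m1_def m2_def L_def algebra_simps)
  moreover have "2 *\<^sub>R (h *\<^sub>R e) - h *\<^sub>R e = h *\<^sub>R e" by (simp only: scaleR_2) simp
  ultimately show ?thesis by simp
qed

text \<open>A symmetric map with vanishing trace and determinant is zero: for \<open>h = 0\<close>
  the vectors \<open>m1, m2\<close> are multiples of \<open>n1, n2\<close>, so \<open>m2_eq\<close>
  makes \<open>n \<times> n1\<close> parallel to \<open>n1\<close>, which forces
  \<open>n1 = 0\<close>.\<close>

lemma singular_trace_nz:
  assumes s: "n1 \<times> n2 = 0" and nz: "n1 \<noteq> 0 \<or> n2 \<noteq> 0"
  shows "h \<noteq> 0"
proof
  assume h: "h = 0"
  have tr: "m1 = (2 * del) *\<^sub>R n1" "m2 = (2 * del) *\<^sub>R n2" using h by (simp_all add: m1_def m2_def)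
  have "del *\<^sub>R (n \<times> m1) = (f1 \<bullet> f2) *\<^sub>R m1 - (f1 \<bullet> f1) *\<^sub>R m2" using m2_eq by simp
  then have "n1 \<times> (del *\<^sub>R (n \<times> m1)) = n1 \<times> ((f1 \<bullet> f2) *\<^sub>R m1 - (f1 \<bullet> f1) *\<^sub>R m2)" by simp
  also have "\<dots> = 0" using s by (simp add: tr Cross3.right_diff_distrib cross_mult_right)
  finally have "n1 \<times> (n \<times> n1) = 0" using del_nz by (simp add: tr cross_mult_right)
  then have "(n1 \<bullet> n1) *\<^sub>R n = 0" by (simp add: Lagrange n1n)
  then have n1: "n1 = 0" using nn by auto
  then have "m2 = 0" using m2_eq f1_nz tr by simp
  then have "n2 = 0" using tr del_nz by simp
  then show False using n1 nz by simp
qed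

lemma gauss_ratio: "(n1 \<times> n2) \<bullet> n / del = ((n1 \<bullet> f1) * (n2 \<bullet> f2) - (n1 \<bullet> f2) * (n1 \<bullet> f2)) / (del * del)"
  using bracket[OF n1n n2n] sym del_nz by (simp add: field_simps)

end

section \<open>Derivatives in charts\<close>

lemma differential_eqI:
  "(in_chart c h has_derivative D) (at (snd c p)) \<Longrightarrow> differential c h p = D"
  unfolding differential_def by (rule frechet_derivative_at[symmetric])

definition cdiff :: "'a chart \<Rightarrow> ('a \<Rightarrow> 'b::real_normed_vector) \<Rightarrow> 'a \<Rightarrow> bool" where
  "cdiff c h p \<longleftrightarrow> in_chart c h differentiable (at (snd c p))"

lemma cdiff_has_derivative: "cdiff c h p \<Longrightarrow> (in_chart c h has_derivative differential c h p) (at (snd c p))"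
  unfolding cdiff_def differential_def by (simp add: frechet_derivative_works)

lemma cdiffI: "(in_chart c h has_derivative D) (at (snd c p)) \<Longrightarrow> cdiff c h p"
  unfolding cdiff_def by (auto simp: differentiable_def)

lemma linear_differential: "cdiff c h p \<Longrightarrow> linear (differential c h p)"
  by (rule has_derivative_linear[OF cdiff_has_derivative])

lemma differential_expand:
  "cdiff c h p \<Longrightarrow> differential c h p \<zeta> = \<zeta>$1 *\<^sub>R partial c 1 h p + \<zeta>$2 *\<^sub>R partial c 2 h p"
  unfolding partial_def by (rule linear_real2[OF linear_differential])

locale chart =
  fixes M :: "'a topology" and c :: "'a chart"
  assumes is_chart: "is_chart M c"
begin

abbreviation "S \<equiv> snd c ` fst c"
abbreviation "inv_c \<equiv> inv_into (fst c) (snd c)"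

lemma homeo: "homeomorphic_map (subtopology M (fst c)) (top_of_set S) (snd c)"
  and openin_dom: "openin M (fst c)" and open_S: "open S"
  using is_chart by (auto simp: is_chart_def)

lemma dom_subset: "fst c \<subseteq> topspace M"
  using openin_dom by (rule openin_subset)

lemma topspace_dom: "topspace (subtopology M (fst c)) = fst c"
  using dom_subset by (auto simp: topspace_subtopology)

lemma inj: "inj_on (snd c) (fst c)"
  using homeo unfolding homeomorphic_eq_everything_map topspace_dom by blast

lemma inv_snd: "p \<in> fst c \<Longrightarrow> inv_c (snd c p) = p"
  using inj by (rule inv_into_f_f)

lemma snd_inv: "z \<in> S \<Longrightarrow> snd c (inv_c z) = z"
  by (rule f_inv_into_f)

lemma inv_in: "z \<in> S \<Longrightarrow> inv_c z \<in> fst c"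
  by (rule inv_into_into)

lemma openin_iff_open: "V \<subseteq> fst c \<Longrightarrow> openin M V \<longleftrightarrow> open (snd c ` V)"
proof -
  assume V: "V \<subseteq> fst c"
  have "openin (top_of_set S) (snd c ` V) \<longleftrightarrow> openin (subtopology M (fst c)) V"
    using homeomorphic_map_openness[OF homeo] V dom_subset by (simp add: topspace_dom)
  then show ?thesis
    using V openin_open_subtopology[OF openin_dom] openin_open_eq[OF open_S] by auto
qed

lemma openin_inv_image: "open W \<Longrightarrow> W \<subseteq> S \<Longrightarrow> openin M (inv_c ` W)"
proof -
  assume W: "open W" "W \<subseteq> S"
  have "snd c ` inv_c ` W = W" using W snd_inv by (force simp: image_image)
  moreover have "inv_c ` W \<subseteq> fst c" using W inv_in by blast
  ultimately show ?thesis using openin_iff_open W by simp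
qed

lemma in_chart_snd: "p \<in> fst c \<Longrightarrow> in_chart c h (snd c p) = h p"
  by (simp add: in_chart_def inv_snd)

lemma differential_cong:
  assumes "openin M V" "V \<subseteq> fst c" "p \<in> V" "\<And>q. q \<in> V \<Longrightarrow> a q = b q" and "cdiff c a p"
  shows "differential c a p = differential c b p" "cdiff c b p"
proof -
  have o: "open (snd c ` V)" using openin_iff_open assms by blast
  have eq: "in_chart c a z = in_chart c b z" if "z \<in> snd c ` V" for z
    using that assms(2,4) by (auto simp: in_chart_snd subset_iff)
  have "(in_chart c b has_derivative differential c a p) (at (snd c p))"
    by (rule has_derivative_transform_within_open[OF cdiff_has_derivative[OF assms(5)] o])
       (use assms(3) eq in auto)
  then show "differential c a p = differential c b p" "cdiff c b p"
    using differential_eqI cdiffI by metis+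
qed

end

lemma in_chart_bilinear: "in_chart c (\<lambda>q. B (a q) (b q)) = (\<lambda>z. B (in_chart c a z) (in_chart c b z))"
  and in_chart_unary: "in_chart c (\<lambda>q. L (a q)) = (\<lambda>z. L (in_chart c a z))"
  by (simp_all add: in_chart_def o_def)

lemma differential_bilinear:
  assumes "bounded_bilinear B" "cdiff c a p" "cdiff c b p" "p \<in> fst c" "inj_on (snd c) (fst c)"
  shows "differential c (\<lambda>q. B (a q) (b q)) p \<zeta> = B (a p) (differential c b p \<zeta>) + B (differential c a p \<zeta>) (b p)"
    and "cdiff c (\<lambda>q. B (a q) (b q)) p"
proof -
  have "(in_chart c (\<lambda>q. B (a q) (b q)) has_derivative
     (\<lambda>\<zeta>. B (a p) (differential c b p \<zeta>) + B (differential c a p \<zeta>) (b p))) (at (snd c p))"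
    unfolding in_chart_bilinear[of c B]
    using bounded_bilinear.FDERIV[OF assms(1) cdiff_has_derivative[OF assms(2)] cdiff_has_derivative[OF assms(3)]]
    unfolding in_chart_def o_def using assms(4,5) by simp
  from differential_eqI[OF this] cdiffI[OF this]
  show "differential c (\<lambda>q. B (a q) (b q)) p \<zeta> = B (a p) (differential c b p \<zeta>) + B (differential c a p \<zeta>) (b p)"
    "cdiff c (\<lambda>q. B (a q) (b q)) p" by simp_all
qed

lemmas differential_inner = differential_bilinear[OF bounded_bilinear_inner]
lemmas differential_scaleR = differential_bilinear[OF bounded_bilinear_scaleR]
lemmas differential_mult = differential_bilinear[OF bounded_bilinear_mult]
lemmas differential_cross3 = differential_bilinear[OF bounded_bilinear_cross3]

lemma differential_add:
  assumes "cdiff c a p" "cdiff c b p"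
  shows "differential c (\<lambda>q. a q + b q) p \<zeta> = differential c a p \<zeta> + differential c b p \<zeta>"
    and "cdiff c (\<lambda>q. a q + b q) p"
proof -
  have "(in_chart c (\<lambda>q. a q + b q) has_derivative (\<lambda>\<zeta>. differential c a p \<zeta> + differential c b p \<zeta>)) (at (snd c p))"
    unfolding in_chart_bilinear[of c "(+)"] by (intro has_derivative_add cdiff_has_derivative assms)
  from differential_eqI[OF this] cdiffI[OF this]
  show "differential c (\<lambda>q. a q + b q) p \<zeta> = differential c a p \<zeta> + differential c b p \<zeta>"
    and "cdiff c (\<lambda>q. a q + b q) p" by simp_all
qed

lemma differential_diff:
  assumes "cdiff c a p" "cdiff c b p"
  shows "differential c (\<lambda>q. a q - b q) p \<zeta> = differential c a p \<zeta> - differential c b p \<zeta>"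
    and "cdiff c (\<lambda>q. a q - b q) p"
proof -
  have "(in_chart c (\<lambda>q. a q - b q) has_derivative (\<lambda>\<zeta>. differential c a p \<zeta> - differential c b p \<zeta>)) (at (snd c p))"
    unfolding in_chart_bilinear[of c "(-)"] by (intro has_derivative_diff cdiff_has_derivative assms)
  from differential_eqI[OF this] cdiffI[OF this]
  show "differential c (\<lambda>q. a q - b q) p \<zeta> = differential c a p \<zeta> - differential c b p \<zeta>"
    and "cdiff c (\<lambda>q. a q - b q) p" by simp_all
qed

lemma differential_const: "differential c (\<lambda>q. k) p \<zeta> = 0"
  by (simp add: differential_def in_chart_def o_def)

definition csmooth :: "'a chart \<Rightarrow> ('a \<Rightarrow> 'b::real_normed_vector) \<Rightarrow> bool" where
  "csmooth c h \<longleftrightarrow> smooth_on (snd c ` fst c) (in_chart c h)"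

lemma csmooth_cdiff: "csmooth c h \<Longrightarrow> p \<in> fst c \<Longrightarrow> cdiff c h p"
  unfolding csmooth_def by (rule cdiffI, rule smooth_on_has_derivative) auto

context chart
begin

lemma csmooth_intros:
  shows "csmooth c (\<lambda>z. k)"
    and "csmooth c a \<Longrightarrow> csmooth c b \<Longrightarrow> csmooth c (\<lambda>z. a z + b z)"
    and "csmooth c a \<Longrightarrow> csmooth c b \<Longrightarrow> csmooth c (\<lambda>z. a z - b z)"
    and "csmooth c a \<Longrightarrow> csmooth c (\<lambda>z. - a z)"
    and "csmooth c r \<Longrightarrow> csmooth c a \<Longrightarrow> csmooth c (\<lambda>z. r z *\<^sub>R a z)"
    and "csmooth c r \<Longrightarrow> csmooth c s \<Longrightarrow> csmooth c (\<lambda>z. r z * s z :: real)"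
    and "csmooth c r \<Longrightarrow> csmooth c s \<Longrightarrow> (\<And>p. p \<in> fst c \<Longrightarrow> s p \<noteq> 0) \<Longrightarrow> csmooth c (\<lambda>z. r z / s z :: real)"
    and "csmooth c x \<Longrightarrow> csmooth c y \<Longrightarrow> csmooth c (\<lambda>z. x z \<times> y z)"
    and "csmooth c v \<Longrightarrow> csmooth c w \<Longrightarrow> csmooth c (\<lambda>z. v z \<bullet> w z)"
  unfolding csmooth_def in_chart_def o_def
  by (simp_all add: smooth_on_intros[OF open_S] inv_in)

lemma csmooth_partial: "csmooth c h \<Longrightarrow> csmooth c (partial c i h)"
proof -
  assume h: "csmooth c h"
  have "smooth_on S (\<lambda>z. frechet_derivative (in_chart c h) (at z) (axis i 1))"
    using h unfolding csmooth_def by (rule smooth_on_frechet_derivative)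
  then show ?thesis
    unfolding csmooth_def
    by (subst smooth_on_cong[OF open_S, of _ "\<lambda>z. frechet_derivative (in_chart c h) (at z) (axis i 1)"])
       (auto simp: in_chart_snd partial_def differential_def)
qed

lemma csmooth_cong: "csmooth c a \<Longrightarrow> (\<And>p. p \<in> fst c \<Longrightarrow> a p = b p) \<Longrightarrow> csmooth c b"
  unfolding csmooth_def
  by (subst smooth_on_cong[OF open_S, of _ "in_chart c a"]) (auto simp: in_chart_snd)

lemma partial_commute:
  fixes h :: "'a \<Rightarrow> 'b::real_inner"
  assumes "csmooth c h" "p \<in> fst c"
  shows "partial c i (partial c j h) p = partial c j (partial c i h) p"
proof -
  have e: "differential c (partial c j h) p = frechet_derivative (\<lambda>z. frechet_derivative (in_chart c h) (at z) (axis j 1)) (at (snd c p))" for j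
  proof (rule differential_eqI)
    have "((\<lambda>z. frechet_derivative (in_chart c h) (at z) (axis j 1)) has_derivative
        frechet_derivative (\<lambda>z. frechet_derivative (in_chart c h) (at z) (axis j 1)) (at (snd c p))) (at (snd c p))"
      using assms unfolding csmooth_def by (intro smooth_on_has_derivative[OF smooth_on_frechet_derivative]) auto
    then show "(in_chart c (partial c j h) has_derivative
        frechet_derivative (\<lambda>z. frechet_derivative (in_chart c h) (at z) (axis j 1)) (at (snd c p))) (at (snd c p))"
      by (rule has_derivative_transform_within_open[OF _ open_S])
         (use assms in \<open>auto simp: in_chart_snd partial_def differential_def\<close>)
  qed
  show ?thesis
    unfolding partial_def[of c i "partial c j h"] partial_def[of c j "partial c i h"] e
    by (rule frechet_derivative_commute[OF open_S]) (use assms in \<open>auto simp: csmooth_def smooth_onD\<close>)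
qed

lemma curve_has_vector_derivative:
  assumes "regular_curve c \<gamma> a b" "t \<in> {a<..<b}"
  shows "((snd c \<circ> \<gamma>) has_vector_derivative velocity c \<gamma> t) (at t)"
proof -
  have "smooth_on {a<..<b} (snd c \<circ> \<gamma>)" using assms by (simp add: regular_curve_def)
  from smooth_on_has_derivative[OF this assms(2)]
  have "(snd c \<circ> \<gamma>) differentiable (at t)" by (auto simp: differentiable_def)
  then show ?thesis unfolding velocity_def by (simp add: vector_derivative_works)
qed

lemma along_curve:
  assumes "regular_curve c \<gamma> a b" "t \<in> {a<..<b}" "cdiff c h (\<gamma> t)"
  shows "((\<lambda>s. h (\<gamma> s)) has_vector_derivative differential c h (\<gamma> t) (velocity c \<gamma> t)) (at t)"
proof -
  have "((\<lambda>s. in_chart c h ((snd c \<circ> \<gamma>) s)) has_vector_derivative differential c h (\<gamma> t) (velocity c \<gamma> t)) (at t)"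
    using has_vector_derivative_chain[OF curve_has_vector_derivative[OF assms(1,2)], of "in_chart c h"]
      cdiff_has_derivative[OF assms(3)] by simp
  moreover have "in_chart c h ((snd c \<circ> \<gamma>) s) = h (\<gamma> s)" if "s \<in> {a<..<b}" for s
    using that assms(1) by (auto simp: regular_curve_def in_chart_snd image_subset_iff)
  ultimately show ?thesis
    using has_vector_derivative_transform_within_open[OF _ open_greaterThanLessThan assms(2), of "\<lambda>s. in_chart c h ((snd c \<circ> \<gamma>) s)" _ "\<lambda>s. h (\<gamma> s)"]
    by blast
qed

end

section \<open>Immersed surfaces with a unit normal field\<close>

locale surface =
  fixes M :: "'a topology" and \<A> :: "'a chart set" and f \<nu> :: "'a \<Rightarrow> real^3"
  assumes surf: "oriented_surface M \<A>" and compact_M: "compact_space M"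
    and imm: "immersion \<A> f" and unit_normal: "unit_normal_field \<A> f \<nu>"
begin

lemma chart_axioms_A: "c \<in> \<A> \<Longrightarrow> chart M c"
  using surf by (simp add: oriented_surface_def chart_def)

lemma cover: "p \<in> topspace M \<Longrightarrow> \<exists>c\<in>\<A>. p \<in> fst c"
  using surf by (auto simp: oriented_surface_def)

lemma in_topspace: "c \<in> \<A> \<Longrightarrow> p \<in> fst c \<Longrightarrow> p \<in> topspace M"
  using chart.dom_subset[OF chart_axioms_A] by blast

lemma csmooth_f: "c \<in> \<A> \<Longrightarrow> csmooth c f" and csmooth_nu: "c \<in> \<A> \<Longrightarrow> csmooth c \<nu>"
  using imm unit_normal by (auto simp: immersion_def unit_normal_field_def smooth_map_def csmooth_def)

definition trans_map :: "'a chart \<Rightarrow> 'a chart \<Rightarrow> 'a \<Rightarrow> real^2 \<Rightarrow> real^2" where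
  "trans_map c d p = differential c (snd d) p"

lemma transition:
  assumes cd: "c \<in> \<A>" "d \<in> \<A>" "p \<in> fst c" "p \<in> fst d"
  shows "(in_chart c (snd d) has_derivative trans_map c d p) (at (snd c p))"
    and "det (matrix (trans_map c d p)) > 0" and "linear (trans_map c d p)"
proof -
  have "snd c p \<in> snd c ` (fst c \<inter> fst d)" using cd by blast
  moreover have "smooth_on (snd c ` (fst c \<inter> fst d)) (in_chart c (snd d))"
      "\<forall>z \<in> snd c ` (fst c \<inter> fst d). det (matrix (frechet_derivative (in_chart c (snd d)) (at z))) > 0"
    using surf cd by (auto simp: oriented_surface_def)
  ultimately show 1: "(in_chart c (snd d) has_derivative trans_map c d p) (at (snd c p))"
    and "det (matrix (trans_map c d p)) > 0"
    unfolding trans_map_def differential_def by (auto intro: smooth_on_has_derivative)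
  show "linear (trans_map c d p)" using 1 by (rule has_derivative_linear)
qed

lemma open_overlap: "c \<in> \<A> \<Longrightarrow> d \<in> \<A> \<Longrightarrow> open (snd c ` (fst c \<inter> fst d))"
  using chart.openin_iff_open[OF chart_axioms_A, of c "fst c \<inter> fst d"]
    openin_Int[OF chart.openin_dom[OF chart_axioms_A, of c] chart.openin_dom[OF chart_axioms_A, of d]] by simp

lemma in_chart_transition:
  assumes "c \<in> \<A>" "d \<in> \<A>" "z \<in> snd c ` (fst c \<inter> fst d)"
  shows "in_chart c h z = in_chart d h (in_chart c (snd d) z)" "in_chart c (snd d) z \<in> snd d ` (fst c \<inter> fst d)"
  using assms(3)
  by (auto simp: chart.in_chart_snd[OF chart_axioms_A[OF assms(1)]] chart.in_chart_snd[OF chart_axioms_A[OF assms(2)]])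

lemma C_k_on_transition:
  fixes h :: "'a \<Rightarrow> 'b::real_normed_vector"
  assumes "c \<in> \<A>" "d \<in> \<A>" "C_k_on k (snd d ` fst d) (in_chart d h)"
  shows "C_k_on k (snd c ` (fst c \<inter> fst d)) (in_chart c h)"
proof -
  have o: "open (snd c ` (fst c \<inter> fst d))" "open (snd d ` fst d)"
    using open_overlap assms chart.open_S[OF chart_axioms_A] by auto
  have "C_k_on k (snd c ` (fst c \<inter> fst d)) (\<lambda>z. in_chart d h (in_chart c (snd d) z))"
  proof (rule C_k_on_compose[OF o _ _ assms(3)])
    show "in_chart c (snd d) ` snd c ` (fst c \<inter> fst d) \<subseteq> snd d ` fst d"
      using in_chart_transition(2)[OF assms(1,2)] by blast
    show "C_k_on k (snd c ` (fst c \<inter> fst d)) (in_chart c (snd d))"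
      using surf assms by (auto simp: oriented_surface_def intro: smooth_onD)
  qed
  then show ?thesis
    by (subst C_k_on_cong[OF o(1), of _ "\<lambda>z. in_chart d h (in_chart c (snd d) z)"])
       (rule in_chart_transition(1)[OF assms(1,2)])
qed

lemma chart_change:
  fixes h :: "'a \<Rightarrow> 'b::real_normed_vector"
  assumes cd: "c \<in> \<A>" "d \<in> \<A>" "p \<in> fst c" "p \<in> fst d" and h: "cdiff d h p"
  shows "differential c h p \<zeta> = differential d h p (trans_map c d p \<zeta>)" "cdiff c h p"
proof -
  have sd: "in_chart c (snd d) (snd c p) = snd d p"
    using chart.in_chart_snd[OF chart_axioms_A[OF cd(1)] cd(3)] .
  have "(in_chart d h \<circ> in_chart c (snd d) has_derivative (differential d h p \<circ> trans_map c d p)) (at (snd c p))"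
    using diff_chain_at[OF transition(1)[OF cd], of "in_chart d h"] cdiff_has_derivative[OF h] by (simp add: sd)
  then have "(in_chart c h has_derivative (differential d h p \<circ> trans_map c d p)) (at (snd c p))"
  proof (rule has_derivative_transform_within_open[OF _ open_overlap[OF cd(1,2)]])
    show "snd c p \<in> snd c ` (fst c \<inter> fst d)" using cd by blast
    show "(in_chart d h \<circ> in_chart c (snd d)) z = in_chart c h z" if "z \<in> snd c ` (fst c \<inter> fst d)" for z
      unfolding o_apply by (rule in_chart_transition(1)[OF cd(1,2) that, symmetric])
  qed
  from differential_eqI[OF this] cdiffI[OF this]
  show "differential c h p \<zeta> = differential d h p (trans_map c d p \<zeta>)" "cdiff c h p" by simp_all
qed

lemma partial_change:
  fixes h :: "'a \<Rightarrow> 'b::real_normed_vector"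
  assumes cd: "c \<in> \<A>" "d \<in> \<A>" "p \<in> fst c" "p \<in> fst d" and h: "cdiff d h p"
  shows "partial c i h p = trans_map c d p (axis i 1) $ 1 *\<^sub>R partial d 1 h p + trans_map c d p (axis i 1) $ 2 *\<^sub>R partial d 2 h p"
  unfolding partial_def[of c i] chart_change(1)[OF assms] by (rule differential_expand[OF h])

lemma det_trans_map:
  "det (matrix (trans_map c d p)) = trans_map c d p (axis 1 1) $ 1 * trans_map c d p (axis 2 1) $ 2
     - trans_map c d p (axis 2 1) $ 1 * trans_map c d p (axis 1 1) $ 2"
  by (simp add: det_2 matrix_def)

lemma cross_change:
  fixes h :: "'a \<Rightarrow> real^3"
  assumes cd: "c \<in> \<A>" "d \<in> \<A>" "p \<in> fst c" "p \<in> fst d" and h: "cdiff d h p"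
  shows "partial c 1 h p \<times> partial c 2 h p = det (matrix (trans_map c d p)) *\<^sub>R (partial d 1 h p \<times> partial d 2 h p)"
  unfolding partial_change[OF assms] det_trans_map
  using cross_skew[of "partial d 2 h p" "partial d 1 h p"]
  by (simp add: cross_add_left cross_add_right cross_mult_left cross_mult_right algebra_simps)

lemma nu_unit: "c \<in> \<A> \<Longrightarrow> p \<in> fst c \<Longrightarrow> \<nu> p \<bullet> \<nu> p = 1"
  using unit_normal by (auto simp: unit_normal_field_def norm_eq_1)

lemma nu_f: "c \<in> \<A> \<Longrightarrow> p \<in> fst c \<Longrightarrow> \<nu> p \<bullet> differential c f p \<zeta> = 0"
  using unit_normal by (auto simp: unit_normal_field_def)

lemma nu_diff_nu: "c \<in> \<A> \<Longrightarrow> p \<in> fst c \<Longrightarrow> \<nu> p \<bullet> differential c \<nu> p \<zeta> = 0"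
proof -
  assume c: "c \<in> \<A>" "p \<in> fst c"
  interpret chart M c using c by (simp add: chart_axioms_A)
  have d: "cdiff c \<nu> p" by (rule csmooth_cdiff[OF csmooth_nu[OF c(1)] c(2)])
  have "differential c (\<lambda>q. \<nu> q \<bullet> \<nu> q) p = differential c (\<lambda>q. 1) p"
    by (rule differential_cong(1)[OF openin_dom order_refl c(2)])
       (use nu_unit[OF c(1)] differential_inner(2)[OF d d c(2) inj] in auto)
  then show ?thesis using differential_inner(1)[OF d d c(2) inj, of \<zeta>]
    by (simp add: differential_const inner_commute)
qed

text \<open>Differentiating the orthogonality of \<open>\<nu>\<close> and
  \<open>partial c j f\<close> turns the left side into minus the normal part of a second derivative
  of \<open>f\<close>, which is symmetric.\<close>

lemma shape_symmetric:
  assumes c: "c \<in> \<A>" "p \<in> fst c"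
  shows "partial c i \<nu> p \<bullet> partial c j f p = - (\<nu> p \<bullet> partial c i (partial c j f) p)"
    and "partial c i \<nu> p \<bullet> partial c j f p = partial c j \<nu> p \<bullet> partial c i f p"
proof -
  interpret chart M c using c by (simp add: chart_axioms_A)
  have d: "cdiff c \<nu> p" by (rule csmooth_cdiff[OF csmooth_nu[OF c(1)] c(2)])
  have d': "cdiff c (partial c j f) p" for j by (rule csmooth_cdiff[OF csmooth_partial[OF csmooth_f[OF c(1)]] c(2)])
  have *: "partial c i \<nu> p \<bullet> partial c j f p = - (\<nu> p \<bullet> partial c i (partial c j f) p)" for i j
  proof -
    have "differential c (\<lambda>q. \<nu> q \<bullet> partial c j f q) p = differential c (\<lambda>q. 0) p"
      by (rule differential_cong(1)[OF openin_dom order_refl c(2)])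
         (use nu_f[OF c(1)] differential_inner(2)[OF d d' c(2) inj] in \<open>auto simp: partial_def\<close>)
    then show ?thesis using differential_inner(1)[OF d d' c(2) inj, of j "axis i 1"]
      by (simp add: differential_const partial_def algebra_simps)
  qed
  show "partial c i \<nu> p \<bullet> partial c j f p = - (\<nu> p \<bullet> partial c i (partial c j f) p)" by (rule *)
  show "partial c i \<nu> p \<bullet> partial c j f p = partial c j \<nu> p \<bullet> partial c i f p"
    unfolding * by (simp add: partial_commute[OF csmooth_f[OF c(1)] c(2), of i j])
qed

lemma surface_point_partial:
  assumes c: "c \<in> \<A>" "p \<in> fst c"
  shows "surface_point (partial c 1 f p) (partial c 2 f p) (\<nu> p) (partial c 1 \<nu> p) (partial c 2 \<nu> p)"
proof
  show "\<nu> p \<bullet> \<nu> p = 1" by (rule nu_unit[OF c])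
  show fn: "partial c 1 f p \<bullet> \<nu> p = 0" "partial c 2 f p \<bullet> \<nu> p = 0"
    using nu_f[OF c] by (simp_all add: partial_def inner_commute)
  show "partial c 1 \<nu> p \<bullet> \<nu> p = 0" "partial c 2 \<nu> p \<bullet> \<nu> p = 0"
    using nu_diff_nu[OF c] by (simp_all add: partial_def inner_commute)
  show "partial c 1 \<nu> p \<bullet> partial c 2 f p = partial c 2 \<nu> p \<bullet> partial c 1 f p"
    by (rule shape_symmetric(2)[OF c])
  have inj: "inj (differential c f p)" using imm c by (auto simp: immersion_def)
  have cd: "cdiff c f p" by (rule csmooth_cdiff[OF csmooth_f[OF c(1)] c(2)])
  show "(partial c 1 f p \<times> partial c 2 f p) \<bullet> \<nu> p \<noteq> 0"
  proof
    assume "(partial c 1 f p \<times> partial c 2 f p) \<bullet> \<nu> p = 0"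
    then have 0: "partial c 1 f p \<times> partial c 2 f p = 0"
      using cross_parallel_normal[OF nu_unit[OF c] fn] by simp
    have "(partial c 1 f p \<times> partial c 2 f p) \<times> partial c 2 f p = 0" unfolding 0 by simp
    then have "partial c 2 f p \<times> (partial c 1 f p \<times> partial c 2 f p) = 0" using cross_skew[of "partial c 2 f p"] by simp
    \<comment> \<open>The vanishing cross product becomes an explicit linear relation between the
      two partial derivatives, which injectivity of the differential rules out.\<close>
    then have "(partial c 2 f p \<bullet> partial c 2 f p) *\<^sub>R partial c 1 f p - (partial c 2 f p \<bullet> partial c 1 f p) *\<^sub>R partial c 2 f p = 0"
      by (simp add: Lagrange)
    then have "differential c f p (vector [partial c 2 f p \<bullet> partial c 2 f p, - (partial c 2 f p \<bullet> partial c 1 f p)]) = differential c f p 0"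
      unfolding differential_expand[OF cd] by simp
    then have "vector [partial c 2 f p \<bullet> partial c 2 f p, - (partial c 2 f p \<bullet> partial c 1 f p)] = (0 :: real^2)"
      using inj by (auto dest: injD)
    then have "partial c 2 f p = 0" by (simp add: vec_eq_iff forall_2)
    then have "differential c f p (axis 2 1) = differential c f p 0"
      unfolding differential_expand[OF cd, of 0] by (simp add: partial_def)
    then have "axis 2 1 = (0 :: real^2)" using inj by (auto dest: injD)
    then show False by (simp add: axis_eq_0_iff)
  qed
qed

text \<open>\<open>delta\<close> and \<open>delta_sharp\<close> are \<open>lam\<close> and
  \<open>lam_sharp\<close> without the factor \<open>sgn\<close> of the area form. They are
  polynomial in \<open>\<nu>\<close> and first derivatives, hence smooth, and both change by the
  Jacobian determinant; the sign of \<open>delta\<close> records whether \<open>\<nu>\<close> agrees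
  with the orientation.\<close>

definition delta :: "'a chart \<Rightarrow> 'a \<Rightarrow> real" where
  "delta c p = (partial c 1 f p \<times> partial c 2 f p) \<bullet> \<nu> p"

definition delta_sharp :: "'a chart \<Rightarrow> 'a \<Rightarrow> real" where
  "delta_sharp c p = (partial c 1 \<nu> p \<times> partial c 2 \<nu> p) \<bullet> \<nu> p"

definition trace_h :: "'a chart \<Rightarrow> 'a \<Rightarrow> real" where
  "trace_h c p = (partial c 1 \<nu> p \<times> partial c 2 f p + partial c 1 f p \<times> partial c 2 \<nu> p) \<bullet> \<nu> p"

definition mfield :: "'a chart \<Rightarrow> 'a \<Rightarrow> real^3" where
  "mfield c p = (2 * delta c p) *\<^sub>R partial c 1 \<nu> p - trace_h c p *\<^sub>R partial c 1 f p"

lemma lam_eq: "lam c f \<nu> p = \<bar>delta c p\<bar>"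
  and lam_sharp_eq: "lam_sharp c f \<nu> p = sgn (delta c p) * delta_sharp c p"
  by (simp_all add: lam_def lam_sharp_def area_form_def delta_def delta_sharp_def sgn_mult_self_eq abs_sgn mult.commute)

lemma delta_nz: "c \<in> \<A> \<Longrightarrow> p \<in> fst c \<Longrightarrow> delta c p \<noteq> 0"
  using surface_point.reg[OF surface_point_partial] by (simp add: delta_def)

lemma lam_pos: "c \<in> \<A> \<Longrightarrow> p \<in> fst c \<Longrightarrow> lam c f \<nu> p > 0"
  using delta_nz by (simp add: lam_eq)

lemma csmooth_surface:
  assumes "c \<in> \<A>"
  shows "csmooth c (delta c)" "csmooth c (delta_sharp c)" "csmooth c (trace_h c)" "csmooth c (mfield c)"
proof -
  interpret chart M c using assms by (simp add: chart_axioms_A)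
  show 1: "csmooth c (delta c)" and 2: "csmooth c (delta_sharp c)" and 3: "csmooth c (trace_h c)"
    unfolding delta_def[abs_def] delta_sharp_def[abs_def] trace_h_def[abs_def] by (intro csmooth_intros csmooth_partial csmooth_f[OF assms] csmooth_nu[OF assms])+
  show "csmooth c (mfield c)"
    unfolding mfield_def[abs_def] by (intro csmooth_intros csmooth_partial csmooth_f[OF assms] csmooth_nu[OF assms] 1 3)
qed

lemma delta_change:
  assumes cd: "c \<in> \<A>" "d \<in> \<A>" "p \<in> fst c" "p \<in> fst d"
  shows "delta c p = det (matrix (trans_map c d p)) * delta d p"
    "delta_sharp c p = det (matrix (trans_map c d p)) * delta_sharp d p"
  using cross_change[OF cd csmooth_cdiff[OF csmooth_f[OF cd(2)] cd(4)]]
    cross_change[OF cd csmooth_cdiff[OF csmooth_nu[OF cd(2)] cd(4)]]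
  by (simp_all add: delta_def delta_sharp_def)

subsection \<open>Theorema egregium\<close>

lemma matrix_inv_2:
  fixes A :: "real^2^2"
  assumes "det A \<noteq> 0"
  shows "A$m$1 * matrix_inv A$1$l + A$m$2 * matrix_inv A$2$l = (if m = l then 1 else 0)"
proof -
  have "A ** matrix_inv A = mat 1"
    using assms someI_ex[of "\<lambda>B. A ** B = mat 1 \<and> B ** A = mat 1"]
    unfolding matrix_inv_def invertible_det_nz[symmetric] invertible_def by blast
  then have "(A ** matrix_inv A)$m$l = mat 1 $ m $ l" by simp
  then show ?thesis by (simp add: matrix_matrix_mult_def sum_2 mat_def)
qed

text \<open>For an induced metric the combination of metric derivatives collapses to twice the inner
  product of a second derivative of \<open>f\<close> with \<open>partial c l f\<close>; inverting
  the metric turns these products into the coefficients of the tangential part.\<close>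

lemma christoffel_tangential:
  assumes c: "c \<in> \<A>" "p \<in> fst c"
  shows "christoffel c f 1 i j p *\<^sub>R partial c 1 f p + christoffel c f 2 i j p *\<^sub>R partial c 2 f p
    = partial c i (partial c j f) p - (partial c i (partial c j f) p \<bullet> \<nu> p) *\<^sub>R \<nu> p"
proof -
  interpret chart M c using c by (simp add: chart_axioms_A)
  interpret surface_point "partial c 1 f p" "partial c 2 f p" "\<nu> p" "partial c 1 \<nu> p" "partial c 2 \<nu> p"
    by (rule surface_point_partial[OF c])
  have d: "cdiff c (partial c j f) p" for j by (rule csmooth_cdiff[OF csmooth_partial[OF csmooth_f[OF c(1)]] c(2)])
  have pm: "partial c l (metric c f i j) p = partial c l (partial c i f) p \<bullet> partial c j f p + partial c i f p \<bullet> partial c l (partial c j f) p" for l i j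
  proof -
    have "metric c f i j = (\<lambda>q. partial c i f q \<bullet> partial c j f q)" by (rule ext) (simp add: metric_def)
    then show ?thesis using differential_inner(1)[OF d d c(2) inj, of i j "axis l 1"] by (simp add: partial_def[of c l])
  qed
  have comm: "partial c k (partial c l f) p = partial c l (partial c k f) p" for k l
    by (rule partial_commute[OF csmooth_f[OF c(1)] c(2)])
  let ?x = "partial c i (partial c j f) p"
  have br: "(partial c i (metric c f j l) p + partial c j (metric c f i l) p - partial c l (metric c f i j) p) = 2 * (?x \<bullet> partial c l f p)" for l
    unfolding pm using comm[of i l] comm[of j l] comm[of j i] by (simp add: inner_commute)
  let ?G = "metric_matrix c f p"
  have chr: "christoffel c f k i j p = matrix_inv ?G $ k $ 1 * (?x \<bullet> partial c 1 f p) + matrix_inv ?G $ k $ 2 * (?x \<bullet> partial c 2 f p)" for k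
    unfolding christoffel_def br sum_2 by simp
  have Gent: "?G $ a $ b = partial c a f p \<bullet> partial c b f p" for a b by (simp add: metric_matrix_def metric_def)
  have "det ?G = del * del" unfolding del_sq by (simp add: det_2 Gent inner_commute)
  then have dG: "det ?G \<noteq> 0" using del_nz by simp
  have fm: "(christoffel c f 1 i j p *\<^sub>R partial c 1 f p + christoffel c f 2 i j p *\<^sub>R partial c 2 f p) \<bullet> partial c m f p = ?x \<bullet> partial c m f p" for m
  proof -
    have "(christoffel c f 1 i j p *\<^sub>R partial c 1 f p + christoffel c f 2 i j p *\<^sub>R partial c 2 f p) \<bullet> partial c m f p
      = (?G $ m $ 1 * matrix_inv ?G $ 1 $ 1 + ?G $ m $ 2 * matrix_inv ?G $ 2 $ 1) * (?x \<bullet> partial c 1 f p)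
       + (?G $ m $ 1 * matrix_inv ?G $ 1 $ 2 + ?G $ m $ 2 * matrix_inv ?G $ 2 $ 2) * (?x \<bullet> partial c 2 f p)"
      unfolding chr Gent inner_add_left by (simp add: inner_commute[of "partial c m f p"] algebra_simps)
    also have "\<dots> = ?x \<bullet> partial c m f p"
      unfolding matrix_inv_2[OF dG] using exhaust_2[of m] by auto
    finally show ?thesis .
  qed
  show ?thesis
  proof (rule eq_by_inner2[OF reg])
    show "(christoffel c f 1 i j p *\<^sub>R partial c 1 f p + christoffel c f 2 i j p *\<^sub>R partial c 2 f p) \<bullet> \<nu> p = (?x - (?x \<bullet> \<nu> p) *\<^sub>R \<nu> p) \<bullet> \<nu> p"
      using f1n f2n nn by (simp add: inner_add_left inner_diff_left)
    show "(christoffel c f 1 i j p *\<^sub>R partial c 1 f p + christoffel c f 2 i j p *\<^sub>R partial c 2 f p) \<bullet> partial c 1 f p = (?x - (?x \<bullet> \<nu> p) *\<^sub>R \<nu> p) \<bullet> partial c 1 f p"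
      unfolding fm inner_diff_left using f1n by (simp add: inner_commute)
    show "(christoffel c f 1 i j p *\<^sub>R partial c 1 f p + christoffel c f 2 i j p *\<^sub>R partial c 2 f p) \<bullet> partial c 2 f p = (?x - (?x \<bullet> \<nu> p) *\<^sub>R \<nu> p) \<bullet> partial c 2 f p"
      unfolding fm inner_diff_left using f2n by (simp add: inner_commute)
  qed
qed

text \<open>Cramer's rule in the tangential formula writes the symbols as quotients of smooth
  functions by \<open>delta\<close>, which bypasses the entries of
  \<open>matrix_inv\<close>.\<close>

lemma csmooth_christoffel:
  assumes c: "c \<in> \<A>"
  shows "csmooth c (christoffel c f k i j)"
proof -
  interpret chart M c using c by (simp add: chart_axioms_A)
  define x where "x q = partial c i (partial c j f) q - (partial c i (partial c j f) q \<bullet> \<nu> q) *\<^sub>R \<nu> q" for q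
  have sx: "csmooth c x"
    unfolding x_def[abs_def] by (intro csmooth_intros csmooth_partial csmooth_f[OF c] csmooth_nu[OF c])
  have 1: "christoffel c f 1 i j q = ((x q \<times> partial c 2 f q) \<bullet> \<nu> q) / delta c q" and 2: "christoffel c f 2 i j q = ((partial c 1 f q \<times> x q) \<bullet> \<nu> q) / delta c q"
    if q: "q \<in> fst c" for q
    using christoffel_tangential[OF c q, of i j, folded x_def, symmetric] delta_nz[OF c q]
    by (simp_all add: cross_add_left cross_add_right cross_mult_left cross_mult_right inner_add_left delta_def)
  have "csmooth c (\<lambda>q. ((x q \<times> partial c 2 f q) \<bullet> \<nu> q) / delta c q)" "csmooth c (\<lambda>q. ((partial c 1 f q \<times> x q) \<bullet> \<nu> q) / delta c q)"
    by (intro csmooth_intros csmooth_partial csmooth_f[OF c] csmooth_nu[OF c] sx csmooth_surface[OF c] delta_nz[OF c]; assumption?)+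
  from csmooth_cong[OF this(1) 1[symmetric]] csmooth_cong[OF this(2) 2[symmetric]]
  have "csmooth c (christoffel c f 1 i j)" "csmooth c (christoffel c f 2 i j)" by blast+
  then show ?thesis using exhaust_2[of k] by auto
qed

text \<open>The Gauss equation. The tangential formula is differentiated once more and paired with
  \<open>partial c 1 f\<close>; in the difference of the two orders the third derivatives cancel,
  and the normal part contributes the determinant of the second fundamental form.\<close>

lemma egregium_chart:
  assumes c: "c \<in> \<A>" "p \<in> fst c"
  shows "(\<Sum>l\<in>UNIV. metric c f l 1 p * riemann c f l 2 1 2 p) / det (metric_matrix c f p) = delta_sharp c p / delta c p"
proof -
  interpret chart M c using c by (simp add: chart_axioms_A)
  interpret surface_point "partial c 1 f p" "partial c 2 f p" "\<nu> p" "partial c 1 \<nu> p" "partial c 2 \<nu> p"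
    by (rule surface_point_partial[OF c])
  note sm = csmooth_intros csmooth_partial csmooth_f[OF c(1)] csmooth_nu[OF c(1)] csmooth_christoffel[OF c(1)]
  have d: "cdiff c (partial c j f) p" for j by (rule csmooth_cdiff[OF _ c(2)]) (intro sm)
  have d2: "cdiff c (partial c i (partial c j f)) p" for i j by (rule csmooth_cdiff[OF _ c(2)]) (intro sm)
  have dn: "cdiff c \<nu> p" by (rule csmooth_cdiff[OF _ c(2)]) (intro sm)
  have dG: "cdiff c (christoffel c f k i j) p" for k i j by (rule csmooth_cdiff[OF _ c(2)]) (intro sm)
  let ?\<Gamma> = "\<lambda>k i j. christoffel c f k i j p"
  let ?g = "\<lambda>i j. partial c i f p \<bullet> partial c j f p"
  have PG: "partial c a (\<lambda>q. christoffel c f 1 i j q *\<^sub>R partial c 1 f q + christoffel c f 2 i j q *\<^sub>R partial c 2 f q) p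
     = ?\<Gamma> 1 i j *\<^sub>R partial c a (partial c 1 f) p + partial c a (christoffel c f 1 i j) p *\<^sub>R partial c 1 f p
     + (?\<Gamma> 2 i j *\<^sub>R partial c a (partial c 2 f) p + partial c a (christoffel c f 2 i j) p *\<^sub>R partial c 2 f p)" for a i j
    unfolding partial_def[of c a]
    by (simp add: differential_add(1)[OF differential_scaleR(2)[OF dG d c(2) inj] differential_scaleR(2)[OF dG d c(2) inj]]
        differential_scaleR(1)[OF dG d c(2) inj])
  have PF: "partial c a (\<lambda>q. partial c i (partial c j f) q - (partial c i (partial c j f) q \<bullet> \<nu> q) *\<^sub>R \<nu> q) p
     = partial c a (partial c i (partial c j f)) p - ((partial c i (partial c j f) p \<bullet> \<nu> p) *\<^sub>R partial c a \<nu> p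
       + partial c a (\<lambda>q. partial c i (partial c j f) q \<bullet> \<nu> q) p *\<^sub>R \<nu> p)" for a i j
    unfolding partial_def[of c a]
    by (simp add: differential_diff(1)[OF d2 differential_scaleR(2)[OF differential_inner(2)[OF d2 dn c(2) inj] dn c(2) inj]]
        differential_scaleR(1)[OF differential_inner(2)[OF d2 dn c(2) inj] dn c(2) inj])
  have eq: "partial c a (\<lambda>q. christoffel c f 1 i j q *\<^sub>R partial c 1 f q + christoffel c f 2 i j q *\<^sub>R partial c 2 f q) p
    = partial c a (\<lambda>q. partial c i (partial c j f) q - (partial c i (partial c j f) q \<bullet> \<nu> q) *\<^sub>R \<nu> q) p" for a i j
    unfolding partial_def[of c a]
    by (subst differential_cong(1)[OF openin_dom order_refl c(2) christoffel_tangential[OF c(1)]])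
      (auto intro!: differential_add(2) differential_scaleR(2) dG d c(2) inj)
  have f1f1: "partial c a (partial c k f) p \<bullet> partial c 1 f p = ?\<Gamma> 1 a k * ?g 1 1 + ?\<Gamma> 2 a k * ?g 2 1" for a k
    using arg_cong[OF christoffel_tangential[OF c, of a k], of "\<lambda>x. x \<bullet> partial c 1 f p"] f1n
    by (simp add: inner_add_left inner_diff_left inner_commute[of "\<nu> p"])
  have A: "(?\<Gamma> 1 i j *\<^sub>R partial c a (partial c 1 f) p + partial c a (christoffel c f 1 i j) p *\<^sub>R partial c 1 f p
     + (?\<Gamma> 2 i j *\<^sub>R partial c a (partial c 2 f) p + partial c a (christoffel c f 2 i j) p *\<^sub>R partial c 2 f p)) \<bullet> partial c 1 f p
     = partial c a (partial c i (partial c j f)) p \<bullet> partial c 1 f p - (partial c i (partial c j f) p \<bullet> \<nu> p) * (partial c a \<nu> p \<bullet> partial c 1 f p)" for a i j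
    using arg_cong[OF eq[of a i j, unfolded PG PF], of "\<lambda>x. x \<bullet> partial c 1 f p"] f1n
    by (simp add: inner_add_left inner_diff_left inner_commute[of "\<nu> p"])
  have third: "partial c 1 (partial c 2 (partial c 2 f)) p = partial c 2 (partial c 1 (partial c 2 f)) p"
    by (rule partial_commute[OF csmooth_partial[OF csmooth_f[OF c(1)]] c(2)])
  have "(\<Sum>l\<in>UNIV. metric c f l 1 p * riemann c f l 2 1 2 p)
     = (partial c 1 \<nu> p \<bullet> partial c 1 f p) * (partial c 2 \<nu> p \<bullet> partial c 2 f p) - (partial c 1 \<nu> p \<bullet> partial c 2 f p) * (partial c 2 \<nu> p \<bullet> partial c 1 f p)"
    using A[where a = 1 and i = 2 and j = 2] A[where a = 2 and i = 1 and j = 2] third shape_symmetric(1)[OF c, of 2 2] shape_symmetric(1)[OF c, of 1 2]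
    by (simp add: sum_2 riemann_def metric_def inner_add_left f1f1 inner_commute[of _ "\<nu> p"] algebra_simps)
  also have "\<dots> = (partial c 1 \<nu> p \<bullet> partial c 1 f p) * (partial c 2 \<nu> p \<bullet> partial c 2 f p) - (partial c 1 \<nu> p \<bullet> partial c 2 f p) * (partial c 1 \<nu> p \<bullet> partial c 2 f p)"
    using sym by simp
  moreover have "det (metric_matrix c f p) = del * del" unfolding del_sq by (simp add: det_2 metric_matrix_def metric_def inner_commute)
  ultimately show ?thesis using gauss_ratio by (simp add: delta_sharp_def delta_def del_def)
qed

text \<open>The definition selects a chart by Hilbert choice; \<open>delta_sharp\<close> and
  \<open>delta\<close> change by the same Jacobian determinant, so every chart gives the same
  quotient.\<close>

lemma gaussian_curvature_eq:
  assumes c: "c \<in> \<A>" "p \<in> fst c"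
  shows "gaussian_curvature \<A> f p = delta_sharp c p / delta c p"
proof -
  define d where "d = (SOME c. c \<in> \<A> \<and> p \<in> fst c)"
  have d: "d \<in> \<A>" "p \<in> fst d" using someI[of "\<lambda>c. c \<in> \<A> \<and> p \<in> fst c" c] c by (auto simp: d_def)
  have "gaussian_curvature \<A> f p = delta_sharp d p / delta d p"
    unfolding gaussian_curvature_def Let_def d_def[symmetric] by (rule egregium_chart[OF d])
  then show ?thesis
    using delta_change[OF c(1) d(1) c(2) d(2)] transition(2)[OF c(1) d(1) c(2) d(2)] by simp
qed

lemma gaussian_curvature_lam:
  assumes c: "c \<in> \<A>" "p \<in> fst c"
  shows "lam_sharp c f \<nu> p = gaussian_curvature \<A> f p * lam c f \<nu> p"
  using delta_nz[OF c] by (simp add: gaussian_curvature_eq[OF c] lam_eq lam_sharp_eq abs_sgn mult.commute)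

end

section \<open>The connection form of the principal directions\<close>

lemma differential_divide:
  fixes a b :: "'a \<Rightarrow> real"
  assumes "cdiff c a p" "cdiff c b p" "p \<in> fst c" "inj_on (snd c) (fst c)" "b p \<noteq> 0"
  shows "differential c (\<lambda>q. a q / b q) p \<zeta> = (differential c a p \<zeta> * b p - a p * differential c b p \<zeta>) / (b p * b p)"
    and "cdiff c (\<lambda>q. a q / b q) p"
proof -
  have v: "in_chart c h (snd c p) = h p" for h :: "'a \<Rightarrow> real" using assms(3,4) by (simp add: in_chart_def)
  have "(in_chart c (\<lambda>q. a q / b q) has_derivative
     (\<lambda>\<zeta>. (differential c a p \<zeta> * b p - a p * differential c b p \<zeta>) / (b p * b p))) (at (snd c p))"
    unfolding in_chart_bilinear[of c "(/)"]
    using has_derivative_divide'[OF cdiff_has_derivative[OF assms(1)] cdiff_has_derivative[OF assms(2)]] assms(5)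
    by (simp add: v)
  from differential_eqI[OF this] cdiffI[OF this]
  show "differential c (\<lambda>q. a q / b q) p \<zeta> = (differential c a p \<zeta> * b p - a p * differential c b p \<zeta>) / (b p * b p)"
    "cdiff c (\<lambda>q. a q / b q) p" by simp_all
qed

lemma section_components:
  fixes n y e :: "real^3"
  assumes "n \<bullet> n = 1" "y \<bullet> n = 0" "e \<bullet> n = 0" "y \<noteq> 0"
  shows "e = (e \<bullet> y / (y \<bullet> y)) *\<^sub>R y + (e \<bullet> (n \<times> y) / (y \<bullet> y)) *\<^sub>R (n \<times> y)"
proof -
  note J = cross_normal_twice[OF assms(1,2)]
  have yy: "y \<bullet> y \<noteq> 0" using assms by simp
  have "(y \<times> (n \<times> y)) \<bullet> n = y \<bullet> y" using assms by (simp add: Lagrange inner_diff_left)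
  then have r: "(y \<times> (n \<times> y)) \<bullet> n \<noteq> 0" using yy by simp
  show ?thesis
    by (rule eq_by_inner2[OF r])
      (use yy J assms in \<open>simp_all add: inner_add_left inner_commute[of y "n \<times> y"]\<close>)
qed

context surface
begin

lemma f1_nonzero: "c \<in> \<A> \<Longrightarrow> p \<in> fst c \<Longrightarrow> partial c 1 f p \<noteq> 0"
  using surface_point.f1_nz[OF surface_point_partial] .

lemma f_orth: "c \<in> \<A> \<Longrightarrow> p \<in> fst c \<Longrightarrow> partial c i f p \<bullet> \<nu> p = 0"
  using nu_f by (simp add: partial_def inner_commute)

lemma nu_orth: "c \<in> \<A> \<Longrightarrow> p \<in> fst c \<Longrightarrow> differential c \<nu> p \<zeta> \<bullet> \<nu> p = 0"
  using nu_diff_nu by (simp add: inner_commute)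

lemma mfield_orth: "c \<in> \<A> \<Longrightarrow> p \<in> fst c \<Longrightarrow> mfield c p \<bullet> \<nu> p = 0"
  using f_orth nu_orth by (simp add: mfield_def inner_diff_left partial_def)

text \<open>A symmetric trace-free map with principal direction at angle \<theta> is a multiple of a
  reflection and sends the angle \<phi> to 2\<theta> - \<phi>, up to a half turn. The mean of the
  two angles is \<theta>. Averaging connection forms instead of angles needs no branch of \<theta>,
  which is determined only up to quarter turns.\<close>

definition omega :: "'a chart \<Rightarrow> 'a \<Rightarrow> real^2 \<Rightarrow> real" where
  "omega c p \<zeta> = (conn (\<nu> p) (partial c 1 f p) (differential c (partial c 1 f) p \<zeta>)
     + conn (\<nu> p) (mfield c p) (differential c (mfield c) p \<zeta>)) / 2"

lemma cdiff_surface: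
  assumes "c \<in> \<A>" "p \<in> fst c"
  shows "cdiff c f p" "cdiff c \<nu> p" "cdiff c (partial c i f) p" "cdiff c (partial c i \<nu>) p" "cdiff c (mfield c) p"
    "cdiff c (delta c) p" "cdiff c (delta_sharp c) p"
proof -
  interpret chart M c using assms by (simp add: chart_axioms_A)
  show "cdiff c f p" "cdiff c \<nu> p" "cdiff c (partial c i f) p" "cdiff c (partial c i \<nu>) p" "cdiff c (mfield c) p"
    "cdiff c (delta c) p" "cdiff c (delta_sharp c) p"
    by (rule csmooth_cdiff[OF _ assms(2)], rule csmooth_f csmooth_nu csmooth_partial csmooth_surface assms,
        (rule csmooth_f csmooth_nu assms)?; (rule assms)?)+
qed

lemma omega_expand:
  assumes "c \<in> \<A>" "p \<in> fst c"
  shows "omega c p \<zeta> = \<zeta>$1 * omega c p (axis 1 1) + \<zeta>$2 * omega c p (axis 2 1)"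
  unfolding omega_def differential_expand[OF cdiff_surface(3)[OF assms], of 1 \<zeta>] differential_expand[OF cdiff_surface(5)[OF assms], of \<zeta>]
    conn_add_right conn_scaleR_right partial_def
  by (simp add: algebra_simps add_divide_distrib)

lemma linear_omega:
  assumes "c \<in> \<A>" "p \<in> fst c"
  shows "linear (omega c p)"
  by (rule linearI) (simp_all add: omega_def linear_add[OF linear_differential[OF cdiff_surface(3)[OF assms]]]
    linear_add[OF linear_differential[OF cdiff_surface(5)[OF assms]]] linear_cmul[OF linear_differential[OF cdiff_surface(3)[OF assms]]]
    linear_cmul[OF linear_differential[OF cdiff_surface(5)[OF assms]]] conn_add_right conn_scaleR_right add_divide_distrib algebra_simps)

lemma conn_rotated_field:
  fixes a b :: "'a \<Rightarrow> real" and w :: "'a \<Rightarrow> real^3"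
  assumes c: "c \<in> \<A>" "p \<in> fst c" and d: "cdiff c a p" "cdiff c b p" "cdiff c w p"
    and w: "w p \<bullet> \<nu> p = 0" "w p \<noteq> 0" and nz: "a p * a p + b p * b p \<noteq> 0"
  shows "conn (\<nu> p) (a p *\<^sub>R w p + b p *\<^sub>R (\<nu> p \<times> w p)) (differential c (\<lambda>q. a q *\<^sub>R w q + b q *\<^sub>R (\<nu> q \<times> w q)) p \<zeta>)
    = conn (\<nu> p) (w p) (differential c w p \<zeta>) + (a p * differential c b p \<zeta> - b p * differential c a p \<zeta>) / (a p * a p + b p * b p)"
    and "cdiff c (\<lambda>q. a q *\<^sub>R w q + b q *\<^sub>R (\<nu> q \<times> w q)) p"
proof -
  interpret chart M c using c by (simp add: chart_axioms_A)
  note dn = cdiff_surface(2)[OF c]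
  note J = differential_cross3[OF dn d(3) c(2) inj]
  note 1 = differential_scaleR[OF d(1,3) c(2) inj]
  note 2 = differential_scaleR[OF d(2) J(2) c(2) inj]
  have D: "differential c (\<lambda>q. a q *\<^sub>R w q + b q *\<^sub>R (\<nu> q \<times> w q)) p \<zeta> =
    a p *\<^sub>R differential c w p \<zeta> + differential c a p \<zeta> *\<^sub>R w p +
      (b p *\<^sub>R (\<nu> p \<times> differential c w p \<zeta> + differential c \<nu> p \<zeta> \<times> w p) + differential c b p \<zeta> *\<^sub>R (\<nu> p \<times> w p))"
    unfolding differential_add(1)[OF 1(2) 2(2)] 1(1) 2(1) J(1) ..
  show "cdiff c (\<lambda>q. a q *\<^sub>R w q + b q *\<^sub>R (\<nu> q \<times> w q)) p" by (rule differential_add(2)[OF 1(2) 2(2)])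
  show "conn (\<nu> p) (a p *\<^sub>R w p + b p *\<^sub>R (\<nu> p \<times> w p)) (differential c (\<lambda>q. a q *\<^sub>R w q + b q *\<^sub>R (\<nu> q \<times> w q)) p \<zeta>)
    = conn (\<nu> p) (w p) (differential c w p \<zeta>) + (a p * differential c b p \<zeta> - b p * differential c a p \<zeta>) / (a p * a p + b p * b p)"
    unfolding D by (rule conn_rotate_section[OF nu_unit[OF c] w nz nu_orth[OF c]])
qed

lemma trace_h_change:
  assumes cd: "c \<in> \<A>" "d \<in> \<A>" "p \<in> fst c" "p \<in> fst d"
  shows "trace_h c p = det (matrix (trans_map c d p)) * trace_h d p"
  unfolding trace_h_def partial_change[OF cd cdiff_surface(1)[OF cd(2,4)]] partial_change[OF cd cdiff_surface(2)[OF cd(2,4)]] det_trans_map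
  using cross_skew[of "partial d 2 f p" "partial d 1 \<nu> p"] cross_skew[of "partial d 1 f p" "partial d 1 \<nu> p"]
    cross_skew[of "partial d 2 f p" "partial d 2 \<nu> p"] cross_skew[of "partial d 1 f p" "partial d 2 \<nu> p"]
  by (simp add: cross_add_left cross_add_right cross_mult_left cross_mult_right inner_add_left algebra_simps)

lemma mfield_change:
  assumes cd: "c \<in> \<A>" "d \<in> \<A>" "p \<in> fst c" "p \<in> fst d"
    and ab: "partial d 1 f p = a *\<^sub>R partial c 1 f p + b *\<^sub>R (\<nu> p \<times> partial c 1 f p)"
  shows "mfield d p = (delta d p / delta c p) *\<^sub>R (a *\<^sub>R mfield c p + (- b) *\<^sub>R (\<nu> p \<times> mfield c p))"
proof -
  interpret surface_point "partial c 1 f p" "partial c 2 f p" "\<nu> p" "partial c 1 \<nu> p" "partial c 2 \<nu> p"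
    by (rule surface_point_partial[OF cd(1,3)])
  define D where "D = det (matrix (trans_map d c p))"
  define x y where "x = trans_map d c p (axis 1 1) $ 1" and "y = trans_map d c p (axis 1 1) $ 2"
  have D: "delta d p = D * delta c p" "trace_h d p = D * trace_h c p"
    using delta_change(1)[OF cd(2,1,4,3)] trace_h_change[OF cd(2,1,4,3)] by (simp_all add: D_def)
  have Df: "delta d p / delta c p = D" using D(1) delta_nz[OF cd(1,3)] by simp
  have f: "partial d 1 f p = x *\<^sub>R partial c 1 f p + y *\<^sub>R partial c 2 f p"
    and n: "partial d 1 \<nu> p = x *\<^sub>R partial c 1 \<nu> p + y *\<^sub>R partial c 2 \<nu> p"
    using partial_change[OF cd(2,1,4,3) cdiff_surface(1)[OF cd(1,3)], of 1] partial_change[OF cd(2,1,4,3) cdiff_surface(2)[OF cd(1,3)], of 1]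
    by (simp_all add: x_def y_def)
  have m: "m1 = mfield c p" by (simp add: m1_def mfield_def del_def h_def delta_def trace_h_def)
  have dh: "del = delta c p" "h = trace_h c p" by (simp_all add: del_def h_def delta_def trace_h_def)
  have "mfield d p = D *\<^sub>R (x *\<^sub>R m1 + y *\<^sub>R m2)"
    unfolding mfield_def D f n m1_def m2_def dh by (simp add: algebra_simps)
  also have "x *\<^sub>R m1 + y *\<^sub>R m2 = a *\<^sub>R m1 - b *\<^sub>R (\<nu> p \<times> m1)"
    by (rule tracefree_anticommute) (use f ab in simp)
  finally show ?thesis unfolding Df m by simp
qed

lemma omega_change:
  assumes cd: "c \<in> \<A>" "d \<in> \<A>" "p \<in> fst c" "p \<in> fst d" and nz: "mfield c p \<noteq> 0"
  shows "omega c p \<zeta> = omega d p (trans_map c d p \<zeta>)"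
proof -
  interpret chart M c using cd by (simp add: chart_axioms_A)
  let ?Y = "partial c 1 f" and ?Z = "partial d 1 f"
  \<comment> \<open>\<open>a\<close> and \<open>b\<close> are the components of the section of
    \<open>d\<close> with respect to the section of \<open>c\<close> and its quarter turn. The sign
    in \<open>b'\<close> is the anticommutation of the trace-free part with that turn, and
    \<open>s\<close> compares the factors \<open>delta\<close> contained in the two fields
    \<open>mfield\<close>.\<close>
  define a where "a q = (?Z q \<bullet> ?Y q) / (?Y q \<bullet> ?Y q)" for q
  define b where "b q = (?Z q \<bullet> (\<nu> q \<times> ?Y q)) / (?Y q \<bullet> ?Y q)" for q
  define b' where "b' q = - b q" for q
  define s where "s q = delta d q / delta c q" for q
  define w where "w q = a q *\<^sub>R mfield c q + b' q *\<^sub>R (\<nu> q \<times> mfield c q)" for q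
  let ?V = "fst c \<inter> fst d"
  have V: "openin M ?V" "?V \<subseteq> fst c" "p \<in> ?V"
    using openin_dom chart.openin_dom[OF chart_axioms_A[OF cd(2)]] cd by auto
  note cdc = cdiff_surface[OF cd(1,3)] and cdd = cdiff_surface[OF cd(2,4)]
  have Zc: "cdiff c ?Z p" "cdiff c (mfield d) p" "cdiff c (delta d) p"
    using chart_change(2)[OF cd cdd(3)] chart_change(2)[OF cd cdd(5)] chart_change(2)[OF cd cdd(6)] by auto
  have YY: "?Y q \<bullet> ?Y q \<noteq> 0" if "q \<in> fst c" for q using f1_nonzero[OF cd(1) that] by simp
  have da: "cdiff c a p" unfolding a_def[abs_def]
    by (intro differential_divide(2) differential_inner(2) Zc cdc cd inj YY)
  have db: "cdiff c b p" unfolding b_def[abs_def]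
    by (intro differential_divide(2) differential_inner(2) differential_cross3(2) Zc cdc cd inj YY)
  have db': "cdiff c b' p" "differential c b' p \<zeta> = - differential c b p \<zeta>"
    using differential_diff[OF csmooth_cdiff[OF csmooth_intros(1)[of 0] cd(3)] db] by (simp_all add: b'_def[abs_def] differential_const)
  have ds: "cdiff c s p" unfolding s_def[abs_def]
    by (intro differential_divide(2) Zc cdc cd inj delta_nz)
  have Z: "?Z q = a q *\<^sub>R ?Y q + b q *\<^sub>R (\<nu> q \<times> ?Y q)" if "q \<in> ?V" for q
    unfolding a_def b_def using that cd
    by (intro section_components nu_unit[of c] f_orth[of c] f_orth[of d] f1_nonzero) auto
  have W: "mfield d q = s q *\<^sub>R w q" if "q \<in> ?V" for q
    unfolding w_def s_def b'_def using that cd by (intro mfield_change Z) auto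
  have ab: "a p * a p + b p * b p \<noteq> 0"
  proof
    assume "a p * a p + b p * b p = 0"
    then have "a p = 0" "b p = 0" by (auto simp: sum_squares_eq_zero_iff)
    then have "?Z p = 0" using Z[OF V(3)] by simp
    then show False using f1_nonzero[OF cd(2,4)] by simp
  qed
  have ab': "a p * a p + b' p * b' p \<noteq> 0" using ab by (simp add: b'_def)
  have 1: "conn (\<nu> p) (?Z p) (differential c ?Z p \<zeta>) = conn (\<nu> p) (?Y p) (differential c ?Y p \<zeta>)
      + (a p * differential c b p \<zeta> - b p * differential c a p \<zeta>) / (a p * a p + b p * b p)"
  proof -
    have "differential c ?Z p = differential c (\<lambda>q. a q *\<^sub>R ?Y q + b q *\<^sub>R (\<nu> q \<times> ?Y q)) p"
      using V Zc(1) by (intro differential_cong(1)[of ?V]) (auto simp: Z)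
    then show ?thesis
      using conn_rotated_field(1)[OF cd(1,3) da db cdc(3) f_orth[OF cd(1,3)] f1_nonzero[OF cd(1,3)] ab]
      by (simp add: Z[OF V(3)])
  qed
  have 2: "conn (\<nu> p) (mfield d p) (differential c (mfield d) p \<zeta>) = conn (\<nu> p) (mfield c p) (differential c (mfield c) p \<zeta>)
      + (a p * differential c b' p \<zeta> - b' p * differential c a p \<zeta>) / (a p * a p + b' p * b' p)"
  proof -
    have dw: "cdiff c w p" unfolding w_def[abs_def]
      by (rule conn_rotated_field(2)[OF cd(1,3) da db'(1) cdc(5) mfield_orth[OF cd(1,3)] nz ab'])
    have "differential c (mfield d) p = differential c (\<lambda>q. s q *\<^sub>R w q) p"
      using V Zc(2) by (intro differential_cong(1)[of ?V]) (auto simp: W)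
    then have "conn (\<nu> p) (mfield d p) (differential c (mfield d) p \<zeta>)
       = conn (\<nu> p) (s p *\<^sub>R w p) (s p *\<^sub>R differential c w p \<zeta> + differential c s p \<zeta> *\<^sub>R w p)"
      using differential_scaleR(1)[OF ds dw cd(3) inj] by (simp add: W[OF V(3)])
    also have "\<dots> = conn (\<nu> p) (w p) (differential c w p \<zeta>)"
      using delta_nz[OF cd(1,3)] delta_nz[OF cd(2,4)] by (intro conn_scale) (simp add: s_def)
    also have "\<dots> = conn (\<nu> p) (mfield c p) (differential c (mfield c) p \<zeta>)
      + (a p * differential c b' p \<zeta> - b' p * differential c a p \<zeta>) / (a p * a p + b' p * b' p)"
      unfolding w_def by (rule conn_rotated_field(1)[OF cd(1,3) da db'(1) cdc(5) mfield_orth[OF cd(1,3)] nz ab'])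
    finally show ?thesis .
  qed
  have "omega d p (trans_map c d p \<zeta>) = (conn (\<nu> p) (?Z p) (differential c ?Z p \<zeta>) + conn (\<nu> p) (mfield d p) (differential c (mfield d) p \<zeta>)) / 2"
    unfolding omega_def chart_change(1)[OF cd cdd(3)] chart_change(1)[OF cd cdd(5)] ..
  also have "\<dots> = omega c p \<zeta>"
    unfolding 1 2 omega_def db'(2) b'_def by (simp add: minus_divide_left[symmetric] algebra_simps diff_divide_distrib)
  finally show ?thesis by simp
qed

text \<open>The quotient rule leaves an antisymmetric expression in which the second derivatives of
  \<open>w\<close> cancel; \<open>connection_curvature_algebra\<close> evaluates the rest. The value
  does not involve \<open>w\<close>, so the mean of two such forms in \<open>omega\<close> has the
  same curl.\<close>

lemma conn_field_curl:
  fixes w :: "'a \<Rightarrow> real^3"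
  assumes c: "c \<in> \<A>" "p \<in> fst c" and w: "csmooth c w" "\<And>q. q \<in> fst c \<Longrightarrow> w q \<bullet> \<nu> q = 0" "w p \<noteq> 0"
  shows "partial c 1 (\<lambda>q. conn (\<nu> q) (w q) (partial c 2 w q)) p - partial c 2 (\<lambda>q. conn (\<nu> q) (w q) (partial c 1 w q)) p
      = - delta_sharp c p" (is "?L = _")
    and "cdiff c (\<lambda>q. conn (\<nu> q) (w q) (partial c i w q)) p"
proof -
  interpret chart M c using c by (simp add: chart_axioms_A)
  note dn = cdiff_surface(2)[OF c]
  have dw: "cdiff c w p" "cdiff c (partial c i w) p" for i
    by (rule csmooth_cdiff[OF _ c(2)], intro w csmooth_partial)+
  note X = differential_cross3[OF dn dw(1) c(2) inj]
  have ww: "w p \<bullet> w p \<noteq> 0" using w(3) by simp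
  note N = differential_inner[OF X(2) dw(2) c(2) inj]
  note Q = differential_inner[OF dw(1) dw(1) c(2) inj]
  note A = differential_divide[OF N(2) Q(2) c(2) inj ww]
  show "cdiff c (\<lambda>q. conn (\<nu> q) (w q) (partial c i w q)) p"
    unfolding conn_def by (rule A(2))
  have wn: "differential c w p \<zeta> \<bullet> \<nu> p = - (w p \<bullet> differential c \<nu> p \<zeta>)" for \<zeta>
  proof -
    have "differential c (\<lambda>q. w q \<bullet> \<nu> q) p = differential c (\<lambda>q. 0) p"
      by (rule differential_cong(1)[OF openin_dom order_refl c(2)]) (use w(2) differential_inner(2)[OF dw(1) dn c(2) inj] in auto)
    then show ?thesis using differential_inner(1)[OF dw(1) dn c(2) inj, of \<zeta>] by (simp add: differential_const)
  qed
  have comm: "partial c 1 (partial c 2 w) p = partial c 2 (partial c 1 w) p" by (rule partial_commute[OF w(1) c(2)])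
  let ?w1 = "partial c 1 w p" and ?w2 = "partial c 2 w p" and ?n1 = "partial c 1 \<nu> p" and ?n2 = "partial c 2 \<nu> p" and ?n = "\<nu> p" and ?w = "w p"
  have P: "partial c i (\<lambda>q. conn (\<nu> q) (w q) (partial c j w q)) p =
    (((?n \<times> ?w) \<bullet> partial c i (partial c j w) p + (?n \<times> partial c i w p + partial c i \<nu> p \<times> ?w) \<bullet> partial c j w p) * (?w \<bullet> ?w)
      - (?n \<times> ?w) \<bullet> partial c j w p * (2 * (?w \<bullet> partial c i w p))) / ((?w \<bullet> ?w) * (?w \<bullet> ?w))" for i j
    unfolding conn_def partial_def[of c i] A(1) N(1) X(1) Q(1) by (simp add: inner_commute)
  have "?L = ((?w \<bullet> ?w) * ((?n1 \<times> ?w) \<bullet> ?w2 + (?n \<times> ?w1) \<bullet> ?w2 - (?n2 \<times> ?w) \<bullet> ?w1 - (?n \<times> ?w2) \<bullet> ?w1)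
     - 2 * ((?w \<bullet> ?w1) * ((?n \<times> ?w) \<bullet> ?w2) - (?w \<bullet> ?w2) * ((?n \<times> ?w) \<bullet> ?w1))) / ((?w \<bullet> ?w) * (?w \<bullet> ?w))"
    unfolding P comm diff_divide_distrib[symmetric] by (rule arg_cong2[where f="(/)"]) (simp_all add: inner_add_left algebra_simps)
  also have "\<dots> = - delta_sharp c p"
    unfolding delta_sharp_def
    by (subst connection_curvature_algebra[OF nu_unit[OF c] w(2)[OF c(2)]])
      (use ww wn nu_orth[OF c] in \<open>simp_all add: partial_def\<close>)
  finally show "?L = - delta_sharp c p" .
qed

lemma omega_curl:
  assumes c: "c \<in> \<A>" "p \<in> fst c" and nz: "mfield c p \<noteq> 0"
  shows "partial c 1 (\<lambda>q. omega c q (axis 2 1)) p - partial c 2 (\<lambda>q. omega c q (axis 1 1)) p = - delta_sharp c p"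
    and "cdiff c (\<lambda>q. omega c q (axis i 1)) p"
proof -
  interpret chart M c using c by (simp add: chart_axioms_A)
  have sY: "csmooth c (partial c 1 f)" by (intro csmooth_partial csmooth_f c)
  have Y: "partial c 1 (\<lambda>q. conn (\<nu> q) (partial c 1 f q) (partial c 2 (partial c 1 f) q)) p
      - partial c 2 (\<lambda>q. conn (\<nu> q) (partial c 1 f q) (partial c 1 (partial c 1 f) q)) p = - delta_sharp c p"
    "cdiff c (\<lambda>q. conn (\<nu> q) (partial c 1 f q) (partial c i (partial c 1 f) q)) p" for i
    by (rule conn_field_curl[OF c sY _ f1_nonzero[OF c]], rule f_orth[OF c(1)], assumption)+
  have W: "partial c 1 (\<lambda>q. conn (\<nu> q) (mfield c q) (partial c 2 (mfield c) q)) p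
      - partial c 2 (\<lambda>q. conn (\<nu> q) (mfield c q) (partial c 1 (mfield c) q)) p = - delta_sharp c p"
    "cdiff c (\<lambda>q. conn (\<nu> q) (mfield c q) (partial c i (mfield c) q)) p" for i
    by (rule conn_field_curl[OF c csmooth_surface(4)[OF c(1)] _ nz], rule mfield_orth[OF c(1)], assumption)+
  have om: "(\<lambda>q. omega c q (axis i 1)) = (\<lambda>q. (1/2) * (conn (\<nu> q) (partial c 1 f q) (partial c i (partial c 1 f) q) + conn (\<nu> q) (mfield c q) (partial c i (mfield c) q)))" for i
    by (rule ext) (simp add: omega_def partial_def)
  have k: "cdiff c (\<lambda>q. 1/2 :: real) p" by (rule csmooth_cdiff[OF csmooth_intros(1) c(2)])
  note S = differential_add[OF Y(2) W(2)]
  note H = differential_mult[OF k S(2) c(2) inj]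
  show "cdiff c (\<lambda>q. omega c q (axis i 1)) p" unfolding om by (rule H(2))
  have "partial c i (\<lambda>q. omega c q (axis j 1)) p = (1/2) * (partial c i (\<lambda>q. conn (\<nu> q) (partial c 1 f q) (partial c j (partial c 1 f) q)) p
     + partial c i (\<lambda>q. conn (\<nu> q) (mfield c q) (partial c j (mfield c) q)) p)" for i j
    unfolding partial_def[of c i] om H(1) S(1) differential_const by simp
  note E = this[of 1 2] this[of 2 1]
  have "x - y = - d" if "x = 1/2 * (a + b)" "y = 1/2 * (a' + b')" "a - a' = - d" "b - b' = - d" for x y a b a' b' d :: real
    using that by (simp add: field_simps)
  from this[OF E Y(1) W(1)]
  show "partial c 1 (\<lambda>q. omega c q (axis 2 1)) p - partial c 2 (\<lambda>q. omega c q (axis 1 1)) p = - delta_sharp c p" .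
qed

lemma smooth_on_omega:
  assumes c: "c \<in> \<A>" and U: "open U" "U \<subseteq> snd c ` fst c" "\<And>p. p \<in> fst c \<Longrightarrow> snd c p \<in> U \<Longrightarrow> mfield c p \<noteq> 0"
  shows "smooth_on U (in_chart c (\<lambda>q. omega c q (axis i 1)))"
proof -
  interpret chart M c using c by (simp add: chart_axioms_A)
  have sm: "smooth_on U (\<lambda>z. g (inv_c z))" if "csmooth c g" for g :: "'a \<Rightarrow> 'b::real_normed_vector"
    using smooth_on_subset[OF that[unfolded csmooth_def] U(2)] by (simp add: in_chart_def o_def)
  have nz: "mfield c (inv_c z) \<noteq> 0" "partial c 1 f (inv_c z) \<noteq> 0" if "z \<in> U" for z
    using that U(2,3) f1_nonzero[OF c] inv_in snd_inv by auto
  show ?thesis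
    unfolding in_chart_def o_def omega_def conn_def partial_def[symmetric]
    by (intro smooth_on_intros[OF U(1)] sm csmooth_partial csmooth_f csmooth_nu csmooth_surface c) (use nz in auto)
qed

section \<open>The singular curvature\<close>

lemma Sigma_iff: "c \<in> \<A> \<Longrightarrow> p \<in> fst c \<Longrightarrow> p \<in> Sigma_sharp \<A> f \<nu> \<longleftrightarrow> delta_sharp c p = 0"
proof -
  assume c: "c \<in> \<A>" "p \<in> fst c"
  have "lam_sharp d f \<nu> p = 0 \<longleftrightarrow> delta_sharp c p = 0" if "d \<in> \<A>" "p \<in> fst d" for d
    using delta_change(2)[OF that(1) c(1) that(2) c(2)] transition(2)[OF that(1) c(1) that(2) c(2)] delta_nz[OF that]
    by (simp add: lam_sharp_eq sgn_zero_iff)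
  then show ?thesis using c unfolding Sigma_sharp_def by blast
qed

lemma delta_sgn_const:
  assumes c: "c \<in> \<A>" "p \<in> fst c"
  obtains V where "openin M V" "V \<subseteq> fst c" "p \<in> V" "\<And>q. q \<in> V \<Longrightarrow> sgn (delta c q) = sgn (delta c p)"
proof -
  interpret chart M c using c by (simp add: chart_axioms_A)
  let ?g = "\<lambda>z. sgn (delta c p) * in_chart c (delta c) z"
  have cg: "continuous_on S ?g"
    using csmooth_surface(1)[OF c(1)] unfolding csmooth_def
    by (intro continuous_intros smooth_on_imp_continuous_on) auto
  have o: "open (S \<inter> ?g -` {0<..})" by (rule continuous_open_preimage[OF cg open_S]) simp
  show thesis
  proof (rule that[OF openin_inv_image[OF o]])
    show "inv_c ` (S \<inter> ?g -` {0<..}) \<subseteq> fst c" using inv_in by auto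
    have "p = inv_c (snd c p)" "snd c p \<in> S \<inter> ?g -` {0<..}"
      using c delta_nz[OF c] by (auto simp: inv_snd in_chart_snd sgn_mult_self_eq abs_sgn[symmetric] mult.commute)
    then show "p \<in> inv_c ` (S \<inter> ?g -` {0<..})" by (rule image_eqI)
    fix q assume "q \<in> inv_c ` (S \<inter> ?g -` {0<..})"
    then have "sgn (delta c p) * delta c q > 0" by (auto simp: in_chart_def)
    then show "sgn (delta c q) = sgn (delta c p)"
      by (auto simp: sgn_if zero_less_mult_iff split: if_splits)
  qed auto
qed

lemma differential_lam_sharp:
  assumes c: "c \<in> \<A>" "p \<in> fst c"
  shows "differential c (lam_sharp c f \<nu>) p \<zeta> = sgn (delta c p) * differential c (delta_sharp c) p \<zeta>"
proof -
  interpret chart M c using c by (simp add: chart_axioms_A)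
  obtain V where V: "openin M V" "V \<subseteq> fst c" "p \<in> V" "\<And>q. q \<in> V \<Longrightarrow> sgn (delta c q) = sgn (delta c p)"
    using delta_sgn_const[OF c] by blast
  have k: "cdiff c (\<lambda>q. sgn (delta c p)) p" by (rule csmooth_cdiff[OF csmooth_intros(1) c(2)])
  note H = differential_mult[OF k cdiff_surface(7)[OF c] c(2) inj]
  have "differential c (\<lambda>q. sgn (delta c p) * delta_sharp c q) p = differential c (lam_sharp c f \<nu>) p"
    by (rule differential_cong(1)[OF V(1-3) _ H(2)]) (simp add: lam_sharp_eq V(4))
  then show ?thesis using H(1)[of \<zeta>] by (simp add: differential_const)
qed

text \<open>Near \<open>p\<close> the Jacobian determinant is written as
  \<open>delta c / delta d\<close>. In the product rule its derivative is multiplied by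
  \<open>delta_sharp d p = 0\<close>, so on the singular set the differential transforms like a
  covector times a density.\<close>

lemma differential_delta_sharp_change:
  assumes cd: "c \<in> \<A>" "d \<in> \<A>" "p \<in> fst c" "p \<in> fst d" and z: "delta_sharp d p = 0"
  shows "differential c (delta_sharp c) p \<zeta> = det (matrix (trans_map c d p)) * differential d (delta_sharp d) p (trans_map c d p \<zeta>)"
proof -
  interpret chart M c using cd by (simp add: chart_axioms_A)
  let ?V = "fst c \<inter> fst d"
  have V: "openin M ?V" "?V \<subseteq> fst c" "p \<in> ?V"
    using openin_dom chart.openin_dom[OF chart_axioms_A[OF cd(2)]] cd by auto
  note 1 = chart_change[OF cd cdiff_surface(6)[OF cd(2,4)]] and 2 = chart_change[OF cd cdiff_surface(7)[OF cd(2,4)]]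
  note D = differential_divide[OF cdiff_surface(6)[OF cd(1,3)] 1(2) cd(3) inj delta_nz[OF cd(2,4)]]
  note H = differential_mult[OF D(2) 2(2) cd(3) inj]
  have "differential c (delta_sharp c) p = differential c (\<lambda>q. delta c q / delta d q * delta_sharp d q) p"
  proof (rule differential_cong(1)[OF V _ cdiff_surface(7)[OF cd(1,3)]])
    fix q assume "q \<in> ?V"
    then have q: "q \<in> fst c" "q \<in> fst d" by auto
    show "delta_sharp c q = delta c q / delta d q * delta_sharp d q"
      using delta_change[OF cd(1,2) q] delta_nz[OF cd(2) q(2)] by simp
  qed
  then have "differential c (delta_sharp c) p \<zeta> = delta c p / delta d p * differential c (delta_sharp d) p \<zeta>"
    using H(1)[of \<zeta>] z by simp
  also have "delta c p / delta d p = det (matrix (trans_map c d p))"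
    using delta_change(1)[OF cd] delta_nz[OF cd(2,4)] by simp
  finally show ?thesis by (simp add: 2(1))
qed

text \<open>In terms of the connection form; \<open>\<xi>\<close> is tangent to the singular set and \<open>\<eta>\<close> is a null vector.\<close>

definition curv :: "'a chart \<Rightarrow> 'a \<Rightarrow> real^2 \<Rightarrow> real^2 \<Rightarrow> real" where
  "curv c p \<xi> \<eta> = sgn (differential c (delta_sharp c) p \<eta>) * omega c p \<xi> / norm (differential c \<nu> p \<xi>)"

lemma nu_partial_nz:
  assumes c: "c \<in> \<A>" "p \<in> fst c" and e: "differential c \<nu> p \<xi> \<noteq> 0"
  shows "partial c 1 \<nu> p \<noteq> 0 \<or> partial c 2 \<nu> p \<noteq> 0"
  using e unfolding differential_expand[OF cdiff_surface(2)[OF c], of \<xi>] by auto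

lemma cross_nu_zero: "c \<in> \<A> \<Longrightarrow> p \<in> fst c \<Longrightarrow> delta_sharp c p = 0 \<Longrightarrow> partial c 1 \<nu> p \<times> partial c 2 \<nu> p = 0"
  using surface_point.cross_n[OF surface_point_partial, of c p] by (simp add: delta_sharp_def)

lemma mfield_nz:
  assumes c: "c \<in> \<A>" "p \<in> fst c" and "delta_sharp c p * delta c p \<le> 0" "partial c 1 \<nu> p \<noteq> 0 \<or> partial c 2 \<nu> p \<noteq> 0"
  shows "mfield c p \<noteq> 0"
proof -
  interpret surface_point "partial c 1 f p" "partial c 2 f p" "\<nu> p" "partial c 1 \<nu> p" "partial c 2 \<nu> p"
    by (rule surface_point_partial[OF c])
  have "m1 = mfield c p" by (simp add: m1_def mfield_def del_def h_def delta_def trace_h_def)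
  then show ?thesis using m1_nonzero assms by (simp add: delta_sharp_def delta_def del_def)
qed

lemma psi_velocity_eq:
  assumes c: "c \<in> \<A>" and \<gamma>: "regular_curve c \<gamma> a b" "t \<in> {a<..<b}"
  shows "((\<lambda>s. \<nu> (\<gamma> s)) has_vector_derivative psi_velocity c \<nu> \<gamma> t) (at t)"
proof -
  interpret chart M c using c by (simp add: chart_axioms_A)
  have "\<gamma> t \<in> fst c" using \<gamma> by (auto simp: regular_curve_def)
  then show ?thesis
    unfolding psi_velocity_def by (intro along_curve[OF \<gamma>] cdiff_surface(2)[OF c])
qed

lemma psi_velocity_differentiable:
  assumes c: "c \<in> \<A>" and \<gamma>: "regular_curve c \<gamma> a b" "t \<in> {a<..<b}"
  obtains e' where "(psi_velocity c \<nu> \<gamma> has_vector_derivative e') (at t)"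
proof -
  interpret chart M c using c by (simp add: chart_axioms_A)
  have img: "\<gamma> s \<in> fst c" if "s \<in> {a<..<b}" for s using \<gamma> that by (auto simp: regular_curve_def)
  have "smooth_on {a<..<b} (\<lambda>s. in_chart c \<nu> ((snd c \<circ> \<gamma>) s))"
    by (rule smooth_on_compose[OF open_greaterThanLessThan open_S])
      (use \<gamma>(1) csmooth_nu[OF c] img in \<open>auto simp: regular_curve_def csmooth_def o_def\<close>)
  moreover have "in_chart c \<nu> ((snd c \<circ> \<gamma>) s) = \<nu> (\<gamma> s)" if "s \<in> {a<..<b}" for s
    using img[OF that] by (simp add: in_chart_snd)
  ultimately have sm: "smooth_on {a<..<b} (\<lambda>s. \<nu> (\<gamma> s))"
    using smooth_on_cong[OF open_greaterThanLessThan, of a b "\<lambda>s. in_chart c \<nu> ((snd c \<circ> \<gamma>) s)" "\<lambda>s. \<nu> (\<gamma> s)"] by simp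
  define E where "E s = frechet_derivative (\<lambda>s. \<nu> (\<gamma> s)) (at s) 1" for s
  have "smooth_on {a<..<b} E" unfolding E_def[abs_def] by (rule smooth_on_frechet_derivative[OF sm])
  from smooth_on_has_derivative[OF this \<gamma>(2)] have "E differentiable (at t)" by (auto simp: differentiable_def)
  then have 1: "(E has_vector_derivative vector_derivative E (at t)) (at t)" by (simp add: vector_derivative_works)
  have 2: "E s = psi_velocity c \<nu> \<gamma> s" if s: "s \<in> {a<..<b}" for s
  proof -
    have "((\<lambda>s. \<nu> (\<gamma> s)) has_derivative (\<lambda>r. r *\<^sub>R psi_velocity c \<nu> \<gamma> s)) (at s)"
      using psi_velocity_eq[OF c \<gamma>(1) s] by (simp add: has_vector_derivative_def)
    from frechet_derivative_at[OF this] show ?thesis by (simp add: E_def fun_eq_iff) (metis scaleR_one)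
  qed
  show thesis
    by (rule that, rule has_vector_derivative_transform_within_open[OF 1 open_greaterThanLessThan \<gamma>(2)], rule 2)
qed

text \<open>On the singular set \<open>psi_velocity\<close> lies in the range of the shape map and
  is a principal direction, so the scaled trace-free part multiplies it by \<open>trace_h\<close>.
  If it arises from \<open>?Y\<close> with components \<open>(A, B)\<close>, then its multiple by
  \<open>trace_h\<close> arises from \<open>?W\<close> with components \<open>(A, -B)\<close>. Its
  connection is therefore that of \<open>?Y\<close> plus an angle derivative and also that of
  \<open>?W\<close> minus the same derivative; the mean is \<open>omega\<close>.\<close>

lemma omega_along_singular_curve:
  assumes c: "c \<in> \<A>" and \<gamma>: "regular_curve c \<gamma> a b" "\<gamma> ` {a<..<b} \<subseteq> Sigma_sharp \<A> f \<nu>" "t \<in> {a<..<b}"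
    and e: "psi_velocity c \<nu> \<gamma> t \<noteq> 0" and e': "(psi_velocity c \<nu> \<gamma> has_vector_derivative e') (at t)"
  shows "omega c (\<gamma> t) (velocity c \<gamma> t) = conn (\<nu> (\<gamma> t)) (psi_velocity c \<nu> \<gamma> t) e'"
proof -
  interpret chart M c using c by (simp add: chart_axioms_A)
  have img: "\<gamma> s \<in> fst c" if "s \<in> {a<..<b}" for s using \<gamma> that by (auto simp: regular_curve_def)
  note ct = c img[OF \<gamma>(3)]
  have z: "delta_sharp c (\<gamma> s) = 0" if "s \<in> {a<..<b}" for s
    using \<gamma>(2) that Sigma_iff[OF c img[OF that]] by blast
  let ?n = "\<lambda>s. \<nu> (\<gamma> s)" and ?Y = "\<lambda>s. partial c 1 f (\<gamma> s)" and ?W = "\<lambda>s. mfield c (\<gamma> s)" and ?e = "psi_velocity c \<nu> \<gamma>"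
  let ?v = "velocity c \<gamma> t"
  have nY: "?Y s \<noteq> 0" if "s \<in> {a<..<b}" for s using f1_nonzero[OF c img[OF that]] .
  have eorth: "?e s \<bullet> ?n s = 0" if "s \<in> {a<..<b}" for s
    unfolding psi_velocity_def by (rule nu_orth[OF c img[OF that]])
  have dn: "(?n has_vector_derivative ?e t) (at t)" by (rule psi_velocity_eq[OF c \<gamma>(1,3)])
  have dY: "(?Y has_vector_derivative differential c (partial c 1 f) (\<gamma> t) ?v) (at t)"
    by (rule along_curve[OF \<gamma>(1,3) cdiff_surface(3)[OF ct]])
  have dW: "(?W has_vector_derivative differential c (mfield c) (\<gamma> t) ?v) (at t)"
    by (rule along_curve[OF \<gamma>(1,3) cdiff_surface(5)[OF ct]])
  have dh: "((\<lambda>s. trace_h c (\<gamma> s)) has_real_derivative differential c (trace_h c) (\<gamma> t) ?v) (at t)"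
    using along_curve[OF \<gamma>(1,3) csmooth_cdiff[OF csmooth_surface(3)[OF c] ct(2)]]
    by (simp add: has_real_derivative_iff_has_vector_derivative)
  define A where "A s = ?e s \<bullet> ?Y s / (?Y s \<bullet> ?Y s)" for s
  define B where "B s = ?e s \<bullet> (?n s \<times> ?Y s) / (?Y s \<bullet> ?Y s)" for s
  have YY: "?Y t \<bullet> ?Y t \<noteq> 0" using nY[OF \<gamma>(3)] by simp
  note bil = bounded_bilinear.has_vector_derivative
  obtain A' where A': "(A has_vector_derivative A') (at t)"
  proof -
    have "A differentiable (at t)"
      unfolding A_def[abs_def]
      by (rule differentiable_divide[OF differentiableI_vector[OF bil[OF bounded_bilinear_inner e' dY]]
          differentiableI_vector[OF bil[OF bounded_bilinear_inner dY dY]] YY])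
    then show thesis using that vector_derivative_works by blast
  qed
  obtain B' where B': "(B has_vector_derivative B') (at t)"
  proof -
    have "B differentiable (at t)"
      unfolding B_def[abs_def]
      by (rule differentiable_divide[OF differentiableI_vector[OF bil[OF bounded_bilinear_inner e' bil[OF bounded_bilinear_cross3 dn dY]]]
          differentiableI_vector[OF bil[OF bounded_bilinear_inner dY dY]] YY])
    then show thesis using that vector_derivative_works by blast
  qed
  have eq: "?e s = A s *\<^sub>R ?Y s + B s *\<^sub>R (?n s \<times> ?Y s)" if s: "s \<in> {a<..<b}" for s
    unfolding A_def B_def
    by (rule section_components[OF nu_unit[OF c img[OF s]] f_orth[OF c img[OF s]] eorth[OF s] nY[OF s]])
  have eqW: "trace_h c (\<gamma> s) *\<^sub>R ?e s = A s *\<^sub>R ?W s + (- B s) *\<^sub>R (?n s \<times> ?W s)" if s: "s \<in> {a<..<b}" for s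
  proof -
    let ?q = "\<gamma> s"
    interpret surface_point "partial c 1 f ?q" "partial c 2 f ?q" "\<nu> ?q" "partial c 1 \<nu> ?q" "partial c 2 \<nu> ?q"
      by (rule surface_point_partial[OF c img[OF s]])
    have m: "m1 = ?W s" by (simp add: m1_def mfield_def del_def h_def delta_def trace_h_def)
    have hh: "h = trace_h c ?q" by (simp add: h_def trace_h_def)
    have "\<nu> ?q \<times> ?Y s = (- (?Y s \<bullet> partial c 2 f ?q) / del) *\<^sub>R ?Y s + (?Y s \<bullet> ?Y s / del) *\<^sub>R partial c 2 f ?q"
    proof -
      have "\<nu> ?q \<times> ?Y s = (1 / del) *\<^sub>R (del *\<^sub>R (\<nu> ?q \<times> ?Y s))" using del_nz by simp
      then show ?thesis unfolding Jf(1) by (simp add: scaleR_diff_right)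
    qed
    then have "?e s = A s *\<^sub>R ?Y s + B s *\<^sub>R ((- (?Y s \<bullet> partial c 2 f ?q) / del) *\<^sub>R ?Y s + (?Y s \<bullet> ?Y s / del) *\<^sub>R partial c 2 f ?q)"
      using eq[OF s] by simp
    then obtain x y where xy: "?e s = x *\<^sub>R ?Y s + y *\<^sub>R partial c 2 f ?q"
    proof -
      assume *: "?e s = A s *\<^sub>R ?Y s + B s *\<^sub>R ((- (?Y s \<bullet> partial c 2 f ?q) / del) *\<^sub>R ?Y s + (?Y s \<bullet> ?Y s / del) *\<^sub>R partial c 2 f ?q)"
      show thesis
        by (rule that[of "A s + B s * (- (?Y s \<bullet> partial c 2 f ?q) / del)" "B s * (?Y s \<bullet> ?Y s / del)"])
          (subst *, simp add: algebra_simps)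
    qed
    have "?e s = (velocity c \<gamma> s $ 1) *\<^sub>R partial c 1 \<nu> ?q + (velocity c \<gamma> s $ 2) *\<^sub>R partial c 2 \<nu> ?q"
      unfolding psi_velocity_def by (rule differential_expand[OF cdiff_surface(2)[OF c img[OF s]]])
    from singular_shape[OF cross_nu_zero[OF c img[OF s] z[OF s]] this xy]
    have "x *\<^sub>R m1 + y *\<^sub>R m2 = trace_h c ?q *\<^sub>R ?e s" unfolding hh .
    moreover have "x *\<^sub>R m1 + y *\<^sub>R m2 = A s *\<^sub>R m1 - B s *\<^sub>R (\<nu> ?q \<times> m1)"
      by (rule tracefree_anticommute) (use xy eq[OF s] in simp)
    ultimately show ?thesis by (simp add: m)
  qed
  have AB: "A t * A t + B t * B t \<noteq> 0"
  proof
    assume "A t * A t + B t * B t = 0"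
    then have "A t = 0" "B t = 0" by (auto simp: sum_squares_eq_zero_iff)
    then show False using eq[OF \<gamma>(3)] e by simp
  qed
  have nz: "partial c 1 \<nu> (\<gamma> t) \<noteq> 0 \<or> partial c 2 \<nu> (\<gamma> t) \<noteq> 0"
    using nu_partial_nz[OF ct] e by (simp add: psi_velocity_def)
  have Wt: "?W t \<noteq> 0" by (rule mfield_nz[OF ct _ nz]) (simp add: z[OF \<gamma>(3)])
  have ht: "trace_h c (\<gamma> t) \<noteq> 0"
    using surface_point.singular_trace_nz[OF surface_point_partial[OF ct] cross_nu_zero[OF ct z[OF \<gamma>(3)]] nz]
    unfolding surface_point.h_def[OF surface_point_partial[OF ct]] trace_h_def .
  have rot: "((\<lambda>s. a s *\<^sub>R w s + b s *\<^sub>R (?n s \<times> w s)) has_vector_derivative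
      a t *\<^sub>R w' + a' *\<^sub>R w t + (b t *\<^sub>R (?n t \<times> w' + ?e t \<times> w t) + b' *\<^sub>R (?n t \<times> w t))) (at t)"
    if "(a has_vector_derivative a') (at t)" "(b has_vector_derivative b') (at t)" "(w has_vector_derivative w') (at t)"
    for a b :: "real \<Rightarrow> real" and w a' b' w'
    by (intro has_vector_derivative_add bil[OF bounded_bilinear_scaleR] bil[OF bounded_bilinear_cross3] that dn)
  have 1: "conn (?n t) (?e t) e' = conn (?n t) (?Y t) (differential c (partial c 1 f) (\<gamma> t) ?v) + (A t * B' - B t * A') / (A t * A t + B t * B t)"
  proof -
    have "(?e has_vector_derivative A t *\<^sub>R differential c (partial c 1 f) (\<gamma> t) ?v + A' *\<^sub>R ?Y t +
       (B t *\<^sub>R (?n t \<times> differential c (partial c 1 f) (\<gamma> t) ?v + ?e t \<times> ?Y t) + B' *\<^sub>R (?n t \<times> ?Y t))) (at t)"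
      by (rule has_vector_derivative_transform_within_open[OF rot[OF A' B' dY] open_greaterThanLessThan \<gamma>(3)]) (simp add: eq)
    from vector_derivative_unique_at[OF e' this]
    have "conn (?n t) (?e t) e' = conn (?n t) (A t *\<^sub>R ?Y t + B t *\<^sub>R (?n t \<times> ?Y t)) (A t *\<^sub>R differential c (partial c 1 f) (\<gamma> t) ?v + A' *\<^sub>R ?Y t +
       (B t *\<^sub>R (?n t \<times> differential c (partial c 1 f) (\<gamma> t) ?v + ?e t \<times> ?Y t) + B' *\<^sub>R (?n t \<times> ?Y t)))"
      using eq[OF \<gamma>(3)] by simp
    also have "\<dots> = conn (?n t) (?Y t) (differential c (partial c 1 f) (\<gamma> t) ?v) + (A t * B' - B t * A') / (A t * A t + B t * B t)"
      by (rule conn_rotate_section[OF nu_unit[OF ct] f_orth[OF ct] nY[OF \<gamma>(3)] AB eorth[OF \<gamma>(3)]])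
    finally show ?thesis .
  qed
  have 2: "conn (?n t) (?e t) e' = conn (?n t) (?W t) (differential c (mfield c) (\<gamma> t) ?v) + (A t * (- B') - (- B t) * A') / (A t * A t + (- B t) * (- B t))"
  proof -
    let ?X = "A t *\<^sub>R differential c (mfield c) (\<gamma> t) ?v + A' *\<^sub>R ?W t +
       ((- B t) *\<^sub>R (?n t \<times> differential c (mfield c) (\<gamma> t) ?v + ?e t \<times> ?W t) + (- B') *\<^sub>R (?n t \<times> ?W t))"
    have mB: "((\<lambda>s. - B s) has_vector_derivative - B') (at t)" by (rule has_vector_derivative_minus[OF B'])
    have "((\<lambda>s. trace_h c (\<gamma> s) *\<^sub>R ?e s) has_vector_derivative ?X) (at t)"
      by (rule has_vector_derivative_transform_within_open[OF rot[OF A' mB dW] open_greaterThanLessThan \<gamma>(3)]) (simp add: eqW)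
    moreover have "((\<lambda>s. trace_h c (\<gamma> s) *\<^sub>R ?e s) has_vector_derivative
       trace_h c (\<gamma> t) *\<^sub>R e' + differential c (trace_h c) (\<gamma> t) ?v *\<^sub>R ?e t) (at t)"
      by (rule has_vector_derivative_scaleR[OF dh e'])
    ultimately have X: "?X = trace_h c (\<gamma> t) *\<^sub>R e' + differential c (trace_h c) (\<gamma> t) ?v *\<^sub>R ?e t"
      by (rule vector_derivative_unique_at)
    have "conn (?n t) (?e t) e' = conn (?n t) (trace_h c (\<gamma> t) *\<^sub>R ?e t) ?X"
      unfolding X by (rule conn_scale[OF ht, symmetric])
    also have "\<dots> = conn (?n t) (A t *\<^sub>R ?W t + (- B t) *\<^sub>R (?n t \<times> ?W t)) ?X" unfolding eqW[OF \<gamma>(3)] ..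
    also have "\<dots> = conn (?n t) (?W t) (differential c (mfield c) (\<gamma> t) ?v) + (A t * (- B') - (- B t) * A') / (A t * A t + (- B t) * (- B t))"
      by (rule conn_rotate_section[OF nu_unit[OF ct] mfield_orth[OF ct] Wt _ eorth[OF \<gamma>(3)]]) (use AB in simp)
    finally show ?thesis .
  qed
  have 3: "(A t * (- B') - (- B t) * A') / (A t * A t + (- B t) * (- B t)) = - ((A t * B' - B t * A') / (A t * A t + B t * B t))"
    by (simp add: minus_divide_left[symmetric] algebra_simps diff_divide_distrib)
  have "(x + y) / 2 = z" if "z = x + q" "z = y + - q" for x y z q :: real
    using that by (simp add: field_simps)
  from this[OF 1 2[unfolded 3]] show ?thesis unfolding omega_def .
qed

text \<open>The conormal is forced to be the normalised quarter turn of \<open>psi_velocity\<close>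
  with the sign of \<open>delta\<close>. In its derivative, the change of the normalising factor
  only gives a vector orthogonal to \<open>psi_velocity\<close>, and what remains is the connection
  of \<open>psi_velocity\<close>. The sign of \<open>delta\<close> occurs again in the differential
  of \<open>lam_sharp\<close>, and the two signs cancel.\<close>

lemma curv_witness:
  assumes c: "c \<in> \<A>" and \<gamma>: "regular_curve c \<gamma> a b" "\<gamma> ` {a<..<b} \<subseteq> Sigma_sharp \<A> f \<nu>" "t \<in> {a<..<b}"
    and n: "conormal_along c f \<nu> \<gamma> a b n"
  shows "- sgn (differential c (lam_sharp c f \<nu>) (\<gamma> t) \<eta>) *
       (D_along \<nu> \<gamma> n t \<bullet> psi_velocity c \<nu> \<gamma> t) / (norm (psi_velocity c \<nu> \<gamma> t))\<^sup>2 = curv c (\<gamma> t) (velocity c \<gamma> t) \<eta>"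
proof -
  interpret chart M c using c by (simp add: chart_axioms_A)
  have img: "\<gamma> s \<in> fst c" if "s \<in> {a<..<b}" for s using \<gamma> that by (auto simp: regular_curve_def)
  note ct = c img[OF \<gamma>(3)]
  let ?n = "\<lambda>s. \<nu> (\<gamma> s)" and ?e = "psi_velocity c \<nu> \<gamma>"
  have e: "?e s \<noteq> 0" if "s \<in> {a<..<b}" for s using n that by (simp add: conormal_along_def)
  have eorth: "?e s \<bullet> ?n s = 0" if "s \<in> {a<..<b}" for s
    unfolding psi_velocity_def by (rule nu_orth[OF c img[OF that]])
  obtain e' where e': "(?e has_vector_derivative e') (at t)" using psi_velocity_differentiable[OF c \<gamma>(1,3)] .
  have dn: "(?n has_vector_derivative ?e t) (at t)" by (rule psi_velocity_eq[OF c \<gamma>(1,3)])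
  have n_eq: "n s = (sgn (delta c (\<gamma> s)) / norm (?e s)) *\<^sub>R (?n s \<times> ?e s)" if s: "s \<in> {a<..<b}" for s
  proof -
    have N: "n s \<bullet> ?n s = 0" "norm (n s) = 1" "n s \<bullet> ?e s = 0" "area_form c f \<nu> (\<gamma> s) (?e s /\<^sub>R norm (?e s)) (n s) > 0"
      using n s by (auto simp: conormal_along_def)
    note J = cross_normal_twice[OF nu_unit[OF c img[OF s]] eorth[OF s]]
    define k where "k = n s \<bullet> (?n s \<times> ?e s) / (?e s \<bullet> ?e s)"
    have nk: "n s = k *\<^sub>R (?n s \<times> ?e s)"
      using section_components[OF nu_unit[OF c img[OF s]] eorth[OF s] N(1) e[OF s]] N(3) by (simp add: k_def)
    have ee: "?e s \<bullet> ?e s = norm (?e s) * norm (?e s)" by (simp add: power2_norm_eq_inner[symmetric] power2_eq_square)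
    have "norm (?n s \<times> ?e s) = norm (?e s)" using J(2) by (simp add: norm_eq_sqrt_inner)
    then have k1: "\<bar>k\<bar> * norm (?e s) = 1" using N(2) nk by (metis norm_scaleR)
    have "(?e s \<times> (?n s \<times> ?e s)) \<bullet> ?n s = ?e s \<bullet> ?e s"
      using eorth[OF s] nu_unit[OF c img[OF s]] by (simp add: Lagrange inner_diff_left)
    then have "area_form c f \<nu> (\<gamma> s) (?e s /\<^sub>R norm (?e s)) (n s) = sgn (delta c (\<gamma> s)) * (k * norm (?e s))"
      unfolding area_form_def delta_def by (subst nk) (use e[OF s] in \<open>simp add: cross_mult_left cross_mult_right ee\<close>)
    with N(4) have "sgn (delta c (\<gamma> s)) * (k * norm (?e s)) > 0" by simp
    then have "k * norm (?e s) = sgn (delta c (\<gamma> s))"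
      using k1 e[OF s] by (auto simp: sgn_if zero_less_mult_iff abs_if split: if_splits)
    then have "k = sgn (delta c (\<gamma> s)) / norm (?e s)" using e[OF s] by (simp add: field_simps)
    then show ?thesis using nk by simp
  qed
  obtain V where V: "openin M V" "V \<subseteq> fst c" "\<gamma> t \<in> V" "\<And>q. q \<in> V \<Longrightarrow> sgn (delta c q) = sgn (delta c (\<gamma> t))"
    using delta_sgn_const[OF ct] by blast
  have "open (snd c ` V)" using openin_iff_open V by blast
  moreover have cont: "continuous_on {a<..<b} (snd c \<circ> \<gamma>)"
    using \<gamma>(1) unfolding regular_curve_def by (blast intro: smooth_on_imp_continuous_on)
  ultimately have o: "open ({a<..<b} \<inter> (snd c \<circ> \<gamma>) -` (snd c ` V))" by (intro continuous_open_preimage) auto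
  have tin: "t \<in> {a<..<b} \<inter> (snd c \<circ> \<gamma>) -` (snd c ` V)" using \<gamma>(3) V(3) by auto
  let ?\<sigma> = "sgn (delta c (\<gamma> t))"
  \<comment> \<open>On a neighbourhood of \<open>t\<close> the sign of \<open>delta\<close> is
    constant, so it can be treated as a constant factor in the differentiation.\<close>
  have near: "n s = ?\<sigma> *\<^sub>R (inverse (norm (?e s)) *\<^sub>R (?n s \<times> ?e s))" if "s \<in> {a<..<b} \<inter> (snd c \<circ> \<gamma>) -` (snd c ` V)" for s
  proof -
    have s: "s \<in> {a<..<b}" using that by blast
    have "snd c (\<gamma> s) \<in> snd c ` V" using that by simp
    then obtain q where "snd c (\<gamma> s) = snd c q" "q \<in> V" by blast
    then have "\<gamma> s \<in> V" using inj img[OF s] V(2) by (metis inj_onD subset_iff)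
    then show ?thesis unfolding n_eq[OF s] V(4)[OF \<open>\<gamma> s \<in> V\<close>] by (simp add: divide_inverse)
  qed
  have "(\<lambda>s. inverse (norm (?e s))) differentiable (at t)"
  proof -
    have "?e differentiable (at t)" using e' by (auto simp: has_vector_derivative_def differentiable_def)
    then have "(\<lambda>s. norm (?e s)) differentiable (at t)"
      using differentiable_compose[of norm ?e t UNIV] differentiable_norm_at[OF e[OF \<gamma>(3)]] by (simp add: o_def)
    then show ?thesis using e[OF \<gamma>(3)] by (intro differentiable_inverse) auto
  qed
  then obtain k' where k': "((\<lambda>s. inverse (norm (?e s))) has_vector_derivative k') (at t)" using vector_derivative_works by blast
  note bil = bounded_bilinear.has_vector_derivative
  let ?X = "?\<sigma> *\<^sub>R (inverse (norm (?e t)) *\<^sub>R (?n t \<times> e' + ?e t \<times> ?e t) + k' *\<^sub>R (?n t \<times> ?e t))"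
  have "((\<lambda>s. ?\<sigma> *\<^sub>R (inverse (norm (?e s)) *\<^sub>R (?n s \<times> ?e s))) has_vector_derivative ?X) (at t)"
    by (intro bounded_linear.has_vector_derivative[OF bounded_linear_scaleR_right] bil[OF bounded_bilinear_scaleR] bil[OF bounded_bilinear_cross3] k' dn e')
  then have "(n has_vector_derivative ?X) (at t)"
    by (rule has_vector_derivative_transform_within_open[OF _ o tin]) (rule near[symmetric])
  then have vd: "vector_derivative n (at t) = ?X" by (rule vector_derivative_at)
  have sk: "(?n t \<times> e') \<bullet> ?e t = - ((?n t \<times> ?e t) \<bullet> e')"
    by (metis cross_skew cross_triple inner_minus_left)
  have "D_along \<nu> \<gamma> n t \<bullet> ?e t = ?X \<bullet> ?e t"
    unfolding D_along_def vd using eorth[OF \<gamma>(3)] by (simp add: inner_diff_left inner_commute[of "?n t"])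
  also have "\<dots> = - (?\<sigma> * ((?n t \<times> ?e t) \<bullet> e' / norm (?e t)))"
    by (simp add: inner_add_left sk dot_cross_self divide_inverse mult.commute)
  finally have D: "D_along \<nu> \<gamma> n t \<bullet> ?e t = - (?\<sigma> * ((?n t \<times> ?e t) \<bullet> e' / norm (?e t)))" .
  have ee: "?e t \<bullet> ?e t = norm (?e t) * norm (?e t)" by (simp add: power2_norm_eq_inner[symmetric] power2_eq_square)
  have s1: "?\<sigma> * ?\<sigma> = 1" using delta_nz[OF ct] by (simp add: sgn_mult_self_eq)
  have "sgn (differential c (lam_sharp c f \<nu>) (\<gamma> t) \<eta>) = ?\<sigma> * sgn (differential c (delta_sharp c) (\<gamma> t) \<eta>)"
    unfolding differential_lam_sharp[OF ct] by (simp add: sgn_mult)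
  then have "- sgn (differential c (lam_sharp c f \<nu>) (\<gamma> t) \<eta>) * (D_along \<nu> \<gamma> n t \<bullet> ?e t) / (norm (?e t))\<^sup>2
     = (?\<sigma> * ?\<sigma>) * (sgn (differential c (delta_sharp c) (\<gamma> t) \<eta>) * ((?n t \<times> ?e t) \<bullet> e' / norm (?e t)) / (norm (?e t))\<^sup>2)"
    unfolding D by simp
  also have "\<dots> = sgn (differential c (delta_sharp c) (\<gamma> t) \<eta>) * conn (?n t) (?e t) e' / norm (?e t)"
    unfolding s1 conn_def ee by (simp add: power2_eq_square mult.commute)
  also have "\<dots> = curv c (\<gamma> t) (velocity c \<gamma> t) \<eta>"
    unfolding curv_def omega_along_singular_curve[OF c \<gamma> e[OF \<gamma>(3)] e'] by (simp add: psi_velocity_def)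
  finally show ?thesis .
qed

lemma curv_change:
  assumes cd: "c \<in> \<A>" "d \<in> \<A>" "p \<in> fst c" "p \<in> fst d" and z: "delta_sharp d p = 0" and e: "differential c \<nu> p \<xi> \<noteq> 0"
  shows "curv c p \<xi> \<eta> = curv d p (trans_map c d p \<xi>) (trans_map c d p \<eta>)"
proof -
  have z': "delta_sharp c p = 0" using delta_change(2)[OF cd] z by simp
  have "mfield c p \<noteq> 0" using mfield_nz[OF cd(1,3)] nu_partial_nz[OF cd(1,3) e] z' by simp
  note 1 = omega_change[OF cd this]
  show ?thesis
    unfolding curv_def 1 chart_change(1)[OF cd cdiff_surface(2)[OF cd(2,4)]] differential_delta_sharp_change[OF cd z]
    using transition(2)[OF cd] by (simp add: sgn_mult)
qed

text \<open>Positive factors cancel between \<open>omega\<close> and the norm, or disappear in the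
  sign. Reversing tangent and null vector together keeps the orientation and changes the sign of
  \<open>omega\<close> and of the factor \<open>sgn\<close>.\<close>

lemma curv_scale:
  assumes c: "c \<in> \<A>" "p \<in> fst c" and rs: "r * s > 0"
  shows "curv c p (r *\<^sub>R \<xi>) (s *\<^sub>R \<eta>) = curv c p \<xi> \<eta>"
proof -
  have r: "r \<noteq> 0" "sgn s * r / \<bar>r\<bar> = 1" using rs by (auto simp: sgn_if zero_less_mult_iff)
  have "curv c p (r *\<^sub>R \<xi>) (s *\<^sub>R \<eta>) = (sgn s * r / \<bar>r\<bar>) * curv c p \<xi> \<eta>"
    unfolding curv_def linear_cmul[OF linear_differential[OF cdiff_surface(7)[OF c]]] linear_cmul[OF linear_omega[OF c]]
      linear_cmul[OF linear_differential[OF cdiff_surface(2)[OF c]]]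
    using r by (simp add: sgn_mult)
  then show ?thesis unfolding r by simp
qed

lemma kernel_line:
  fixes F :: "real^2 \<Rightarrow> 'b::real_vector"
  assumes "linear F" "F \<zeta> \<noteq> 0" "F \<xi> = 0" "F \<eta> = 0" "\<xi> \<noteq> 0"
  obtains r where "\<eta> = r *\<^sub>R \<xi>"
proof -
  have cr: "\<xi>$1 * \<eta>$2 = \<xi>$2 * \<eta>$1"
  proof (rule ccontr)
    define D where "D = \<xi>$1 * \<eta>$2 - \<xi>$2 * \<eta>$1"
    assume "\<xi>$1 * \<eta>$2 \<noteq> \<xi>$2 * \<eta>$1"
    then have D: "D \<noteq> 0" by (simp add: D_def)
    have "D *\<^sub>R \<zeta> = (\<zeta>$1 * \<eta>$2 - \<zeta>$2 * \<eta>$1) *\<^sub>R \<xi> + (\<xi>$1 * \<zeta>$2 - \<xi>$2 * \<zeta>$1) *\<^sub>R \<eta>"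
      by (simp add: D_def vec_eq_iff forall_2 algebra_simps)
    then have "F (D *\<^sub>R \<zeta>) = 0" using assms by (simp add: linear_add linear_cmul)
    then show False using D assms by (simp add: linear_cmul)
  qed
  have "\<xi> \<bullet> \<xi> \<noteq> 0" using assms by simp
  moreover have "(\<xi> \<bullet> \<xi>) *\<^sub>R \<eta> = (\<xi> \<bullet> \<eta>) *\<^sub>R \<xi>"
    using cr by (simp add: vec_eq_iff forall_2 inner_vec_def sum_2 algebra_simps)
  ultimately have "\<eta> = ((\<xi> \<bullet> \<eta>) / (\<xi> \<bullet> \<xi>)) *\<^sub>R \<xi>" by (metis (no_types, lifting) divideR_right divide_inverse_commute scaleR_scaleR)
  then show thesis by (rule that)
qed

text \<open>The tangents lie in the kernel of the nonzero differential of
  \<open>delta_sharp\<close>, the null vectors in that of the nonzero differential of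
  \<open>\<nu>\<close>; both kernels are lines, and orientation makes the two factors of
  proportionality have the same sign.\<close>

lemma curv_unique:
  assumes c: "c \<in> \<A>" "p \<in> fst c" and nd: "differential c (delta_sharp c) p \<zeta> \<noteq> 0"
    and \<xi>: "differential c (delta_sharp c) p \<xi> = 0" "differential c (delta_sharp c) p \<xi>' = 0" "differential c \<nu> p \<xi> \<noteq> 0"
    and \<eta>: "differential c \<nu> p \<eta> = 0" "differential c \<nu> p \<eta>' = 0"
    and pos: "\<xi>$1 * \<eta>$2 - \<xi>$2 * \<eta>$1 > 0" "\<xi>'$1 * \<eta>'$2 - \<xi>'$2 * \<eta>'$1 > 0"
  shows "curv c p \<xi>' \<eta>' = curv c p \<xi> \<eta>"
proof -
  have "\<xi> \<noteq> 0" "\<eta> \<noteq> 0" using pos by auto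
  obtain r where r: "\<xi>' = r *\<^sub>R \<xi>"
    using kernel_line[OF linear_differential[OF cdiff_surface(7)[OF c]] nd \<xi>(1,2) \<open>\<xi> \<noteq> 0\<close>] by blast
  obtain s where s: "\<eta>' = s *\<^sub>R \<eta>"
    using kernel_line[OF linear_differential[OF cdiff_surface(2)[OF c]] \<xi>(3) \<eta> \<open>\<eta> \<noteq> 0\<close>] by blast
  have "r * s * (\<xi>$1 * \<eta>$2 - \<xi>$2 * \<eta>$1) > 0" using pos(2) unfolding r s by (simp add: algebra_simps)
  then have "r * s > 0" using pos(1) zero_less_mult_pos2 by blast
  then show ?thesis unfolding r s by (rule curv_scale[OF c])
qed

lemma singular_curve_tangent:
  assumes c: "c \<in> \<A>" and \<gamma>: "regular_curve c \<gamma> a b" "\<gamma> ` {a<..<b} \<subseteq> Sigma_sharp \<A> f \<nu>" "t \<in> {a<..<b}"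
  shows "differential c (delta_sharp c) (\<gamma> t) (velocity c \<gamma> t) = 0"
proof -
  interpret chart M c using c by (simp add: chart_axioms_A)
  have img: "\<gamma> s \<in> fst c" if "s \<in> {a<..<b}" for s using \<gamma> that by (auto simp: regular_curve_def)
  have z: "delta_sharp c (\<gamma> s) = 0" if "s \<in> {a<..<b}" for s
    using \<gamma>(2) that Sigma_iff[OF c img[OF that]] by blast
  have "((\<lambda>s. delta_sharp c (\<gamma> s)) has_vector_derivative differential c (delta_sharp c) (\<gamma> t) (velocity c \<gamma> t)) (at t)"
    by (rule along_curve[OF \<gamma>(1,3) cdiff_surface(7)[OF c img[OF \<gamma>(3)]]])
  then have "((\<lambda>s. 0 :: real) has_vector_derivative differential c (delta_sharp c) (\<gamma> t) (velocity c \<gamma> t)) (at t)"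
    by (rule has_vector_derivative_transform_within_open[OF _ open_greaterThanLessThan \<gamma>(3)]) (rule z)
  from vector_derivative_unique_at[OF this has_vector_derivative_const] show ?thesis .
qed

lemma conormal_exists:
  assumes c: "c \<in> \<A>" and \<gamma>: "regular_curve c \<gamma> a b" and e: "\<And>s. s \<in> {a<..<b} \<Longrightarrow> psi_velocity c \<nu> \<gamma> s \<noteq> 0"
  shows "conormal_along c f \<nu> \<gamma> a b (\<lambda>s. (sgn (delta c (\<gamma> s)) / norm (psi_velocity c \<nu> \<gamma> s)) *\<^sub>R (\<nu> (\<gamma> s) \<times> psi_velocity c \<nu> \<gamma> s))"
  unfolding conormal_along_def
proof (intro ballI conjI)
  fix s assume s: "s \<in> {a<..<b}"
  have img: "\<gamma> s \<in> fst c" using \<gamma> s by (auto simp: regular_curve_def)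
  let ?e = "psi_velocity c \<nu> \<gamma> s" and ?n = "\<nu> (\<gamma> s)"
  have eorth: "?e \<bullet> ?n = 0" unfolding psi_velocity_def by (rule nu_orth[OF c img])
  note J = cross_normal_twice[OF nu_unit[OF c img] eorth]
  have nn: "norm (?n \<times> ?e) = norm ?e" using J(2) by (simp add: norm_eq_sqrt_inner)
  have sg: "\<bar>sgn (delta c (\<gamma> s))\<bar> = 1" "sgn (delta c (\<gamma> s)) * sgn (delta c (\<gamma> s)) = 1"
    using delta_nz[OF c img] by (simp_all add: abs_sgn_eq sgn_mult_self_eq)
  show "?e \<noteq> 0" by (rule e[OF s])
  show "((sgn (delta c (\<gamma> s)) / norm ?e) *\<^sub>R (?n \<times> ?e)) \<bullet> ?n = 0" "((sgn (delta c (\<gamma> s)) / norm ?e) *\<^sub>R (?n \<times> ?e)) \<bullet> ?e = 0"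
    using J by simp_all
  show "norm ((sgn (delta c (\<gamma> s)) / norm ?e) *\<^sub>R (?n \<times> ?e)) = 1" using sg nn e[OF s] by simp
  have ee: "?e \<bullet> ?e = norm ?e * norm ?e" by (simp add: power2_norm_eq_inner[symmetric] power2_eq_square)
  have "(?e \<times> (?n \<times> ?e)) \<bullet> ?n = ?e \<bullet> ?e"
    using eorth nu_unit[OF c img] by (simp add: Lagrange inner_diff_left)
  then have "area_form c f \<nu> (\<gamma> s) (?e /\<^sub>R norm ?e) ((sgn (delta c (\<gamma> s)) / norm ?e) *\<^sub>R (?n \<times> ?e)) = sgn (delta c (\<gamma> s)) * sgn (delta c (\<gamma> s))"
    unfolding area_form_def delta_def using e[OF s] by (simp add: cross_mult_left cross_mult_right ee)
  then show "area_form c f \<nu> (\<gamma> s) (?e /\<^sub>R norm ?e) ((sgn (delta c (\<gamma> s)) / norm ?e) *\<^sub>R (?n \<times> ?e)) > 0" using sg by simp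
qed

lemma trans_map_det_pair:
  assumes cd: "c \<in> \<A>" "d \<in> \<A>" "p \<in> fst c" "p \<in> fst d"
  shows "trans_map c d p \<xi> $ 1 * trans_map c d p \<eta> $ 2 - trans_map c d p \<xi> $ 2 * trans_map c d p \<eta> $ 1
    = det (matrix (trans_map c d p)) * (\<xi>$1 * \<eta>$2 - \<xi>$2 * \<eta>$1)"
  unfolding det_trans_map linear_real2[OF transition(3)[OF cd], of \<xi>] linear_real2[OF transition(3)[OF cd], of \<eta>]
  by (simp add: algebra_simps)

text \<open>The definite description has a solution because the given curve carries a conormal. For
  uniqueness a competing curve in any chart is evaluated by \<open>curv_witness\<close> and moved to
  \<open>c\<close> by \<open>curv_change\<close>, where its tangent and null vector span the same
  lines with the same orientation.\<close>

lemma singular_curvature_eq_curv: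
  assumes c: "c \<in> \<A>" and \<gamma>: "regular_curve c \<gamma> a b" "\<gamma> ` {a<..<b} \<subseteq> Sigma_sharp \<A> f \<nu>" "t \<in> {a<..<b}"
    and e: "\<And>s. s \<in> {a<..<b} \<Longrightarrow> psi_velocity c \<nu> \<gamma> s \<noteq> 0"
    and \<eta>: "differential c \<nu> (\<gamma> t) \<eta> = 0" "velocity c \<gamma> t $ 1 * \<eta>$2 - velocity c \<gamma> t $ 2 * \<eta>$1 > 0"
    and nd: "differential c (delta_sharp c) (\<gamma> t) \<zeta> \<noteq> 0"
  shows "singular_curvature \<A> f \<nu> (\<gamma> t) = curv c (\<gamma> t) (velocity c \<gamma> t) \<eta>"
  unfolding singular_curvature_def
proof (rule the_equality)
  let ?k = "curv c (\<gamma> t) (velocity c \<gamma> t) \<eta>"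
  let ?n = "\<lambda>s. (sgn (delta c (\<gamma> s)) / norm (psi_velocity c \<nu> \<gamma> s)) *\<^sub>R (\<nu> (\<gamma> s) \<times> psi_velocity c \<nu> \<gamma> s)"
  have det2: "det (vector [x, y] :: real^2^2) = x$1 * y$2 - x$2 * y$1" for x y :: "real^2" by (simp add: det_2)
  show "\<exists>c\<in>\<A>. \<exists>\<gamma>' a b s n \<eta>. regular_curve c \<gamma>' a b \<and> \<gamma>' ` {a<..<b} \<subseteq> Sigma_sharp \<A> f \<nu> \<and>
       s \<in> {a<..<b} \<and> \<gamma>' s = \<gamma> t \<and> conormal_along c f \<nu> \<gamma>' a b n \<and>
       differential c \<nu> (\<gamma> t) \<eta> = 0 \<and> det (vector [velocity c \<gamma>' s, \<eta>] :: real^2^2) > 0 \<and>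
       ?k = - sgn (differential c (lam_sharp c f \<nu>) (\<gamma> t) \<eta>) *
             (D_along \<nu> \<gamma>' n s \<bullet> psi_velocity c \<nu> \<gamma>' s) / (norm (psi_velocity c \<nu> \<gamma>' s))\<^sup>2"
  proof (rule bexI[OF _ c], intro exI conjI)
    show "regular_curve c \<gamma> a b" "\<gamma> ` {a<..<b} \<subseteq> Sigma_sharp \<A> f \<nu>" "t \<in> {a<..<b}" "\<gamma> t = \<gamma> t" by (rule \<gamma> refl)+
    show n: "conormal_along c f \<nu> \<gamma> a b ?n" by (rule conormal_exists[OF c \<gamma>(1) e])
    show "differential c \<nu> (\<gamma> t) \<eta> = 0" by (rule \<eta>(1))
    show "det (vector [velocity c \<gamma> t, \<eta>] :: real^2^2) > 0" using \<eta>(2) by (simp add: det2)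
    show "?k = - sgn (differential c (lam_sharp c f \<nu>) (\<gamma> t) \<eta>) *
             (D_along \<nu> \<gamma> ?n t \<bullet> psi_velocity c \<nu> \<gamma> t) / (norm (psi_velocity c \<nu> \<gamma> t))\<^sup>2"
      by (rule curv_witness[OF c \<gamma> n, symmetric])
  qed
  fix k
  assume "\<exists>c\<in>\<A>. \<exists>\<gamma>' a b s n \<eta>. regular_curve c \<gamma>' a b \<and> \<gamma>' ` {a<..<b} \<subseteq> Sigma_sharp \<A> f \<nu> \<and>
       s \<in> {a<..<b} \<and> \<gamma>' s = \<gamma> t \<and> conormal_along c f \<nu> \<gamma>' a b n \<and>
       differential c \<nu> (\<gamma> t) \<eta> = 0 \<and> det (vector [velocity c \<gamma>' s, \<eta>] :: real^2^2) > 0 \<and>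
       k = - sgn (differential c (lam_sharp c f \<nu>) (\<gamma> t) \<eta>) *
             (D_along \<nu> \<gamma>' n s \<bullet> psi_velocity c \<nu> \<gamma>' s) / (norm (psi_velocity c \<nu> \<gamma>' s))\<^sup>2"
  then obtain d \<gamma>' a' b' s n \<eta>' where d: "d \<in> \<A>" and \<gamma>': "regular_curve d \<gamma>' a' b'" "\<gamma>' ` {a'<..<b'} \<subseteq> Sigma_sharp \<A> f \<nu>"
       "s \<in> {a'<..<b'}" "\<gamma>' s = \<gamma> t" and n: "conormal_along d f \<nu> \<gamma>' a' b' n"
       and \<eta>': "differential d \<nu> (\<gamma> t) \<eta>' = 0" "det (vector [velocity d \<gamma>' s, \<eta>'] :: real^2^2) > 0"
       and k: "k = - sgn (differential d (lam_sharp d f \<nu>) (\<gamma> t) \<eta>') *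
             (D_along \<nu> \<gamma>' n s \<bullet> psi_velocity d \<nu> \<gamma>' s) / (norm (psi_velocity d \<nu> \<gamma>' s))\<^sup>2"
    by blast
  have pc: "\<gamma> t \<in> fst c" using \<gamma> by (auto simp: regular_curve_def)
  have pd: "\<gamma> t \<in> fst d" using \<gamma>' by (force simp: regular_curve_def)
  note dc = d c pd pc
  have zc: "delta_sharp c (\<gamma> t) = 0" using \<gamma>(2,3) Sigma_iff[OF c pc] by blast
  have "k = curv d (\<gamma> t) (velocity d \<gamma>' s) \<eta>'" unfolding k using curv_witness[OF d \<gamma>'(1-3) n, of \<eta>'] by (simp add: \<gamma>'(4))
  also have "\<dots> = curv c (\<gamma> t) (trans_map d c (\<gamma> t) (velocity d \<gamma>' s)) (trans_map d c (\<gamma> t) \<eta>')"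
  proof (rule curv_change[OF dc zc])
    show "differential d \<nu> (\<gamma> t) (velocity d \<gamma>' s) \<noteq> 0"
      using n \<gamma>'(3,4) unfolding conormal_along_def psi_velocity_def by metis
  qed
  also have "\<dots> = curv c (\<gamma> t) (velocity c \<gamma> t) \<eta>"
  proof (rule curv_unique[OF c pc nd _ _ _ \<eta>(1) _ \<eta>(2)])
    show "differential c (delta_sharp c) (\<gamma> t) (velocity c \<gamma> t) = 0" by (rule singular_curve_tangent[OF c \<gamma>])
    have "det (matrix (trans_map d c (\<gamma> t))) * differential c (delta_sharp c) (\<gamma> t) (trans_map d c (\<gamma> t) (velocity d \<gamma>' s)) = 0"
      using singular_curve_tangent[OF d \<gamma>'(1-3)] unfolding \<gamma>'(4) differential_delta_sharp_change[OF dc zc] .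
    then show "differential c (delta_sharp c) (\<gamma> t) (trans_map d c (\<gamma> t) (velocity d \<gamma>' s)) = 0"
      using transition(2)[OF dc] by simp
    show "differential c \<nu> (\<gamma> t) (velocity c \<gamma> t) \<noteq> 0" using e[OF \<gamma>(3)] by (simp add: psi_velocity_def)
    show "differential c \<nu> (\<gamma> t) (trans_map d c (\<gamma> t) \<eta>') = 0"
      using \<eta>'(1) chart_change(1)[OF dc cdiff_surface(2)[OF c pc]] by simp
    show "0 < trans_map d c (\<gamma> t) (velocity d \<gamma>' s) $ 1 * trans_map d c (\<gamma> t) \<eta>' $ 2 - trans_map d c (\<gamma> t) (velocity d \<gamma>' s) $ 2 * trans_map d c (\<gamma> t) \<eta>' $ 1"
      unfolding trans_map_det_pair[OF dc] using transition(2)[OF dc] \<eta>'(2) by (simp add: det2)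
  qed
  finally show "k = curv c (\<gamma> t) (velocity c \<gamma> t) \<eta>" .
qed

end

unbundle no cross3_syntax

section \<open>The area measure\<close>

text \<open>Common form of the area measure in a chart and the length measure on an arc. The
  restriction to \<open>\<Omega>\<close> comes first because \<open>\<phi>\<close> is meaningful
  only there.\<close>

definition push :: "'e::euclidean_space set \<Rightarrow> ('e \<Rightarrow> real) \<Rightarrow> 'a measure \<Rightarrow> ('e \<Rightarrow> 'a) \<Rightarrow> 'a measure" where
  "push \<Omega> D N \<phi> = distr (density (restrict_space lborel \<Omega>) (\<lambda>z. ennreal (D z))) N \<phi>"

lemma sets_push [simp]: "sets (push \<Omega> D N \<phi>) = sets N" and space_push [simp]: "space (push \<Omega> D N \<phi>) = space N"
  by (simp_all add: push_def)

context
  fixes \<Omega> :: "'e::euclidean_space set" and D :: "'e \<Rightarrow> real" and N :: "'a measure" and \<phi> :: "'e \<Rightarrow> 'a"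
  assumes \<Omega>: "\<Omega> \<in> sets borel" and D: "D \<in> borel_measurable (restrict_space borel \<Omega>)"
    and \<phi>: "\<phi> \<in> measurable (restrict_space borel \<Omega>) N"
begin

lemma measurable_density_restrict:
  "measurable (density (restrict_space lborel \<Omega>) g) N' = measurable (restrict_space borel \<Omega>) N'"
  by (rule measurable_cong_sets) (auto intro!: sets_restrict_space_cong)

lemma measurable_restrict_lborel: "measurable (restrict_space lborel \<Omega>) N' = measurable (restrict_space borel \<Omega>) N'"
  by (rule measurable_cong_sets) (auto intro!: sets_restrict_space_cong)

lemma emeasure_push:
  assumes "B \<in> sets N"
  shows "emeasure (push \<Omega> D N \<phi>) B = (\<integral>\<^sup>+z\<in>{z\<in>\<Omega>. \<phi> z \<in> B}. ennreal (D z) \<partial>lborel)"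
proof -
  have sp: "space (restrict_space lborel \<Omega>) = \<Omega>" using \<Omega> by (simp add: space_restrict_space)
  have pre: "\<phi> -` B \<inter> \<Omega> \<in> sets (restrict_space lborel \<Omega>)"
    using measurable_sets[OF \<phi> assms] \<Omega> by (simp add: space_restrict_space sets_restrict_space)
  have "emeasure (push \<Omega> D N \<phi>) B = emeasure (density (restrict_space lborel \<Omega>) (\<lambda>z. ennreal (D z))) (\<phi> -` B \<inter> \<Omega>)"
    unfolding push_def using \<phi> assms by (subst emeasure_distr) (simp_all add: measurable_density_restrict sp)
  also have "\<dots> = (\<integral>\<^sup>+z. ennreal (D z) * indicator (\<phi> -` B \<inter> \<Omega>) z \<partial>restrict_space lborel \<Omega>)"
    using D pre by (subst emeasure_density) (simp_all add: measurable_restrict_lborel)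
  also have "\<dots> = (\<integral>\<^sup>+z. (ennreal (D z) * indicator (\<phi> -` B \<inter> \<Omega>) z) * indicator \<Omega> z \<partial>lborel)"
    using \<Omega> by (intro nn_integral_restrict_space) simp
  also have "\<dots> = (\<integral>\<^sup>+z\<in>{z\<in>\<Omega>. \<phi> z \<in> B}. ennreal (D z) \<partial>lborel)"
    by (intro nn_integral_cong) (auto simp: indicator_def)
  finally show ?thesis .
qed

text \<open>The measures are known to agree only inside \<open>V\<close>. Since \<open>F\<close>
  vanishes outside \<open>V\<close>, both integrals can be taken over the restrictions to
  \<open>V\<close>, which coincide.\<close>

lemma integral_push:
  fixes F :: "'a \<Rightarrow> real"
  assumes m: "sets m = sets N" and V: "V \<in> sets N" and eq: "\<And>B. B \<in> sets N \<Longrightarrow> B \<subseteq> V \<Longrightarrow> emeasure m B = emeasure (push \<Omega> D N \<phi>) B"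
    and F: "F \<in> borel_measurable N" "\<And>q. q \<notin> V \<Longrightarrow> F q = 0" and pos: "\<And>z. z \<in> \<Omega> \<Longrightarrow> D z \<ge> 0"
  shows "integrable m F \<longleftrightarrow> integrable lborel (\<lambda>z. indicator \<Omega> z * (D z * F (\<phi> z)))"
    and "(\<integral>q. F q \<partial>m) = (\<integral>z. indicator \<Omega> z * (D z * F (\<phi> z)) \<partial>lborel)"
proof -
  let ?P = "push \<Omega> D N \<phi>"
  have VF: "(\<lambda>q. indicator V q *\<^sub>R F q) = F" using F(2) by (auto simp: indicator_def fun_eq_iff)
  have Vm: "V \<inter> space m \<in> sets m" "V \<inter> space ?P \<in> sets ?P"
    using V m sets_eq_imp_space_eq[OF m] sets.sets_into_space[OF V] by (auto simp: Int_absorb2)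
  have R: "restrict_space m V = restrict_space ?P V"
  proof (rule measure_eqI)
    show "sets (restrict_space m V) = sets (restrict_space ?P V)" by (intro sets_restrict_space_cong) (simp add: m)
    fix B assume "B \<in> sets (restrict_space m V)"
    then have "B \<in> sets N" "B \<subseteq> V" using Vm(1) m by (auto simp: sets_restrict_space_iff)
    then show "emeasure (restrict_space m V) B = emeasure (restrict_space ?P V) B"
      using Vm eq by (simp add: emeasure_restrict_space)
  qed
  have "integrable m F \<longleftrightarrow> integrable ?P F" "(\<integral>q. F q \<partial>m) = (\<integral>q. F q \<partial>?P)"
    using integrable_restrict_space[OF Vm(1), of F] integrable_restrict_space[OF Vm(2), of F]
      integral_restrict_space[OF Vm(1), of F] integral_restrict_space[OF Vm(2), of F] unfolding VF R by simp_all
  moreover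
  have F\<phi>: "(\<lambda>z. F (\<phi> z)) \<in> borel_measurable (restrict_space borel \<Omega>)" by (rule measurable_compose[OF \<phi> F(1)])
  have O: "\<Omega> \<inter> space lborel \<in> sets lborel" using \<Omega> by simp
  have AE: "AE z in restrict_space lborel \<Omega>. 0 \<le> D z" using pos by (intro AE_I2) (simp add: space_restrict_space)
  have "integrable ?P F \<longleftrightarrow> integrable (density (restrict_space lborel \<Omega>) (\<lambda>z. ennreal (D z))) (\<lambda>z. F (\<phi> z))"
    "(\<integral>q. F q \<partial>?P) = (\<integral>z. F (\<phi> z) \<partial>density (restrict_space lborel \<Omega>) (\<lambda>z. ennreal (D z)))"
    unfolding push_def using \<phi> F(1)
    by (auto intro!: integrable_distr_eq integral_distr simp: measurable_density_restrict)
  moreover have "integrable (density (restrict_space lborel \<Omega>) (\<lambda>z. ennreal (D z))) (\<lambda>z. F (\<phi> z)) \<longleftrightarrow> integrable (restrict_space lborel \<Omega>) (\<lambda>z. D z *\<^sub>R F (\<phi> z))"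
    "(\<integral>z. F (\<phi> z) \<partial>density (restrict_space lborel \<Omega>) (\<lambda>z. ennreal (D z))) = (\<integral>z. D z *\<^sub>R F (\<phi> z) \<partial>restrict_space lborel \<Omega>)"
    using F\<phi> D AE by (intro integrable_density integral_density; simp add: measurable_restrict_lborel)+
  moreover have "integrable (restrict_space lborel \<Omega>) (\<lambda>z. D z *\<^sub>R F (\<phi> z)) \<longleftrightarrow> integrable lborel (\<lambda>z. indicator \<Omega> z * (D z * F (\<phi> z)))"
    "(\<integral>z. D z *\<^sub>R F (\<phi> z) \<partial>restrict_space lborel \<Omega>) = (\<integral>z. indicator \<Omega> z * (D z * F (\<phi> z)) \<partial>lborel)"
    using integrable_restrict_space[OF O, of "\<lambda>z. D z *\<^sub>R F (\<phi> z)"] integral_restrict_space[OF O, of "\<lambda>z. D z *\<^sub>R F (\<phi> z)"] by simp_all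
  ultimately show "integrable m F \<longleftrightarrow> integrable lborel (\<lambda>z. indicator \<Omega> z * (D z * F (\<phi> z)))"
    and "(\<integral>q. F q \<partial>m) = (\<integral>z. indicator \<Omega> z * (D z * F (\<phi> z)) \<partial>lborel)" by simp_all
qed

end

lemma glue_measures_family:
  fixes P :: "('a set \<times> 'a measure) set" and N :: "'a measure"
  assumes "countable P" "P \<noteq> {}" and s: "\<And>A \<mu>. (A, \<mu>) \<in> P \<Longrightarrow> sets \<mu> = sets N \<and> A \<in> sets N" and cov: "(\<Union>(A, \<mu>)\<in>P. A) = space N"
    and eq: "\<And>A \<mu> A' \<mu>' B. (A, \<mu>) \<in> P \<Longrightarrow> (A', \<mu>') \<in> P \<Longrightarrow> B \<in> sets N \<Longrightarrow> B \<subseteq> A \<Longrightarrow> B \<subseteq> A' \<Longrightarrow> emeasure \<mu> B = emeasure \<mu>' B"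
  obtains m where "space m = space N" "sets m = sets N"
    "\<And>A \<mu> B. (A, \<mu>) \<in> P \<Longrightarrow> B \<in> sets N \<Longrightarrow> B \<subseteq> A \<Longrightarrow> emeasure m B = emeasure \<mu> B"
proof -
  let ?e = "from_nat_into P"
  have e: "(fst (?e n), snd (?e n)) \<in> P" for n using from_nat_into[OF assms(2)] by simp
  have surj: "\<exists>n. ?e n = x" if "x \<in> P" for x using from_nat_into_surj[OF assms(1) that] by blast
  have "(\<Union>n. fst (?e n)) = space N"
    unfolding cov[symmetric] using e surj by (auto simp: split_beta) (metis fst_conv)
  then obtain m where m: "space m = space N" "sets m = sets N"
    "\<And>n B. B \<in> sets N \<Longrightarrow> B \<subseteq> fst (?e n) \<Longrightarrow> emeasure m B = emeasure (snd (?e n)) B"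
    using glue_measures[of "\<lambda>n. snd (?e n)" N "\<lambda>n. fst (?e n)"] s[OF e] eq[OF e e] by metis
  show thesis
  proof (rule that[OF m(1,2)])
    fix A \<mu> B assume A: "(A, \<mu>) \<in> P" "B \<in> sets N" "B \<subseteq> A"
    obtain n where "?e n = (A, \<mu>)" using surj[OF A(1)] by blast
    then show "emeasure m B = emeasure \<mu> B" using m(3)[of B n] A by simp
  qed
qed

lemma measure_eqI_countable_cover:
  assumes "sets m = sets m'" and A: "countable \<C>" "\<C> \<noteq> {}" "\<C> \<subseteq> sets m" "\<Union>\<C> = space m"
    and eq: "\<And>A B. A \<in> \<C> \<Longrightarrow> B \<in> sets m \<Longrightarrow> B \<subseteq> A \<Longrightarrow> emeasure m B = emeasure m' B"
  shows "m = m'"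
proof (rule measure_eqI_cover[OF assms(1), of "from_nat_into \<C>"])
  show "from_nat_into \<C> n \<in> sets m" for n using A from_nat_into by blast
  show "(\<Union>n. from_nat_into \<C> n) = space m" using A by (simp add: range_from_nat_into)
  show "emeasure m B = emeasure m' B" if "B \<in> sets m" "B \<subseteq> from_nat_into \<C> n" for n B
    using eq[OF from_nat_into[OF A(2)] that] .
qed

text \<open>Carrier of the Borel sigma-algebra of \<open>M\<close>, so that measurability into and
  out of \<open>M\<close> can be stated.\<close>

definition BM :: "'a topology \<Rightarrow> 'a measure" where
  "BM M = sigma (topspace M) {U. openin M U}"

lemma space_BM: "space (BM M) = topspace M" and sets_BM: "sets (BM M) = borel_sets M"
  and openin_BM: "openin M U \<Longrightarrow> U \<in> sets (BM M)"
proof -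
  have *: "{U. openin M U} \<subseteq> Pow (topspace M)" using openin_subset by blast
  show "space (BM M) = topspace M" "sets (BM M) = borel_sets M"
    unfolding BM_def borel_sets_def using * by (simp_all add: space_measure_of sets_measure_of)
  then show "openin M U \<Longrightarrow> U \<in> sets (BM M)" by (auto simp: borel_sets_def)
qed

lemma measurable_BM:
  assumes "\<And>z. z \<in> space N \<Longrightarrow> \<phi> z \<in> topspace M" "\<And>U. openin M U \<Longrightarrow> \<phi> -` U \<inter> space N \<in> sets N"
  shows "\<phi> \<in> measurable N (BM M)"
  unfolding BM_def by (rule measurable_measure_of) (use assms in \<open>auto simp: Pi_iff dest: openin_subset[THEN subsetD]\<close>)

lemma image_eq_by_inverse: "\<lbrakk>\<And>x. x \<in> A \<Longrightarrow> f x \<in> B; \<And>y. y \<in> B \<Longrightarrow> g y \<in> A \<and> f (g y) = y\<rbrakk> \<Longrightarrow> f ` A = B"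
  by force

context chart
begin

lemma dom_BM: "fst c \<in> sets (BM M)" by (rule openin_BM[OF openin_dom])

lemma inv_preimage: "inv_c -` B \<inter> S = snd c ` (B \<inter> fst c)"
  using inv_snd snd_inv inv_in by (auto simp: image_iff)

lemma inv_measurable: "inv_c \<in> measurable (restrict_space borel S) (BM M)"
proof (rule measurable_BM)
  show "inv_c z \<in> topspace M" if "z \<in> space (restrict_space borel S)" for z
    using that inv_in dom_subset by (auto simp: space_restrict_space)
  fix U assume "openin M U"
  then have "open (snd c ` (U \<inter> fst c))" using openin_iff_open[of "U \<inter> fst c"] openin_dom by auto
  then show "inv_c -` U \<inter> space (restrict_space borel S) \<in> sets (restrict_space borel S)"
    using open_S by (auto simp: space_restrict_space sets_restrict_space_iff inv_preimage)
qed

lemma image_borel: "B \<in> sets (BM M) \<Longrightarrow> snd c ` (B \<inter> fst c) \<in> sets borel"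
  using measurable_sets[OF inv_measurable, of B] open_S
  by (simp add: space_restrict_space sets_restrict_space_iff inv_preimage)

lemma snd_measurable: "snd c \<in> measurable (restrict_space (BM M) (fst c)) borel"
proof (rule borel_measurableI)
  fix W :: "(real^2) set" assume "open W"
  then have "openin M (inv_c ` (W \<inter> S))" using open_S by (intro openin_inv_image) auto
  moreover have "inv_c ` (W \<inter> S) = snd c -` W \<inter> fst c"
    by (rule image_eq_by_inverse[where g = "snd c"]) (use inv_snd snd_inv inv_in in auto)
  ultimately show "snd c -` W \<inter> space (restrict_space (BM M) (fst c)) \<in> sets (restrict_space (BM M) (fst c))"
    using dom_BM dom_subset by (auto simp: space_restrict_space space_BM Int_absorb2 sets_restrict_space_iff openin_BM)
qed

end

context surface
begin

lemma openin_local: "V \<subseteq> topspace M \<Longrightarrow> (\<And>c. c \<in> \<A> \<Longrightarrow> openin M (V \<inter> fst c)) \<Longrightarrow> openin M V"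
proof -
  assume V: "V \<subseteq> topspace M" "\<And>c. c \<in> \<A> \<Longrightarrow> openin M (V \<inter> fst c)"
  have "V = (\<Union>c\<in>\<A>. V \<inter> fst c)" using V(1) cover by blast
  moreover have "openin M (\<Union>c\<in>\<A>. V \<inter> fst c)" using V(2) by (intro openin_Union) auto
  ultimately show ?thesis by simp
qed

lemma openin_preimage:
  fixes h :: "'a \<Rightarrow> 'b::topological_space"
  assumes "\<And>c. c \<in> \<A> \<Longrightarrow> continuous_on (snd c ` fst c) (in_chart c h)" "open W"
  shows "openin M {p \<in> topspace M. h p \<in> W}"
proof (rule openin_local)
  fix c assume c: "c \<in> \<A>"
  interpret chart M c using c by (rule chart_axioms_A)
  have "open (S \<inter> in_chart c h -` W)" by (rule continuous_open_preimage[OF assms(1)[OF c] open_S assms(2)])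
  then have "openin M (inv_c ` (S \<inter> in_chart c h -` W))" by (rule openin_inv_image) auto
  moreover have "inv_c ` (S \<inter> in_chart c h -` W) = {p \<in> topspace M. h p \<in> W} \<inter> fst c"
  proof (rule image_eq_by_inverse[where g = "snd c"])
    show "inv_c z \<in> {p \<in> topspace M. h p \<in> W} \<inter> fst c" if "z \<in> S \<inter> in_chart c h -` W" for z
      using that inv_in[of z] dom_subset by (auto simp: in_chart_def)
    show "snd c y \<in> S \<inter> in_chart c h -` W \<and> inv_c (snd c y) = y" if "y \<in> {p \<in> topspace M. h p \<in> W} \<inter> fst c" for y
      using that by (auto simp: in_chart_snd inv_snd)
  qed
  ultimately show "openin M ({p \<in> topspace M. h p \<in> W} \<inter> fst c)" by simp
qed auto

lemma borel_measurable_charts: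
  fixes h :: "'a \<Rightarrow> 'b::topological_space"
  assumes "\<And>c. c \<in> \<A> \<Longrightarrow> continuous_on (snd c ` fst c) (in_chart c h)"
  shows "h \<in> borel_measurable (BM M)"
proof (rule borel_measurableI)
  fix W :: "'b set" assume "open W"
  from openin_BM[OF openin_preimage[OF assms this]]
  have "{p \<in> topspace M. h p \<in> W} \<in> sets (BM M)" by simp
  moreover have "h -` W \<inter> space (BM M) = {p \<in> topspace M. h p \<in> W}" by (auto simp: space_BM)
  ultimately show "h -` W \<inter> space (BM M) \<in> sets (BM M)" by simp
qed

lemma finite_chart_cover:
  obtains C where "finite C" "C \<subseteq> \<A>" "(\<Union>c\<in>C. fst c) = topspace M"
proof -
  have op: "openin M (fst c)" if "c \<in> \<A>" for c using chart.openin_dom[OF chart_axioms_A[OF that]] .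
  have cov: "topspace M \<subseteq> \<Union>(fst ` \<A>)" using cover by blast
  obtain \<F> where \<F>: "finite \<F>" "\<F> \<subseteq> fst ` \<A>" "topspace M \<subseteq> \<Union>\<F>"
    using compact_M cov op unfolding compact_space_def compactin_def by (metis (no_types, lifting) imageE)
  obtain C where C: "finite C" "C \<subseteq> \<A>" "\<F> = fst ` C" using finite_subset_image[OF \<F>(1,2)] by blast
  have "(\<Union>c\<in>C. fst c) = topspace M"
    using \<F>(3) C op openin_subset by (intro equalityI) (auto, blast)
  then show thesis using that C by blast
qed

lemma in_chart_lam:
  assumes c: "c \<in> \<A>"
  shows "continuous_on (snd c ` fst c) (in_chart c (lam c f \<nu>))"
proof -
  have "continuous_on (snd c ` fst c) (\<lambda>z. \<bar>in_chart c (delta c) z\<bar>)"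
    using csmooth_surface(1)[OF c] unfolding csmooth_def by (intro continuous_intros smooth_on_imp_continuous_on)
  then show ?thesis by (simp add: in_chart_def o_def lam_eq)
qed

definition chart_area :: "'a chart \<Rightarrow> 'a measure" where
  "chart_area c = push (snd c ` fst c) (in_chart c (lam c f \<nu>)) (BM M) (inv_into (fst c) (snd c))"

lemma push_chart:
  assumes c: "c \<in> \<A>"
  shows "snd c ` fst c \<in> sets borel" "in_chart c (lam c f \<nu>) \<in> borel_measurable (restrict_space borel (snd c ` fst c))"
    "inv_into (fst c) (snd c) \<in> measurable (restrict_space borel (snd c ` fst c)) (BM M)"
proof -
  interpret chart M c using c by (rule chart_axioms_A)
  show "snd c ` fst c \<in> sets borel" using open_S by simp
  show "in_chart c (lam c f \<nu>) \<in> borel_measurable (restrict_space borel (snd c ` fst c))"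
    by (rule borel_measurable_continuous_on_restrict[OF in_chart_lam[OF c]])
  show "inv_into (fst c) (snd c) \<in> measurable (restrict_space borel (snd c ` fst c)) (BM M)" by (rule inv_measurable)
qed

lemma emeasure_chart_area:
  assumes c: "c \<in> \<A>" and B: "B \<in> sets (BM M)" "B \<subseteq> fst c"
  shows "emeasure (chart_area c) B = (\<integral>\<^sup>+z\<in>snd c ` B. ennreal (in_chart c (lam c f \<nu>) z) \<partial>lborel)"
proof -
  interpret chart M c using c by (rule chart_axioms_A)
  have "{z \<in> S. inv_c z \<in> B} = snd c ` B" using inv_preimage[of B] B(2) by (auto simp: Int_absorb2)
  then show ?thesis unfolding chart_area_def by (simp add: emeasure_push[OF push_chart[OF c] B(1)])
qed

text \<open>The density \<open>lam\<close> changes by the Jacobian determinant of the transition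
  map, which is exactly the factor in the change of variables.\<close>

lemma chart_area_agree:
  assumes cd: "c \<in> \<A>" "d \<in> \<A>" and B: "B \<in> sets (BM M)" "B \<subseteq> fst c" "B \<subseteq> fst d"
  shows "emeasure (chart_area c) B = emeasure (chart_area d) B"
proof -
  interpret c: chart M c using cd by (simp add: chart_axioms_A)
  interpret d: chart M d using cd by (simp add: chart_axioms_A)
  let ?T = "in_chart c (snd d)" and ?inv = "inv_into (fst c) (snd c)"
  have img: "?T ` snd c ` B = snd d ` B" using B by (auto simp: image_image c.in_chart_snd subset_iff)
  have Bb: "snd c ` B \<in> sets borel" "snd d ` B \<in> sets borel"
    using c.image_borel[OF B(1)] d.image_borel[OF B(1)] B by (simp_all add: Int_absorb2)
  have meas: "(\<lambda>z. indicator (snd e ` B) z * in_chart e (lam e f \<nu>) z) \<in> borel_measurable borel" if e: "e \<in> \<A>" "B \<subseteq> fst e" "snd e ` B \<in> sets borel" for e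
  proof -
    have "in_chart e (lam e f \<nu>) \<in> borel_measurable (restrict_space borel (snd e ` B))"
      by (rule borel_measurable_continuous_on_restrict[OF continuous_on_subset[OF in_chart_lam[OF e(1)]]]) (use e in auto)
    then show ?thesis using e(3) by (subst (asm) borel_measurable_restrict_space_iff) auto
  qed
  have lam: "\<bar>det (matrix (trans_map c d (?inv z)))\<bar> * in_chart d (lam d f \<nu>) (?T z) = in_chart c (lam c f \<nu>) z" if z: "z \<in> snd c ` B" for z
  proof -
    obtain p where p: "p \<in> B" "z = snd c p" using z by blast
    then have pp: "p \<in> fst c" "p \<in> fst d" using B by auto
    show ?thesis
      using delta_change(1)[OF cd pp] transition(2)[OF cd pp] pp
      by (simp add: p(2) c.inv_snd c.in_chart_snd d.in_chart_snd lam_eq abs_mult)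
  qed
  have "(\<integral>\<^sup>+z\<in>?T ` snd c ` B. ennreal (in_chart d (lam d f \<nu>) z) \<partial>lborel)
    = (\<integral>\<^sup>+z\<in>snd c ` B. ennreal (\<bar>det (matrix (trans_map c d (?inv z)))\<bar> * in_chart d (lam d f \<nu>) (?T z)) \<partial>lborel)"
  proof (rule nn_integral_change_of_variables_vec[OF Bb(1)])
    fix z assume "z \<in> snd c ` B"
    then obtain p where p: "p \<in> B" "z = snd c p" by blast
    then have pp: "p \<in> fst c" "p \<in> fst d" using B by auto
    show "(?T has_derivative trans_map c d (?inv z)) (at z within snd c ` B)"
      using transition(1)[OF cd pp] pp unfolding p(2) by (simp add: c.inv_snd has_derivative_at_withinI)
  next
    show "inj_on ?T (snd c ` B)"
      using B d.inj by (auto simp: inj_on_def c.in_chart_snd subset_iff) metis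
    have "indicator (snd c ` B) z * (\<bar>det (matrix (trans_map c d (?inv z)))\<bar> * in_chart d (lam d f \<nu>) (?T z)) = indicator (snd c ` B) z * in_chart c (lam c f \<nu>) z" for z
      using lam[of z] by (simp add: indicator_def)
    then show "(\<lambda>z. indicator (snd c ` B) z * (\<bar>det (matrix (trans_map c d (?inv z)))\<bar> * in_chart d (lam d f \<nu>) (?T z))) \<in> borel_measurable borel"
      using meas[OF cd(1) B(2) Bb(1)] by (simp only:)
    show "(\<lambda>z. indicator (?T ` snd c ` B) z * in_chart d (lam d f \<nu>) z) \<in> borel_measurable borel"
      unfolding img by (rule meas[OF cd(2) B(3) Bb(2)])
    show "in_chart d (lam d f \<nu>) z \<ge> 0" for z by (simp add: in_chart_def lam_eq)
  qed
  also have "\<dots> = (\<integral>\<^sup>+z\<in>snd c ` B. ennreal (in_chart c (lam c f \<nu>) z) \<partial>lborel)"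
    using lam by (intro nn_integral_cong) (simp add: indicator_def)
  finally show ?thesis unfolding img emeasure_chart_area[OF cd(1) B(1,2)] emeasure_chart_area[OF cd(2) B(1,3)] by simp
qed

text \<open>The description quantifies over all charts of a possibly uncountable atlas. Gluing uses
  a finite subcover; any other chart is cut up by this subcover, which extends the formula to it.
  Uniqueness is tested on the same subcover.\<close>

lemma area_measure:
  shows "space (area_measure M \<A> f \<nu>) = topspace M" "sets (area_measure M \<A> f \<nu>) = sets (BM M)"
    "\<And>c B. c \<in> \<A> \<Longrightarrow> B \<in> sets (BM M) \<Longrightarrow> B \<subseteq> fst c \<Longrightarrow> emeasure (area_measure M \<A> f \<nu>) B = emeasure (chart_area c) B"
proof -
  let ?spec = "\<lambda>m. space m = topspace M \<and> sets m = borel_sets M \<and>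
     (\<forall>c\<in>\<A>. \<forall>B\<in>borel_sets M. B \<subseteq> fst c \<longrightarrow>
        emeasure m B = (\<integral>\<^sup>+z \<in> snd c ` B. ennreal (in_chart c (lam c f \<nu>) z) \<partial>lborel))"
  obtain C where C: "finite C" "C \<subseteq> \<A>" "(\<Union>c\<in>C. fst c) = topspace M" using finite_chart_cover by blast
  \<comment> \<open>The empty piece keeps the family nonempty when \<open>M\<close> is
    empty.\<close>
  define P where "P = insert ({}, null_measure (BM M)) ((\<lambda>c. (fst c, chart_area c)) ` C)"
  have P: "(A, \<mu>) \<in> P \<longleftrightarrow> (A = {} \<and> \<mu> = null_measure (BM M)) \<or> (\<exists>c\<in>C. A = fst c \<and> \<mu> = chart_area c)" for A \<mu>
    by (auto simp: P_def)
  obtain m where m: "space m = space (BM M)" "sets m = sets (BM M)"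
    "\<And>A \<mu> B. (A, \<mu>) \<in> P \<Longrightarrow> B \<in> sets (BM M) \<Longrightarrow> B \<subseteq> A \<Longrightarrow> emeasure m B = emeasure \<mu> B"
  proof (rule glue_measures_family[of P "BM M"])
    show "countable P" "P \<noteq> {}" using C(1) by (simp_all add: P_def countable_finite)
    show "sets \<mu> = sets (BM M) \<and> A \<in> sets (BM M)" if "(A, \<mu>) \<in> P" for A \<mu>
      using that C(2) chart.dom_BM[OF chart_axioms_A] by (auto simp: P chart_area_def)
    show "(\<Union>(A, \<mu>)\<in>P. A) = space (BM M)" unfolding space_BM C(3)[symmetric] by (auto simp: P_def)
    show "emeasure \<mu> B = emeasure \<mu>' B" if h: "(A, \<mu>) \<in> P" "(A', \<mu>') \<in> P" "B \<in> sets (BM M)" "B \<subseteq> A" "B \<subseteq> A'" for A \<mu> A' \<mu>' B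
    proof (cases "B = {}")
      case False
      then obtain c d where "c \<in> C" "d \<in> C" "A = fst c" "A' = fst d" "\<mu> = chart_area c" "\<mu>' = chart_area d"
        using h by (auto simp: P)
      then show ?thesis using h C(2) chart_area_agree[of c d B] by auto
    qed simp
  qed blast
  have mC: "emeasure m B = emeasure (chart_area c) B" if "c \<in> C" "B \<in> sets (BM M)" "B \<subseteq> fst c" for c B
    using m(3)[OF _ that(2,3)] that(1) by (auto simp: P)
  have all: "emeasure m B = emeasure (chart_area c) B" if c: "c \<in> \<A>" and B: "B \<in> sets (BM M)" "B \<subseteq> fst c" for c B
  proof -
    have cB: "fst c \<in> sets (BM M)" by (rule chart.dom_BM[OF chart_axioms_A[OF c]])
    have "fst c \<inter> space (BM M) = fst c" using sets.sets_into_space[OF cB] by blast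
    then have Vm: "fst c \<inter> space m \<in> sets m" "fst c \<inter> space (chart_area c) \<in> sets (chart_area c)"
      using cB m by (simp_all add: chart_area_def)
    have "restrict_space m (fst c) = restrict_space (chart_area c) (fst c)"
    proof (rule measure_eqI_countable_cover[of _ _ "insert {} ((\<lambda>d. fst d \<inter> fst c) ` C)"])
      show "sets (restrict_space m (fst c)) = sets (restrict_space (chart_area c) (fst c))"
        by (intro sets_restrict_space_cong) (simp add: m chart_area_def)
      show "countable (insert {} ((\<lambda>d. fst d \<inter> fst c) ` C))" using C(1) by (simp add: countable_finite)
      show "insert {} ((\<lambda>d. fst d \<inter> fst c) ` C) \<noteq> {}" by simp
      show "insert {} ((\<lambda>d. fst d \<inter> fst c) ` C) \<subseteq> sets (restrict_space m (fst c))"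
        using C(2) Vm(1) cB m chart.dom_BM[OF chart_axioms_A] by (auto simp: sets_restrict_space_iff)
      show "\<Union> (insert {} ((\<lambda>d. fst d \<inter> fst c) ` C)) = space (restrict_space m (fst c))"
        unfolding space_restrict_space m(1) space_BM using C(3) in_topspace[OF c] by auto
      fix A B assume A: "A \<in> insert {} ((\<lambda>d. fst d \<inter> fst c) ` C)" "B \<in> sets (restrict_space m (fst c))" "B \<subseteq> A"
      then have B: "B \<in> sets (BM M)" "B \<subseteq> fst c" using Vm(1) m by (auto simp: sets_restrict_space_iff)
      show "emeasure (restrict_space m (fst c)) B = emeasure (restrict_space (chart_area c) (fst c)) B"
      proof (cases "B = {}")
        case False
        then obtain d where d: "d \<in> C" "B \<subseteq> fst d" using A by auto
        then show ?thesis
          using mC[OF d(1) B(1) d(2)] chart_area_agree[of d c B] d C(2) c B by (auto simp: emeasure_restrict_space[OF Vm(1) B(2)] emeasure_restrict_space[OF Vm(2) B(2)])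
      qed simp
    qed
    then show ?thesis
      using emeasure_restrict_space[OF Vm(1) B(2)] emeasure_restrict_space[OF Vm(2) B(2)] by simp
  qed
  have spec: "?spec m" using m all emeasure_chart_area by (simp add: space_BM sets_BM[symmetric])
  have "area_measure M \<A> f \<nu> = m"
    unfolding area_measure_def
  proof (rule the_equality[of ?spec m, OF spec])
    fix m' assume m': "?spec m'"
    show "m' = m"
    proof (rule measure_eqI_countable_cover[of _ _ "insert {} (fst ` C)"])
      show "sets m' = sets m" using m' m by (simp add: sets_BM)
      show "countable (insert {} (fst ` C))" "insert {} (fst ` C) \<noteq> {}" using C(1) by (simp_all add: countable_finite)
      show "insert {} (fst ` C) \<subseteq> sets m'"
        using m' C(2) chart.dom_BM[OF chart_axioms_A] by (auto simp: sets_BM[symmetric])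
      show "\<Union> (insert {} (fst ` C)) = space m'" using m' C(3) by auto
      fix A B assume A: "A \<in> insert {} (fst ` C)" "B \<in> sets m'" "B \<subseteq> A"
      show "emeasure m' B = emeasure m B"
      proof (cases "B = {}")
        case False
        then obtain d where d: "d \<in> \<A>" "B \<subseteq> fst d" using A C(2) by auto
        then show ?thesis using m' spec A(2) by auto
      qed simp
    qed
  qed
  then show "space (area_measure M \<A> f \<nu>) = topspace M" "sets (area_measure M \<A> f \<nu>) = sets (BM M)"
    "\<And>c B. c \<in> \<A> \<Longrightarrow> B \<in> sets (BM M) \<Longrightarrow> B \<subseteq> fst c \<Longrightarrow> emeasure (area_measure M \<A> f \<nu>) B = emeasure (chart_area c) B"
    using m all by (simp_all add: space_BM)
qed

lemma area_integral:
  fixes F :: "'a \<Rightarrow> real"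
  assumes c: "c \<in> \<A>" and F: "F \<in> borel_measurable (BM M)" "\<And>q. q \<notin> fst c \<Longrightarrow> F q = 0"
  shows "integrable (area_measure M \<A> f \<nu>) F \<longleftrightarrow> integrable lborel (\<lambda>z. indicator (snd c ` fst c) z * (in_chart c (lam c f \<nu>) z * in_chart c F z))"
    and "(\<integral>q. F q \<partial>area_measure M \<A> f \<nu>) = (\<integral>z. indicator (snd c ` fst c) z * (in_chart c (lam c f \<nu>) z * in_chart c F z) \<partial>lborel)"
proof -
  have "in_chart c (lam c f \<nu>) z \<ge> 0" for z by (simp add: in_chart_def lam_eq)
  note I = integral_push[OF push_chart[OF c] area_measure(2) chart.dom_BM[OF chart_axioms_A[OF c]]
      area_measure(3)[OF c, unfolded chart_area_def] F this]
  show "integrable (area_measure M \<A> f \<nu>) F \<longleftrightarrow> integrable lborel (\<lambda>z. indicator (snd c ` fst c) z * (in_chart c (lam c f \<nu>) z * in_chart c F z))"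
    and "(\<integral>q. F q \<partial>area_measure M \<A> f \<nu>) = (\<integral>z. indicator (snd c ` fst c) z * (in_chart c (lam c f \<nu>) z * in_chart c F z) \<partial>lborel)"
    using I by (simp_all add: in_chart_def)
qed

end

section \<open>Arcs of the singular set\<close>

text \<open>Affine coordinates for the frame produced by \<open>implicit_graph\<close>;
  \<open>plane_u\<close> and \<open>plane_v\<close> solve for them by Cramer's rule with determinant
  1.\<close>

definition plane_pt :: "real^2 \<Rightarrow> real^2 \<Rightarrow> real^2 \<Rightarrow> real \<Rightarrow> real \<Rightarrow> real^2" where
  "plane_pt z0 r1 r2 u v = z0 + u *\<^sub>R r1 + v *\<^sub>R r2"

definition plane_u :: "real^2 \<Rightarrow> real^2 \<Rightarrow> real^2 \<Rightarrow> real^2 \<Rightarrow> real" where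
  "plane_u z0 r1 r2 w = (w - z0)$1 * r2$2 - (w - z0)$2 * r2$1"

definition plane_v :: "real^2 \<Rightarrow> real^2 \<Rightarrow> real^2 \<Rightarrow> real^2 \<Rightarrow> real" where
  "plane_v z0 r1 r2 w = r1$1 * (w - z0)$2 - r1$2 * (w - z0)$1"

lemma plane_coords:
  fixes r1 r2 z0 w :: "real^2"
  assumes det: "r1$1 * r2$2 - r1$2 * r2$1 = 1"
  shows "plane_u z0 r1 r2 (plane_pt z0 r1 r2 u v) = u" "plane_v z0 r1 r2 (plane_pt z0 r1 r2 u v) = v"
    "plane_pt z0 r1 r2 (plane_u z0 r1 r2 w) (plane_v z0 r1 r2 w) = w"
proof -
  have "(u * r1$1 + v * r2$1) * r2$2 - (u * r1$2 + v * r2$2) * r2$1 = u * (r1$1 * r2$2 - r1$2 * r2$1)"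
    "r1$1 * (u * r1$2 + v * r2$2) - r1$2 * (u * r1$1 + v * r2$1) = v * (r1$1 * r2$2 - r1$2 * r2$1)"
    by (simp_all add: algebra_simps)
  then show "plane_u z0 r1 r2 (plane_pt z0 r1 r2 u v) = u" "plane_v z0 r1 r2 (plane_pt z0 r1 r2 u v) = v"
    unfolding det by (simp_all add: plane_u_def plane_v_def plane_pt_def)
  define x y where "x = (w - z0)$1" and "y = (w - z0)$2"
  have "(x * r2$2 - y * r2$1) * r1$1 + (r1$1 * y - r1$2 * x) * r2$1 = x * (r1$1 * r2$2 - r1$2 * r2$1)"
    "(x * r2$2 - y * r2$1) * r1$2 + (r1$1 * y - r1$2 * x) * r2$2 = y * (r1$1 * r2$2 - r1$2 * r2$1)"
    by (simp_all add: algebra_simps)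
  then show "plane_pt z0 r1 r2 (plane_u z0 r1 r2 w) (plane_v z0 r1 r2 w) = w" unfolding det
    by (simp add: plane_u_def plane_v_def plane_pt_def vec_eq_iff forall_2 x_def y_def algebra_simps)
qed

lemma continuous_plane_uv: "continuous_on X (plane_u z0 r1 r2)" "continuous_on X (plane_v z0 r1 r2)"
  unfolding plane_u_def plane_v_def by (intro continuous_intros)+

definition plane_box :: "real^2 \<Rightarrow> real^2 \<Rightarrow> real^2 \<Rightarrow> real \<Rightarrow> real \<Rightarrow> (real^2) set" where
  "plane_box z0 r1 r2 a b = {w. \<bar>plane_u z0 r1 r2 w\<bar> < a \<and> \<bar>plane_v z0 r1 r2 w\<bar> < b}"

lemma open_plane_box: "open (plane_box z0 r1 r2 a b)"
  unfolding plane_box_def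
  by (intro open_Collect_conj open_Collect_less continuous_intros continuous_plane_uv)

definition arc_dom :: "'a chart \<Rightarrow> real^2 \<Rightarrow> real^2 \<Rightarrow> real^2 \<Rightarrow> real \<Rightarrow> real \<Rightarrow> 'a set" where
  "arc_dom c z0 r1 r2 a b = inv_into (fst c) (snd c) ` plane_box z0 r1 r2 a b"

definition arc_curve :: "'a chart \<Rightarrow> real^2 \<Rightarrow> real^2 \<Rightarrow> real^2 \<Rightarrow> (real \<Rightarrow> real) \<Rightarrow> real \<Rightarrow> 'a" where
  "arc_curve c z0 r1 r2 g u = inv_into (fst c) (snd c) (plane_pt z0 r1 r2 u (g u))"

context surface
begin

lemma continuous_curvature: "c \<in> \<A> \<Longrightarrow> C_k_on k (snd c ` fst c) (in_chart c (gaussian_curvature \<A> f))"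
proof -
  assume c: "c \<in> \<A>"
  interpret chart M c using c by (rule chart_axioms_A)
  have "csmooth c (\<lambda>q. delta_sharp c q / delta c q)"
    by (intro csmooth_intros csmooth_surface c delta_nz)
  then have "csmooth c (gaussian_curvature \<A> f)"
    by (rule csmooth_cong) (simp add: gaussian_curvature_eq[OF c])
  then show ?thesis unfolding csmooth_def by (rule smooth_onD)
qed

lemma curvature_zero_iff: "c \<in> \<A> \<Longrightarrow> p \<in> fst c \<Longrightarrow> gaussian_curvature \<A> f p = 0 \<longleftrightarrow> p \<in> Sigma_sharp \<A> f \<nu>"
  using delta_nz by (simp add: gaussian_curvature_eq Sigma_iff)

lemma Sigma_subset: "Sigma_sharp \<A> f \<nu> \<subseteq> topspace M"
  using in_topspace by (auto simp: Sigma_sharp_def)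

text \<open>The singular set is the zero set of the curvature, which is continuous on all of
  \<open>M\<close>, whereas \<open>delta_sharp\<close> depends on the chart.\<close>

lemma Sigma_closed: "openin M (topspace M - Sigma_sharp \<A> f \<nu>)" "Sigma_sharp \<A> f \<nu> \<in> sets (BM M)"
proof -
  have "topspace M - Sigma_sharp \<A> f \<nu> = {p \<in> topspace M. gaussian_curvature \<A> f p \<in> - {0}}"
  proof -
    have "gaussian_curvature \<A> f p = 0 \<longleftrightarrow> p \<in> Sigma_sharp \<A> f \<nu>" if "p \<in> topspace M" for p
      using cover[OF that] curvature_zero_iff by blast
    then show ?thesis by auto
  qed
  moreover have "openin M {p \<in> topspace M. gaussian_curvature \<A> f p \<in> - {0}}"
    using continuous_curvature[of _ 0] by (intro openin_preimage) auto
  ultimately show 1: "openin M (topspace M - Sigma_sharp \<A> f \<nu>)" by simp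
  from sets.compl_sets[OF openin_BM[OF this]] Sigma_subset
  show "Sigma_sharp \<A> f \<nu> \<in> sets (BM M)" by (simp add: space_BM double_diff)
qed

lemma A2_subset: "A2_points M \<A> f \<nu> \<subseteq> Sigma_sharp \<A> f \<nu>"
  by (auto simp: A2_points_def)

text \<open>Gives the iterated derivative in the cusp condition its meaning. As the sign of
  \<open>delta\<close> is locally constant, \<open>along\<close> is locally a combination of the
  components of \<open>\<eta>\<close> and the partial derivatives of
  \<open>delta_sharp\<close>.\<close>

lemma along_cdiff:
  assumes c: "c \<in> \<A>" and nf: "null_field M \<A> c f \<nu> V \<eta>" and q: "q \<in> V"
  shows "cdiff c (along c \<eta> (lam_sharp c f \<nu>)) q" "cdiff c (lam_sharp c f \<nu>) q"
proof -
  interpret chart M c using c by (rule chart_axioms_A)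
  have V: "openin M V" "V \<subseteq> fst c" "smooth_on (snd c ` V) (in_chart c \<eta>)" using nf by (auto simp: null_field_def)
  have qc: "q \<in> fst c" using q V by auto
  have lam: "lam_sharp c f \<nu> = (\<lambda>p. sgn (delta c p) * delta_sharp c p)" by (rule ext) (rule lam_sharp_eq)
  obtain U where U: "openin M U" "U \<subseteq> fst c" "q \<in> U" "\<And>p. p \<in> U \<Longrightarrow> sgn (delta c p) = sgn (delta c q)"
    using delta_sgn_const[OF c qc] by blast
  have k: "cdiff c (\<lambda>p. sgn (delta c q)) p" if "p \<in> fst c" for p by (rule csmooth_cdiff[OF csmooth_intros(1) that])
  show "cdiff c (lam_sharp c f \<nu>) q"
    by (rule differential_cong(2)[OF U(1-3) _ differential_mult(2)[OF k[OF qc] cdiff_surface(7)[OF c qc] qc inj]])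
      (simp add: lam U(4))
  have e: "cdiff c \<eta> q"
    by (rule cdiffI, rule smooth_on_has_derivative[OF V(3)]) (use q in auto)
  have ei: "cdiff c (\<lambda>p. \<eta> p $ i) q" for i
  proof (rule cdiffI)
    show "(in_chart c (\<lambda>p. \<eta> p $ i) has_derivative (\<lambda>x. differential c \<eta> q x $ i)) (at (snd c q))"
      unfolding in_chart_unary[of c "\<lambda>v. v $ i"]
      by (rule bounded_linear.has_derivative[OF bounded_linear_vec_nth cdiff_has_derivative[OF e]])
  qed
  have pd: "cdiff c (partial c i (delta_sharp c)) q" for i
    by (rule csmooth_cdiff[OF _ qc]) (intro csmooth_partial csmooth_surface c)
  note T = differential_mult[OF ei pd qc inj]
  note A = differential_add(2)[OF T(2) T(2), of 1 1 2 2]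
  have kk: "cdiff c (\<lambda>p. sgn (delta c q)) q" by (rule k[OF qc])
  note B = differential_mult(2)[OF kk A qc inj]
  show "cdiff c (along c \<eta> (lam_sharp c f \<nu>)) q"
  proof (rule differential_cong(2)[OF U(1-3) _ B])
    fix p assume p: "p \<in> U"
    then have pc: "p \<in> fst c" using U by auto
    show "sgn (delta c q) * (\<eta> p $ 1 * partial c 1 (delta_sharp c) p + \<eta> p $ 2 * partial c 2 (delta_sharp c) p) = along c \<eta> (lam_sharp c f \<nu>) p"
      unfolding along_def differential_lam_sharp[OF c pc] differential_expand[OF cdiff_surface(7)[OF c pc], of "\<eta> p"]
      by (simp add: U(4)[OF p])
  qed
qed

lemma A2_near:
  assumes c: "c \<in> \<A>" and nf: "null_field M \<A> c f \<nu> V \<eta>" and q: "q \<in> V" "q \<in> Sigma_sharp \<A> f \<nu>" "along c \<eta> (lam_sharp c f \<nu>) q \<noteq> 0"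
  shows "q \<in> A2_points M \<A> f \<nu>"
proof -
  have "q \<in> fst c" using nf q by (auto simp: null_field_def)
  moreover have "nondegenerate c f \<nu> q" using q(3) by (auto simp: nondegenerate_def along_def)
  ultimately show ?thesis using c nf q unfolding A2_points_def by blast
qed

text \<open>The derivative of \<open>lam_sharp\<close> along the null field is continuous and stays
  nonzero near \<open>p\<close>; the same null field then witnesses the fold condition at the
  neighbouring singular points.\<close>

lemma A2_open_nbhd:
  assumes "p \<in> A2_points M \<A> f \<nu>"
  obtains W where "openin M W" "p \<in> W" "W \<inter> Sigma_sharp \<A> f \<nu> \<subseteq> A2_points M \<A> f \<nu>"
proof -
  obtain c V \<eta> where c: "c \<in> \<A>" "p \<in> V" and nf: "null_field M \<A> c f \<nu> V \<eta>" and nz: "along c \<eta> (lam_sharp c f \<nu>) p \<noteq> 0"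
    using assms by (auto simp: A2_points_def)
  interpret chart M c using c by (simp add: chart_axioms_A)
  have V: "openin M V" "V \<subseteq> fst c" using nf by (auto simp: null_field_def)
  have oV: "open (snd c ` V)" using openin_iff_open[OF V(2)] V(1) by simp
  have VS: "snd c ` V \<subseteq> S" using V(2) by blast
  let ?h = "in_chart c (along c \<eta> (lam_sharp c f \<nu>))"
  have "continuous_on (snd c ` V) ?h"
  proof (rule continuous_at_imp_continuous_on, rule ballI)
    fix z assume "z \<in> snd c ` V"
    then obtain q where q: "q \<in> V" "z = snd c q" by blast
    show "isCont ?h z" unfolding q(2)
      by (rule has_derivative_continuous[OF cdiff_has_derivative[OF along_cdiff(1)[OF c(1) nf q(1)]]])
  qed
  then have "open (snd c ` V \<inter> ?h -` (- {0}))" by (intro continuous_open_preimage oV) auto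
  then have W: "openin M (inv_c ` (snd c ` V \<inter> ?h -` (- {0})))" using VS by (intro openin_inv_image) auto
  show thesis
  proof (rule that[OF W])
    have "p = inv_c (snd c p)" "snd c p \<in> snd c ` V \<inter> ?h -` (- {0})"
      using c(2) V(2) nz by (auto simp: inv_snd in_chart_snd subset_iff)
    then show "p \<in> inv_c ` (snd c ` V \<inter> ?h -` (- {0}))" by (rule image_eqI)
    show "inv_c ` (snd c ` V \<inter> ?h -` (- {0})) \<inter> Sigma_sharp \<A> f \<nu> \<subseteq> A2_points M \<A> f \<nu>"
    proof
      fix q assume q: "q \<in> inv_c ` (snd c ` V \<inter> ?h -` (- {0})) \<inter> Sigma_sharp \<A> f \<nu>"
      then obtain q' where "q' \<in> V" "q = inv_c (snd c q')" "?h (snd c q') \<noteq> 0" by auto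
      then have "q \<in> V" "along c \<eta> (lam_sharp c f \<nu>) q \<noteq> 0"
        using V(2) by (auto simp: inv_snd in_chart_snd subset_iff)
      then show "q \<in> A2_points M \<A> f \<nu>" using A2_near[OF c(1) nf] q by blast
    qed
  qed
qed

lemma A2_eq_open_Int:
  obtains W where "openin M W" "A2_points M \<A> f \<nu> = W \<inter> Sigma_sharp \<A> f \<nu>"
proof -
  define W where "W = \<Union>{U. openin M U \<and> U \<inter> Sigma_sharp \<A> f \<nu> \<subseteq> A2_points M \<A> f \<nu>}"
  have "openin M W" unfolding W_def by (intro openin_Union) auto
  moreover have "A2_points M \<A> f \<nu> = W \<inter> Sigma_sharp \<A> f \<nu>"
  proof
    show "A2_points M \<A> f \<nu> \<subseteq> W \<inter> Sigma_sharp \<A> f \<nu>"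
      using A2_subset by (auto simp: W_def elim!: A2_open_nbhd)
  qed (auto simp: W_def)
  ultimately show thesis by (rule that)
qed

lemma A2_BM: "A2_points M \<A> f \<nu> \<in> sets (BM M)"
  using A2_eq_open_Int Sigma_closed(2) openin_BM by (metis sets.Int)

lemma curve_preimage_open:
  assumes c: "c \<in> \<A>" and \<gamma>: "regular_curve c \<gamma> a b" and W: "openin M W"
  shows "open {t \<in> {a<..<b}. \<gamma> t \<in> W}"
proof -
  interpret chart M c using c by (simp add: chart_axioms_A)
  have img: "\<gamma> s \<in> fst c" if "s \<in> {a<..<b}" for s using \<gamma> that by (auto simp: regular_curve_def)
  have "open (snd c ` (W \<inter> fst c))" using openin_iff_open[of "W \<inter> fst c"] W openin_dom by auto
  moreover have "continuous_on {a<..<b} (snd c \<circ> \<gamma>)"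
    using \<gamma> unfolding regular_curve_def by (blast intro: smooth_on_imp_continuous_on)
  ultimately have "open ({a<..<b} \<inter> (snd c \<circ> \<gamma>) -` (snd c ` (W \<inter> fst c)))" by (intro continuous_open_preimage) auto
  moreover have "{a<..<b} \<inter> (snd c \<circ> \<gamma>) -` (snd c ` (W \<inter> fst c)) = {t \<in> {a<..<b}. \<gamma> t \<in> W}"
  proof (intro set_eqI iffI)
    fix t assume t: "t \<in> {a<..<b} \<inter> (snd c \<circ> \<gamma>) -` (snd c ` (W \<inter> fst c))"
    then obtain q where "q \<in> W \<inter> fst c" "snd c (\<gamma> t) = snd c q" by auto
    then show "t \<in> {t \<in> {a<..<b}. \<gamma> t \<in> W}" using t img[of t] inj_onD[OF inj, of "\<gamma> t" q] by auto
  next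
    fix t assume "t \<in> {t \<in> {a<..<b}. \<gamma> t \<in> W}"
    then show "t \<in> {a<..<b} \<inter> (snd c \<circ> \<gamma>) -` (snd c ` (W \<inter> fst c))" using img[of t] by auto
  qed
  ultimately show ?thesis by simp
qed

lemma curve_measurable:
  assumes c: "c \<in> \<A>" and \<gamma>: "regular_curve c \<gamma> a b"
  shows "\<gamma> \<in> measurable (restrict_space borel {a<..<b}) (BM M)"
proof (rule measurable_BM)
  show "\<gamma> z \<in> topspace M" if "z \<in> space (restrict_space borel {a<..<b})" for z
  proof (rule in_topspace[OF c])
    show "\<gamma> z \<in> fst c" using that \<gamma> by (auto simp: space_restrict_space regular_curve_def)
  qed
  fix U assume "openin M U"
  from curve_preimage_open[OF c \<gamma> this]
  have "{t \<in> {a<..<b}. \<gamma> t \<in> U} \<in> sets borel" by simp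
  moreover have "\<gamma> -` U \<inter> {a<..<b} = {t \<in> {a<..<b}. \<gamma> t \<in> U}" by auto
  ultimately show "\<gamma> -` U \<inter> space (restrict_space borel {a<..<b}) \<in> sets (restrict_space borel {a<..<b})"
    by (auto simp: space_restrict_space sets_restrict_space_iff)
qed

lemma curve_preimage_borel:
  assumes c: "c \<in> \<A>" and \<gamma>: "regular_curve c \<gamma> a b" and B: "B \<in> sets (BM M)"
  shows "{t \<in> {a<..<b}. \<gamma> t \<in> B} \<in> sets borel"
proof -
  have "\<gamma> -` B \<inter> {a<..<b} = {t \<in> {a<..<b}. \<gamma> t \<in> B}" by auto
  then show ?thesis using measurable_sets[OF curve_measurable[OF c \<gamma>] B] by (simp add: space_restrict_space sets_restrict_space_iff)
qed

lemma continuous_psi_velocity: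
  assumes c: "c \<in> \<A>" and \<gamma>: "regular_curve c \<gamma> a b"
  shows "continuous_on {a<..<b} (psi_velocity c \<nu> \<gamma>)"
proof (rule continuous_at_imp_continuous_on, rule ballI)
  fix t assume t: "t \<in> {a<..<b}"
  obtain e' where "(psi_velocity c \<nu> \<gamma> has_vector_derivative e') (at t)"
    using psi_velocity_differentiable[OF c \<gamma> t] by blast
  then show "isCont (psi_velocity c \<nu> \<gamma>) t" by (rule has_vector_derivative_continuous)
qed

text \<open>The condition inside the definite description of \<open>length_measure\<close>, named so
  that existence and uniqueness can be argued separately.\<close>

definition weak_length :: "'a measure \<Rightarrow> bool" where
  "weak_length m \<longleftrightarrow>
     space m = topspace M \<and> sets m = borel_sets M \<and>
     emeasure m (topspace M - A2_points M \<A> f \<nu>) = 0 \<and>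
     (\<forall>c\<in>\<A>. \<forall>\<gamma> a b. regular_curve c \<gamma> a b \<and> inj_on \<gamma> {a<..<b} \<and>
          \<gamma> ` {a<..<b} \<subseteq> A2_points M \<A> f \<nu> \<longrightarrow>
        (\<forall>B\<in>sets borel. B \<subseteq> {a<..<b} \<longrightarrow>
           emeasure m (\<gamma> ` B) = (\<integral>\<^sup>+t\<in>B. ennreal (norm (psi_velocity c \<nu> \<gamma> t)) \<partial>lborel)))"

text \<open>Both sides are countably additive in the set of parameters: on the right through the
  auxiliary measure \<open>L\<close> on the interval, on the left because \<open>\<gamma>\<close> is
  injective.\<close>

lemma curve_length_pieces:
  fixes B :: "nat \<Rightarrow> real set"
  assumes c: "c \<in> \<A>" and \<gamma>: "regular_curve c \<gamma> a b" "inj_on \<gamma> {a<..<b}"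
    and B: "\<And>n. B n \<in> sets borel" "\<And>n. B n \<subseteq> {a<..<b}" "disjoint_family B"
    and m: "\<And>n. \<gamma> ` B n \<in> sets m" "\<And>n. emeasure m (\<gamma> ` B n) = (\<integral>\<^sup>+t\<in>B n. ennreal (norm (psi_velocity c \<nu> \<gamma> t)) \<partial>lborel)"
  shows "emeasure m (\<gamma> ` (\<Union>n. B n)) = (\<integral>\<^sup>+t\<in>(\<Union>n. B n). ennreal (norm (psi_velocity c \<nu> \<gamma> t)) \<partial>lborel)"
proof -
  define L where "L = push {a<..<b} (\<lambda>t. norm (psi_velocity c \<nu> \<gamma> t)) borel (\<lambda>t. t)"
  have L: "emeasure L X = (\<integral>\<^sup>+t\<in>X. ennreal (norm (psi_velocity c \<nu> \<gamma> t)) \<partial>lborel)" if X: "X \<in> sets borel" "X \<subseteq> {a<..<b}" for X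
  proof -
    have n: "(\<lambda>t. norm (psi_velocity c \<nu> \<gamma> t)) \<in> borel_measurable (restrict_space borel {a<..<b})"
      by (intro borel_measurable_continuous_on_restrict continuous_on_norm continuous_psi_velocity[OF c \<gamma>(1)])
    have "(\<lambda>t. t) \<in> measurable (restrict_space borel {a<..<b}) borel" by (intro measurable_restrict_space1) simp
    from emeasure_push[OF _ n this X(1)] have "emeasure L X = (\<integral>\<^sup>+t\<in>{t\<in>{a<..<b}. t \<in> X}. ennreal (norm (psi_velocity c \<nu> \<gamma> t)) \<partial>lborel)"
      by (simp add: L_def)
    moreover have "{t\<in>{a<..<b}. t \<in> X} = X" using X by auto
    ultimately show ?thesis by simp
  qed
  have "emeasure m (\<gamma> ` (\<Union>n. B n)) = emeasure m (\<Union>n. \<gamma> ` B n)" by (simp add: image_UN)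
  also have "\<dots> = (\<Sum>n. emeasure m (\<gamma> ` B n))"
  proof (rule suminf_emeasure[symmetric])
    show "range (\<lambda>n. \<gamma> ` B n) \<subseteq> sets m" using m(1) by auto
    show "disjoint_family (\<lambda>n. \<gamma> ` B n)"
    proof (unfold disjoint_family_on_def, intro ballI impI)
      fix i j :: nat assume "i \<noteq> j"
      then have "B i \<inter> B j = {}" using B(3) by (auto simp: disjoint_family_on_def)
      then show "\<gamma> ` B i \<inter> \<gamma> ` B j = {}" using inj_on_image_Int[OF \<gamma>(2) B(2,2)] by (metis image_empty)
    qed
  qed
  also have "\<dots> = (\<Sum>n. emeasure L (B n))" using L[OF B(1,2)] m(2) by simp
  also have "\<dots> = emeasure L (\<Union>n. B n)" by (rule suminf_emeasure) (use B in \<open>auto simp: L_def\<close>)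
  also have "\<dots> = (\<integral>\<^sup>+t\<in>(\<Union>n. B n). ennreal (norm (psi_velocity c \<nu> \<gamma> t)) \<partial>lborel)"
    by (rule L) (use B in auto)
  finally show ?thesis .
qed

end

text \<open>A parallelogram in the chart \<open>c\<close> in which \<open>M_sharp_minus\<close> is
  exactly the part below the graph of \<open>g\<close>; \<open>\<sigma>\<close> is the constant sign
  of \<open>delta\<close>. The graph may leave the box, so the same notion covers points of negative
  curvature, around which a whole box belongs to \<open>M_sharp_minus\<close>.\<close>

locale patch = surface M \<A> f \<nu>
  for M :: "'a topology" and \<A> f \<nu> +
  fixes c :: "'a chart" and z0 r1 r2 :: "real^2" and a b :: real and g :: "real \<Rightarrow> real" and \<sigma> :: real
  assumes cA: "c \<in> \<A>" and det: "r1$1 * r2$2 - r1$2 * r2$1 = 1" and a0: "a > 0" and b0: "b > 0"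
    and g_smooth: "smooth_on {-a<..<a} g"
    and inS: "\<And>u v. \<bar>u\<bar> < a \<Longrightarrow> \<bar>v\<bar> < b \<Longrightarrow> plane_pt z0 r1 r2 u v \<in> snd c ` fst c"
    and sgn_delta: "\<And>q. q \<in> arc_dom c z0 r1 r2 a b \<Longrightarrow> sgn (delta c q) = \<sigma>"
    and neg: "\<And>u v. \<bar>u\<bar> < a \<Longrightarrow> \<bar>v\<bar> < b \<Longrightarrow> \<sigma> * in_chart c (delta_sharp c) (plane_pt z0 r1 r2 u v) < 0 \<longleftrightarrow> v < g u"
    and mnz: "\<And>q. q \<in> arc_dom c z0 r1 r2 a b \<Longrightarrow> mfield c q \<noteq> 0"
begin

sublocale chart M c by (rule chart_axioms_A[OF cA])

abbreviation "pt \<equiv> plane_pt z0 r1 r2"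
abbreviation "cu \<equiv> plane_u z0 r1 r2"
abbreviation "cv \<equiv> plane_v z0 r1 r2"
abbreviation "bx \<equiv> plane_box z0 r1 r2 a b"
abbreviation "V \<equiv> arc_dom c z0 r1 r2 a b"

lemmas coords = plane_coords[OF det, of z0]

lemma bx_S: "bx \<subseteq> S"
proof
  fix w assume "w \<in> bx"
  then have "pt (cu w) (cv w) \<in> S" by (intro inS) (auto simp: plane_box_def)
  then show "w \<in> S" by (simp only: coords)
qed

lemma openin_V: "openin M V" and V_sub: "V \<subseteq> fst c"
  unfolding arc_dom_def by (rule openin_inv_image[OF open_plane_box bx_S]) (use bx_S inv_in in auto)

lemma V_iff: "q \<in> V \<longleftrightarrow> q \<in> fst c \<and> \<bar>cu (snd c q)\<bar> < a \<and> \<bar>cv (snd c q)\<bar> < b"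
proof -
  have "q \<in> V \<longleftrightarrow> q \<in> fst c \<and> snd c q \<in> bx"
    unfolding arc_dom_def using bx_S inv_snd inv_in snd_inv by (auto simp: image_iff subset_iff) metis+
  then show ?thesis by (simp add: plane_box_def)
qed

definition "g' u = frechet_derivative g (at u) 1"

lemma g_deriv: "\<bar>u\<bar> < a \<Longrightarrow> (g has_real_derivative g' u) (at u)"
proof -
  assume "\<bar>u\<bar> < a"
  then have "(g has_derivative frechet_derivative g (at u)) (at u)" by (intro smooth_on_has_derivative[OF g_smooth]) auto
  moreover have "frechet_derivative g (at u) = (\<lambda>h. g' u * h)"
  proof
    fix h
    have "frechet_derivative g (at u) (h *\<^sub>R 1) = h *\<^sub>R frechet_derivative g (at u) 1"
      by (rule linear_cmul[OF has_derivative_linear[OF calculation]])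
    then show "frechet_derivative g (at u) h = g' u * h" by (simp add: g'_def mult.commute)
  qed
  ultimately show ?thesis by (simp add: has_field_derivative_def)
qed

lemma continuous_g': "continuous_on {-a<..<a} g'"
  unfolding g'_def[abs_def] by (rule smooth_on_imp_continuous_on[OF smooth_on_frechet_derivative[OF g_smooth]])

lemma V_BM: "V \<in> sets (BM M)" by (rule openin_BM[OF openin_V])

lemma u_preimage_BM:
  assumes "C \<in> sets borel"
  shows "{q \<in> V. cu (snd c q) \<in> C} \<in> sets (BM M)"
proof -
  have cum: "cu \<in> borel_measurable borel" by (rule borel_measurable_continuous_onI[OF continuous_plane_uv(1)])
  have "(\<lambda>q. cu (snd c q)) \<in> measurable (restrict_space (BM M) (fst c)) borel"
    by (rule measurable_compose[OF snd_measurable cum])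
  from measurable_sets[OF this assms]
  have 1: "(\<lambda>q. cu (snd c q)) -` C \<inter> fst c \<in> sets (BM M)"
    using dom_BM dom_subset by (auto simp: space_restrict_space space_BM Int_absorb2 sets_restrict_space_iff)
  have "{q \<in> V. cu (snd c q) \<in> C} = ((\<lambda>q. cu (snd c q)) -` C \<inter> fst c) \<inter> V" using V_sub by auto
  then show ?thesis using 1 V_BM by auto
qed

end

text \<open>Here the graph stays in the box and is the singular set there. By \<open>dpos\<close>
  the direction \<open>r2\<close> points to the side of increasing \<open>lam_sharp\<close>.\<close>

locale arc = patch M \<A> f \<nu> c z0 r1 r2 a b g \<sigma>
  for M :: "'a topology" and \<A> f \<nu> c z0 r1 r2 a b g \<sigma> +
  assumes gb: "\<And>u. \<bar>u\<bar> < a \<Longrightarrow> \<bar>g u\<bar> < b"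
    and dpos: "\<And>q. q \<in> arc_dom c z0 r1 r2 a b \<Longrightarrow> \<sigma> * differential c (delta_sharp c) q r2 > 0"
    and zero: "\<And>u v. \<bar>u\<bar> < a \<Longrightarrow> \<bar>v\<bar> < b \<Longrightarrow> in_chart c (delta_sharp c) (plane_pt z0 r1 r2 u v) = 0 \<longleftrightarrow> v = g u"
begin

abbreviation "\<gamma> \<equiv> arc_curve c z0 r1 r2 g"
abbreviation "A2 \<equiv> A2_points M \<A> f \<nu>"
abbreviation "\<Sigma> \<equiv> Sigma_sharp \<A> f \<nu>"

lemma gamma_facts:
  assumes "\<bar>u\<bar> < a"
  shows "\<gamma> u \<in> V" "snd c (\<gamma> u) = pt u (g u)" "\<gamma> u \<in> \<Sigma>" "cu (snd c (\<gamma> u)) = u" "\<gamma> u \<in> fst c"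
proof -
  have S: "pt u (g u) \<in> S" by (rule inS[OF assms gb[OF assms]])
  show 1: "snd c (\<gamma> u) = pt u (g u)" unfolding arc_curve_def by (rule snd_inv[OF S])
  show 2: "\<gamma> u \<in> fst c" unfolding arc_curve_def by (rule inv_in[OF S])
  show 3: "cu (snd c (\<gamma> u)) = u" unfolding 1 by (rule coords)
  show "\<gamma> u \<in> V" unfolding V_iff 3 unfolding 1 coords using assms gb 2 by simp
  have "delta_sharp c (\<gamma> u) = 0" using zero[OF assms gb[OF assms]] by (simp add: 1[symmetric] in_chart_snd[OF 2])
  then show "\<gamma> u \<in> \<Sigma>" using Sigma_iff[OF cA 2] by simp
qed

lemma V_Sigma:
  assumes "q \<in> V" "q \<in> \<Sigma>"
  shows "\<bar>cu (snd c q)\<bar> < a" "\<gamma> (cu (snd c q)) = q"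
proof -
  have q: "q \<in> fst c" "\<bar>cu (snd c q)\<bar> < a" "\<bar>cv (snd c q)\<bar> < b" using assms V_iff by auto
  show "\<bar>cu (snd c q)\<bar> < a" by (rule q(2))
  have "delta_sharp c q = 0" using Sigma_iff[OF cA q(1)] assms by simp
  then have "in_chart c (delta_sharp c) (pt (cu (snd c q)) (cv (snd c q))) = 0" unfolding coords by (simp add: in_chart_snd[OF q(1)])
  then have "cv (snd c q) = g (cu (snd c q))" using zero[OF q(2,3)] by simp
  then have "pt (cu (snd c q)) (g (cu (snd c q))) = snd c q" using coords(3)[of "snd c q"] by simp
  then show "\<gamma> (cu (snd c q)) = q" by (simp add: arc_curve_def inv_snd[OF q(1)])
qed

lemma inj_gamma: "inj_on \<gamma> {-a<..<a}"
proof (rule inj_onI)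
  fix x y assume "x \<in> {-a<..<a}" "y \<in> {-a<..<a}" and e: "\<gamma> x = \<gamma> y"
  then have "\<bar>x\<bar> < a" "\<bar>y\<bar> < a" by auto
  then have 1: "cu (snd c (\<gamma> x)) = x" and 2: "cu (snd c (\<gamma> y)) = y" using gamma_facts(4) by blast+
  show "x = y" using arg_cong[OF e, of "\<lambda>q. cu (snd c q)"] unfolding 1 2 .
qed

lemma gamma_velocity:
  assumes "\<bar>u\<bar> < a"
  shows "((snd c \<circ> \<gamma>) has_vector_derivative r1 + g' u *\<^sub>R r2) (at u)" "velocity c \<gamma> u = r1 + g' u *\<^sub>R r2"
proof -
  have u: "u \<in> {-a<..<a}" using assms by auto
  have gv: "(g has_vector_derivative g' u) (at u)"
    using g_deriv[OF assms] by (simp add: has_real_derivative_iff_has_vector_derivative)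
  have "((\<lambda>u. pt u (g u)) has_vector_derivative r1 + g' u *\<^sub>R r2) (at u)"
  proof -
    have "((\<lambda>u. z0 + u *\<^sub>R r1 + g u *\<^sub>R r2) has_vector_derivative (0 + (u *\<^sub>R 0 + 1 *\<^sub>R r1)) + (g u *\<^sub>R 0 + g' u *\<^sub>R r2)) (at u)"
      by (intro has_vector_derivative_add has_vector_derivative_const has_vector_derivative_scaleR DERIV_ident g_deriv[OF assms])
    then show ?thesis by (simp add: plane_pt_def)
  qed
  then show 1: "((snd c \<circ> \<gamma>) has_vector_derivative r1 + g' u *\<^sub>R r2) (at u)"
    by (rule has_vector_derivative_transform_within_open[OF _ open_greaterThanLessThan u]) (simp add: gamma_facts(2) abs_less_iff)
  then show "velocity c \<gamma> u = r1 + g' u *\<^sub>R r2" unfolding velocity_def by (rule vector_derivative_at)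
qed

lemma regular_gamma: "regular_curve c \<gamma> (-a) a"
  unfolding regular_curve_def
proof (intro conjI ballI)
  show "\<gamma> ` {-a<..<a} \<subseteq> fst c" using gamma_facts(5) by auto
  have "smooth_on {-a<..<a} (\<lambda>u. pt u (g u))"
    unfolding plane_pt_def by (intro smooth_on_intros g_smooth open_greaterThanLessThan)
  then show "smooth_on {-a<..<a} (snd c \<circ> \<gamma>)"
    by (subst smooth_on_cong[OF open_greaterThanLessThan, of _ _ _ "\<lambda>u. pt u (g u)"]) (auto simp: gamma_facts(2) abs_less_iff)
  fix u assume "u \<in> {-a<..<a}"
  then have "\<bar>u\<bar> < a" by auto
  have "r1 + g' u *\<^sub>R r2 \<noteq> 0"
  proof
    assume "r1 + g' u *\<^sub>R r2 = 0"
    then have "r1 = - (g' u *\<^sub>R r2)" by (simp add: eq_neg_iff_add_eq_0)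
    then show False using det by simp
  qed
  then show "velocity c \<gamma> u \<noteq> 0" using gamma_velocity(2)[OF \<open>\<bar>u\<bar> < a\<close>] by simp
qed

lemma gamma_Sigma: "\<gamma> ` {-a<..<a} \<subseteq> \<Sigma>"
  using gamma_facts(3) by auto

text \<open>Parameters of fold points. The arc itself passes smoothly through cusps; these are left
  out to match the carrier of the length measure.\<close>

definition "T2 = {u \<in> {-a<..<a}. \<gamma> u \<in> A2}"

lemma open_T2: "open T2"
proof -
  obtain W where "openin M W" "A2 = W \<inter> \<Sigma>" using A2_eq_open_Int by blast
  moreover from this have "T2 = {u \<in> {-a<..<a}. \<gamma> u \<in> W}" unfolding T2_def using gamma_Sigma by auto
  ultimately show ?thesis using curve_preimage_open[OF cA regular_gamma] by simp
qed

lemma T2_sub: "T2 \<subseteq> {-a<..<a}" by (auto simp: T2_def)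

definition "arc_measure = push T2 (\<lambda>u. norm (psi_velocity c \<nu> \<gamma> u)) (BM M) \<gamma>"

lemma push_arc:
  shows "T2 \<in> sets borel" "(\<lambda>u. norm (psi_velocity c \<nu> \<gamma> u)) \<in> borel_measurable (restrict_space borel T2)"
    "\<gamma> \<in> measurable (restrict_space borel T2) (BM M)"
proof -
  show "T2 \<in> sets borel" using open_T2 by simp
  show "(\<lambda>u. norm (psi_velocity c \<nu> \<gamma> u)) \<in> borel_measurable (restrict_space borel T2)"
    by (intro borel_measurable_continuous_on_restrict continuous_on_norm
        continuous_on_subset[OF continuous_psi_velocity[OF cA regular_gamma] T2_sub])
  have "restrict_space (restrict_space borel {-a<..<a}) T2 = restrict_space borel T2"
    using T2_sub open_T2 by (subst restrict_restrict_space) (auto simp: Int_absorb1)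
  then show "\<gamma> \<in> measurable (restrict_space borel T2) (BM M)"
    using measurable_restrict_space1[OF curve_measurable[OF cA regular_gamma], of T2] by simp
qed

lemma emeasure_arc: "B \<in> sets (BM M) \<Longrightarrow>
    emeasure arc_measure B = (\<integral>\<^sup>+u\<in>{u\<in>T2. \<gamma> u \<in> B}. ennreal (norm (psi_velocity c \<nu> \<gamma> u)) \<partial>lborel)"
  unfolding arc_measure_def by (rule emeasure_push[OF push_arc])

lemma gamma_image_BM:
  assumes "C \<in> sets borel" "C \<subseteq> {-a<..<a}"
  shows "\<gamma> ` C \<in> sets (BM M)"
proof -
  have "\<gamma> ` C = {q \<in> V. cu (snd c q) \<in> C} \<inter> \<Sigma>"
  proof (rule image_eq_by_inverse[where g = "\<lambda>q. cu (snd c q)"])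
    fix u assume "u \<in> C"
    then have "\<bar>u\<bar> < a" using assms(2) by (auto simp: abs_less_iff)
    then show "\<gamma> u \<in> {q \<in> V. cu (snd c q) \<in> C} \<inter> \<Sigma>" using gamma_facts \<open>u \<in> C\<close> by simp
  qed (use V_Sigma in auto)
  then show ?thesis using u_preimage_BM[OF assms(1)] Sigma_closed(2) by auto
qed

text \<open>Inside \<open>V\<close> the singular set is the graph, so any other curve in it is
  \<open>\<gamma>\<close> after the parameter change \<open>h\<close>, the first adapted coordinate
  along that curve. The length density changes by \<open>\<bar>h'\<bar>\<close>, as the substitution
  rule requires.\<close>

lemma arc_measure_curve:
  assumes d: "d \<in> \<A>" and \<gamma>': "regular_curve d \<gamma>' a' b'" "inj_on \<gamma>' {a'<..<b'}" "\<gamma>' ` {a'<..<b'} \<subseteq> \<Sigma>"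
    and B: "B \<in> sets borel" "B \<subseteq> {a'<..<b'}" "\<gamma>' ` B \<subseteq> V \<inter> A2"
  shows "\<gamma>' ` B \<in> sets (BM M)" and "emeasure arc_measure (\<gamma>' ` B) = (\<integral>\<^sup>+t\<in>B. ennreal (norm (psi_velocity d \<nu> \<gamma>' t)) \<partial>lborel)"
proof -
  define U where "U = {s \<in> {a'<..<b'}. \<gamma>' s \<in> V}"
  have oU: "open U" unfolding U_def by (rule curve_preimage_open[OF d \<gamma>'(1) openin_V])
  define h where "h s = cu (snd c (\<gamma>' s))" for s
  have BU: "B \<subseteq> U" using B by (auto simp: U_def)
  have U: "s \<in> {a'<..<b'}" "\<gamma>' s \<in> V" "\<gamma>' s \<in> \<Sigma>" "\<bar>h s\<bar> < a" "\<gamma> (h s) = \<gamma>' s" "\<gamma>' s \<in> fst d" "\<gamma>' s \<in> fst c" if s: "s \<in> U" for s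
  proof -
    show 1: "s \<in> {a'<..<b'}" "\<gamma>' s \<in> V" "\<gamma>' s \<in> \<Sigma>" using s \<gamma>'(3) by (auto simp: U_def)
    show "\<bar>h s\<bar> < a" "\<gamma> (h s) = \<gamma>' s" unfolding h_def using V_Sigma[OF 1(2,3)] by auto
    show "\<gamma>' s \<in> fst d" "\<gamma>' s \<in> fst c" using 1 \<gamma>'(1) V_sub by (auto simp: regular_curve_def)
  qed
  have injh: "inj_on h U"
  proof (rule inj_onI)
    fix x y assume x: "x \<in> U" and y: "y \<in> U" and e: "h x = h y"
    have "\<gamma>' x = \<gamma>' y" using U(5)[OF x] U(5)[OF y] e by simp
    then show "x = y" using inj_onD[OF \<gamma>'(2)] U(1)[OF x] U(1)[OF y] by blast
  qed
  have "\<exists>D. (h has_real_derivative D) (at s)" if s: "s \<in> U" for s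
  proof -
    have "cdiff d (snd c) (\<gamma>' s)" by (rule cdiffI[OF transition(1)[OF d cA U(6,7)[OF s]]])
    from chart.along_curve[OF chart_axioms_A[OF d] \<gamma>'(1) U(1)[OF s] this]
    obtain w where w: "((\<lambda>s. snd c (\<gamma>' s)) has_vector_derivative w) (at s)" by blast
    have comp: "((\<lambda>s. (snd c (\<gamma>' s))$i) has_vector_derivative w$i) (at s)" for i
      by (rule bounded_linear.has_vector_derivative[OF bounded_linear_vec_nth w])
    then have comp': "((\<lambda>s. (snd c (\<gamma>' s))$i) has_real_derivative w$i) (at s)" for i
      by (simp add: has_real_derivative_iff_has_vector_derivative)
    have "((\<lambda>s. ((snd c (\<gamma>' s))$1 - z0$1) * r2$2 - ((snd c (\<gamma>' s))$2 - z0$2) * r2$1) has_real_derivative w$1 * r2$2 - w$2 * r2$1) (at s)"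
      by (auto intro!: derivative_eq_intros comp')
    then show ?thesis unfolding h_def plane_u_def by auto
  qed
  then obtain h' where h': "\<And>s. s \<in> U \<Longrightarrow> (h has_real_derivative h' s) (at s)" by metis
  have psi: "psi_velocity d \<nu> \<gamma>' s = h' s *\<^sub>R psi_velocity c \<nu> \<gamma> (h s)" if s: "s \<in> U" for s
  proof -
    have hs: "h s \<in> {-a<..<a}" using U(4)[OF s] by auto
    have "((\<lambda>s. \<nu> (\<gamma>' s)) has_vector_derivative psi_velocity d \<nu> \<gamma>' s) (at s)"
      by (rule psi_velocity_eq[OF d \<gamma>'(1) U(1)[OF s]])
    moreover have "((\<lambda>u. \<nu> (\<gamma> u)) \<circ> h has_vector_derivative h' s *\<^sub>R psi_velocity c \<nu> \<gamma> (h s)) (at s)"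
      using h'[OF s] psi_velocity_eq[OF cA regular_gamma hs]
      by (intro vector_diff_chain_at) (simp_all add: has_real_derivative_iff_has_vector_derivative)
    then have "((\<lambda>s. \<nu> (\<gamma>' s)) has_vector_derivative h' s *\<^sub>R psi_velocity c \<nu> \<gamma> (h s)) (at s)"
      by (rule has_vector_derivative_transform_within_open[OF _ oU s]) (simp add: U(5))
    ultimately show ?thesis by (rule vector_derivative_unique_at)
  qed
  have ch: "continuous_on U h" by (auto intro!: continuous_at_imp_continuous_on DERIV_isCont[OF h'])
  \<comment> \<open>Invariance of domain: an injective continuous \<open>h\<close> on an open set of
    reals is a homeomorphism onto an open set, so it maps Borel sets to Borel sets.\<close>
  obtain k where k: "homeomorphism U (h ` U) h k" using invariance_of_domain_homeomorphism[OF oU ch _ injh] by auto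
  have oh: "open (h ` U)" by (rule invariance_of_domain[OF ch oU injh])
  have "k \<in> borel_measurable (restrict_space borel (h ` U))"
    using k by (intro borel_measurable_continuous_on_restrict) (auto simp: homeomorphism_def)
  from measurable_sets[OF this B(1)] have "k -` B \<inter> h ` U \<in> sets borel"
    using oh by (simp add: space_restrict_space sets_restrict_space_iff)
  moreover have "k -` B \<inter> h ` U = h ` B"
    using k BU by (auto simp: homeomorphism_def image_iff subset_iff)
  ultimately have hB: "h ` B \<in> sets borel" by simp
  have hBa: "h ` B \<subseteq> {-a<..<a}"
  proof
    fix u assume "u \<in> h ` B"
    then obtain x where "x \<in> U" "u = h x" using BU by blast
    then show "u \<in> {-a<..<a}" using U(4)[of x] by auto
  qed
  have img: "\<gamma>' ` B = \<gamma> ` h ` B" using U(5) BU by (auto simp: image_image subset_iff intro!: image_cong)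
  show m: "\<gamma>' ` B \<in> sets (BM M)" unfolding img by (rule gamma_image_BM[OF hB hBa])
  have pre: "{u \<in> T2. \<gamma> u \<in> \<gamma>' ` B} = h ` B"
  proof
    show "{u \<in> T2. \<gamma> u \<in> \<gamma>' ` B} \<subseteq> h ` B"
    proof
      fix u assume u: "u \<in> {u \<in> T2. \<gamma> u \<in> \<gamma>' ` B}"
      then obtain x where x: "x \<in> h ` B" "\<gamma> u = \<gamma> x" unfolding img by auto
      have "u \<in> {-a<..<a}" "x \<in> {-a<..<a}" using u x(1) T2_sub hBa by blast+
      then show "u \<in> h ` B" using inj_onD[OF inj_gamma x(2)] x(1) by simp
    qed
    show "h ` B \<subseteq> {u \<in> T2. \<gamma> u \<in> \<gamma>' ` B}"
      unfolding T2_def using hBa img B(3) by (auto simp: subset_iff)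
  qed
  have meas: "(\<lambda>x. indicator X x * norm (psi_velocity e \<nu> \<beta> x)) \<in> borel_measurable borel"
    if X: "X \<in> sets borel" "X \<subseteq> {l<..<r}" and e: "e \<in> \<A>" "regular_curve e \<beta> l r" for X e \<beta> l r
  proof -
    have "(\<lambda>x. norm (psi_velocity e \<nu> \<beta> x)) \<in> borel_measurable (restrict_space borel X)"
      by (intro borel_measurable_continuous_on_restrict continuous_on_norm continuous_on_subset[OF continuous_psi_velocity[OF e] X(2)])
    then show ?thesis using X(1) by (subst (asm) borel_measurable_restrict_space_iff) auto
  qed
  have "emeasure arc_measure (\<gamma>' ` B) = (\<integral>\<^sup>+u\<in>h ` B. ennreal (norm (psi_velocity c \<nu> \<gamma> u)) \<partial>lborel)"
    unfolding emeasure_arc[OF m] pre ..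
  also have "\<dots> = (\<integral>\<^sup>+t\<in>B. ennreal (\<bar>h' t\<bar> * norm (psi_velocity c \<nu> \<gamma> (h t))) \<partial>lborel)"
  proof (rule nn_integral_change_of_variables_real[OF B(1)])
    show "(h has_real_derivative h' x) (at x)" if "x \<in> B" for x using h' that BU by blast
    show "inj_on h B" using injh BU by (rule inj_on_subset)
    have "indicator B x * (\<bar>h' x\<bar> * norm (psi_velocity c \<nu> \<gamma> (h x))) = indicator B x * norm (psi_velocity d \<nu> \<gamma>' x)" for x
      using psi[of x] BU by (auto simp: indicator_def)
    then show "(\<lambda>x. indicator B x * (\<bar>h' x\<bar> * norm (psi_velocity c \<nu> \<gamma> (h x)))) \<in> borel_measurable borel"
      using meas[OF B(1,2) d \<gamma>'(1)] by (simp only:)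
    show "(\<lambda>x. indicator (h ` B) x * norm (psi_velocity c \<nu> \<gamma> x)) \<in> borel_measurable borel"
      by (rule meas[OF hB hBa cA regular_gamma])
  qed simp
  also have "\<dots> = (\<integral>\<^sup>+t\<in>B. ennreal (norm (psi_velocity d \<nu> \<gamma>' t)) \<partial>lborel)"
    using psi BU by (intro nn_integral_cong) (auto simp: indicator_def)
  finally show "emeasure arc_measure (\<gamma>' ` B) = (\<integral>\<^sup>+t\<in>B. ennreal (norm (psi_velocity d \<nu> \<gamma>' t)) \<partial>lborel)" .
qed

text \<open>The specification speaks only of curves consisting entirely of fold points, so the open
  set \<open>T2\<close> is divided into countably many intervals whose contributions are added. The
  part of \<open>B\<close> outside the fold points is null by the specification.\<close>

lemma weak_length_arc:
  assumes m: "weak_length m" and B: "B \<in> sets (BM M)" "B \<subseteq> V"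
  shows "emeasure m B = emeasure arc_measure B"
proof -
  have sm: "sets m = sets (BM M)" "space m = topspace M" "emeasure m (topspace M - A2) = 0"
    using m by (auto simp: weak_length_def sets_BM)
  have mc: "emeasure m (\<beta> ` X) = (\<integral>\<^sup>+t\<in>X. ennreal (norm (psi_velocity e \<nu> \<beta> t)) \<partial>lborel)"
    if "e \<in> \<A>" "regular_curve e \<beta> l r" "inj_on \<beta> {l<..<r}" "\<beta> ` {l<..<r} \<subseteq> A2" "X \<in> sets borel" "X \<subseteq> {l<..<r}" for e \<beta> l r X
    using m that unfolding weak_length_def by blast
  obtain \<D> where \<D>: "countable \<D>" "\<D> \<subseteq> Pow T2" "\<And>X. X \<in> \<D> \<Longrightarrow> \<exists>l r. X = box l r" "\<Union>\<D> = T2"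
    using open_countable_Union_open_box[OF open_T2] by metis
  define J where "J = from_nat_into (insert {} \<D>)"
  have J: "J n \<in> insert {} \<D>" for n unfolding J_def by (rule from_nat_into) simp
  have JU: "(\<Union>n. J n) = T2" unfolding J_def using \<D>(1,4) by (subst range_from_nat_into) auto
  have Jlr: "\<exists>l r. J n = {l<..<r}" for n
  proof (cases "J n = {}")
    case True then show ?thesis by (intro exI[of _ 0]) simp
  next
    case False
    then obtain l r where "J n = box l r" using J[of n] \<D>(3) by blast
    then show ?thesis by (auto simp: box_real)
  qed
  have JT: "J n \<subseteq> T2" for n using JU by blast
  have Jb: "J n \<in> sets borel" for n using Jlr[of n] by auto
  define C where "C = {u \<in> T2. \<gamma> u \<in> B}"
  have Cb: "C \<in> sets borel"
  proof -
    have "C = {u \<in> {-a<..<a}. \<gamma> u \<in> B} \<inter> T2" using T2_sub by (auto simp: C_def)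
    then show ?thesis using curve_preimage_borel[OF cA regular_gamma B(1)] push_arc(1) by auto
  qed
  have Dj: "disjointed J n \<in> sets borel" for n using sets.range_disjointed_sets[of J borel] Jb by auto
  let ?P = "\<lambda>n. C \<inter> disjointed J n"
  have PU: "(\<Union>n. ?P n) = C" using UN_disjointed_eq[of J] JU by (auto simp: C_def)
  have Psub: "?P n \<subseteq> J n" "?P n \<subseteq> {-a<..<a}" for n using disjointed_subset[of J n] T2_sub by (auto simp: C_def)
  have dis: "disjoint_family ?P" using disjoint_family_disjointed[of J] by (auto simp: disjoint_family_on_def)
  have "emeasure m (\<gamma> ` (\<Union>n. ?P n)) = (\<integral>\<^sup>+t\<in>(\<Union>n. ?P n). ennreal (norm (psi_velocity c \<nu> \<gamma> t)) \<partial>lborel)"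
  proof (rule curve_length_pieces[OF cA regular_gamma inj_gamma])
    show "?P n \<in> sets borel" for n using Cb Dj by auto
    show "\<gamma> ` ?P n \<in> sets m" for n unfolding sm by (rule gamma_image_BM) (use Cb Dj Psub in auto)
    show "emeasure m (\<gamma> ` ?P n) = (\<integral>\<^sup>+t\<in>?P n. ennreal (norm (psi_velocity c \<nu> \<gamma> t)) \<partial>lborel)" for n
    proof -
      obtain l r where lr: "J n = {l<..<r}" using Jlr by blast
      have sub: "{l<..<r} \<subseteq> {-a<..<a}" using JT[of n] T2_sub unfolding lr by blast
      show ?thesis
      proof (rule mc[OF cA, of \<gamma> l r])
        show "regular_curve c \<gamma> l r"
          using regular_gamma sub smooth_on_subset[OF _ sub] unfolding regular_curve_def by blast
        show "inj_on \<gamma> {l<..<r}" using inj_gamma sub by (rule inj_on_subset)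
        show "\<gamma> ` {l<..<r} \<subseteq> A2" using JT[of n] unfolding lr T2_def by blast
        show "?P n \<in> sets borel" using Cb Dj by auto
        show "?P n \<subseteq> {l<..<r}" using Psub(1)[of n] lr by simp
      qed
    qed
  qed (use Psub(2) dis in auto)
  then have 1: "emeasure m (\<gamma> ` C) = emeasure arc_measure B" by (simp only: PU emeasure_arc[OF B(1)] C_def[symmetric])
  have BA: "B \<inter> A2 = \<gamma> ` C"
  proof
    show "B \<inter> A2 \<subseteq> \<gamma> ` C"
    proof
      fix q assume q: "q \<in> B \<inter> A2"
      then have "q \<in> V" "q \<in> \<Sigma>" using B A2_subset by auto
      from V_Sigma[OF this] q show "q \<in> \<gamma> ` C" by (intro image_eqI[of _ _ "cu (snd c q)"]) (auto simp: C_def T2_def)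
    qed
  qed (auto simp: C_def T2_def)
  have "emeasure m B = emeasure m (B \<inter> A2) + emeasure m (B - A2)"
    using B(1) A2_BM sm by (subst plus_emeasure) (auto intro!: arg_cong[where f = "emeasure m"])
  moreover have "emeasure m (B - A2) = 0"
  proof -
    have "emeasure m (B - A2) \<le> emeasure m (topspace M - A2)"
      using sets.sets_into_space[OF B(1)] A2_BM sm by (intro emeasure_mono) (auto simp: space_BM intro!: sets.Diff sets.top[of "BM M", unfolded space_BM])
    then show ?thesis using sm(3) by simp
  qed
  ultimately show ?thesis using 1 BA by simp
qed

end

section \<open>The length measure\<close>

context surface
begin

text \<open>\<open>delta_sharp\<close> is quadratic in the derivative of \<open>\<nu>\<close>; where
  that derivative vanishes, so does the differential of \<open>delta_sharp\<close>. Hence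
  \<open>\<nu>\<close> does not have rank 0 at a non-degenerate point, and \<open>mfield\<close> is
  nonzero at a non-degenerate singular point.\<close>

lemma delta_sharp_nondeg:
  assumes c: "c \<in> \<A>" "p \<in> fst c" and nd: "differential c (delta_sharp c) p \<zeta> \<noteq> 0"
  shows "partial c 1 \<nu> p \<noteq> 0 \<or> partial c 2 \<nu> p \<noteq> 0"
proof (rule ccontr)
  interpret chart M c using c by (simp add: chart_axioms_A)
  assume "\<not> (partial c 1 \<nu> p \<noteq> 0 \<or> partial c 2 \<nu> p \<noteq> 0)"
  then have 0: "partial c 1 \<nu> p = 0" "partial c 2 \<nu> p = 0" by auto
  have d: "cdiff c (partial c i \<nu>) p" for i by (rule cdiff_surface(4)[OF c])
  note X = differential_cross3[OF d d c(2) inj, of 1 2]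
  have "delta_sharp c = (\<lambda>q. cross3 (partial c 1 \<nu> q) (partial c 2 \<nu> q) \<bullet> \<nu> q)" by (rule ext) (simp add: delta_sharp_def)
  then have "differential c (delta_sharp c) p \<zeta> = 0"
    using differential_inner(1)[OF X(2) cdiff_surface(2)[OF c] c(2) inj, of \<zeta>] X(1)[of \<zeta>] by (simp add: 0)
  then show False using nd by simp
qed

lemma csmooth_imp_continuous: "csmooth c h \<Longrightarrow> continuous_on (snd c ` fst c) (in_chart c h)"
  unfolding csmooth_def by (rule smooth_on_imp_continuous_on)

lemma patch_region:
  assumes c: "c \<in> \<A>" "p \<in> fst c" and m: "mfield c p \<noteq> 0"
  obtains W where "open W" "W \<subseteq> snd c ` fst c" "snd c p \<in> W"
    "\<And>q. q \<in> fst c \<Longrightarrow> snd c q \<in> W \<Longrightarrow> sgn (delta c q) = sgn (delta c p) \<and> mfield c q \<noteq> 0"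
proof -
  interpret chart M c using c by (simp add: chart_axioms_A)
  obtain U where U: "openin M U" "U \<subseteq> fst c" "p \<in> U" "\<And>q. q \<in> U \<Longrightarrow> sgn (delta c q) = sgn (delta c p)"
    using delta_sgn_const[OF c] by blast
  have "open (S \<inter> in_chart c (mfield c) -` (- {0}))"
    by (rule continuous_open_preimage[OF csmooth_imp_continuous[OF csmooth_surface(4)[OF c(1)]] open_S]) auto
  moreover have "open (snd c ` U)" using openin_iff_open[OF U(2)] U(1) by simp
  ultimately have o: "open ((S \<inter> in_chart c (mfield c) -` (- {0})) \<inter> snd c ` U)" by (rule open_Int)
  show thesis
  proof (rule that[OF o])
    show "snd c p \<in> (S \<inter> in_chart c (mfield c) -` (- {0})) \<inter> snd c ` U" using U(3) m c by (simp add: in_chart_snd)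
    fix q assume q: "q \<in> fst c" "snd c q \<in> (S \<inter> in_chart c (mfield c) -` (- {0})) \<inter> snd c ` U"
    then obtain q' where "q' \<in> U" "snd c q = snd c q'" by auto
    then have "q \<in> U" using inj_onD[OF inj] q(1) U(2) by blast
    then show "sgn (delta c q) = sgn (delta c p) \<and> mfield c q \<noteq> 0" using U(4) q by (simp add: in_chart_snd)
  qed auto
qed

lemma frechet_delta_sharp:
  assumes "c \<in> \<A>" "q \<in> fst c"
  shows "frechet_derivative (in_chart c (delta_sharp c)) (at (snd c q)) = differential c (delta_sharp c) q"
  by (simp add: differential_def)

lemma arc_exists:
  assumes c: "c \<in> \<A>" "p \<in> fst c" and p: "p \<in> Sigma_sharp \<A> f \<nu>" and nd: "differential c (delta_sharp c) p \<zeta> \<noteq> 0"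
  obtains z0 r1 r2 a b g \<sigma> where "arc M \<A> f \<nu> c z0 r1 r2 a b g \<sigma>" "p \<in> arc_dom c z0 r1 r2 a b"
proof -
  interpret chart M c using c by (simp add: chart_axioms_A)
  have z: "delta_sharp c p = 0" using Sigma_iff[OF c] p by simp
  have m: "mfield c p \<noteq> 0" by (rule mfield_nz[OF c _ delta_sharp_nondeg[OF c nd]]) (simp add: z)
  obtain W where W: "open W" "W \<subseteq> S" "snd c p \<in> W"
    "\<And>q. q \<in> fst c \<Longrightarrow> snd c q \<in> W \<Longrightarrow> sgn (delta c q) = sgn (delta c p) \<and> mfield c q \<noteq> 0"
    using patch_region[OF c m] by blast
  define \<sigma> where "\<sigma> = sgn (delta c p)"
  have s: "\<sigma> \<noteq> 0" "\<sigma> * \<sigma> = 1" using delta_nz[OF c] by (auto simp: \<sigma>_def sgn_zero_iff sgn_mult_self_eq)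
  \<comment> \<open>The sign turns \<open>delta_sharp\<close> into \<open>lam_sharp\<close> near
    \<open>p\<close>, so that \<open>L < 0\<close> describes \<open>M_sharp_minus\<close>.\<close>
  define L where "L z = \<sigma> * in_chart c (delta_sharp c) z" for z
  have sm: "smooth_on W (in_chart c (delta_sharp c))"
    using smooth_on_subset[OF csmooth_surface(2)[OF c(1), unfolded csmooth_def] W(2)] .
  have smL: "smooth_on W L" unfolding L_def[abs_def] by (intro smooth_on_intros W(1) sm)
  have DL: "frechet_derivative L (at w) v = \<sigma> * frechet_derivative (in_chart c (delta_sharp c)) (at w) v" if "w \<in> W" for w v
  proof -
    have "(L has_derivative (\<lambda>v. \<sigma> * frechet_derivative (in_chart c (delta_sharp c)) (at w) v)) (at w)"
      unfolding L_def[abs_def] by (rule has_derivative_mult_right[OF smooth_on_has_derivative[OF sm that]])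
    from frechet_derivative_at[OF this] show ?thesis by metis
  qed
  have L0: "L (snd c p) = 0" using z by (simp add: L_def in_chart_snd[OF c(2)])
  have "frechet_derivative L (at (snd c p)) \<zeta> \<noteq> 0"
    unfolding DL[OF W(3)] frechet_delta_sharp[OF c] using nd s by simp
  from implicit_graph[OF W(1,3) smL L0 this]
  obtain r1 r2 :: "real^2" and a b g where I: "r1$1 * r2$2 - r1$2 * r2$1 = 1" "a > 0" "b > 0" "smooth_on {-a<..<a} g" "g 0 = 0"
    "\<And>u. \<bar>u\<bar> < a \<Longrightarrow> \<bar>g u\<bar> < b"
    "\<And>u v. \<bar>u\<bar> < a \<Longrightarrow> \<bar>v\<bar> < b \<Longrightarrow> snd c p + u *\<^sub>R r1 + v *\<^sub>R r2 \<in> W"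
    "\<And>u v. \<bar>u\<bar> < a \<Longrightarrow> \<bar>v\<bar> < b \<Longrightarrow> frechet_derivative L (at (snd c p + u *\<^sub>R r1 + v *\<^sub>R r2)) r2 > 0"
    "\<And>u v. \<bar>u\<bar> < a \<Longrightarrow> \<bar>v\<bar> < b \<Longrightarrow> L (snd c p + u *\<^sub>R r1 + v *\<^sub>R r2) < 0 \<longleftrightarrow> v < g u"
    "\<And>u v. \<bar>u\<bar> < a \<Longrightarrow> \<bar>v\<bar> < b \<Longrightarrow> L (snd c p + u *\<^sub>R r1 + v *\<^sub>R r2) = 0 \<longleftrightarrow> v = g u"
    by blast
  note I' = I(7-10)[folded plane_pt_def]
  have dom: "q \<in> fst c \<and> snd c q \<in> W \<and> frechet_derivative L (at (snd c q)) r2 > 0" if q: "q \<in> arc_dom c (snd c p) r1 r2 a b" for q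
  proof -
    obtain w where w: "w \<in> plane_box (snd c p) r1 r2 a b" "q = inv_c w" using q unfolding arc_dom_def by blast
    have uv: "\<bar>plane_u (snd c p) r1 r2 w\<bar> < a" "\<bar>plane_v (snd c p) r1 r2 w\<bar> < b" using w(1) by (auto simp: plane_box_def)
    have "w \<in> W" "frechet_derivative L (at w) r2 > 0" using I'(1,2)[OF uv] unfolding plane_coords[OF I(1)] by auto
    then show ?thesis using W(2) w(2) by (auto simp: inv_in snd_inv subset_iff)
  qed
  have "arc M \<A> f \<nu> c (snd c p) r1 r2 a b g \<sigma>"
  proof unfold_locales
    show "c \<in> \<A>" "r1$1 * r2$2 - r1$2 * r2$1 = 1" "a > 0" "b > 0" "smooth_on {-a<..<a} g" by (rule c I)+
    show "\<And>u. \<bar>u\<bar> < a \<Longrightarrow> \<bar>g u\<bar> < b" by (rule I)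
    show "plane_pt (snd c p) r1 r2 u v \<in> S" if "\<bar>u\<bar> < a" "\<bar>v\<bar> < b" for u v using I'(1)[OF that] W(2) by blast
    show "sgn (delta c q) = \<sigma>" "mfield c q \<noteq> 0" if "q \<in> arc_dom c (snd c p) r1 r2 a b" for q
      using dom[OF that] W(4)[of q] by (auto simp: \<sigma>_def)
    show "0 < \<sigma> * differential c (delta_sharp c) q r2" if "q \<in> arc_dom c (snd c p) r1 r2 a b" for q
      using dom[OF that] DL[of "snd c q" r2] frechet_delta_sharp[OF c(1), of q] by simp
    show "\<sigma> * in_chart c (delta_sharp c) (plane_pt (snd c p) r1 r2 u v) < 0 \<longleftrightarrow> v < g u"
      "in_chart c (delta_sharp c) (plane_pt (snd c p) r1 r2 u v) = 0 \<longleftrightarrow> v = g u" if "\<bar>u\<bar> < a" "\<bar>v\<bar> < b" for u v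
      using I'(3,4)[OF that] s by (auto simp: L_def)
  qed
  moreover have "p \<in> arc_dom c (snd c p) r1 r2 a b"
    unfolding arc_dom_def
    by (rule image_eqI[of _ _ "snd c p"]) (use inv_snd[OF c(2)] I(2,3) in \<open>auto simp: plane_box_def plane_u_def plane_v_def\<close>)
  ultimately show thesis by (rule that)
qed

text \<open>Hides the parameters of an arc, so that arcs from different charts can be collected in
  one finite family. The measure is the one called \<open>arc_measure\<close> inside the
  locale.\<close>

definition is_arc :: "'a set \<Rightarrow> 'a measure \<Rightarrow> bool" where
  "is_arc V \<mu> \<longleftrightarrow> (\<exists>c z0 r1 r2 a b g \<sigma>. arc M \<A> f \<nu> c z0 r1 r2 a b g \<sigma> \<and> V = arc_dom c z0 r1 r2 a b \<and>
     \<mu> = push {u \<in> {-a<..<a}. arc_curve c z0 r1 r2 g u \<in> A2_points M \<A> f \<nu>}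
       (\<lambda>u. norm (psi_velocity c \<nu> (arc_curve c z0 r1 r2 g) u)) (BM M) (arc_curve c z0 r1 r2 g))"

end

context arc
begin

lemma is_arc_V: "is_arc V arc_measure"
  unfolding is_arc_def arc_measure_def T2_def using arc_axioms by blast

lemma arc_measure_A2:
  assumes B: "B \<in> sets (BM M)"
  shows "emeasure arc_measure B = emeasure arc_measure (B \<inter> A2)"
proof -
  have "{u \<in> T2. \<gamma> u \<in> B} = {u \<in> T2. \<gamma> u \<in> B \<inter> A2}" by (auto simp: T2_def)
  then show ?thesis using emeasure_arc[OF B] emeasure_arc[of "B \<inter> A2"] B A2_BM by auto
qed

lemma arc_measure_null: "B \<in> sets (BM M) \<Longrightarrow> B \<inter> A2 = {} \<Longrightarrow> emeasure arc_measure B = 0"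
  using arc_measure_A2[of B] by simp

text \<open>At a fold the null direction is transversal to the singular set, so the velocity is not
  null. Decompose a null vector along the velocity and \<open>r2\<close>: its coefficient at
  \<open>r2\<close> is its determinant with the velocity, and it is also the factor between its
  derivative of \<open>delta_sharp\<close> and that of \<open>r2\<close>. Making this coefficient
  positive settles orientation and sign together.\<close>

lemma psi_nonzero:
  assumes u: "u \<in> T2"
  shows "psi_velocity c \<nu> \<gamma> u \<noteq> 0"
    and "\<exists>\<eta>. differential c \<nu> (\<gamma> u) \<eta> = 0 \<and> velocity c \<gamma> u $ 1 * \<eta>$2 - velocity c \<gamma> u $ 2 * \<eta>$1 > 0 \<and>
      sgn (differential c (delta_sharp c) (\<gamma> u) \<eta>) = \<sigma>"
proof -
  have ua: "\<bar>u\<bar> < a" "u \<in> {-a<..<a}" using u by (auto simp: T2_def)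
  note G = gamma_facts[OF ua(1)]
  let ?p = "\<gamma> u" and ?v = "velocity c \<gamma> u"
  have z: "delta_sharp c ?p = 0" using Sigma_iff[OF cA G(5)] G(3) by simp
  obtain d V' \<eta> where d: "d \<in> \<A>" "?p \<in> V'" and nf: "null_field M \<A> d f \<nu> V' \<eta>" and nz: "along d \<eta> (lam_sharp d f \<nu>) ?p \<noteq> 0"
    using u by (auto simp: T2_def A2_points_def)
  have pd: "?p \<in> fst d" using d nf by (auto simp: null_field_def)
  have ker: "{\<zeta>. differential d \<nu> ?p \<zeta> = 0} = span {\<eta> ?p}" using nf d(2) G(3) by (auto simp: null_field_def)
  note cd = cA d(1) G(5) pd and dc = d(1) cA pd G(5)
  have nz': "differential d (delta_sharp d) ?p (\<eta> ?p) \<noteq> 0"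
    using nz unfolding along_def differential_lam_sharp[OF d(1) pd] by auto
  have zd: "delta_sharp d ?p = 0" using Sigma_iff[OF d(1) pd] G(3) by simp
  have tan: "differential c (delta_sharp c) ?p ?v = 0" by (rule singular_curve_tangent[OF cA regular_gamma gamma_Sigma ua(2)])
  have tand: "differential d (delta_sharp d) ?p (trans_map c d ?p ?v) = 0"
    using tan differential_delta_sharp_change[OF cd zd, of ?v] transition(2)[OF cd] by simp
  have vr: "?v = r1 + g' u *\<^sub>R r2" by (rule gamma_velocity(2)[OF ua(1)])
  have vdet: "?v$1 * r2$2 - ?v$2 * r2$1 = 1" unfolding vr using det by (simp add: algebra_simps)
  show "psi_velocity c \<nu> \<gamma> u \<noteq> 0"
  proof
    assume "psi_velocity c \<nu> \<gamma> u = 0"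
    then have "differential c \<nu> ?p ?v = 0" by (simp add: psi_velocity_def)
    then have "differential d \<nu> ?p (trans_map c d ?p ?v) = 0" using chart_change(1)[OF cd cdiff_surface(2)[OF d(1) pd]] by simp
    then obtain s where s: "trans_map c d ?p ?v = s *\<^sub>R \<eta> ?p" using ker by (auto simp: span_singleton)
    have "s * differential d (delta_sharp d) ?p (\<eta> ?p) = 0"
      using tand unfolding s linear_cmul[OF linear_differential[OF cdiff_surface(7)[OF d(1) pd]]] by simp
    then have "s = 0" using nz' by simp
    then have "trans_map c d ?p ?v = 0" using s by simp
    then have "det (matrix (trans_map c d ?p)) * (?v$1 * r2$2 - ?v$2 * r2$1) = 0"
      using trans_map_det_pair[OF cd, of ?v r2] by simp
    then show False using vdet transition(2)[OF cd] by simp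
  qed
  define \<eta>' where "\<eta>' = trans_map d c ?p (\<eta> ?p)"
  have k: "differential c \<nu> ?p \<eta>' = 0"
  proof -
    have "differential d \<nu> ?p (\<eta> ?p) = 0" using ker span_base[of "\<eta> ?p" "{\<eta> ?p}"] by auto
    then show ?thesis unfolding \<eta>'_def using chart_change(1)[OF dc cdiff_surface(2)[OF cA G(5)]] by simp
  qed
  have n: "differential c (delta_sharp c) ?p \<eta>' \<noteq> 0"
    using nz' unfolding \<eta>'_def differential_delta_sharp_change[OF dc z] by simp
  define \<beta> where "\<beta> = ?v$1 * \<eta>'$2 - ?v$2 * \<eta>'$1"
  define \<alpha> where "\<alpha> = \<eta>'$1 * r2$2 - \<eta>'$2 * r2$1"
  have dec: "\<eta>' = \<alpha> *\<^sub>R ?v + \<beta> *\<^sub>R r2"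
  proof -
    have "\<alpha> * ?v$1 + \<beta> * r2$1 = \<eta>'$1 * (?v$1 * r2$2 - ?v$2 * r2$1)" "\<alpha> * ?v$2 + \<beta> * r2$2 = \<eta>'$2 * (?v$1 * r2$2 - ?v$2 * r2$1)"
      by (simp_all add: \<alpha>_def \<beta>_def algebra_simps)
    then show ?thesis unfolding vdet by (simp add: vec_eq_iff forall_2)
  qed
  have lin: "linear (differential c (delta_sharp c) ?p)" "linear (differential c \<nu> ?p)"
    by (rule linear_differential[OF cdiff_surface(7)[OF cA G(5)]], rule linear_differential[OF cdiff_surface(2)[OF cA G(5)]])
  have D\<eta>: "differential c (delta_sharp c) ?p \<eta>' = \<beta> * differential c (delta_sharp c) ?p r2"
    by (subst dec) (simp add: linear_add[OF lin(1)] linear_cmul[OF lin(1)] tan)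
  then have \<beta>: "\<beta> \<noteq> 0" using n by auto
  have "\<sigma> \<noteq> 0" using sgn_delta[OF G(1)] delta_nz[OF cA G(5)] by (auto simp: sgn_zero_iff)
  have s1: "\<sigma> = 1 \<or> \<sigma> = -1" using sgn_delta[OF G(1)] delta_nz[OF cA G(5)] by (auto simp: sgn_if split: if_splits)
  have sr: "sgn (differential c (delta_sharp c) ?p r2) = \<sigma>" using dpos[OF G(1)] s1 by auto
  show "\<exists>\<eta>. differential c \<nu> ?p \<eta> = 0 \<and> ?v $ 1 * \<eta>$2 - ?v $ 2 * \<eta>$1 > 0 \<and> sgn (differential c (delta_sharp c) ?p \<eta>) = \<sigma>"
  proof (intro exI[of _ "sgn \<beta> *\<^sub>R \<eta>'"] conjI)
    show "differential c \<nu> ?p (sgn \<beta> *\<^sub>R \<eta>') = 0" by (simp add: linear_cmul[OF lin(2)] k)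
    have "?v $ 1 * (sgn \<beta> *\<^sub>R \<eta>')$2 - ?v $ 2 * (sgn \<beta> *\<^sub>R \<eta>')$1 = sgn \<beta> * \<beta>" by (simp add: \<beta>_def algebra_simps)
    then show "?v $ 1 * (sgn \<beta> *\<^sub>R \<eta>')$2 - ?v $ 2 * (sgn \<beta> *\<^sub>R \<eta>')$1 > 0" using \<beta> by (simp add: sgn_if)
    have "differential c (delta_sharp c) ?p (sgn \<beta> *\<^sub>R \<eta>') = \<bar>\<beta>\<bar> * differential c (delta_sharp c) ?p r2"
      unfolding linear_cmul[OF lin(1)] D\<eta> by (simp add: abs_sgn)
    then show "sgn (differential c (delta_sharp c) ?p (sgn \<beta> *\<^sub>R \<eta>')) = \<sigma>" using \<beta> sr by (simp add: sgn_mult)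
  qed
qed

lemma curvature_on_arc:
  assumes u: "u \<in> T2"
  shows "singular_curvature \<A> f \<nu> (\<gamma> u) = \<sigma> * omega c (\<gamma> u) (velocity c \<gamma> u) / norm (psi_velocity c \<nu> \<gamma> u)"
proof -
  obtain e where e: "e > 0" "ball u e \<subseteq> T2" using open_T2 u open_contains_ball by blast
  let ?l = "u - e" and ?r = "u + e"
  have sub: "{?l<..<?r} \<subseteq> T2" using e(2) by (simp add: ball_eq_greaterThanLessThan)
  then have sub': "{?l<..<?r} \<subseteq> {-a<..<a}" using T2_sub by blast
  obtain \<eta> where \<eta>: "differential c \<nu> (\<gamma> u) \<eta> = 0" "velocity c \<gamma> u $ 1 * \<eta>$2 - velocity c \<gamma> u $ 2 * \<eta>$1 > 0"
      "sgn (differential c (delta_sharp c) (\<gamma> u) \<eta>) = \<sigma>" using psi_nonzero(2)[OF u] by blast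
  have ua: "\<bar>u\<bar> < a" using u by (auto simp: T2_def)
  have "differential c (delta_sharp c) (\<gamma> u) r2 \<noteq> 0" using dpos[OF gamma_facts(1)[OF ua]] by auto
  then have "singular_curvature \<A> f \<nu> (\<gamma> u) = curv c (\<gamma> u) (velocity c \<gamma> u) \<eta>"
  proof (rule singular_curvature_eq_curv[OF cA _ _ _ _ \<eta>(1,2), rotated -1])
    show "regular_curve c \<gamma> ?l ?r"
      using regular_gamma sub' smooth_on_subset[OF _ sub'] unfolding regular_curve_def by blast
    show "\<gamma> ` {?l<..<?r} \<subseteq> \<Sigma>" using gamma_Sigma sub' by blast
    show "u \<in> {?l<..<?r}" using e by simp
    show "psi_velocity c \<nu> \<gamma> s \<noteq> 0" if "s \<in> {?l<..<?r}" for s using psi_nonzero(1) sub that by blast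
  qed
  then show ?thesis by (simp add: curv_def \<eta>(3) psi_velocity_def)
qed

end

section \<open>Arc covers of the singular set and existence of the length measure\<close>

locale folds_cusps = surface +
  assumes A2A3: "Sigma_sharp \<A> f \<nu> = A2_points M \<A> f \<nu> \<union> A3_points M \<A> f \<nu>"
begin

lemma Sigma_nondegenerate:
  assumes "p \<in> Sigma_sharp \<A> f \<nu>"
  obtains c \<zeta> where "c \<in> \<A>" "p \<in> fst c" "differential c (delta_sharp c) p \<zeta> \<noteq> 0"
proof -
  obtain c \<zeta> where c: "c \<in> \<A>" "p \<in> fst c" "differential c (lam_sharp c f \<nu>) p \<zeta> \<noteq> 0"
    using assms unfolding A2A3 by (auto simp: A2_points_def A3_points_def nondegenerate_def)
  then have "differential c (delta_sharp c) p \<zeta> \<noteq> 0" unfolding differential_lam_sharp[OF c(1,2)] by simp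
  with c(1,2) show thesis by (rule that)
qed

lemma Sigma_is_arc:
  assumes "p \<in> Sigma_sharp \<A> f \<nu>"
  obtains V \<mu> where "is_arc V \<mu>" "p \<in> V"
proof -
  obtain c \<zeta> where c: "c \<in> \<A>" "p \<in> fst c" "differential c (delta_sharp c) p \<zeta> \<noteq> 0"
    using Sigma_nondegenerate[OF assms] by blast
  obtain z0 r1 r2 a b g \<sigma> where "arc M \<A> f \<nu> c z0 r1 r2 a b g \<sigma>" "p \<in> arc_dom c z0 r1 r2 a b"
    using arc_exists[OF c(1,2) assms c(3)] by blast
  then show thesis using that arc.is_arc_V by blast
qed

lemma finite_arc_cover:
  obtains Q where "finite Q" "\<And>V \<mu>. (V, \<mu>) \<in> Q \<Longrightarrow> is_arc V \<mu>" "Sigma_sharp \<A> f \<nu> \<subseteq> (\<Union>(V, \<mu>)\<in>Q. V)"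
proof -
  let ?Q = "{(V, \<mu>). is_arc V \<mu>}"
  have op: "openin M V" if "is_arc V \<mu>" for V \<mu>
  proof -
    obtain c z0 r1 r2 a b g \<sigma> where "arc M \<A> f \<nu> c z0 r1 r2 a b g \<sigma>" "V = arc_dom c z0 r1 r2 a b" using \<open>is_arc V \<mu>\<close> by (auto simp: is_arc_def)
    then show ?thesis using patch.openin_V[OF arc.axioms(1)] by blast
  qed
  have "closedin M (Sigma_sharp \<A> f \<nu>)" using Sigma_closed(1) Sigma_subset by (simp add: closedin_def)
  then have K: "compactin M (Sigma_sharp \<A> f \<nu>)" by (rule closedin_compact_space[OF compact_M])
  have cov: "Sigma_sharp \<A> f \<nu> \<subseteq> \<Union>(fst ` ?Q)"
  proof
    fix p assume "p \<in> Sigma_sharp \<A> f \<nu>"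
    then obtain V \<mu> where V: "is_arc V \<mu>" "p \<in> V" using Sigma_is_arc by blast
    then have "(V, \<mu>) \<in> ?Q" by simp
    then have "V \<in> fst ` ?Q" by (rule image_eqI[rotated]) simp
    with V(2) show "p \<in> \<Union>(fst ` ?Q)" by (rule UnionI[rotated])
  qed
  have "\<And>U. U \<in> fst ` ?Q \<Longrightarrow> openin M U" using op by auto
  then obtain \<F> where \<F>: "finite \<F>" "\<F> \<subseteq> fst ` ?Q" "Sigma_sharp \<A> f \<nu> \<subseteq> \<Union>\<F>"
    using compactinD[OF K _ cov] by blast
  obtain Q where Q: "finite Q" "Q \<subseteq> ?Q" "\<F> = fst ` Q" using finite_subset_image[OF \<F>(1,2)] by blast
  show thesis
  proof (rule that[OF Q(1)])
    show "is_arc V \<mu>" if "(V, \<mu>) \<in> Q" for V \<mu> using that Q(2) by auto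
    show "Sigma_sharp \<A> f \<nu> \<subseteq> (\<Union>(V, \<mu>)\<in>Q. V)" using \<F>(3) unfolding Q(3) by (auto simp: split_beta)
  qed
qed

text \<open>Interface of an arc outside its locale. The last statement is the compatibility needed
  for gluing: the fold points of a set in the overlap are parametrised by the second arc and
  measured as a curve in the first.\<close>

lemma is_arc_facts:
  assumes "is_arc V \<mu>"
  shows "V \<in> sets (BM M)" "sets \<mu> = sets (BM M)"
    and "\<And>B. B \<in> sets (BM M) \<Longrightarrow> B \<inter> A2_points M \<A> f \<nu> = {} \<Longrightarrow> emeasure \<mu> B = 0"
    and "\<And>d \<beta> l r B. d \<in> \<A> \<Longrightarrow> regular_curve d \<beta> l r \<Longrightarrow> inj_on \<beta> {l<..<r} \<Longrightarrow> \<beta> ` {l<..<r} \<subseteq> Sigma_sharp \<A> f \<nu> \<Longrightarrow>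
      B \<in> sets borel \<Longrightarrow> B \<subseteq> {l<..<r} \<Longrightarrow> \<beta> ` B \<subseteq> V \<inter> A2_points M \<A> f \<nu> \<Longrightarrow>
      \<beta> ` B \<in> sets (BM M) \<and> emeasure \<mu> (\<beta> ` B) = (\<integral>\<^sup>+t\<in>B. ennreal (norm (psi_velocity d \<nu> \<beta> t)) \<partial>lborel)"
    and "\<And>m B. weak_length m \<Longrightarrow> B \<in> sets (BM M) \<Longrightarrow> B \<subseteq> V \<Longrightarrow> emeasure m B = emeasure \<mu> B"
    and "\<And>V' \<mu>' B. is_arc V' \<mu>' \<Longrightarrow> B \<in> sets (BM M) \<Longrightarrow> B \<subseteq> V \<Longrightarrow> B \<subseteq> V' \<Longrightarrow> emeasure \<mu> B = emeasure \<mu>' B"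
proof -
  obtain c z0 r1 r2 a b g \<sigma> where A: "arc M \<A> f \<nu> c z0 r1 r2 a b g \<sigma>" "V = arc_dom c z0 r1 r2 a b"
    "\<mu> = push {u \<in> {-a<..<a}. arc_curve c z0 r1 r2 g u \<in> A2_points M \<A> f \<nu>}
       (\<lambda>u. norm (psi_velocity c \<nu> (arc_curve c z0 r1 r2 g) u)) (BM M) (arc_curve c z0 r1 r2 g)"
    using assms by (auto simp: is_arc_def)
  interpret x: arc M \<A> f \<nu> c z0 r1 r2 a b g \<sigma> by (rule A(1))
  have \<mu>: "\<mu> = x.arc_measure" unfolding A(3) x.arc_measure_def x.T2_def ..
  show "V \<in> sets (BM M)" unfolding A(2) by (rule x.V_BM)
  show "sets \<mu> = sets (BM M)" by (simp add: A(3))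
  show null: "\<And>B. B \<in> sets (BM M) \<Longrightarrow> B \<inter> A2_points M \<A> f \<nu> = {} \<Longrightarrow> emeasure \<mu> B = 0"
    unfolding \<mu> by (rule x.arc_measure_null)
  show curve: "\<beta> ` B \<in> sets (BM M) \<and> emeasure \<mu> (\<beta> ` B) = (\<integral>\<^sup>+t\<in>B. ennreal (norm (psi_velocity d \<nu> \<beta> t)) \<partial>lborel)"
    if "d \<in> \<A>" "regular_curve d \<beta> l r" "inj_on \<beta> {l<..<r}" "\<beta> ` {l<..<r} \<subseteq> Sigma_sharp \<A> f \<nu>"
      "B \<in> sets borel" "B \<subseteq> {l<..<r}" "\<beta> ` B \<subseteq> V \<inter> A2_points M \<A> f \<nu>" for d \<beta> l r B
    using x.arc_measure_curve[OF that[unfolded A(2)]] unfolding \<mu> by blast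
  show "emeasure m B = emeasure \<mu> B" if "weak_length m" "B \<in> sets (BM M)" "B \<subseteq> V" for m B
    unfolding \<mu> by (rule x.weak_length_arc[OF that[unfolded A(2)]])
  fix V' \<mu>' B assume h: "is_arc V' \<mu>'" and B: "B \<in> sets (BM M)" "B \<subseteq> V" "B \<subseteq> V'"
  obtain c' z0' r1' r2' a' b' g' \<sigma>' where A': "arc M \<A> f \<nu> c' z0' r1' r2' a' b' g' \<sigma>'" "V' = arc_dom c' z0' r1' r2' a' b'"
    "\<mu>' = push {u \<in> {-a'<..<a'}. arc_curve c' z0' r1' r2' g' u \<in> A2_points M \<A> f \<nu>}
       (\<lambda>u. norm (psi_velocity c' \<nu> (arc_curve c' z0' r1' r2' g') u)) (BM M) (arc_curve c' z0' r1' r2' g')"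
    using h by (auto simp: is_arc_def)
  interpret y: arc M \<A> f \<nu> c' z0' r1' r2' a' b' g' \<sigma>' by (rule A'(1))
  have \<mu>': "\<mu>' = y.arc_measure" unfolding A'(3) y.arc_measure_def y.T2_def ..
  define C where "C = {u \<in> y.T2. y.\<gamma> u \<in> B}"
  have Cb: "C \<in> sets borel"
  proof -
    have "C = {u \<in> {-a'<..<a'}. y.\<gamma> u \<in> B} \<inter> y.T2" using y.T2_sub by (auto simp: C_def)
    then show ?thesis using curve_preimage_borel[OF y.cA y.regular_gamma B(1)] y.push_arc(1) by auto
  qed
  have Ca: "C \<subseteq> {-a'<..<a'}" using y.T2_sub by (auto simp: C_def)
  have BA: "y.\<gamma> ` C = B \<inter> A2_points M \<A> f \<nu>"
  proof
    show "B \<inter> A2_points M \<A> f \<nu> \<subseteq> y.\<gamma> ` C"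
    proof
      fix q assume q: "q \<in> B \<inter> A2_points M \<A> f \<nu>"
      then have "q \<in> arc_dom c' z0' r1' r2' a' b'" "q \<in> Sigma_sharp \<A> f \<nu>" using B A'(2) A2_subset by auto
      from y.V_Sigma[OF this] q show "q \<in> y.\<gamma> ` C"
        by (intro image_eqI[of _ _ "plane_u z0' r1' r2' (snd c' q)"]) (auto simp: C_def y.T2_def)
    qed
  qed (auto simp: C_def y.T2_def)
  have "emeasure \<mu> B = emeasure \<mu> (y.\<gamma> ` C)" unfolding \<mu> BA by (rule x.arc_measure_A2[OF B(1)])
  also have "\<dots> = (\<integral>\<^sup>+t\<in>C. ennreal (norm (psi_velocity c' \<nu> y.\<gamma> t)) \<partial>lborel)"
    using curve[OF y.cA y.regular_gamma y.inj_gamma y.gamma_Sigma Cb Ca] BA B by auto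
  also have "\<dots> = emeasure \<mu>' B" unfolding \<mu>' y.emeasure_arc[OF B(1)] C_def ..
  finally show "emeasure \<mu> B = emeasure \<mu>' B" .
qed

text \<open>Existence: the arc measures and the zero measure on the complement of the singular set
  are glued. Uniqueness: the specification determines the measure on every arc and makes the
  complement of the fold points null, and these sets cover \<open>M\<close>.\<close>

lemma length_measure_weak: "weak_length (length_measure M \<A> f \<nu>)"
proof -
  let ?A2 = "A2_points M \<A> f \<nu>" and ?S = "Sigma_sharp \<A> f \<nu>"
  obtain Q where Q: "finite Q" "\<And>V \<mu>. (V, \<mu>) \<in> Q \<Longrightarrow> is_arc V \<mu>" "?S \<subseteq> (\<Union>(V, \<mu>)\<in>Q. V)"
    using finite_arc_cover by blast
  define P where "P = insert (topspace M - ?S, null_measure (BM M)) Q"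
  have P: "(V, \<mu>) \<in> P \<longleftrightarrow> (V = topspace M - ?S \<and> \<mu> = null_measure (BM M)) \<or> (V, \<mu>) \<in> Q" for V \<mu>
    by (auto simp: P_def)
  have Pne: "P \<noteq> {}" and Pfin: "finite P" using Q(1) by (auto simp: P_def)
  have Psets: "sets \<mu> = sets (BM M) \<and> V \<in> sets (BM M)" if "(V, \<mu>) \<in> P" for V \<mu>
    using that is_arc_facts(1,2)[OF Q(2)] openin_BM[OF Sigma_closed(1)] by (auto simp: P)
  have Pcov: "(\<Union>(V, \<mu>)\<in>P. V) = space (BM M)"
  proof
    show "(\<Union>(V, \<mu>)\<in>P. V) \<subseteq> space (BM M)" using Psets sets.sets_into_space by fastforce
    show "space (BM M) \<subseteq> (\<Union>(V, \<mu>)\<in>P. V)" using Q(3) by (auto simp: space_BM P_def)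
  qed
  have zero: "emeasure \<mu> B = 0" if "(V, \<mu>) \<in> P" "B \<in> sets (BM M)" "B \<inter> ?A2 = {}" for V \<mu> B
    using that is_arc_facts(3)[OF Q(2)] by (auto simp: P)
  obtain m where m: "space m = space (BM M)" "sets m = sets (BM M)"
    "\<And>A \<mu> B. (A, \<mu>) \<in> P \<Longrightarrow> B \<in> sets (BM M) \<Longrightarrow> B \<subseteq> A \<Longrightarrow> emeasure m B = emeasure \<mu> B"
  proof (rule glue_measures_family[of P "BM M"])
    show "countable P" using Pfin by (rule countable_finite)
    fix A \<mu> A' \<mu>' B assume h: "(A, \<mu>) \<in> P" "(A', \<mu>') \<in> P" "B \<in> sets (BM M)" "B \<subseteq> A" "B \<subseteq> A'"
    show "emeasure \<mu> B = emeasure \<mu>' B"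
    proof (cases "(A, \<mu>) \<in> Q \<and> (A', \<mu>') \<in> Q")
      case True
      then show ?thesis using is_arc_facts(6)[OF Q(2) Q(2)] h by blast
    next
      case False
      then have "B \<subseteq> topspace M - ?S" using h by (auto simp: P)
      then have "B \<inter> ?A2 = {}" using A2_subset by blast
      then show ?thesis using zero h by metis
    qed
  qed (use Pne Psets Pcov in blast)+
  have weak: "weak_length m"
    unfolding weak_length_def
  proof (intro conjI ballI allI impI)
    show "space m = topspace M" "sets m = borel_sets M" using m by (simp_all add: space_BM sets_BM)
    have "topspace M - ?A2 = (\<Union>x\<in>P. fst x - ?A2)"
      using Pcov unfolding space_BM by (auto simp: split_beta)
    moreover have "(\<Union>x\<in>P. fst x - ?A2) \<in> null_sets m"
    proof (rule null_sets.finite_UN[OF Pfin])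
      fix x assume x: "x \<in> P"
      obtain V \<mu> where V: "x = (V, \<mu>)" using prod.exhaust by blast
      have B: "V - ?A2 \<in> sets (BM M)" using Psets[of V \<mu>] x V A2_BM by auto
      have "emeasure m (V - ?A2) = emeasure \<mu> (V - ?A2)" using m(3)[of V \<mu>] x V B by auto
      also have "\<dots> = 0" using zero[of V \<mu>] x V B by auto
      finally show "fst x - ?A2 \<in> null_sets m" using B m V by (auto simp: null_sets_def)
    qed
    ultimately show "emeasure m (topspace M - ?A2) = 0" by (simp add: null_sets_def)
    fix e \<beta> l r B
    assume e: "e \<in> \<A>" and \<beta>: "regular_curve e \<beta> l r \<and> inj_on \<beta> {l<..<r} \<and> \<beta> ` {l<..<r} \<subseteq> ?A2" and B: "B \<in> sets borel" "B \<subseteq> {l<..<r}"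
    then have \<beta>': "regular_curve e \<beta> l r" "inj_on \<beta> {l<..<r}" "\<beta> ` {l<..<r} \<subseteq> ?A2" "\<beta> ` {l<..<r} \<subseteq> ?S" using A2_subset by auto
    define E where "E n = fst (from_nat_into P n)" for n
    define \<mu> where "\<mu> n = snd (from_nat_into P n)" for n
    have E: "(E n, \<mu> n) \<in> P" for n using from_nat_into[OF Pne, of n] by (simp add: E_def \<mu>_def)
    have EU: "(\<Union>n. E n) = space (BM M)"
    proof -
      have "(\<Union>n. E n) = (\<Union>x\<in>range (from_nat_into P). fst x)" by (simp add: E_def)
      also have "\<dots> = (\<Union>x\<in>P. fst x)" using Pne Pfin by (simp add: range_from_nat_into countable_finite)
      finally show ?thesis using Pcov by (simp add: split_beta)
    qed
    have Eb: "disjointed E n \<in> sets (BM M)" for n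
      using sets.range_disjointed_sets[of E "BM M"] Psets[OF E] by auto
    \<comment> \<open>A curve may pass through several pieces of the cover, and its parameters are
      divided accordingly. Only arcs receive a nonempty share, since the curve stays in the singular
      set.\<close>
    define C where "C n = B \<inter> {t \<in> {l<..<r}. \<beta> t \<in> disjointed E n}" for n
    have CU: "(\<Union>n. C n) = B"
    proof
      show "B \<subseteq> (\<Union>n. C n)"
      proof
        fix t assume t: "t \<in> B"
        then have "\<beta> t \<in> space (BM M)" using B \<beta>'(4) Sigma_subset by (auto simp: space_BM)
        then have "\<beta> t \<in> (\<Union>n. disjointed E n)" unfolding UN_disjointed_eq EU .
        then show "t \<in> (\<Union>n. C n)" using t B by (auto simp: C_def)
      qed
    qed (auto simp: C_def)
    have Cb: "C n \<in> sets borel" for n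
      unfolding C_def using B(1) curve_preimage_borel[OF e \<beta>'(1) Eb[of n]] by (rule sets.Int)
    have piece: "\<beta> ` C n \<in> sets (BM M) \<and> emeasure m (\<beta> ` C n) = (\<integral>\<^sup>+t\<in>C n. ennreal (norm (psi_velocity e \<nu> \<beta> t)) \<partial>lborel)" for n
    proof (cases "(E n, \<mu> n) \<in> Q")
      case True
      have "\<beta> ` C n \<subseteq> E n \<inter> ?A2" using disjointed_subset[of E n] \<beta>'(3) B by (auto simp: C_def)
      moreover from this have "\<beta> ` C n \<in> sets (BM M) \<and> emeasure (\<mu> n) (\<beta> ` C n) = (\<integral>\<^sup>+t\<in>C n. ennreal (norm (psi_velocity e \<nu> \<beta> t)) \<partial>lborel)"
        by (intro is_arc_facts(4)[OF Q(2)[OF True] e \<beta>'(1,2,4) Cb]) (auto simp: C_def)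
      ultimately show ?thesis using m(3)[OF E[of n]] by auto
    next
      case False
      then have "E n = topspace M - ?S" using E[of n] by (simp add: P)
      then have "disjointed E n \<inter> ?S = {}" using disjointed_subset[of E n] by blast
      moreover have "\<beta> t \<in> ?S" if "t \<in> {l<..<r}" for t using \<beta>'(4) that by blast
      ultimately have "C n = {}" unfolding C_def by blast
      then show ?thesis by simp
    qed
    have "emeasure m (\<beta> ` (\<Union>n. C n)) = (\<integral>\<^sup>+t\<in>(\<Union>n. C n). ennreal (norm (psi_velocity e \<nu> \<beta> t)) \<partial>lborel)"
    proof (rule curve_length_pieces[OF e \<beta>'(1,2) Cb])
      show "C n \<subseteq> {l<..<r}" for n by (auto simp: C_def)
      show "disjoint_family C" using disjoint_family_disjointed[of E] by (auto simp: C_def disjoint_family_on_def)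
      show "\<beta> ` C n \<in> sets m" "emeasure m (\<beta> ` C n) = (\<integral>\<^sup>+t\<in>C n. ennreal (norm (psi_velocity e \<nu> \<beta> t)) \<partial>lborel)" for n
        using piece[of n] m(2) by simp_all
    qed
    then show "emeasure m (\<beta> ` B) = (\<integral>\<^sup>+t\<in>B. ennreal (norm (psi_velocity e \<nu> \<beta> t)) \<partial>lborel)" unfolding CU .
  qed
  have uniq: "m' = m" if w: "weak_length m'" for m'
  proof (rule measure_eqI_countable_cover[of _ _ "insert (topspace M - ?A2) (fst ` Q)"])
    have m': "space m' = topspace M" "sets m' = sets (BM M)" using w by (auto simp: weak_length_def sets_BM)
    have cA2: "topspace M - ?A2 \<in> sets (BM M)" using sets.compl_sets[OF A2_BM] by (simp add: space_BM)
    show "sets m' = sets m" using m' m by simp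
    show "countable (insert (topspace M - ?A2) (fst ` Q))" using Q(1) by (simp add: countable_finite)
    show "insert (topspace M - ?A2) (fst ` Q) \<noteq> {}" by simp
    show "insert (topspace M - ?A2) (fst ` Q) \<subseteq> sets m'" using m' cA2 is_arc_facts(1)[OF Q(2)] by auto
    show "\<Union> (insert (topspace M - ?A2) (fst ` Q)) = space m'"
    proof
      show "\<Union> (insert (topspace M - ?A2) (fst ` Q)) \<subseteq> space m'"
      proof -
        have "V \<subseteq> topspace M" if "(V, \<mu>) \<in> Q" for V \<mu>
          using sets.sets_into_space[OF is_arc_facts(1)[OF Q(2)[OF that]]] by (simp add: space_BM)
        then show ?thesis using m'(1) by fastforce
      qed
      show "space m' \<subseteq> \<Union> (insert (topspace M - ?A2) (fst ` Q))" using Q(3) A2_subset m'(1) by (auto simp: split_beta)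
    qed
    fix A B assume h: "A \<in> insert (topspace M - ?A2) (fst ` Q)" "B \<in> sets m'" "B \<subseteq> A"
    have B: "B \<in> sets (BM M)" using h m' by simp
    show "emeasure m' B = emeasure m B"
    proof (cases "A \<in> fst ` Q")
      case True
      then obtain \<mu> where "(A, \<mu>) \<in> Q" by auto
      then show ?thesis using is_arc_facts(5)[OF Q(2)] w weak B h(3) by metis
    next
      case False
      then have "B \<subseteq> topspace M - ?A2" using h by auto
      then have "emeasure m' B \<le> emeasure m' (topspace M - ?A2)" "emeasure m B \<le> emeasure m (topspace M - ?A2)"
        using cA2 m' m by (auto intro!: emeasure_mono)
      then show ?thesis using w weak by (simp add: weak_length_def)
    qed
  qed
  have "length_measure M \<A> f \<nu> = (THE m. weak_length m)" unfolding length_measure_def weak_length_def ..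
  also have "\<dots> = m" using weak uniq by (rule the_equality)
  finally show ?thesis using weak by simp
qed

end

section \<open>Isolation of the cusps along an arc\<close>

locale arc_folds = arc M \<A> f \<nu> c z0 r1 r2 a b g \<sigma> + folds_cusps M \<A> f \<nu>
  for M :: "'a topology" and \<A> f \<nu> c z0 r1 r2 a b g \<sigma>
begin

text \<open>At a cusp the velocity and the null vector both lie in the kernel of the nonzero
  differential of \<open>lam_sharp\<close>, so the velocity is a nonzero multiple of the null
  vector. Along the curve the first null derivative of \<open>lam_sharp\<close> then vanishes at the
  cusp with a slope that is a nonzero multiple of the second null derivative, so it is nonzero at
  all other nearby parameters.\<close>

lemma eventually_A2:
  assumes u0: "\<bar>u0\<bar> < a"
  shows "\<forall>\<^sub>F u in at u0. \<gamma> u \<in> A2"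
proof (cases "\<gamma> u0 \<in> A2")
  case True
  then have "u0 \<in> T2" using u0 by (auto simp: T2_def)
  then have "\<forall>\<^sub>F u in at u0. u \<in> T2" by (rule eventually_at_in_open'[OF open_T2])
  then show ?thesis by eventually_elim (simp add: T2_def)
next
  case False
  note G = gamma_facts[OF u0]
  have u0': "u0 \<in> {-a<..<a}" using u0 by auto
  let ?p = "\<gamma> u0" and ?v = "velocity c \<gamma> u0"
  have "?p \<in> A3_points M \<A> f \<nu>" using False G(3) A2A3 by blast
  then obtain d \<zeta> V' \<eta> where d: "d \<in> \<A>" "?p \<in> V'" and nd: "differential d (lam_sharp d f \<nu>) ?p \<zeta> \<noteq> 0" and nf: "null_field M \<A> d f \<nu> V' \<eta>"
    and a1: "along d \<eta> (lam_sharp d f \<nu>) ?p = 0" and a2: "along d \<eta> (along d \<eta> (lam_sharp d f \<nu>)) ?p \<noteq> 0"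
    by (auto simp: A3_points_def nondegenerate_def)
  have V': "openin M V'" "V' \<subseteq> fst d" and nz\<eta>: "\<eta> ?p \<noteq> 0" using nf d(2) by (auto simp: null_field_def)
  have pd: "?p \<in> fst d" using d V' by auto
  note cd = cA d(1) G(5) pd
  have zd: "delta_sharp d ?p = 0" using Sigma_iff[OF d(1) pd] G(3) by simp
  define w where "w = trans_map c d ?p ?v"
  have "differential c (delta_sharp c) ?p ?v = 0" by (rule singular_curve_tangent[OF cA regular_gamma gamma_Sigma u0'])
  then have "differential d (delta_sharp d) ?p w = 0"
    unfolding w_def using differential_delta_sharp_change[OF cd zd, of ?v] transition(2)[OF cd] by simp
  then have w1: "differential d (lam_sharp d f \<nu>) ?p w = 0" by (simp add: differential_lam_sharp[OF d(1) pd])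
  have "differential d (lam_sharp d f \<nu>) ?p (\<eta> ?p) = 0" using a1 by (simp add: along_def)
  then obtain s where s: "w = s *\<^sub>R \<eta> ?p"
    using kernel_line[OF linear_differential[OF along_cdiff(2)[OF d(1) nf d(2)]] nd _ w1 nz\<eta>] by blast
  have "w \<noteq> 0"
  proof
    assume "w = 0"
    then have "det (matrix (trans_map c d ?p)) * (?v$1 * r2$2 - ?v$2 * r2$1) = 0"
      using trans_map_det_pair[OF cd, of ?v r2] by (simp add: w_def)
    moreover have "?v$1 * r2$2 - ?v$2 * r2$1 = 1" unfolding gamma_velocity(2)[OF u0] using det by (simp add: algebra_simps)
    ultimately show False using transition(2)[OF cd] by simp
  qed
  then have s0: "s \<noteq> 0" using s by auto
  let ?h = "along d \<eta> (lam_sharp d f \<nu>)"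
  have dh: "cdiff d ?h ?p" by (rule along_cdiff(1)[OF d(1) nf d(2)])
  have "((\<lambda>u. ?h (\<gamma> u)) has_vector_derivative differential c ?h ?p ?v) (at u0)"
    by (rule along_curve[OF regular_gamma u0' chart_change(2)[OF cd dh]])
  moreover have "differential c ?h ?p ?v = s * along d \<eta> ?h ?p"
    unfolding chart_change(1)[OF cd dh] w_def[symmetric] s along_def[of d \<eta> ?h] linear_cmul[OF linear_differential[OF dh]] by simp
  ultimately have der: "((\<lambda>u. ?h (\<gamma> u)) has_real_derivative s * along d \<eta> ?h ?p) (at u0)"
    by (simp add: has_real_derivative_iff_has_vector_derivative)
  have "s * along d \<eta> ?h ?p \<noteq> 0" using s0 a2 by simp
  from tendsto_imp_eventually_ne[OF der[unfolded has_field_derivative_iff] this]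
  have ne: "\<forall>\<^sub>F u in at u0. (?h (\<gamma> u) - ?h ?p) / (u - u0) \<noteq> 0" .
  have "open {t \<in> {-a<..<a}. \<gamma> t \<in> V'}" by (rule curve_preimage_open[OF cA regular_gamma V'(1)])
  then have near: "\<forall>\<^sub>F u in at u0. u \<in> {t \<in> {-a<..<a}. \<gamma> t \<in> V'}"
    by (rule eventually_at_in_open') (use u0' d(2) in auto)
  show ?thesis using ne near
  proof eventually_elim
    case (elim u)
    then have "?h (\<gamma> u) \<noteq> 0" "\<gamma> u \<in> V'" "\<gamma> u \<in> \<Sigma>" using a1 gamma_Sigma by auto
    then show ?case by (intro A2_near[OF d(1) nf])
  qed
qed

text \<open>The exceptional parameters do not accumulate in the interval, hence there are only
  countably many.\<close>

lemma AE_T2: "AE u in lborel. u \<in> {-a<..<a} \<longrightarrow> u \<in> T2"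
proof -
  have "({-a<..<a} - T2) sparse_in {-a<..<a}"
    unfolding sparse_in_eventually_iff[OF open_greaterThanLessThan]
  proof
    fix u0 assume "u0 \<in> {-a<..<a}"
    then have "\<bar>u0\<bar> < a" by auto
    from eventually_A2[OF this] show "\<forall>\<^sub>F y in at u0. y \<notin> {-a<..<a} - T2"
      by eventually_elim (auto simp: T2_def)
  qed
  from sparse_imp_countable[OF open_greaterThanLessThan this]
  have "countable ({-a<..<a} - T2)" by (simp add: Int_absorb1)
  then have "{-a<..<a} - T2 \<in> null_sets lborel" by (rule countable_imp_null_set_lborel)
  then show ?thesis by (rule AE_I') auto
qed

lemma length_integral:
  fixes F :: "'a \<Rightarrow> real"
  assumes F: "F \<in> borel_measurable (BM M)" "\<And>q. q \<notin> V \<Longrightarrow> F q = 0"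
  shows "integrable (length_measure M \<A> f \<nu>) F \<longleftrightarrow> integrable lborel (\<lambda>u. indicator T2 u * (norm (psi_velocity c \<nu> \<gamma> u) * F (\<gamma> u)))"
    and "(\<integral>q. F q \<partial>length_measure M \<A> f \<nu>) = (\<integral>u. indicator T2 u * (norm (psi_velocity c \<nu> \<gamma> u) * F (\<gamma> u)) \<partial>lborel)"
proof -
  have s: "sets (length_measure M \<A> f \<nu>) = sets (BM M)" using length_measure_weak by (simp add: weak_length_def sets_BM)
  note I = integral_push[OF push_arc s V_BM weak_length_arc[OF length_measure_weak, unfolded arc_measure_def] F]
  show "integrable (length_measure M \<A> f \<nu>) F \<longleftrightarrow> integrable lborel (\<lambda>u. indicator T2 u * (norm (psi_velocity c \<nu> \<gamma> u) * F (\<gamma> u)))"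
    and "(\<integral>q. F q \<partial>length_measure M \<A> f \<nu>) = (\<integral>u. indicator T2 u * (norm (psi_velocity c \<nu> \<gamma> u) * F (\<gamma> u)) \<partial>lborel)"
    using I by simp_all
qed

end

section \<open>The local Stokes formula\<close>

lemma C_k_on_Un:
  assumes "open U" "open W" "C_k_on k U h" "C_k_on k W h"
  shows "C_k_on k (U \<union> W) h"
  using assms(3,4)
proof (induction k arbitrary: h)
  case 0
  then have "continuous_on U h" "continuous_on W h" by simp_all
  from continuous_on_open_Un[OF assms(1,2) this] show ?case by simp
next
  case (Suc k)
  then show ?case by auto
qed

lemma C_k_on_extend_zero:
  assumes "open U" "closed K" "K \<subseteq> U" "C_k_on k U h" "\<And>z. z \<in> U \<Longrightarrow> z \<notin> K \<Longrightarrow> h z = 0"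
  shows "C_k_on k UNIV (\<lambda>z. if z \<in> U then h z else 0)"
proof -
  have "C_k_on k U (\<lambda>z. if z \<in> U then h z else 0)"
    by (subst C_k_on_cong[OF assms(1), of _ h]) (use assms(4) in auto)
  moreover have "C_k_on k (- K) (\<lambda>z. if z \<in> U then h z else 0)"
    by (subst C_k_on_cong[of _ _ "\<lambda>z. 0"]) (use assms(2,5) C_k_on_const in auto)
  ultimately have "C_k_on k (U \<union> - K) (\<lambda>z. if z \<in> U then h z else 0)"
    using assms(1,2) by (intro C_k_on_Un) auto
  moreover have "U \<union> - K = UNIV" using assms(3) by auto
  ultimately show ?thesis by simp
qed

context chart
begin

lemma borel_measurable_chart_extend:
  fixes h :: "'a \<Rightarrow> real"
  assumes W: "openin M W" "W \<subseteq> fst c" and h: "continuous_on (snd c ` W) (in_chart c h)"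
    and F: "\<And>q. q \<in> W \<Longrightarrow> F q = h q" "\<And>q. q \<notin> W \<Longrightarrow> F q = 0"
  shows "F \<in> borel_measurable (BM M)"
proof -
  have B: "W \<in> sets (BM M)" by (rule openin_BM[OF W(1)])
  have Wt: "W \<subseteq> topspace M" using W(1) by (rule openin_subset)
  have r: "restrict_space (restrict_space (BM M) (fst c)) W = restrict_space (BM M) W"
    using W(2) dom_BM B dom_subset by (subst restrict_restrict_space) (auto simp: Int_absorb1)
  have "snd c \<in> measurable (restrict_space (BM M) W) borel"
    using measurable_restrict_space1[OF snd_measurable, of W] unfolding r .
  then have s: "snd c \<in> measurable (restrict_space (BM M) W) (restrict_space borel (snd c ` W))"
    by (rule measurable_restrict_space2[rotated]) (auto simp: space_restrict_space)
  have "(\<lambda>q. in_chart c h (snd c q)) \<in> borel_measurable (restrict_space (BM M) W)"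
    by (rule measurable_compose[OF s borel_measurable_continuous_on_restrict[OF h]])
  then have "(\<lambda>q. if q \<in> W then in_chart c h (snd c q) else 0) \<in> borel_measurable (BM M)"
    using B Wt by (subst measurable_If_restrict_space_iff) (auto simp: space_BM Int_absorb1 Collect_conj_eq)
  moreover have "(\<lambda>q. if q \<in> W then in_chart c h (snd c q) else 0) = F"
    using F W(2) by (auto simp: in_chart_snd subset_iff)
  ultimately show ?thesis by simp
qed

end

context surface
begin

text \<open>One derivative is enough for Stokes' formula, and a partition of unity of this class can
  be built from squared positive parts.\<close>

definition C1 :: "('a \<Rightarrow> real) \<Rightarrow> bool" where
  "C1 \<rho> \<longleftrightarrow> (\<forall>c\<in>\<A>. C_k_on 1 (snd c ` fst c) (in_chart c \<rho>))"

text \<open>In the chart \<open>c\<close> this is the coefficient of \<open>- d(\<rho> \<omega>)\<close>.\<close>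

definition curl_coeff :: "('a \<Rightarrow> real) \<Rightarrow> 'a chart \<Rightarrow> 'a \<Rightarrow> real" where
  "curl_coeff \<rho> c q = \<rho> q * delta_sharp c q
     - (partial c 1 \<rho> q * omega c q (axis 2 1) - partial c 2 \<rho> q * omega c q (axis 1 1))"

text \<open>The density of \<open>- d(\<rho> \<omega>)\<close> on \<open>M_sharp_minus\<close> with
  respect to the area form \<open>delta du dv\<close>. In the sum over a partition of unity the
  terms with derivatives of \<open>\<rho>\<close> cancel and the Gaussian curvature remains.\<close>

definition bulk :: "('a \<Rightarrow> real) \<Rightarrow> 'a \<Rightarrow> real" where
  "bulk \<rho> q = indicator (M_sharp_minus \<A> f \<nu>) q *
     (let c = (SOME c. c \<in> \<A> \<and> q \<in> fst c) in curl_coeff \<rho> c q / delta c q)"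

definition bdry :: "('a \<Rightarrow> real) \<Rightarrow> 'a \<Rightarrow> real" where
  "bdry \<rho> q = indicator (A2_points M \<A> f \<nu>) q * (\<rho> q * singular_curvature \<A> f \<nu> q)"

text \<open>What the local analysis provides for each member of the partition of unity.
  Integrability is part of it, so that the sum of the integrals is the integral of the sum.\<close>

definition stokes :: "('a \<Rightarrow> real) \<Rightarrow> bool" where
  "stokes \<rho> \<longleftrightarrow> integrable (area_measure M \<A> f \<nu>) (bulk \<rho>) \<and> integrable (length_measure M \<A> f \<nu>) (bdry \<rho>) \<and>
     (\<integral>q. bulk \<rho> q \<partial>area_measure M \<A> f \<nu>) = (\<integral>q. bdry \<rho> q \<partial>length_measure M \<A> f \<nu>)"

lemma C1_D: "C1 \<rho> \<Longrightarrow> c \<in> \<A> \<Longrightarrow> C_k_on 1 (snd c ` fst c) (in_chart c \<rho>)"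
  unfolding C1_def by blast

lemma C1_continuous: "C1 \<rho> \<Longrightarrow> c \<in> \<A> \<Longrightarrow> continuous_on (snd c ` fst c) (in_chart c \<rho>)"
  by (rule C_k_on_imp_continuous_on[OF C1_D])

lemma C1_cdiff: "C1 \<rho> \<Longrightarrow> c \<in> \<A> \<Longrightarrow> q \<in> fst c \<Longrightarrow> cdiff c \<rho> q"
  by (rule cdiffI, rule C_k_on_has_derivative[OF C1_D[unfolded One_nat_def]]) auto

lemma some_chart:
  assumes "c \<in> \<A>" "q \<in> fst c"
  shows "(SOME c. c \<in> \<A> \<and> q \<in> fst c) \<in> \<A>" "q \<in> fst (SOME c. c \<in> \<A> \<and> q \<in> fst c)"
  using someI[of "\<lambda>c. c \<in> \<A> \<and> q \<in> fst c" c] assms by auto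

lemma M_minus_iff:
  assumes c: "c \<in> \<A>" "q \<in> fst c"
  shows "q \<in> M_sharp_minus \<A> f \<nu> \<longleftrightarrow> gaussian_curvature \<A> f q < 0"
proof -
  have "lam_sharp d f \<nu> q < 0 \<longleftrightarrow> gaussian_curvature \<A> f q < 0" if "d \<in> \<A>" "q \<in> fst d" for d
    using gaussian_curvature_lam[OF that] lam_pos[OF that] by (simp add: mult_less_0_iff)
  then show ?thesis using c unfolding M_sharp_minus_def by blast
qed

lemma M_minus_sub: "M_sharp_minus \<A> f \<nu> \<subseteq> topspace M"
  using in_topspace by (auto simp: M_sharp_minus_def)

lemma K_neg_iff:
  assumes c: "c \<in> \<A>" "q \<in> fst c"
  shows "gaussian_curvature \<A> f q < 0 \<longleftrightarrow> sgn (delta c q) * delta_sharp c q < 0"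
proof -
  have "sgn (delta c q) * delta_sharp c q = gaussian_curvature \<A> f q * lam c f \<nu> q"
    using gaussian_curvature_lam[OF c] by (simp add: lam_sharp_eq)
  then show ?thesis using lam_pos[OF c] by (simp add: mult_less_0_iff)
qed

lemma K_neg_mfield:
  assumes c: "c \<in> \<A>" "q \<in> fst c" and K: "gaussian_curvature \<A> f q < 0"
  shows "mfield c q \<noteq> 0"
proof (rule mfield_nz[OF c])
  have "delta_sharp c q \<noteq> 0" using K delta_nz[OF c] by (auto simp: gaussian_curvature_eq[OF c])
  then show "partial c 1 \<nu> q \<noteq> 0 \<or> partial c 2 \<nu> q \<noteq> 0" by (auto simp: delta_sharp_def)
  show "delta_sharp c q * delta c q \<le> 0" using K by (auto simp: gaussian_curvature_eq[OF c] divide_less_0_iff mult_le_0_iff)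
qed

text \<open>\<open>curl_coeff\<close> transforms like the coefficient of a 2-form because
  \<open>omega\<close> transforms like a 1-form; the latter is available since \<open>mfield\<close>
  is nonzero where the curvature is negative.\<close>

lemma curl_coeff_change:
  assumes cd: "c \<in> \<A>" "d \<in> \<A>" "q \<in> fst c" "q \<in> fst d" and \<rho>: "C1 \<rho>" and K: "gaussian_curvature \<A> f q < 0"
  shows "curl_coeff \<rho> c q / delta c q = curl_coeff \<rho> d q / delta d q"
proof -
  let ?T = "trans_map c d q" and ?D = "det (matrix (trans_map c d q))"
  have w: "omega c q (axis i 1) = ?T (axis i 1) $ 1 * omega d q (axis 1 1) + ?T (axis i 1) $ 2 * omega d q (axis 2 1)" for i
    unfolding omega_change[OF cd K_neg_mfield[OF cd(1,3) K]] by (rule omega_expand[OF cd(2,4)])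
  have p: "partial c i \<rho> q = ?T (axis i 1) $ 1 * partial d 1 \<rho> q + ?T (axis i 1) $ 2 * partial d 2 \<rho> q" for i
    using partial_change[OF cd C1_cdiff[OF \<rho> cd(2,4)]] by simp
  have "curl_coeff \<rho> c q = ?D * curl_coeff \<rho> d q"
    unfolding curl_coeff_def w p delta_change(2)[OF cd] det_trans_map by (simp add: algebra_simps)
  then show ?thesis using delta_change(1)[OF cd] transition(2)[OF cd] by simp
qed

lemma bulk_eq:
  assumes c: "c \<in> \<A>" "q \<in> fst c" and \<rho>: "C1 \<rho>"
  shows "bulk \<rho> q = indicator (M_sharp_minus \<A> f \<nu>) q * (curl_coeff \<rho> c q / delta c q)"
proof (cases "q \<in> M_sharp_minus \<A> f \<nu>")
  case True
  then have "gaussian_curvature \<A> f q < 0" using M_minus_iff[OF c] by simp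
  from curl_coeff_change[OF some_chart(1)[OF c] c(1) some_chart(2)[OF c] c(2) \<rho> this]
  show ?thesis by (simp add: bulk_def Let_def)
qed (simp add: bulk_def)

lemma partial_zero:
  assumes c: "c \<in> \<A>" "q \<in> fst c" and U: "openin M U" "q \<in> U" "\<And>p. p \<in> U \<Longrightarrow> \<rho> p = 0"
  shows "partial c i (\<rho> :: 'a \<Rightarrow> real) q = 0"
proof -
  interpret chart M c using c by (simp add: chart_axioms_A)
  have k: "cdiff c (\<lambda>p. 0 :: real) q" by (rule csmooth_cdiff[OF csmooth_intros(1) c(2)])
  have "differential c (\<lambda>p. 0) q = differential c \<rho> q"
    by (rule differential_cong(1)[of "U \<inter> fst c", OF openin_Int[OF U(1) openin_dom] _ _ _ k]) (use U c in auto)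
  then show ?thesis unfolding partial_def by (metis differential_const)
qed

text \<open>\<open>bulk\<close> contains derivatives of \<open>\<rho>\<close>, so vanishing on a
  neighbourhood is what is asked for.\<close>

lemma bulk_zero:
  assumes U: "openin M U" "q \<in> U" "\<And>p. p \<in> U \<Longrightarrow> \<rho> p = 0"
  shows "bulk \<rho> q = 0"
proof -
  obtain c where "c \<in> \<A>" "q \<in> fst c" using cover openin_subset[OF U(1)] U(2) by blast
  note c = some_chart[OF this]
  show ?thesis unfolding bulk_def Let_def curl_coeff_def using partial_zero[OF c U] U(2,3) by simp
qed

lemma continuous_in_chart_partial:
  assumes c: "c \<in> \<A>" and \<rho>: "C1 \<rho>"
  shows "continuous_on (snd c ` fst c) (in_chart c (partial c i \<rho>))"
proof -
  interpret chart M c using c by (simp add: chart_axioms_A)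
  have "continuous_on S (\<lambda>z. frechet_derivative (in_chart c \<rho>) (at z) (axis i 1))" using \<rho> c by (simp add: C1_def)
  then show ?thesis
    by (rule continuous_on_eq) (auto simp: in_chart_snd partial_def differential_def)
qed

lemma C1_measurable: "C1 \<rho> \<Longrightarrow> \<rho> \<in> borel_measurable (BM M)"
  by (intro borel_measurable_charts C1_continuous)

lemma openin_K_neg: "openin M {p \<in> topspace M. gaussian_curvature \<A> f p \<in> W}" if "open W"
  using continuous_curvature[of _ 0] that by (intro openin_preimage) auto

text \<open>Compact sets are closed in the Hausdorff space \<open>M\<close>. This is what allows
  functions supported in a chart to be extended by zero.\<close>

lemma compact_image_closed:
  assumes c: "c \<in> \<A>" and K: "compact K" "K \<subseteq> snd c ` fst c"
  shows "openin M (topspace M - inv_into (fst c) (snd c) ` K)"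
proof -
  interpret chart M c using c by (simp add: chart_axioms_A)
  have "homeomorphic_map (top_of_set S) (subtopology M (fst c)) inv_c"
  proof -
    obtain k where k: "homeomorphic_maps (subtopology M (fst c)) (top_of_set S) (snd c) k"
      using homeo unfolding homeomorphic_map_maps by blast
    then have "homeomorphic_map (top_of_set S) (subtopology M (fst c)) k"
      using homeomorphic_maps_sym homeomorphic_map_maps by blast
    moreover have "k z = inv_c z" if "z \<in> S" for z
    proof -
      obtain x where x: "x \<in> fst c" "z = snd c x" using \<open>z \<in> S\<close> by blast
      then have "k (snd c x) = x" using k by (simp add: homeomorphic_maps_def topspace_dom del: topspace_subtopology)
      then show ?thesis using x inv_snd by simp
    qed
    ultimately show ?thesis by (rule homeomorphic_map_eq) simp
  qed
  then have "continuous_map (top_of_set S) M inv_c"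
    using homeomorphic_imp_continuous_map continuous_map_into_fulltopology by blast
  moreover have "compactin (top_of_set S) K" using K by (simp add: compactin_subtopology compactin_euclidean_iff)
  ultimately have "compactin M (inv_c ` K)" by (rule image_compactin[rotated])
  moreover have "Hausdorff_space M" using surf by (simp add: oriented_surface_def)
  ultimately show ?thesis using compactin_imp_closedin by (auto simp: closedin_def)
qed

lemma bulk_off_compact:
  assumes c: "c \<in> \<A>" and K: "compact K" "K \<subseteq> snd c ` fst c"
    and supp: "\<And>q. q \<notin> inv_into (fst c) (snd c) ` K \<Longrightarrow> \<rho> q = 0" and q: "q \<notin> inv_into (fst c) (snd c) ` K"
  shows "bulk \<rho> q = 0"
proof (cases "q \<in> topspace M")
  case True
  show ?thesis by (rule bulk_zero[OF compact_image_closed[OF c K]]) (use True q supp in auto)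
next
  case False
  then have "q \<notin> M_sharp_minus \<A> f \<nu>" using M_minus_sub by blast
  then show ?thesis by (simp add: bulk_def)
qed

lemma bulk_measurable:
  assumes c: "c \<in> \<A>" and \<rho>: "C1 \<rho>" and V: "openin M V" "V \<subseteq> fst c" "\<And>q. q \<notin> V \<Longrightarrow> bulk \<rho> q = 0"
  shows "bulk \<rho> \<in> borel_measurable (BM M)"
proof -
  interpret chart M c using c by (simp add: chart_axioms_A)
  define W where "W = {p \<in> topspace M. gaussian_curvature \<A> f p \<in> {..<0}} \<inter> V"
  have W: "openin M W" "W \<subseteq> fst c" using openin_K_neg[of "{..<0}"] V by (auto simp: W_def)
  have Wc: "c \<in> \<A> \<and> q \<in> fst c \<and> gaussian_curvature \<A> f q < 0" if "q \<in> W" for q using that W c by (auto simp: W_def)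
  have o: "open (snd c ` W)" using openin_iff_open[OF W(2)] W(1) by simp
  have sub: "snd c ` W \<subseteq> S" using W(2) by auto
  have m: "mfield c q \<noteq> 0" if "q \<in> fst c" "snd c q \<in> snd c ` W" for q
  proof -
    have "q \<in> W" using that inj_onD[OF inj] W(2) by auto
    then show ?thesis using K_neg_mfield Wc by blast
  qed
  have cont: "continuous_on (snd c ` W) (in_chart c (\<lambda>q. omega c q (axis i 1)))"
    "continuous_on (snd c ` W) (in_chart c (partial c i \<rho>))" for i
    by (rule smooth_on_imp_continuous_on[OF smooth_on_omega[OF c o sub m]], assumption+)
      (rule continuous_on_subset[OF continuous_in_chart_partial[OF c \<rho>] sub])
  have cont': "continuous_on (snd c ` W) (in_chart c (delta_sharp c))" "continuous_on (snd c ` W) (in_chart c (delta c))"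
    "continuous_on (snd c ` W) (in_chart c \<rho>)"
    using csmooth_imp_continuous[OF csmooth_surface(1)[OF c]] csmooth_imp_continuous[OF csmooth_surface(2)[OF c]] C1_continuous[OF \<rho> c]
    by (auto intro: continuous_on_subset[OF _ sub])
  have "continuous_on (snd c ` W) (in_chart c (\<lambda>q. curl_coeff \<rho> c q / delta c q))"
    using cont cont' unfolding in_chart_def o_def curl_coeff_def
    by (intro continuous_intros) (use Wc W delta_nz inv_snd in auto)
  then show ?thesis
  proof (rule borel_measurable_chart_extend[OF W])
    show "bulk \<rho> q = curl_coeff \<rho> c q / delta c q" if "q \<in> W" for q
      using bulk_eq[OF c _ \<rho>, of q] M_minus_iff[OF c, of q] Wc[OF that] by simp
    show "bulk \<rho> q = 0" if "q \<notin> W" for q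
    proof (cases "q \<in> V")
      case True
      then have "q \<notin> M_sharp_minus \<A> f \<nu>" using that V M_minus_iff[OF c, of q] dom_subset by (auto simp: W_def)
      then show ?thesis by (simp add: bulk_def)
    qed (rule V(3))
  qed
qed

end

context patch
begin

lemma pt_box: "pt u v \<in> bx \<longleftrightarrow> \<bar>u\<bar> < a \<and> \<bar>v\<bar> < b"
  unfolding plane_box_def by (simp add: coords)

text \<open>The value of \<open>\<rho> \<omega>\<close> on the constant vector \<open>r\<close>,
  extended by zero from the box to the whole plane, where \<open>green_below_graph\<close> expects
  its functions.\<close>

definition ext :: "('a \<Rightarrow> real) \<Rightarrow> real^2 \<Rightarrow> real^2 \<Rightarrow> real" where
  "ext \<rho> r z = (if z \<in> bx then in_chart c (\<lambda>q. \<rho> q * omega c q r) z else 0)"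

lemma ext_on_graph:
  assumes u: "\<bar>u\<bar> < a" "\<bar>g u\<bar> < b"
  shows "ext \<rho> r (pt u (g u)) = \<rho> (arc_curve c z0 r1 r2 g u) * omega c (arc_curve c z0 r1 r2 g u) r"
  using u by (simp add: ext_def pt_box in_chart_def arc_curve_def)

context
  fixes \<rho> :: "'a \<Rightarrow> real" and K0 :: "(real^2) set"
  assumes \<rho>: "C1 \<rho>" and K0: "compact K0" "K0 \<subseteq> bx" and supp: "\<And>q. q \<notin> inv_c ` K0 \<Longrightarrow> \<rho> q = 0"
begin

lemma supp_chart: "z \<in> S \<Longrightarrow> z \<notin> K0 \<Longrightarrow> in_chart c \<rho> z = 0"
proof -
  assume z: "z \<in> S" "z \<notin> K0"
  have "inv_c z \<notin> inv_c ` K0"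
  proof
    assume "inv_c z \<in> inv_c ` K0"
    then obtain w where "w \<in> K0" "inv_c z = inv_c w" by auto
    moreover from this have "w = z" using snd_inv[OF z(1)] snd_inv[of w] K0(2) bx_S by auto
    ultimately show False using z by simp
  qed
  then show ?thesis using supp by (simp add: in_chart_def)
qed

lemma bulk_off: "q \<notin> V \<Longrightarrow> bulk \<rho> q = 0"
  by (rule bulk_off_compact[OF cA K0(1) subset_trans[OF K0(2) bx_S] supp]) (use K0(2) in \<open>auto simp: arc_dom_def\<close>)

lemma omega_C1: "C_k_on k bx (in_chart c (\<lambda>q. omega c q r))"
proof -
  have m: "mfield c q \<noteq> 0" if "q \<in> fst c" "snd c q \<in> bx" for q
    by (rule mnz) (use that in \<open>simp add: V_iff plane_box_def\<close>)
  have sm: "smooth_on bx (in_chart c (\<lambda>q. omega c q (axis i 1)))" for i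
    by (rule smooth_on_omega[OF cA open_plane_box bx_S m])
  have "smooth_on bx (\<lambda>z. r$1 * in_chart c (\<lambda>q. omega c q (axis 1 1)) z + r$2 * in_chart c (\<lambda>q. omega c q (axis 2 1)) z)"
    by (intro smooth_on_intros open_plane_box sm)
  then have "C_k_on k bx (\<lambda>z. r$1 * in_chart c (\<lambda>q. omega c q (axis 1 1)) z + r$2 * in_chart c (\<lambda>q. omega c q (axis 2 1)) z)"
    by (rule smooth_onD)
  then show ?thesis
  proof (subst C_k_on_cong[OF open_plane_box])
    fix z assume "z \<in> bx"
    then have "inv_c z \<in> fst c" using bx_S inv_in by blast
    from omega_expand[OF cA this, of r]
    show "in_chart c (\<lambda>q. omega c q r) z = r$1 * in_chart c (\<lambda>q. omega c q (axis 1 1)) z + r$2 * in_chart c (\<lambda>q. omega c q (axis 2 1)) z"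
      by (simp add: in_chart_def)
  qed
qed

lemma ext_C1: "C_k_on 1 UNIV (ext \<rho> r)"
proof -
  have "C_k_on 1 bx (in_chart c \<rho>)" by (rule C_k_on_subset[OF C1_D[OF \<rho> cA] bx_S])
  then have "C_k_on 1 bx (\<lambda>z. in_chart c \<rho> z * in_chart c (\<lambda>q. omega c q r) z)"
    by (rule C_k_on_mult[OF open_plane_box _ omega_C1])
  from C_k_on_extend_zero[OF open_plane_box compact_imp_closed[OF K0(1)] K0(2) this]
  have "C_k_on 1 UNIV (\<lambda>z. if z \<in> bx then in_chart c \<rho> z * in_chart c (\<lambda>q. omega c q r) z else 0)"
    using supp_chart bx_S by (auto simp: subset_iff)
  then show ?thesis unfolding ext_def[abs_def] in_chart_bilinear[of c "(*)"] .
qed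

abbreviation "dext r z \<equiv> frechet_derivative (ext \<rho> r) (at z)"

lemma ext_deriv: "(ext \<rho> r has_derivative dext r z) (at z)"
  using C_k_on_has_derivative[of 0 UNIV "ext \<rho> r"] ext_C1[of r] by simp

lemma ext_cont: "continuous_on UNIV (ext \<rho> r)" "continuous_on UNIV (\<lambda>z. dext r z s)"
  using ext_C1[of r] C_k_on_imp_continuous_on[OF ext_C1] by simp_all

lemma ext_off: "z \<notin> K0 \<Longrightarrow> ext \<rho> r z = 0" "z \<notin> K0 \<Longrightarrow> dext r z s = 0"
proof -
  have e: "ext \<rho> r z = 0" if "z \<notin> K0" for z
    using supp_chart[of z] that bx_S by (auto simp: ext_def in_chart_bilinear[of c "(*)"])
  then show "z \<notin> K0 \<Longrightarrow> ext \<rho> r z = 0" .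
  assume z: "z \<notin> K0"
  have "(ext \<rho> r has_derivative (\<lambda>s. 0)) (at z)"
    by (rule has_derivative_transform_within_open[OF has_derivative_const, of "- K0" z 0])
      (use z e compact_imp_closed[OF K0(1)] in auto)
  from frechet_derivative_at[OF this] show "dext r z s = 0" by metis
qed

text \<open>Passing from chart coordinates to \<open>(u, v)\<close> multiplies the curl by the
  determinant of the frame, which is 1; the product rule and \<open>omega_curl\<close> give the
  rest.\<close>

lemma dext_eq:
  assumes z: "z \<in> bx"
  shows "dext r2 z r1 - dext r1 z r2 = - curl_coeff \<rho> c (inv_c z)"
proof -
  let ?q = "inv_c z"
  have q: "?q \<in> fst c" "snd c ?q = z" using z bx_S inv_in snd_inv by auto
  have qV: "?q \<in> V" unfolding arc_dom_def using z by simp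
  have dw: "cdiff c (\<lambda>q. omega c q (axis i 1)) ?q" for i
    by (rule cdiffI, unfold q(2), rule C_k_on_has_derivative[of 0]) (use omega_C1 z in auto)
  have dw': "cdiff c (\<lambda>q. omega c q r) ?q" for r
    by (rule cdiffI, unfold q(2), rule C_k_on_has_derivative[of 0]) (use omega_C1 z in auto)
  have k: "cdiff c (\<lambda>q. t :: real) ?q" for t by (rule csmooth_cdiff[OF csmooth_intros(1) q(1)])
  note d\<rho> = C1_cdiff[OF \<rho> cA q(1)]
  define W where "W i j = partial c i (\<lambda>q. omega c q (axis j 1)) ?q" for i j
  have D: "differential c (\<lambda>q. omega c q r) ?q s =
      r$1 * (s$1 * W 1 1 + s$2 * W 2 1) + r$2 * (s$1 * W 1 2 + s$2 * W 2 2)" for r s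
  proof -
    note m = differential_mult[OF k dw q(1) inj]
    have "differential c (\<lambda>q. r$1 * omega c q (axis 1 1) + r$2 * omega c q (axis 2 1)) ?q = differential c (\<lambda>q. omega c q r) ?q"
      by (rule differential_cong(1)[OF openin_dom order_refl q(1) omega_expand[OF cA, symmetric] differential_add(2)[OF m(2) m(2)]])
    then have "differential c (\<lambda>q. omega c q r) ?q s = differential c (\<lambda>q. r$1 * omega c q (axis 1 1) + r$2 * omega c q (axis 2 1)) ?q s"
      by simp
    also have "\<dots> = r$1 * differential c (\<lambda>q. omega c q (axis 1 1)) ?q s + r$2 * differential c (\<lambda>q. omega c q (axis 2 1)) ?q s"
      unfolding differential_add(1)[OF m(2) m(2)] m(1) by (simp add: differential_const)
    also have "\<dots> = r$1 * (s$1 * W 1 1 + s$2 * W 2 1) + r$2 * (s$1 * W 1 2 + s$2 * W 2 2)"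
      unfolding differential_expand[OF dw, of _ s] by (simp add: W_def)
    finally show ?thesis .
  qed
  have E: "dext r z s = \<rho> ?q * differential c (\<lambda>q. omega c q r) ?q s
      + (s$1 * partial c 1 \<rho> ?q + s$2 * partial c 2 \<rho> ?q) * (r$1 * omega c ?q (axis 1 1) + r$2 * omega c ?q (axis 2 1))" for r s
  proof -
    note m = differential_mult[OF d\<rho> dw' q(1) inj]
    have "(in_chart c (\<lambda>q. \<rho> q * omega c q r) has_derivative differential c (\<lambda>q. \<rho> q * omega c q r) ?q) (at z)"
      using cdiff_has_derivative[OF m(2)] unfolding q(2) .
    then have "(ext \<rho> r has_derivative differential c (\<lambda>q. \<rho> q * omega c q r) ?q) (at z)"
      by (rule has_derivative_transform_within_open[OF _ open_plane_box z]) (simp add: ext_def)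
    from frechet_derivative_at[OF this]
    have "dext r z s = differential c (\<lambda>q. \<rho> q * omega c q r) ?q s" by metis
    then show ?thesis unfolding m(1) differential_expand[OF d\<rho>, of s] omega_expand[OF cA q(1), of r] by simp
  qed
  have curl: "W 1 2 - W 2 1 = - delta_sharp c ?q"
    unfolding W_def by (rule omega_curl(1)[OF cA q(1) mnz[OF qV]])
  let ?p1 = "partial c 1 \<rho> ?q" and ?p2 = "partial c 2 \<rho> ?q" and ?w1 = "omega c ?q (axis 1 1)" and ?w2 = "omega c ?q (axis 2 1)"
  have "dext r2 z r1 - dext r1 z r2 = (r1$1 * r2$2 - r1$2 * r2$1) * (\<rho> ?q * (W 1 2 - W 2 1) + (?p1 * ?w2 - ?p2 * ?w1))"
    unfolding E D by (simp add: algebra_simps)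
  then show ?thesis unfolding det curl curl_coeff_def by simp
qed

text \<open>On the box \<open>lam\<close> is \<open>\<sigma> * delta\<close>, which cancels the
  denominator in \<open>bulk\<close> up to \<open>\<sigma>\<close>. Off the box both sides vanish,
  so the region may extend below it.\<close>

lemma bulk_chart:
  "indicator S z * (in_chart c (lam c f \<nu>) z * in_chart c (bulk \<rho>) z)
     = - \<sigma> * (indicator {w. \<bar>cu w\<bar> < a \<and> cv w < g (cu w)} z * (dext r2 z r1 - dext r1 z r2))"
proof (cases "z \<in> bx")
  case True
  let ?q = "inv_c z"
  have q: "?q \<in> fst c" "snd c ?q = z" "z \<in> S" using True bx_S inv_in snd_inv by auto
  have qV: "?q \<in> V" unfolding arc_dom_def using True by simp
  have uv: "\<bar>cu z\<bar> < a" "\<bar>cv z\<bar> < b" using True by (auto simp: plane_box_def)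
  have "?q \<in> M_sharp_minus \<A> f \<nu> \<longleftrightarrow> cv z < g (cu z)"
    unfolding M_minus_iff[OF cA q(1)] K_neg_iff[OF cA q(1)] sgn_delta[OF qV]
    using neg[OF uv] unfolding coords by (simp add: in_chart_def)
  moreover have "\<bar>delta c ?q\<bar> = \<sigma> * delta c ?q" using sgn_delta[OF qV] by (metis abs_sgn mult.commute)
  ultimately show ?thesis
    using uv q delta_nz[OF cA q(1)] bulk_eq[OF cA q(1) \<rho>] dext_eq[OF True]
    by (simp add: in_chart_def lam_eq indicator_def)
next
  case False
  have "z \<notin> K0" using False K0 by blast
  moreover have "bulk \<rho> (inv_c z) = 0" if "z \<in> S"
  proof (rule bulk_off)
    show "inv_c z \<notin> V" using False that unfolding V_iff snd_inv[OF that] by (auto simp: plane_box_def)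
  qed
  ultimately show ?thesis by (cases "z \<in> S") (simp_all add: ext_off in_chart_def)
qed

lemma bulk_integral:
  shows "integrable (area_measure M \<A> f \<nu>) (bulk \<rho>)"
    and "(\<integral>q. bulk \<rho> q \<partial>area_measure M \<A> f \<nu>)
      = \<sigma> * (\<integral>u. indicator {-a<..<a} u * (ext \<rho> r1 (pt u (g u)) + ext \<rho> r2 (pt u (g u)) * g' u) \<partial>lborel)"
    and "integrable lborel (\<lambda>u. indicator {-a<..<a} u * (ext \<rho> r1 (pt u (g u)) + ext \<rho> r2 (pt u (g u)) * g' u))"
proof -
  define G where "G z = indicator {w. \<bar>cu w\<bar> < a \<and> cv w < g (cu w)} z * (dext r2 z r1 - dext r1 z r2)" for z
  \<comment> \<open>The largest \<open>\<bar>u\<bar>\<close> on the support; the added 0 covers an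
    empty support. Then \<open>(m + a) / 2\<close> is a positive half-width that contains the
    support and is strictly smaller than \<open>a\<close>.\<close>
  have "compact (insert 0 ((\<lambda>z. \<bar>cu z\<bar>) ` K0))"
    by (intro compact_insert compact_continuous_image K0(1) continuous_intros continuous_plane_uv)
  from compact_attains_sup[OF this] obtain m where m': "m \<in> insert 0 ((\<lambda>z. \<bar>cu z\<bar>) ` K0)" "\<forall>t\<in>insert 0 ((\<lambda>z. \<bar>cu z\<bar>) ` K0). t \<le> m"
    by blast
  then have m: "m \<in> insert 0 ((\<lambda>z. \<bar>cu z\<bar>) ` K0)" "\<And>z. z \<in> K0 \<Longrightarrow> \<bar>cu z\<bar> \<le> m" "0 \<le> m" by simp_all
  have ma: "m < a" using m(1) a0 K0(2) by (auto simp: plane_box_def subset_iff)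
  have ptd: "((\<lambda>p. pt (fst p) (snd p)) has_derivative (\<lambda>h. fst h *\<^sub>R r1 + snd h *\<^sub>R r2)) (at p)" for p
    unfolding plane_pt_def by (auto intro!: derivative_eq_intros)
  have ptc: "continuous_on UNIV (\<lambda>p. pt (fst p) (snd p))"
    unfolding plane_pt_def by (intro continuous_intros)
  have lin: "linear (dext r z)" for r z by (rule has_derivative_linear[OF ext_deriv])
  have K0': "pt u v \<notin> K0" if "\<not> (\<bar>u\<bar> \<le> (m + a) / 2 \<and> \<bar>v\<bar> \<le> b)" for u v
  proof
    assume "pt u v \<in> K0"
    then have "\<bar>u\<bar> \<le> m" "\<bar>v\<bar> < b" using m(2)[of "pt u v"] K0(2) pt_box[of u v] by (auto simp: coords)
    then show False using that ma by auto
  qed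
  have green: "integrable lborel (\<lambda>p. indicator {p. \<bar>fst p\<bar> < a \<and> snd p < g (fst p)} p *
        (dext r2 (pt (fst p) (snd p)) r1 - dext r1 (pt (fst p) (snd p)) r2))"
    "(\<integral>p. indicator {p. \<bar>fst p\<bar> < a \<and> snd p < g (fst p)} p *
        (dext r2 (pt (fst p) (snd p)) r1 - dext r1 (pt (fst p) (snd p)) r2) \<partial>lborel)
      = - (\<integral>u. indicator {-a<..<a} u * (ext \<rho> r1 (pt u (g u)) + ext \<rho> r2 (pt u (g u)) * g' u) \<partial>lborel)"
    "integrable lborel (\<lambda>u. indicator {-a<..<a} u * (ext \<rho> r1 (pt u (g u)) + ext \<rho> r2 (pt u (g u)) * g' u))"
  proof -
    have 1: "0 < (m + a) / 2" "(m + a) / 2 < a" using m(3) ma by auto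
    have 2: "((\<lambda>v. ext \<rho> r1 (pt u v)) has_real_derivative dext r1 (pt u v) r2) (at v)" for u v
    proof -
      have "((\<lambda>v. pt u v) has_vector_derivative r2) (at v)"
        unfolding plane_pt_def by (auto intro!: derivative_eq_intros simp: has_vector_derivative_def)
      from has_vector_derivative_chain[OF this ext_deriv]
      show ?thesis by (simp add: has_real_derivative_iff_has_vector_derivative)
    qed
    have 3: "((\<lambda>p. ext \<rho> r2 (pt (fst p) (snd p))) has_derivative (\<lambda>h. fst h * dext r2 (pt u v) r1 + snd h * dext r2 (pt u v) r2)) (at (u, v))" for u v
    proof -
      have "(ext \<rho> r2 has_derivative dext r2 (pt u v)) (at (pt (fst (u, v)) (snd (u, v))))" using ext_deriv by simp
      from diff_chain_at[OF ptd this] show ?thesis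
        by (simp add: o_def linear_add[OF lin] linear_cmul[OF lin])
    qed
    have 4: "continuous_on UNIV (\<lambda>p. ext \<rho> r (pt (fst p) (snd p)))" "continuous_on UNIV (\<lambda>p. dext r (pt (fst p) (snd p)) s)" for r s
      using continuous_on_compose2[OF ext_cont(1) ptc] continuous_on_compose2[OF ext_cont(2) ptc] by auto
    have 5: "ext \<rho> r1 (pt u v) = 0 \<and> ext \<rho> r2 (pt u v) = 0 \<and> dext r1 (pt u v) r2 = 0 \<and> dext r2 (pt u v) r1 = 0 \<and> dext r2 (pt u v) r2 = 0"
      if "\<not> (\<bar>u\<bar> \<le> (m + a) / 2 \<and> \<bar>v\<bar> \<le> b)" for u v
      using ext_off[OF K0'[OF that]] by simp
    note X = green_below_graph[where P = "\<lambda>u v. ext \<rho> r1 (pt u v)" and Q = "\<lambda>u v. ext \<rho> r2 (pt u v)"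
        and ?P2.0 = "\<lambda>u v. dext r1 (pt u v) r2" and ?Q1.0 = "\<lambda>u v. dext r2 (pt u v) r1" and ?Q2.0 = "\<lambda>u v. dext r2 (pt u v) r2",
        OF 1 2 3 4(1) 4(2) 4(2) 4(2) 5 g_deriv continuous_g']
    show "integrable lborel (\<lambda>p. indicator {p. \<bar>fst p\<bar> < a \<and> snd p < g (fst p)} p *
        (dext r2 (pt (fst p) (snd p)) r1 - dext r1 (pt (fst p) (snd p)) r2))" by (rule X(1))
    show "(\<integral>p. indicator {p. \<bar>fst p\<bar> < a \<and> snd p < g (fst p)} p *
        (dext r2 (pt (fst p) (snd p)) r1 - dext r1 (pt (fst p) (snd p)) r2) \<partial>lborel)
      = - (\<integral>u. indicator {-a<..<a} u * (ext \<rho> r1 (pt u (g u)) + ext \<rho> r2 (pt u (g u)) * g' u) \<partial>lborel)" by (rule X(3))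
    show "integrable lborel (\<lambda>u. indicator {-a<..<a} u * (ext \<rho> r1 (pt u (g u)) + ext \<rho> r2 (pt u (g u)) * g' u))" by (rule X(2))
  qed
  have ptG: "G (pt (fst p) (snd p)) = indicator {p. \<bar>fst p\<bar> < a \<and> snd p < g (fst p)} p *
        (dext r2 (pt (fst p) (snd p)) r1 - dext r1 (pt (fst p) (snd p)) r2)" for p
    by (simp add: G_def coords indicator_def)
  have m1: "(\<lambda>p. pt (fst p) (snd p)) \<in> measurable lborel borel"
    using ptc by (simp add: borel_measurable_continuous_onI)
  have bm: "bulk \<rho> \<in> borel_measurable (BM M)" by (rule bulk_measurable[OF cA \<rho> openin_V V_sub bulk_off])
  show "integrable lborel (\<lambda>u. indicator {-a<..<a} u * (ext \<rho> r1 (pt u (g u)) + ext \<rho> r2 (pt u (g u)) * g' u))" by (rule green(3))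
  have Gm: "G \<in> borel_measurable borel"
  proof -
    have o: "{-a<..<a} \<in> sets borel" by simp
    have gm: "g \<in> borel_measurable (restrict_space borel {-a<..<a})"
      by (rule borel_measurable_continuous_on_restrict[OF smooth_on_imp_continuous_on[OF g_smooth]])
    \<comment> \<open>\<open>g\<close> is known to be measurable only on its interval. The extension
      by zero describes the same region, because \<open>\<bar>cu w\<bar> < a\<close> is part of its
      definition.\<close>
    define gz where "gz u = (if u \<in> {-a<..<a} then g u else 0)" for u
    have "{x \<in> space borel. x \<in> {-a<..<a}} = {-a<..<a}" by auto
    then have gz: "gz \<in> borel_measurable borel" unfolding gz_def[abs_def]
      by (subst measurable_If_restrict_space_iff) (use gm o in \<open>simp_all only: Collect_mem_eq measurable_const space_borel simp_thms UNIV_I\<close>)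
    have cum [measurable]: "cu \<in> borel_measurable borel"
      by (rule borel_measurable_continuous_onI[OF continuous_plane_uv(1)])
    have [measurable]: "cv \<in> borel_measurable borel"
      by (rule borel_measurable_continuous_onI[OF continuous_plane_uv(2)])
    have [measurable]: "(\<lambda>w. gz (cu w)) \<in> borel_measurable borel" by (rule measurable_compose[OF cum gz])
    have "{w. \<bar>cu w\<bar> < a \<and> cv w < g (cu w)} = {w. \<bar>cu w\<bar> < a \<and> cv w < gz (cu w)}"
      by (auto simp: gz_def)
    moreover have "{w. \<bar>cu w\<bar> < a \<and> cv w < gz (cu w)} \<in> sets borel" by measurable
    ultimately have [measurable]: "{w. \<bar>cu w\<bar> < a \<and> cv w < g (cu w)} \<in> sets borel" by simp
    have "(\<lambda>z. dext r2 z r1 - dext r1 z r2) \<in> borel_measurable borel"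
      by (intro borel_measurable_continuous_onI continuous_on_diff ext_cont)
    then show ?thesis unfolding G_def[abs_def] by (intro borel_measurable_times borel_measurable_indicator) auto
  qed
  have dl: "distr lborel borel (\<lambda>p. pt (fst p) (snd p)) = lborel"
    unfolding plane_pt_def by (rule lborel_affine_plane[OF det])
  have iG: "integrable lborel G"
    by (subst dl[symmetric], subst integrable_distr_eq[OF m1 Gm]) (use green(1) in \<open>simp add: ptG\<close>)
  have eG: "integral\<^sup>L lborel G = - (\<integral>u. indicator {-a<..<a} u * (ext \<rho> r1 (pt u (g u)) + ext \<rho> r2 (pt u (g u)) * g' u) \<partial>lborel)"
    by (subst dl[symmetric], subst integral_distr[OF m1 Gm]) (use green(2) in \<open>simp add: ptG\<close>)
  have off: "\<And>q. q \<notin> fst c \<Longrightarrow> bulk \<rho> q = 0" using bulk_off V_sub by blast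
  have ch: "indicator S z * (in_chart c (lam c f \<nu>) z * in_chart c (bulk \<rho>) z) = - \<sigma> * G z" for z
    unfolding G_def by (rule bulk_chart)
  show "integrable (area_measure M \<A> f \<nu>) (bulk \<rho>)"
    by (rule area_integral(1)[OF cA bm, THEN iffD2], erule off, unfold ch) (rule integrable_mult_right[OF iG])
  show "(\<integral>q. bulk \<rho> q \<partial>area_measure M \<A> f \<nu>)
      = \<sigma> * (\<integral>u. indicator {-a<..<a} u * (ext \<rho> r1 (pt u (g u)) + ext \<rho> r2 (pt u (g u)) * g' u) \<partial>lborel)"
    by (rule trans[OF area_integral(2)[OF cA bm]], erule off, unfold ch integral_mult_right_zero eG) simp
qed

end

end

section \<open>Stokes' formula across an arc of the singular set\<close>

context arc_folds
begin

context
  fixes \<rho> :: "'a \<Rightarrow> real" and K0 :: "(real^2) set"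
  assumes \<rho>: "C1 \<rho>" and K0: "compact K0" "K0 \<subseteq> bx" and supp: "\<And>q. q \<notin> inv_c ` K0 \<Longrightarrow> \<rho> q = 0"
begin

lemma boundary_term:
  assumes u: "\<bar>u\<bar> < a"
  shows "ext \<rho> r1 (pt u (g u)) + ext \<rho> r2 (pt u (g u)) * g' u = \<rho> (\<gamma> u) * omega c (\<gamma> u) (velocity c \<gamma> u)"
  unfolding ext_on_graph[OF u gb[OF u]] gamma_velocity(2)[OF u]
  using linear_omega[OF cA gamma_facts(5)[OF u]] by (simp add: linear_add linear_cmul algebra_simps)

text \<open>\<open>singular_curvature\<close> is a definite description, so its measurability is
  drawn from the formula of \<open>curvature_on_arc\<close>, which is continuous in the parameter on
  \<open>T2\<close>.\<close>

lemma bdry_measurable: "bdry \<rho> \<in> borel_measurable (BM M)"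
proof -
  define h where "h u = indicator T2 u * (\<sigma> * omega c (\<gamma> u) (velocity c \<gamma> u) / norm (psi_velocity c \<nu> \<gamma> u))" for u
  have "continuous_on T2 (\<lambda>u. \<sigma> * omega c (\<gamma> u) (velocity c \<gamma> u) / norm (psi_velocity c \<nu> \<gamma> u))"
  proof -
    have c1: "continuous_on T2 (psi_velocity c \<nu> \<gamma>)"
      by (rule continuous_on_subset[OF continuous_psi_velocity[OF cA regular_gamma] T2_sub])
    have c2: "continuous_on T2 (\<lambda>u. pt u (g u))"
      unfolding plane_pt_def
      by (intro continuous_intros continuous_on_subset[OF smooth_on_imp_continuous_on[OF g_smooth] T2_sub])
    have c3: "continuous_on T2 (\<lambda>u. in_chart c (\<lambda>q. omega c q r) (pt u (g u)))" for r
      by (rule continuous_on_compose2[OF C_k_on_imp_continuous_on[OF omega_C1[OF \<rho> K0 supp]] c2])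
        (use T2_sub gb pt_box in \<open>auto simp: abs_less_iff\<close>)
    have c4: "continuous_on T2 g'" by (rule continuous_on_subset[OF continuous_g' T2_sub])
    have "continuous_on T2 (\<lambda>u. \<sigma> * (in_chart c (\<lambda>q. omega c q r1) (pt u (g u)) + g' u * in_chart c (\<lambda>q. omega c q r2) (pt u (g u)))
        / norm (psi_velocity c \<nu> \<gamma> u))"
      using psi_nonzero(1) by (intro continuous_intros c1 c3 c4) auto
    then show ?thesis
    proof (rule continuous_on_eq)
      fix u assume "u \<in> T2"
      then have u: "\<bar>u\<bar> < a" using T2_sub by (auto simp: abs_less_iff)
      show "\<sigma> * (in_chart c (\<lambda>q. omega c q r1) (pt u (g u)) + g' u * in_chart c (\<lambda>q. omega c q r2) (pt u (g u)))
        / norm (psi_velocity c \<nu> \<gamma> u) = \<sigma> * omega c (\<gamma> u) (velocity c \<gamma> u) / norm (psi_velocity c \<nu> \<gamma> u)"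
        unfolding gamma_velocity(2)[OF u] using linear_omega[OF cA gamma_facts(5)[OF u]]
        by (simp add: linear_add linear_cmul in_chart_def arc_curve_def)
    qed
  qed
  from borel_measurable_continuous_on_indicator[OF borel_open[OF open_T2] this]
  have "h \<in> borel_measurable borel" unfolding h_def[abs_def] real_scaleR_def .
  moreover have "(\<lambda>q. if q \<in> V then cu (snd c q) else 0) \<in> borel_measurable (BM M)"
  proof (rule borel_measurable_chart_extend[OF openin_V V_sub])
    show "continuous_on (snd c ` V) (in_chart c (\<lambda>q. cu (snd c q)))"
      by (rule continuous_on_eq[OF continuous_plane_uv(1)]) (use V_sub in \<open>auto simp: in_chart_snd subset_iff\<close>)
  qed auto
  ultimately have "(\<lambda>q. h (if q \<in> V then cu (snd c q) else 0)) \<in> borel_measurable (BM M)"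
    by (rule measurable_compose[rotated])
  moreover have "A2 \<inter> V \<in> sets (BM M)" using A2_BM V_BM by auto
  ultimately have m: "(\<lambda>q. \<rho> q * (indicator (A2 \<inter> V) q * h (if q \<in> V then cu (snd c q) else 0))) \<in> borel_measurable (BM M)"
    by (intro borel_measurable_times C1_measurable[OF \<rho>] borel_measurable_indicator)
  have "bdry \<rho> q = \<rho> q * (indicator (A2 \<inter> V) q * h (if q \<in> V then cu (snd c q) else 0))" for q
  proof (cases "q \<in> V")
    case True
    show ?thesis
    proof (cases "q \<in> A2")
      case A: True
      then have S: "q \<in> \<Sigma>" using A2_subset by blast
      note X = V_Sigma[OF True S]
      have T: "cu (snd c q) \<in> T2" using X A by (auto simp: T2_def abs_less_iff)
      show ?thesis using curvature_on_arc[OF T] T A True unfolding X(2) by (simp add: bdry_def h_def X(2))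
    qed (simp add: bdry_def)
  next
    case False
    then have "\<rho> q = 0" using supp K0(2) by (auto simp: arc_dom_def)
    then show ?thesis by (simp add: bdry_def)
  qed
  then show ?thesis using m by (simp cong: measurable_cong)
qed

text \<open>The norm in the denominator of the curvature cancels against the length density. The
  boundary integrand becomes \<open>\<sigma> \<rho> \<omega>(\<gamma>')\<close>, which is continuous
  across cusps, and by \<open>AE_T2\<close> leaving out the cusps does not change its
  integral.\<close>

lemma stokes_arc: "stokes \<rho>"
proof -
  define H where "H u = indicator {-a<..<a} u * (ext \<rho> r1 (pt u (g u)) + ext \<rho> r2 (pt u (g u)) * g' u)" for u
  note B = bulk_integral[OF \<rho> K0 supp, folded H_def]
  have off: "bdry \<rho> q = 0" if "q \<notin> V" for q
  proof -
    have "\<rho> q = 0" using supp K0(2) that by (auto simp: arc_dom_def)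
    then show ?thesis by (simp add: bdry_def)
  qed
  have pw: "indicator T2 u * (norm (psi_velocity c \<nu> \<gamma> u) * bdry \<rho> (\<gamma> u)) = \<sigma> * (indicator T2 u * H u)" for u
  proof (cases "u \<in> T2")
    case True
    then have u: "\<bar>u\<bar> < a" "u \<in> {-a<..<a}" "\<gamma> u \<in> A2" by (auto simp: T2_def abs_less_iff)
    show ?thesis using True u(2,3) psi_nonzero(1)[OF True]
      by (simp add: H_def boundary_term[OF u(1)] bdry_def curvature_on_arc[OF True])
  qed simp
  have T2b: "T2 \<in> sets lborel" using open_T2 by simp
  have i: "integrable lborel (\<lambda>u. indicator T2 u * H u)"
    using integrable_mult_indicator[OF T2b B(3)] by simp
  have e: "(\<integral>u. indicator T2 u * H u \<partial>lborel) = (\<integral>u. H u \<partial>lborel)"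
  proof (rule integral_cong_AE)
    show "AE u in lborel. indicator T2 u * H u = H u" using AE_T2
      by eventually_elim (auto simp: H_def indicator_def)
  qed (use i B(3) in auto)
  have "integrable (length_measure M \<A> f \<nu>) (bdry \<rho>)"
    by (rule length_integral(1)[OF bdry_measurable, THEN iffD2], erule off, unfold pw) (rule integrable_mult_right[OF i])
  moreover have "(\<integral>q. bdry \<rho> q \<partial>length_measure M \<A> f \<nu>) = \<sigma> * (\<integral>u. H u \<partial>lborel)"
    by (rule trans[OF length_integral(2)[OF bdry_measurable]], erule off, unfold pw integral_mult_right_zero e) (rule refl)
  ultimately show ?thesis unfolding stokes_def using B(1,2) by simp
qed

end

end

context folds_cusps
begin

lemma stokes_no_boundary:
  assumes "bdry \<rho> = (\<lambda>q. 0)" "integrable (area_measure M \<A> f \<nu>) (bulk \<rho>)" "(\<integral>q. bulk \<rho> q \<partial>area_measure M \<A> f \<nu>) = 0"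
  shows "stokes \<rho>"
  using assms by (simp add: stokes_def)

text \<open>Where the curvature vanishes, an arc passes through the point and
  \<open>stokes_arc\<close> applies. Where it is positive, both integrands are identically zero.
  Where it is negative, a whole box lies in \<open>M_sharp_minus\<close>, and Green's formula
  without a boundary contribution gives zero.\<close>

lemma local_stokes:
  assumes p: "p \<in> topspace M"
  obtains c V where "c \<in> \<A>" "openin M V" "p \<in> V" "V \<subseteq> fst c"
    "\<And>\<rho> K. C1 \<rho> \<Longrightarrow> compact K \<Longrightarrow> K \<subseteq> snd c ` V \<Longrightarrow> (\<And>q. q \<notin> inv_into (fst c) (snd c) ` K \<Longrightarrow> \<rho> q = 0) \<Longrightarrow> stokes \<rho>"
proof -
  let ?K = "gaussian_curvature \<A> f"
  consider "?K p = 0" | "?K p > 0" | "?K p < 0" by linarith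
  then show thesis
  proof cases
    case 1
    obtain d where "d \<in> \<A>" "p \<in> fst d" using cover[OF p] by blast
    then have pS: "p \<in> Sigma_sharp \<A> f \<nu>" using curvature_zero_iff 1 by blast
    obtain c \<zeta> where c: "c \<in> \<A>" "p \<in> fst c" "differential c (delta_sharp c) p \<zeta> \<noteq> 0"
      using Sigma_nondegenerate[OF pS] by blast
    obtain z0 r1 r2 a b g \<sigma> where A: "arc M \<A> f \<nu> c z0 r1 r2 a b g \<sigma>" "p \<in> arc_dom c z0 r1 r2 a b"
      using arc_exists[OF c(1,2) pS c(3)] by blast
    interpret x: arc_folds M \<A> f \<nu> c z0 r1 r2 a b g \<sigma>
      using A(1) folds_cusps_axioms by (simp add: arc_folds_def)
    have V: "snd c ` x.V = x.bx" using x.snd_inv x.bx_S by (force simp: arc_dom_def image_image)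
    show thesis
    proof (rule that[OF c(1) x.openin_V A(2) x.V_sub], unfold V)
      fix \<rho> K assume "C1 \<rho>" "compact K" "K \<subseteq> x.bx" "\<And>q. q \<notin> x.inv_c ` K \<Longrightarrow> \<rho> q = 0"
      then show "stokes \<rho>" by (rule x.stokes_arc)
    qed
  next
    case 2
    obtain c where c: "c \<in> \<A>" "p \<in> fst c" using cover[OF p] by blast
    interpret chart M c using c by (simp add: chart_axioms_A)
    define V where "V = {q \<in> topspace M. ?K q \<in> {0<..}} \<inter> fst c"
    have V: "openin M V" "p \<in> V" "V \<subseteq> fst c" using openin_K_neg[of "{0<..}"] openin_dom p 2 c by (auto simp: V_def)
    show thesis
    proof (rule that[OF c(1) V])
      fix \<rho> K assume h: "C1 \<rho>" "compact K" "K \<subseteq> snd c ` V" and supp: "\<And>q. q \<notin> inv_c ` K \<Longrightarrow> \<rho> q = 0"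
      have KS: "K \<subseteq> S" using h(3) V(3) by blast
      have pos: "?K q > 0 \<and> q \<in> fst c" if q: "q \<in> inv_c ` K" for q
      proof -
        obtain z where z: "z \<in> K" "q = inv_c z" using q by blast
        then obtain q' where "q' \<in> V" "z = snd c q'" using h(3) by blast
        then show ?thesis using z V(3) inv_snd by (auto simp: V_def)
      qed
      have "bulk \<rho> q = 0" for q
      proof (cases "q \<in> inv_c ` K")
        case True
        then show ?thesis using pos[OF True] M_minus_iff[OF c(1), of q] by (simp add: bulk_def)
      qed (rule bulk_off_compact[OF c(1) h(2) KS supp])
      then have b: "bulk \<rho> = (\<lambda>q. 0)" by blast
      have "bdry \<rho> q = 0" for q
      proof (cases "q \<in> inv_c ` K")
        case True
        then have "q \<notin> A2_points M \<A> f \<nu>" using pos[OF True] curvature_zero_iff[OF c(1), of q] A2_subset by auto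
        then show ?thesis by (simp add: bdry_def)
      qed (simp add: bdry_def supp)
      then have "bdry \<rho> = (\<lambda>q. 0)" by blast
      then show "stokes \<rho>" by (simp add: stokes_def b)
    qed
  next
    case 3
    obtain c where c: "c \<in> \<A>" "p \<in> fst c" using cover[OF p] by blast
    interpret chart M c using c by (simp add: chart_axioms_A)
    obtain W where W: "open W" "W \<subseteq> S" "snd c p \<in> W"
      "\<And>q. q \<in> fst c \<Longrightarrow> snd c q \<in> W \<Longrightarrow> sgn (delta c q) = sgn (delta c p) \<and> mfield c q \<noteq> 0"
      using patch_region[OF c K_neg_mfield[OF c 3]] by blast
    define N where "N = snd c ` ({q \<in> topspace M. ?K q \<in> {..<0}} \<inter> fst c)"
    have oN: "open N" unfolding N_def
      by (rule openin_iff_open[THEN iffD1]) (use openin_K_neg[of "{..<0}"] openin_dom in auto)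
    have pN: "snd c p \<in> N" using c p 3 by (auto simp: N_def)
    obtain e where e: "e > 0" "ball (snd c p) e \<subseteq> W \<inter> N"
      using open_Int[OF W(1) oN] W(3) pN open_contains_ball by blast
    define a where "a = e / 2"
    have a0: "a > 0" using e by (simp add: a_def)
    let ?r1 = "axis 1 1 :: real^2" and ?r2 = "axis 2 1 :: real^2" and ?z = "snd c p"
    have det: "?r1$1 * ?r2$2 - ?r1$2 * ?r2$1 = 1" by (simp add: axis_def)
    have inW: "plane_pt ?z ?r1 ?r2 u v \<in> W \<inter> N" if "\<bar>u\<bar> < a" "\<bar>v\<bar> < a" for u v
    proof -
      have "norm (u *\<^sub>R ?r1 + v *\<^sub>R ?r2) \<le> \<bar>u\<bar> + \<bar>v\<bar>"
        by (rule norm_triangle_le) (simp add: norm_axis_1)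
      moreover have "dist ?z (plane_pt ?z ?r1 ?r2 u v) = norm (u *\<^sub>R ?r1 + v *\<^sub>R ?r2)"
        unfolding plane_pt_def by (subst dist_commute) (simp add: dist_norm add.assoc)
      ultimately have "plane_pt ?z ?r1 ?r2 u v \<in> ball ?z e" using that by (simp add: a_def)
      then show ?thesis using e by blast
    qed
    define \<sigma> where "\<sigma> = sgn (delta c p)"
    have dom: "q \<in> fst c \<and> snd c q \<in> W \<inter> N" if q: "q \<in> arc_dom c ?z ?r1 ?r2 a a" for q
    proof -
      obtain w where w: "w \<in> plane_box ?z ?r1 ?r2 a a" "q = inv_c w" using q unfolding arc_dom_def by blast
      have "w \<in> W \<inter> N" using inW[of "plane_u ?z ?r1 ?r2 w" "plane_v ?z ?r1 ?r2 w"] w(1)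
        unfolding plane_coords[OF det] by (auto simp: plane_box_def)
      then show ?thesis using W(2) w(2) inv_in snd_inv by auto
    qed
    have NK: "?K q < 0" if "q \<in> fst c" "snd c q \<in> N" for q
      using that inj_onD[OF inj] by (auto simp: N_def)
    \<comment> \<open>The constant graph of height \<open>a\<close> is the upper edge of the box, so
      the whole open box counts as lying below the graph.\<close>
    interpret x: patch M \<A> f \<nu> c ?z ?r1 ?r2 a a "\<lambda>u. a" \<sigma>
    proof unfold_locales
      show "c \<in> \<A>" "?r1$1 * ?r2$2 - ?r1$2 * ?r2$1 = 1" "a > 0" "smooth_on {-a<..<a} (\<lambda>u. a)"
        using c det a0 smooth_on_intros(1)[OF open_greaterThanLessThan] by auto
      show "plane_pt ?z ?r1 ?r2 u v \<in> S" if "\<bar>u\<bar> < a" "\<bar>v\<bar> < a" for u v using inW[OF that] W(2) by blast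
      show "sgn (delta c q) = \<sigma>" "mfield c q \<noteq> 0" if "q \<in> arc_dom c ?z ?r1 ?r2 a a" for q
        using dom[OF that] W(4)[of q] by (auto simp: \<sigma>_def)
      show "\<sigma> * in_chart c (delta_sharp c) (plane_pt ?z ?r1 ?r2 u v) < 0 \<longleftrightarrow> v < a" if uv: "\<bar>u\<bar> < a" "\<bar>v\<bar> < a" for u v
      proof -
        let ?q = "inv_c (plane_pt ?z ?r1 ?r2 u v)"
        have q: "?q \<in> fst c" "snd c ?q = plane_pt ?z ?r1 ?r2 u v" using inW[OF uv] W(2) inv_in snd_inv by auto
        have "?K ?q < 0" by (rule NK[OF q(1)]) (use inW[OF uv] q(2) in simp)
        then have "sgn (delta c ?q) * delta_sharp c ?q < 0" using K_neg_iff[OF c(1) q(1)] by simp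
        moreover have "sgn (delta c ?q) = \<sigma>" using W(4)[OF q(1)] inW[OF uv] q(2) by (simp add: \<sigma>_def)
        ultimately show ?thesis using uv by (simp add: in_chart_def)
      qed
    qed
    have V: "snd c ` x.V = x.bx" using snd_inv x.bx_S by (force simp: arc_dom_def image_image)
    have pV: "p \<in> x.V" unfolding x.V_iff using c a0 by (simp add: plane_u_def plane_v_def)
    show thesis
    proof (rule that[OF c(1) x.openin_V pV x.V_sub], unfold V)
      fix \<rho> K assume h: "C1 \<rho>" "compact K" "K \<subseteq> x.bx" and supp: "\<And>q. q \<notin> inv_c ` K \<Longrightarrow> \<rho> q = 0"
      have "bdry \<rho> q = 0" for q
      proof (cases "q \<in> x.V")
        case True
        then have "q \<notin> A2_points M \<A> f \<nu>" using dom[OF True] NK[of q] curvature_zero_iff[OF c(1), of q] A2_subset by auto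
        then show ?thesis by (simp add: bdry_def)
      next
        case False
        then have "\<rho> q = 0" using supp h(3) by (auto simp: arc_dom_def)
        then show ?thesis by (simp add: bdry_def)
      qed
      then have b: "bdry \<rho> = (\<lambda>q. 0)" by blast
      \<comment> \<open>The upper edge does not belong to the open box, hence not to the support;
        the extended form vanishes there and the boundary integral is zero.\<close>
      have "plane_pt ?z ?r1 ?r2 u a \<notin> K" for u
      proof
        assume "plane_pt ?z ?r1 ?r2 u a \<in> K"
        then have "plane_pt ?z ?r1 ?r2 u a \<in> x.bx" using h(3) by blast
        then show False unfolding x.pt_box using a0 by simp
      qed
      then have z: "x.ext \<rho> r (plane_pt ?z ?r1 ?r2 u a) = 0" for r u
        using x.ext_off(1)[OF h supp] by simp
      show "stokes \<rho>"
        by (rule stokes_no_boundary[OF b x.bulk_integral(1)[OF h supp]])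
          (simp_all add: x.bulk_integral(2)[OF h supp] z)
    qed
  qed
qed

end

section \<open>Partition of unity\<close>

lemma C_k_on_max_square: "C_k_on 1 UNIV (\<lambda>t::real. (max 0 t)\<^sup>2)"
proof -
  have "((\<lambda>t. (max 0 t)\<^sup>2) has_real_derivative 2 * max 0 t) (at t)" for t :: real
  proof -
    consider "t > 0" | "t < 0" | "t = 0" by linarith
    then show ?thesis
    proof cases
      case 1
      have "((\<lambda>t. t\<^sup>2) has_real_derivative 2 * max 0 t) (at t)"
        using 1 by (auto intro!: derivative_eq_intros)
      then show ?thesis by (rule has_field_derivative_transform_within_open[where S = "{0<..}"]) (use 1 in auto)
    next
      case 2
      have "((\<lambda>t. 0) has_real_derivative 2 * max 0 t) (at t)" using 2 by simp
      then show ?thesis by (rule has_field_derivative_transform_within_open[where S = "{..<0}"]) (use 2 in auto)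
    next
      case 3
      \<comment> \<open>At the kink the difference quotient is \<open>max 0 z\<close> itself, which
        is continuous: Caratheodory's form of the derivative.\<close>
      have "isCont (\<lambda>z::real. max 0 z) 0" by (intro continuous_intros)
      moreover have "\<forall>z::real. (max 0 z)\<^sup>2 - (max 0 0)\<^sup>2 = max 0 z * (z - 0)" by (simp add: max_def power2_eq_square)
      ultimately show ?thesis unfolding 3 CARAT_DERIV by (intro exI[of _ "\<lambda>z. max 0 z"]) simp
    qed
  qed
  then have d: "((\<lambda>t. (max 0 t)\<^sup>2) has_derivative (\<lambda>h. 2 * max 0 t * h)) (at t)" for t :: real
    by (simp add: has_field_derivative_def)
  have c: "C_k_on 0 UNIV (\<lambda>t. 2 * max 0 t * v)" for v :: real
    by (simp, intro continuous_intros)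
  show ?thesis unfolding One_nat_def by (rule C_k_on_SucI[OF open_UNIV d c])
qed

definition bump :: "real^2 \<Rightarrow> real \<Rightarrow> real^2 \<Rightarrow> real" where
  "bump z r w = (max 0 (r\<^sup>2 - (w - z) \<bullet> (w - z)))\<^sup>2"

lemma C_k_on_bump: "C_k_on 1 UNIV (bump z r)"
proof -
  have "C_k_on 1 UNIV (\<lambda>w. r\<^sup>2 - (w - z) \<bullet> (w - z))"
    by (rule smooth_onD) (intro smooth_on_intros open_UNIV)
  from C_k_on_compose[OF open_UNIV open_UNIV _ this C_k_on_max_square]
  show ?thesis unfolding bump_def[abs_def] by simp
qed

lemma bump_pos_iff: "r > 0 \<Longrightarrow> bump z r w > 0 \<longleftrightarrow> w \<in> ball z r" and bump_nonneg: "bump z r w \<ge> 0"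
  and bump_zero: "r > 0 \<Longrightarrow> w \<notin> cball z r \<Longrightarrow> bump z r w = 0"
proof -
  have d: "(w - z) \<bullet> (w - z) = (dist z w)\<^sup>2" by (simp add: dist_norm norm_minus_commute power2_norm_eq_inner)
  show "bump z r w > 0 \<longleftrightarrow> w \<in> ball z r" if "r > 0"
  proof -
    have "(dist z w)\<^sup>2 < r\<^sup>2 \<longleftrightarrow> dist z w < r" using that by (intro iffI power_strict_mono) (auto intro: power_less_imp_less_base)
    then show ?thesis unfolding bump_def d by (auto simp: max_def)
  qed
  show "bump z r w \<ge> 0" by (simp add: bump_def)
  show "bump z r w = 0" if "r > 0" "w \<notin> cball z r"
  proof -
    have "r\<^sup>2 \<le> (dist z w)\<^sup>2" using that by (intro power_mono) auto
    then show ?thesis unfolding bump_def d by (simp add: max_def)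
  qed
qed

context surface
begin

definition surface_bump :: "'a chart \<Rightarrow> real^2 \<Rightarrow> real \<Rightarrow> 'a \<Rightarrow> real" where
  "surface_bump c z r q = (if q \<in> fst c then bump z r (snd c q) else 0)"

lemma surface_bump_off:
  assumes "r > 0" "q \<notin> inv_into (fst c) (snd c) ` cball z r" and c: "c \<in> \<A>"
  shows "surface_bump c z r q = 0"
proof (cases "q \<in> fst c")
  case True
  have "snd c q \<notin> cball z r"
  proof
    assume "snd c q \<in> cball z r"
    then have "inv_into (fst c) (snd c) (snd c q) \<in> inv_into (fst c) (snd c) ` cball z r" by (rule imageI)
    then show False using assms(2) chart.inv_snd[OF chart_axioms_A[OF c] True] by simp
  qed
  then show ?thesis using bump_zero[OF assms(1)] by (simp add: surface_bump_def)
qed (simp add: surface_bump_def)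

text \<open>Off the compact image of the closed ball the function is zero, and in the chart of the
  bump it is given by the formula; these two open sets cover every other chart.\<close>

lemma surface_bump_C1:
  assumes c: "c \<in> \<A>" and r: "r > 0" "cball z r \<subseteq> snd c ` fst c"
  shows "C1 (surface_bump c z r)"
  unfolding C1_def
proof
  fix d assume d: "d \<in> \<A>"
  interpret d: chart M d by (rule chart_axioms_A[OF d])
  interpret c: chart M c by (rule chart_axioms_A[OF c])
  let ?N = "topspace M - c.inv_c ` cball z r"
  have N: "openin M ?N" by (rule compact_image_closed[OF c compact_cball r(2)])
  have "C_k_on 1 c.S (in_chart c (surface_bump c z r))"
    by (subst C_k_on_cong[OF c.open_S, of _ "bump z r"])
      (use C_k_on_subset[OF C_k_on_bump] in \<open>auto simp: c.in_chart_snd surface_bump_def simp del: C_k_on.simps One_nat_def\<close>)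
  then have 1: "C_k_on 1 (snd d ` (fst d \<inter> fst c)) (in_chart d (surface_bump c z r))" by (rule C_k_on_transition[OF d c])
  have o: "open (snd d ` (fst d \<inter> ?N))"
    by (rule d.openin_iff_open[THEN iffD1]) (use openin_Int[OF d.openin_dom N] in auto)
  have 2: "C_k_on 1 (snd d ` (fst d \<inter> ?N)) (in_chart d (surface_bump c z r))"
  proof (subst C_k_on_cong[OF o])
    show "in_chart d (surface_bump c z r) w = 0" if "w \<in> snd d ` (fst d \<inter> ?N)" for w
      using that surface_bump_off[OF r(1) _ c] by (auto simp: d.in_chart_snd)
  qed (rule C_k_on_const)
  have "c.inv_c ` cball z r \<subseteq> fst c" using r(2) c.inv_in by blast
  then have "d.S = snd d ` (fst d \<inter> fst c) \<union> snd d ` (fst d \<inter> ?N)" using d.dom_subset by blast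
  then show "C_k_on 1 d.S (in_chart d (surface_bump c z r))"
    using C_k_on_Un[OF open_overlap[OF d c] o 1 2] by simp
qed

text \<open>The derivatives of the constant sum 1 vanish, which removes all terms containing
  \<open>omega\<close>.\<close>

lemma curl_coeff_partition:
  assumes c: "c \<in> \<A>" "q \<in> fst c" and T: "finite T" and \<rho>: "\<And>x. x \<in> T \<Longrightarrow> C1 (\<rho> x)"
    and one: "\<And>p. p \<in> topspace M \<Longrightarrow> (\<Sum>x\<in>T. \<rho> x p) = 1"
  shows "(\<Sum>x\<in>T. curl_coeff (\<rho> x) c q) = delta_sharp c q"
proof -
  interpret chart M c using c by (simp add: chart_axioms_A)
  have p0: "(\<Sum>x\<in>T. partial c i (\<rho> x) q) = 0" for i
  proof -
    have "((\<lambda>z. \<Sum>x\<in>T. in_chart c (\<rho> x) z) has_derivative (\<lambda>h. \<Sum>x\<in>T. differential c (\<rho> x) q h)) (at (snd c q))"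
      by (rule has_derivative_sum) (rule cdiff_has_derivative[OF C1_cdiff[OF \<rho> c]])
    moreover have "((\<lambda>z. \<Sum>x\<in>T. in_chart c (\<rho> x) z) has_derivative (\<lambda>h. 0)) (at (snd c q))"
    proof (rule has_derivative_transform_within_open[OF has_derivative_const open_S])
      show "snd c q \<in> S" using c by simp
      show "(1::real) = (\<Sum>x\<in>T. in_chart c (\<rho> x) z)" if "z \<in> S" for z
        using that one dom_subset by (auto simp: in_chart_snd)
    qed
    ultimately have "(\<lambda>h. \<Sum>x\<in>T. differential c (\<rho> x) q h) = (\<lambda>h. 0)" by (rule has_derivative_unique)
    then show ?thesis unfolding partial_def by metis
  qed
  have "(\<Sum>x\<in>T. curl_coeff (\<rho> x) c q) = (\<Sum>x\<in>T. \<rho> x q) * delta_sharp c q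
      - ((\<Sum>x\<in>T. partial c 1 (\<rho> x) q) * omega c q (axis 2 1) - (\<Sum>x\<in>T. partial c 2 (\<rho> x) q) * omega c q (axis 1 1))"
    by (simp add: curl_coeff_def sum_subtractf sum_distrib_right)
  then show ?thesis using one[OF in_topspace[OF c]] by (simp add: p0)
qed

end

context folds_cusps
begin

lemma stokes_partition:
  obtains T and \<rho> :: "'a \<Rightarrow> 'a \<Rightarrow> real" where "finite T" "\<And>x. x \<in> T \<Longrightarrow> C1 (\<rho> x)" "\<And>x. x \<in> T \<Longrightarrow> stokes (\<rho> x)"
    "\<And>p. p \<in> topspace M \<Longrightarrow> (\<Sum>x\<in>T. \<rho> x p) = 1"
proof -
  \<comment> \<open>Stokes' formula is demanded for every \<open>C1\<close> function supported in
    the ball, because the normalised bumps depend on the finite subcover, which is chosen only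
    afterwards.\<close>
  define good where "good c z r \<longleftrightarrow> c \<in> \<A> \<and> r > 0 \<and> cball z r \<subseteq> snd c ` fst c \<and>
      (\<forall>\<rho>. C1 \<rho> \<longrightarrow> (\<forall>q. q \<notin> inv_into (fst c) (snd c) ` cball z r \<longrightarrow> \<rho> q = 0) \<longrightarrow> stokes \<rho>)" for c z r
  have "\<exists>c r. p \<in> fst c \<and> good c (snd c p) r" if p: "p \<in> topspace M" for p
  proof -
    obtain c V where cV: "c \<in> \<A>" "openin M V" "p \<in> V" "V \<subseteq> fst c" and
      st: "\<And>\<rho> K. C1 \<rho> \<Longrightarrow> compact K \<Longrightarrow> K \<subseteq> snd c ` V \<Longrightarrow> (\<And>q. q \<notin> inv_into (fst c) (snd c) ` K \<Longrightarrow> \<rho> q = 0) \<Longrightarrow> stokes \<rho>"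
      using local_stokes[OF p] by blast
    have "open (snd c ` V)" using chart.openin_iff_open[OF chart_axioms_A[OF cV(1)] cV(4)] cV(2) by simp
    then obtain r where r: "r > 0" "cball (snd c p) r \<subseteq> snd c ` V" using cV(3) open_contains_cball by blast
    have "good c (snd c p) r"
      unfolding good_def using cV(1,4) r st[OF _ compact_cball r(2)] by blast
    then show ?thesis using cV by blast
  qed
  then obtain c r where cr: "\<And>p. p \<in> topspace M \<Longrightarrow> p \<in> fst (c p) \<and> good (c p) (snd (c p) p) (r p)" by metis
  have g: "c p \<in> \<A>" "r p > 0" "cball (snd (c p) p) (r p) \<subseteq> snd (c p) ` fst (c p)" "p \<in> fst (c p)"
    "\<And>\<rho>. C1 \<rho> \<Longrightarrow> (\<And>q. q \<notin> inv_into (fst (c p)) (snd (c p)) ` cball (snd (c p) p) (r p) \<Longrightarrow> \<rho> q = 0) \<Longrightarrow> stokes \<rho>"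
    if "p \<in> topspace M" for p using cr[OF that] unfolding good_def by blast+
  define b where "b p = surface_bump (c p) (snd (c p) p) (r p)" for p
  define U where "U p = inv_into (fst (c p)) (snd (c p)) ` ball (snd (c p) p) (r p)" for p
  have U: "openin M (U p)" "p \<in> U p" "\<And>q. q \<in> U p \<Longrightarrow> b p q > 0" if p: "p \<in> topspace M" for p
  proof -
    interpret chart M "c p" by (rule chart_axioms_A[OF g(1)[OF p]])
    have B: "ball (snd (c p) p) (r p) \<subseteq> S" using g(3)[OF p] ball_subset_cball by blast
    show "openin M (U p)" unfolding U_def by (rule openin_inv_image[OF open_ball B])
    have "p = inv_c (snd (c p) p)" using inv_snd[OF g(4)[OF p]] by simp
    then show "p \<in> U p" unfolding U_def by (rule image_eqI) (simp add: g(2)[OF p])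
    fix q assume "q \<in> U p"
    then obtain w where w: "w \<in> ball (snd (c p) p) (r p)" "q = inv_c w" by (auto simp: U_def)
    then have "q \<in> fst (c p)" "snd (c p) q = w" using B inv_in snd_inv by blast+
    then show "b p q > 0" using bump_pos_iff[OF g(2)[OF p]] w(1) by (simp add: b_def surface_bump_def)
  qed
  have "compactin M (topspace M)" using compact_M by (simp add: compact_space_def)
  moreover have "topspace M \<subseteq> \<Union>(U ` topspace M)" using U(2) by blast
  ultimately obtain \<F> where \<F>: "finite \<F>" "\<F> \<subseteq> U ` topspace M" "topspace M \<subseteq> \<Union>\<F>"
    using compactinD[of M "topspace M" "U ` topspace M"] U(1) by blast
  obtain T where T: "finite T" "T \<subseteq> topspace M" "\<F> = U ` T" using finite_subset_image[OF \<F>(1,2)] by blast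
  have bC1: "C1 (b p)" if "p \<in> T" for p
    unfolding b_def using surface_bump_C1[OF g(1-3)] that T(2) by blast
  have bnn: "b p q \<ge> 0" for p q by (simp add: b_def surface_bump_def bump_nonneg)
  have pos: "(\<Sum>x\<in>T. b x q) > 0" if q: "q \<in> topspace M" for q
  proof -
    obtain x where x: "x \<in> T" "q \<in> U x" using \<F>(3) T(3) q by blast
    have "b x q > 0" using U(3) x T(2) by blast
    then show ?thesis by (rule sum_pos2[OF T(1) x(1)]) (rule bnn)
  qed
  \<comment> \<open>Division by the positive sum keeps the support in the ball and the class
    \<open>C1\<close>, so the choice of the balls still yields \<open>stokes\<close>.\<close>
  define \<rho> where "\<rho> x q = b x q / (\<Sum>y\<in>T. b y q)" for x q
  have C: "C1 (\<rho> x)" if x: "x \<in> T" for x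
    unfolding C1_def
  proof
    fix d assume d: "d \<in> \<A>"
    interpret d: chart M d by (rule chart_axioms_A[OF d])
    have "C_k_on 1 d.S (\<lambda>z. in_chart d (b x) z / (\<Sum>y\<in>T. in_chart d (b y) z))"
    proof (intro C_k_on_divide C_k_on_sum d.open_S C1_D[OF bC1 d] x)
      show "(\<Sum>y\<in>T. in_chart d (b y) z) \<noteq> 0" if "z \<in> d.S" for z
        using that pos d.dom_subset by (force simp: d.in_chart_snd)
    qed
    then show "C_k_on 1 d.S (in_chart d (\<rho> x))" unfolding \<rho>_def[abs_def] in_chart_def o_def .
  qed
  show thesis
  proof (rule that[OF T(1) C])
    show "stokes (\<rho> x)" if x: "x \<in> T" for x
    proof (rule g(5)[OF subsetD[OF T(2) x] C[OF x]])
      fix q assume q: "q \<notin> inv_into (fst (c x)) (snd (c x)) ` cball (snd (c x) x) (r x)"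
      have xt: "x \<in> topspace M" using x T(2) by blast
      show "\<rho> x q = 0" using surface_bump_off[OF g(2)[OF xt] q g(1)[OF xt]] by (simp add: \<rho>_def b_def)
    qed
    show "(\<Sum>x\<in>T. \<rho> x p) = 1" if "p \<in> topspace M" for p
      using pos[OF that] by (simp add: \<rho>_def flip: sum_divide_distrib)
  qed
qed

text \<open>Both integrands are finite sums over the partition of unity of functions that
  \<open>stokes\<close> declares integrable, so integrability and equality are obtained from the
  same decomposition.\<close>

lemma curvature_integrals:
  shows "integrable (length_measure M \<A> f \<nu>) (\<lambda>q. indicator (A2_points M \<A> f \<nu>) q * singular_curvature \<A> f \<nu> q)"
    and "integrable (area_measure M \<A> f \<nu>) (\<lambda>q. indicator (M_sharp_minus \<A> f \<nu>) q * gaussian_curvature \<A> f q)"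
    and "(\<integral>q. indicator (A2_points M \<A> f \<nu>) q * singular_curvature \<A> f \<nu> q \<partial>length_measure M \<A> f \<nu>)
      = (\<integral>q. indicator (M_sharp_minus \<A> f \<nu>) q * gaussian_curvature \<A> f q \<partial>area_measure M \<A> f \<nu>)"
proof -
  obtain T and \<rho> :: "'a \<Rightarrow> 'a \<Rightarrow> real" where T: "finite T" "\<And>x. x \<in> T \<Longrightarrow> C1 (\<rho> x)" "\<And>x. x \<in> T \<Longrightarrow> stokes (\<rho> x)"
    "\<And>p. p \<in> topspace M \<Longrightarrow> (\<Sum>x\<in>T. \<rho> x p) = 1" using stokes_partition by blast
  have bulk: "(\<Sum>x\<in>T. bulk (\<rho> x) q) = indicator (M_sharp_minus \<A> f \<nu>) q * gaussian_curvature \<A> f q" for q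
  proof (cases "q \<in> M_sharp_minus \<A> f \<nu>")
    case True
    then obtain c where c: "c \<in> \<A>" "q \<in> fst c" by (auto simp: M_sharp_minus_def)
    have "(\<Sum>x\<in>T. bulk (\<rho> x) q) = (\<Sum>x\<in>T. curl_coeff (\<rho> x) c q / delta c q)"
      using True by (intro sum.cong refl) (simp add: bulk_eq[OF c T(2)])
    also have "\<dots> = delta_sharp c q / delta c q"
      by (simp only: sum_divide_distrib[symmetric] curl_coeff_partition[OF c T(1,2,4)])
    finally show ?thesis using True by (simp add: gaussian_curvature_eq[OF c])
  qed (simp add: bulk_def)
  have bdry: "(\<Sum>x\<in>T. bdry (\<rho> x) q) = indicator (A2_points M \<A> f \<nu>) q * singular_curvature \<A> f \<nu> q" for q
  proof (cases "q \<in> A2_points M \<A> f \<nu>")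
    case True
    then have "q \<in> topspace M" using A2_subset Sigma_subset by blast
    then show ?thesis using T(4)[of q] True by (simp add: bdry_def flip: sum_distrib_right)
  qed (simp add: bdry_def)
  have s: "integrable (area_measure M \<A> f \<nu>) (bulk (\<rho> x))" "integrable (length_measure M \<A> f \<nu>) (bdry (\<rho> x))"
    "(\<integral>q. bulk (\<rho> x) q \<partial>area_measure M \<A> f \<nu>) = (\<integral>q. bdry (\<rho> x) q \<partial>length_measure M \<A> f \<nu>)" if "x \<in> T" for x
    using T(3)[OF that] by (simp_all add: stokes_def)
  show "integrable (length_measure M \<A> f \<nu>) (\<lambda>q. indicator (A2_points M \<A> f \<nu>) q * singular_curvature \<A> f \<nu> q)"
    unfolding bdry[symmetric] by (intro Bochner_Integration.integrable_sum s)
  show "integrable (area_measure M \<A> f \<nu>) (\<lambda>q. indicator (M_sharp_minus \<A> f \<nu>) q * gaussian_curvature \<A> f q)"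
    unfolding bulk[symmetric] by (intro Bochner_Integration.integrable_sum s)
  show "(\<integral>q. indicator (A2_points M \<A> f \<nu>) q * singular_curvature \<A> f \<nu> q \<partial>length_measure M \<A> f \<nu>)
      = (\<integral>q. indicator (M_sharp_minus \<A> f \<nu>) q * gaussian_curvature \<A> f q \<partial>area_measure M \<A> f \<nu>)"
    unfolding bulk[symmetric] bdry[symmetric] by (simp add: Bochner_Integration.integral_sum s)
qed

lemma curvature_negative_part:
  "q \<in> topspace M \<Longrightarrow> indicator (M_sharp_minus \<A> f \<nu>) q * gaussian_curvature \<A> f q = min 0 (gaussian_curvature \<A> f q)"
proof -
  assume "q \<in> topspace M"
  then obtain c where "c \<in> \<A>" "q \<in> fst c" using cover by blast
  from M_minus_iff[OF this] show ?thesis by (simp add: indicator_def min_def)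
qed

end

theorem theorem3p18:
  fixes M :: "'a topology" and \<A> :: "'a chart set" and f \<nu> :: "'a \<Rightarrow> real^3"
  assumes "oriented_surface M \<A>" and "compact_space M"
    and "immersion \<A> f" and "unit_normal_field \<A> f \<nu>"
    and "Sigma_sharp \<A> f \<nu> = A2_points M \<A> f \<nu> \<union> A3_points M \<A> f \<nu>"
  shows "set_integrable (length_measure M \<A> f \<nu>) (A2_points M \<A> f \<nu>) (singular_curvature \<A> f \<nu>) \<and>
     set_integrable (area_measure M \<A> f \<nu>) (M_sharp_minus \<A> f \<nu>) (gaussian_curvature \<A> f) \<and>
     integrable (area_measure M \<A> f \<nu>) (\<lambda>p. min 0 (gaussian_curvature \<A> f p)) \<and>
     (LINT p : A2_points M \<A> f \<nu> | length_measure M \<A> f \<nu>. singular_curvature \<A> f \<nu> p)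
       = (LINT p : M_sharp_minus \<A> f \<nu> | area_measure M \<A> f \<nu>. gaussian_curvature \<A> f p) \<and>
     (LINT p : M_sharp_minus \<A> f \<nu> | area_measure M \<A> f \<nu>. gaussian_curvature \<A> f p)
       = (LINT p | area_measure M \<A> f \<nu>. min 0 (gaussian_curvature \<A> f p)) \<and>
     (LINT p : A2_points M \<A> f \<nu> | length_measure M \<A> f \<nu>. singular_curvature \<A> f \<nu> p) \<le> 0"
proof -
  interpret folds_cusps M \<A> f \<nu>
    using assms by (simp add: folds_cusps_def folds_cusps_axioms_def surface_def)
  let ?\<mu> = "area_measure M \<A> f \<nu>" and ?K = "gaussian_curvature \<A> f"
  note C = curvature_integrals
  have neg: "indicator (M_sharp_minus \<A> f \<nu>) q * ?K q = min 0 (?K q)" if "q \<in> space ?\<mu>" for q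
    using that by (intro curvature_negative_part) (simp add: area_measure(1))
  have i: "integrable ?\<mu> (\<lambda>p. min 0 (?K p))"
    using C(2) by (subst Bochner_Integration.integrable_cong[OF refl neg[symmetric]])
  have e: "(\<integral>q. indicator (M_sharp_minus \<A> f \<nu>) q * ?K q \<partial>?\<mu>) = (\<integral>p. min 0 (?K p) \<partial>?\<mu>)"
    by (rule Bochner_Integration.integral_cong[OF refl neg])
  have "(\<integral>p. - min 0 (?K p) \<partial>?\<mu>) \<ge> 0" by (rule Bochner_Integration.integral_nonneg) simp
  then have "(\<integral>p. min 0 (?K p) \<partial>?\<mu>) \<le> 0" by simp
  then show ?thesis
    using C i e unfolding set_integrable_def set_lebesgue_integral_def real_scaleR_def by simp
qed

end
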